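(* Let $n\in(0,2)$, $0<r_1<r_2$ and $V=\sqrt{r_2/r_1}$. For $\mathfrak{c}\in\mathbb{R}^+$ let $\mathcal{L}_{\mathfrak{c}}=x\frac{d}{dx}+\ell_{\mathfrak{c}}(x)\Delta_n$ with $\ell_{\mathfrak{c}}(x)=r_1$ for $x\le\mathfrak{c}$ and $\ell_{\mathfrak{c}}(x)=r_2$ for $x>\mathfrak{c}$, regarded as a self-adjoint operator as in the context, and let $\overline{\Sigma}(\mathcal{L}_{\mathfrak{c}})$ be the maximum element of its spectrum. With $\eta(n,V)$ and $\kappa(n,V)$ the constants defined in the context, $$\max_{\mathfrak{c}\in\mathbb{R}^+}\overline{\Sigma}\big(\mathcal{L}_{\mathfrak{c}}\big)=\eta(n,V)-n.$$ Moreover, the maximizing value $\mathfrak{c}\in\mathbb{R}^+$ is unique and given by $\mathfrak{c}=\kappa(n,V)\sqrt{r_1}$.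
   Context: Convention: $\mathbb{R}^+=(0,\infty)$. Operators. $\Delta_n:=\frac{n-1}{x}\frac{d}{dx}+\frac{d^2}{dx^2}$. For a Borel measurable $R:\mathbb{R}^+\to[r_1,r_2]$ let $w(x):=\frac{x^{n-1}}{R(x)}e^{\int_0^x\frac{v}{R(v)}dv}$, let $L^2(\mathbb{R}^+,w(x)dx)$ be the weighted Hilbert space with norm $\|\cdot\|_{2,R}$, and let $$\mathbf{D}=\Big\{f\in L^2(\mathbb{R}^+,w(x)dx)\ \Big|\ \|\Delta_nf\|_{2,R}<\infty\ \text{ and }\ \lim_{x\searrow0}x^{n-1}\tfrac{df}{dx}(x)=0\Big\}$$ (where $f$ and $f'$ are locally absolutely continuous on $(0,\infty)$). The operator $\mathcal{L}^{(R)}:=x\frac{d}{dx}+R(x)\Delta_n$ with domain $\mathbf{D}$ is self-adjoint in $L^2(\mathbb{R}^+,w(x)dx)$ with compact resolvent and strictly negative eigenvalues. Here $\mathcal{L}_{\mathfrak{c}}:=\mathcal{L}^{(\ell_{\mathfrak{c}})}$, with the weight and domain corresponding to $R=\ell_{\mathfrak{c}}$. Constants $\eta(n,V)$ and $\kappa(n,V)$. Let $I_\nu,K_\nu$ be the modified Bessel functions of the first and second kind. For $\nu>-1$ and $\eta>0$ put $$S^-_\nu(x):=x^{-\nu}I_\nu(x),\qquad S^+_\nu(x):=x^{-\nu}K_\nu(x),\qquad Y^{\pm}_{\nu,\eta}(x):=\int_0^\infty z^{\eta-1}S^{\pm}_\nu(xz)\,e^{-\frac{z^2+x^2}{2}}\,dz\qquad(x>0).$$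 For $n\in(0,2)$ and $V>1$, the positive numbers $\eta\equiv\eta(n,V)$ and $\kappa\equiv\kappa(n,V)$ are determined as the positive solution of the pair of equations $$\frac{Y^+_{\frac n2,\eta+2}(\frac{\kappa}{V})}{Y^+_{\frac{n-2}{2},\eta}(\frac{\kappa}{V})}=\frac{n-\eta-\frac{\kappa^2}{V^2}}{\frac{\kappa^2}{V^2}},\qquad \frac{\kappa^{2-n}\int_0^{\kappa}Y^-_{\frac{n-2}{2},\eta}(a)\,a^{n-1}e^{\frac{a^2-\kappa^2}{2}}\,da}{Y^-_{\frac{n-2}{2},\eta}(\kappa)}=1.$$ *)

theory Defs
  imports "HOL-Analysis.Analysis"
begin

section \<open>Modified Bessel functions and the constants\<close>

definition bessel_I :: "real \<Rightarrow> real \<Rightarrow> real" where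
  "bessel_I \<nu> x = (\<Sum>k. (x / 2) powr (2 * real k + \<nu>) * rGamma (real k + \<nu> + 1) / fact k)"

text \<open>At integer order the quotient is indeterminate and the function is its limit in the order.\<close>

definition bessel_K :: "real \<Rightarrow> real \<Rightarrow> real" where
  "bessel_K \<nu> x =
     (let q = (\<lambda>\<mu>. pi / 2 * (bessel_I (- \<mu>) x - bessel_I \<mu> x) / sin (\<mu> * pi))
      in if \<nu> \<in> \<int> then Lim (at \<nu>) q else q \<nu>)"

definition S_minus :: "real \<Rightarrow> real \<Rightarrow> real" where
  "S_minus \<nu> x = x powr (- \<nu>) * bessel_I \<nu> x"

definition S_plus :: "real \<Rightarrow> real \<Rightarrow> real" where
  "S_plus \<nu> x = x powr (- \<nu>) * bessel_K \<nu> x"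

definition Y_minus :: "real \<Rightarrow> real \<Rightarrow> real \<Rightarrow> real" where
  "Y_minus \<nu> \<eta> x =
     (LINT z:{0<..}|lborel. z powr (\<eta> - 1) * S_minus \<nu> (x * z) * exp (- ((z\<^sup>2 + x\<^sup>2) / 2)))"

definition Y_plus :: "real \<Rightarrow> real \<Rightarrow> real \<Rightarrow> real" where
  "Y_plus \<nu> \<eta> x =
     (LINT z:{0<..}|lborel. z powr (\<eta> - 1) * S_plus \<nu> (x * z) * exp (- ((z\<^sup>2 + x\<^sup>2) / 2)))"

definition eta_kappa_solution :: "real \<Rightarrow> real \<Rightarrow> real \<times> real \<Rightarrow> bool" where
  "eta_kappa_solution n V = (\<lambda>(\<eta>, \<kappa>).
     0 < \<eta> \<and> 0 < \<kappa> \<and>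
     Y_plus (n / 2) (\<eta> + 2) (\<kappa> / V) / Y_plus ((n - 2) / 2) \<eta> (\<kappa> / V)
       = (n - \<eta> - \<kappa>\<^sup>2 / V\<^sup>2) / (\<kappa>\<^sup>2 / V\<^sup>2) \<and>
     \<kappa> powr (2 - n)
       * (LINT a:{0<..<\<kappa>}|lborel.
            Y_minus ((n - 2) / 2) \<eta> a * a powr (n - 1) * exp ((a\<^sup>2 - \<kappa>\<^sup>2) / 2))
       / Y_minus ((n - 2) / 2) \<eta> \<kappa> = 1)"

definition eta_const :: "real \<Rightarrow> real \<Rightarrow> real" where
  "eta_const n V = fst (THE p. eta_kappa_solution n V p)"

definition kappa_const :: "real \<Rightarrow> real \<Rightarrow> real" where
  "kappa_const n V = snd (THE p. eta_kappa_solution n V p)"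


section \<open>The weighted Hilbert space\<close>

text \<open>
  Elements of the weighted space are represented by complex-valued functions on the line of which
  only the restriction to the open half line matters; equality in the space is equality almost
  everywhere with respect to \<open>weight_measure n R\<close>, the measure w(x)dx on the
  Lebesgue sets of the half line.
\<close>

definition weight :: "real \<Rightarrow> (real \<Rightarrow> real) \<Rightarrow> real \<Rightarrow> real" where
  "weight n R x = x powr (n - 1) / R x * exp (LINT v:{0<..<x}|lborel. v / R v)"

definition weight_measure :: "real \<Rightarrow> (real \<Rightarrow> real) \<Rightarrow> real measure" where
  "weight_measure n R = density (lebesgue_on {0<..}) (\<lambda>x. ennreal (weight n R x))"

definition L2_space :: "real \<Rightarrow> (real \<Rightarrow> real) \<Rightarrow> (real \<Rightarrow> complex) set" where
  "L2_space n R = {f. f \<in> borel_measurable (weight_measure n R) \<and>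
                      integrable (weight_measure n R) (\<lambda>x. (cmod (f x))\<^sup>2)}"

definition L2_norm :: "real \<Rightarrow> (real \<Rightarrow> real) \<Rightarrow> (real \<Rightarrow> complex) \<Rightarrow> real" where
  "L2_norm n R f = sqrt (LINT x|weight_measure n R. (cmod (f x))\<^sup>2)"


section \<open>The operator\<close>

definition abs_continuous_on_interval :: "real \<Rightarrow> real \<Rightarrow> (real \<Rightarrow> complex) \<Rightarrow> bool" where
  "abs_continuous_on_interval a b f \<longleftrightarrow>
     (\<forall>\<epsilon>>0. \<exists>\<delta>>0. \<forall>(N::nat) u v.
        (\<forall>i<N. a \<le> u i \<and> u i \<le> v i \<and> v i \<le> b) \<longrightarrow>
        disjoint_family_on (\<lambda>i. {u i<..<v i}) {..<N} \<longrightarrow>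
        (\<Sum>i<N. v i - u i) < \<delta> \<longrightarrow>
        (\<Sum>i<N. cmod (f (v i) - f (u i))) < \<epsilon>)"

definition locally_abs_continuous :: "(real \<Rightarrow> complex) \<Rightarrow> bool" where
  "locally_abs_continuous f \<longleftrightarrow>
     (\<forall>a b. 0 < a \<longrightarrow> a \<le> b \<longrightarrow> abs_continuous_on_interval a b f)"

abbreviation deriv1 :: "(real \<Rightarrow> complex) \<Rightarrow> real \<Rightarrow> complex" where
  "deriv1 f \<equiv> (\<lambda>x. vector_derivative f (at x))"

text \<open>
  For functions with locally absolutely continuous derivative the second derivative exists almost
  everywhere only; its arbitrary values elsewhere sit on a Lebesgue null set.
\<close>

definition Delta :: "real \<Rightarrow> (real \<Rightarrow> complex) \<Rightarrow> real \<Rightarrow> complex" where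
  "Delta n f x = ((n - 1) / x) *\<^sub>R deriv1 f x + deriv1 (deriv1 f) x"

definition L_op :: "real \<Rightarrow> (real \<Rightarrow> real) \<Rightarrow> (real \<Rightarrow> complex) \<Rightarrow> real \<Rightarrow> complex" where
  "L_op n R f x = x *\<^sub>R deriv1 f x + R x *\<^sub>R Delta n f x"

definition L_domain :: "real \<Rightarrow> (real \<Rightarrow> real) \<Rightarrow> (real \<Rightarrow> complex) set" where
  "L_domain n R = {f. f \<in> L2_space n R \<and>
     (\<forall>x>0. f differentiable (at x)) \<and>
     locally_abs_continuous f \<and> locally_abs_continuous (deriv1 f) \<and>
     Delta n f \<in> L2_space n R \<and>
     ((\<lambda>x. x powr (n - 1) *\<^sub>R deriv1 f x) \<longlongrightarrow> 0) (at_right 0)}"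

text \<open>
  The resolvent set: the operator minus \<open>\<mu>\<close> is a bijection from the domain onto the weighted
  space (up to null sets) whose inverse is bounded, with bound \<open>C\<close>.
\<close>

definition L_resolvent_set :: "real \<Rightarrow> (real \<Rightarrow> real) \<Rightarrow> complex set" where
  "L_resolvent_set n R = {\<mu>. \<exists>C. \<forall>g\<in>L2_space n R. \<exists>f\<in>L_domain n R.
     (AE x in weight_measure n R. L_op n R f x - \<mu> * f x = g x) \<and>
     L2_norm n R f \<le> C * L2_norm n R g \<and>
     (\<forall>h\<in>L_domain n R. (AE x in weight_measure n R. L_op n R h x - \<mu> * h x = g x) \<longrightarrow>
        (AE x in weight_measure n R. h x = f x))}"

definition L_spectrum :: "real \<Rightarrow> (real \<Rightarrow> real) \<Rightarrow> complex set" where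
  "L_spectrum n R = - L_resolvent_set n R"

definition is_max_of_spectrum :: "real \<Rightarrow> (real \<Rightarrow> real) \<Rightarrow> real \<Rightarrow> bool" where
  "is_max_of_spectrum n R s \<longleftrightarrow>
     complex_of_real s \<in> L_spectrum n R \<and> (\<forall>\<mu>\<in>L_spectrum n R. \<mu> \<in> \<real> \<and> Re \<mu> \<le> s)"

definition Sigma_bar :: "real \<Rightarrow> (real \<Rightarrow> real) \<Rightarrow> real" where
  "Sigma_bar n R = (THE s. is_max_of_spectrum n R s)"

definition ell :: "real \<Rightarrow> real \<Rightarrow> real \<Rightarrow> real \<Rightarrow> real" where
  "ell r1 r2 c x = (if x \<le> c then r1 else r2)"

end

theory Submission
  imports Defs
begin

text \<open>
  The operator \<open>- L\<close> is inverted by an integral operator with positive kernel.  A positive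
  eigenfunction turns Schur's test into a sharp norm bound, so its eigenvalue is the bottom of the
  spectrum of \<open>- L\<close>.  For \<open>R = ell r1 r2 c\<close> it is glued at \<open>c\<close> from a Gaussian times Kummer's
  function \<open>M(a, n / 2, s)\<close> on the left and a Gaussian times Tricomi's function \<open>U(a, n / 2, s)\<close> on
  the right, with \<open>s = x\<^sup>2 / (2 * R x)\<close>, and the eigenvalue of \<open>L\<close> is \<open>2 * a - n\<close>.  The logarithmic
  derivatives of the two pieces satisfy the same Riccati equation.  With \<open>\<theta> = r1 / r2\<close> and
  \<open>b = n / 2\<close>, both take the value \<open>b - a\<close>, at \<open>s\<close> and \<open>\<theta> * s\<close> respectively, for exactly one pair
  \<open>(a, s)\<close>; comparing them for this \<open>a\<close> at other arguments shows that any other interface \<open>c\<close> needs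
  a smaller \<open>a\<close>.  Integrating the Bessel series termwise against the Gaussian shows that the
  equations for \<open>\<eta> = 2 * a\<close> and \<open>\<kappa>\<^sup>2 / 2 = s\<close> express exactly this coincidence.
\<close>

section \<open>Absolutely continuous functions\<close>

text \<open>For a profile \<open>f x = exp (- s) * y s\<close> the ratio
  \<open>s * (1 - y' / y)\<close> equals \<open>- x * f' / (2 * f)\<close>. Equal ratios at
  \<open>c\<close> therefore mean that the glued function has a continuous derivative. The common
  value \<open>b - a\<close> says more: \<open>x * f' = (2 * a - n) * f\<close> there, which by the
  eigenvalue equation means \<open>Delta n f = 0\<close>. The pair \<open>(a, s)\<close> thus
  describes an eigenfunction for which \<open>Delta n\<close> changes sign, from negative to
  positive, exactly where the coefficient jumps from \<open>r1\<close> to \<open>r2\<close>. Two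
  obstacles shape the functional analysis. The domain is given by absolute continuity in its
  epsilon-delta form, so that recovering a domain element from its image needs differentiability
  almost everywhere and the fundamental theorem for such functions. Elements of the space are
  functions and not classes, so that the resolvent is built from series that converge pointwise
  almost everywhere. Moreover the domain asks for \<open>Delta n f\<close> itself to be square
  integrable, which costs a second Schur estimate, with a Gaussian weight. For a given interface
  only one \<open>a\<close> can match, because every match gives the maximum of the spectrum of the
  same operator.\<close>

lemma abs_continuous_finite_family:
  fixes f :: "real \<Rightarrow> complex"
  assumes "abs_continuous_on_interval a b f" "0 < \<epsilon>"
  obtains \<delta> where "0 < \<delta>"
    "\<And>(I::'i set) u v. finite I \<Longrightarrow> (\<And>i. i \<in> I \<Longrightarrow> a \<le> u i \<and> u i \<le> v i \<and> v i \<le> b) \<Longrightarrow>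
       disjoint_family_on (\<lambda>i. {u i<..<v i}) I \<Longrightarrow> (\<Sum>i\<in>I. v i - u i) < \<delta> \<Longrightarrow>
       (\<Sum>i\<in>I. cmod (f (v i) - f (u i))) < \<epsilon>"
proof -
  obtain \<delta> where d: "\<delta> > 0" and D: "\<forall>(N::nat) u v. (\<forall>i<N. a \<le> u i \<and> u i \<le> v i \<and> v i \<le> b) \<longrightarrow>
        disjoint_family_on (\<lambda>i. {u i<..<v i}) {..<N} \<longrightarrow>
        (\<Sum>i<N. v i - u i) < \<delta> \<longrightarrow>
        (\<Sum>i<N. cmod (f (v i) - f (u i))) < \<epsilon>"
    using assms unfolding abs_continuous_on_interval_def by meson
  show thesis
  proof (rule that[OF d])
    fix I :: "'i set" and u v
    assume fin: "finite I" and bd: "\<And>i. i \<in> I \<Longrightarrow> a \<le> u i \<and> u i \<le> v i \<and> v i \<le> b"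
      and dj: "disjoint_family_on (\<lambda>i. {u i<..<v i}) I" and s: "(\<Sum>i\<in>I. v i - u i) < \<delta>"
    \<comment> \<open>The families met below are indexed by pairs of points and by tagged cells,
      whereas the definition speaks of initial segments of the naturals; an enumeration transfers
      the bound.\<close>
    obtain h where h: "bij_betw h {..<card I} I"
      using ex_bij_betw_nat_finite[OF fin] by (auto simp: lessThan_atLeast0)
    have S: "(\<Sum>i\<in>I. g i) = (\<Sum>k<card I. g (h k))" for g :: "'i \<Rightarrow> real"
      using sum.reindex_bij_betw[OF h, of g] by simp
    have hI: "h k \<in> I" if "k < card I" for k
      using h that by (auto simp: bij_betw_def)
    have "disjoint_family_on (\<lambda>k. {u (h k)<..<v (h k)}) {..<card I}"
      unfolding disjoint_family_on_def
    proof (intro ballI impI)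
      fix k l assume kl: "k \<in> {..<card I}" "l \<in> {..<card I}" "k \<noteq> l"
      have "h k \<noteq> h l" using h kl by (auto simp: bij_betw_def inj_on_def)
      then show "{u (h k)<..<v (h k)} \<inter> {u (h l)<..<v (h l)} = {}"
        using dj hI kl unfolding disjoint_family_on_def by blast
    qed
    then show "(\<Sum>i\<in>I. cmod (f (v i) - f (u i))) < \<epsilon>"
      using D[rule_format, of "card I" "u \<circ> h" "v \<circ> h"] bd hI s by (simp add: S)
  qed
qed

text \<open>On a piece of length below \<open>\<delta>\<close>, disjoint segments whose end points
  have a difference quotient above \<open>K\<close> carry total variation below 1, hence total
  length at most \<open>1 / K\<close>. Vitali's covering theorem extracts from all such segments a
  countable disjoint family that covers almost all exceptional points of the piece.\<close>

lemma abs_continuous_quotients_bounded: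
  assumes ac: "abs_continuous_on_interval a b f"
  shows "negligible {x \<in> {a<..<b}. \<forall>L::nat. \<exists>y\<in>{a<..<b}.
           \<bar>y - x\<bar> < 1 / (real L + 1) \<and> real L * \<bar>y - x\<bar> < cmod (f y - f x)}" (is "negligible ?Z")
proof -
  obtain \<delta> where d0: "0 < \<delta>" and d: "\<And>(I::(real \<times> real) set) u v. finite I \<Longrightarrow>
       (\<And>i. i \<in> I \<Longrightarrow> a \<le> u i \<and> u i \<le> v i \<and> v i \<le> b) \<Longrightarrow>
       disjoint_family_on (\<lambda>i. {u i<..<v i}) I \<Longrightarrow> (\<Sum>i\<in>I. v i - u i) < \<delta> \<Longrightarrow>
       (\<Sum>i\<in>I. cmod (f (v i) - f (u i))) < 1"
    by (rule abs_continuous_finite_family[OF ac zero_less_one, where ?'i = "real \<times> real"]) blast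
  have cell: "negligible (?Z \<inter> {u<..<v})" if uv: "a \<le> u" "u < v" "v \<le> b" "v - u < \<delta>" for u v
    unfolding negligible_outer_le
  proof (intro allI impI)
    fix e :: real assume "e > 0"
    then obtain K0 :: nat where "1 / e < K0" using reals_Archimedean2 by blast
    define K where "K = K0 + 1"
    have K: "real K > 0" "1 / real K \<le> e"
    proof -
      show "real K > 0" by (simp add: K_def)
      have "1 / e \<le> real K" using \<open>1 / e < K0\<close> by (simp add: K_def)
      then show "1 / real K \<le> e" using \<open>e > 0\<close> \<open>real K > 0\<close> by (simp add: field_simps)
    qed
    define P where "P = {(x,y). x \<in> {u<..<v} \<and> y \<in> {u<..<v} \<and> x \<noteq> y \<and> real K * \<bar>y - x\<bar> < cmod (f y - f x)}"
    \<comment> \<open>The closed ball about the midpoint with half the distance as radius is the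
      segment between \<open>x\<close> and \<open>y\<close>. The steep pairs thus become a Vitali
      family that covers each exceptional point by arbitrarily small balls.\<close>
    define cen where "cen = (\<lambda>(x::real,y::real). (x + y) / 2)"
    define rad where "rad = (\<lambda>(x::real,y::real). \<bar>y - x\<bar> / 2)"
    have rad0: "0 < rad i" if "i \<in> P" for i using that by (auto simp: P_def rad_def)
    have cover: "\<exists>i. i \<in> P \<and> x \<in> cball (cen i) (rad i) \<and> rad i < d"
      if x: "x \<in> ?Z \<inter> {u<..<v}" and "d > 0" for x d
    proof -
      define m where "m = min d (min (x - u) (v - x))"
      have "m > 0" using x that by (auto simp: m_def)
      then obtain L0 :: nat where "1 / m < L0" using reals_Archimedean2 by blast
      define L where "L = max L0 K"
      have "1 / m < real L + 1" using \<open>1 / m < L0\<close> by (simp add: L_def max_def)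
      then have L: "1 / (real L + 1) < m" "K \<le> L" using \<open>m > 0\<close>
        by (auto simp: field_simps L_def)
      from x obtain y where y: "\<bar>y - x\<bar> < 1 / (real L + 1)" "real L * \<bar>y - x\<bar> < cmod (f y - f x)"
        by blast
      have "x \<noteq> y" using y(2) by auto
      have "\<bar>y - x\<bar> < m" using y L by linarith
      have "real K * \<bar>y - x\<bar> \<le> real L * \<bar>y - x\<bar>" using L by (intro mult_right_mono) auto
      then have "real K * \<bar>y - x\<bar> < cmod (f y - f x)" using y by linarith
      then have "(x, y) \<in> P" using x \<open>x \<noteq> y\<close> \<open>\<bar>y - x\<bar> < m\<close> by (auto simp: P_def m_def)
      moreover have "x \<in> cball (cen (x,y)) (rad (x,y))"
        by (auto simp: cen_def rad_def dist_real_def)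
      moreover have "rad (x,y) < d" using \<open>\<bar>y - x\<bar> < m\<close> by (auto simp: rad_def m_def)
      ultimately show ?thesis by blast
    qed
    obtain C where C: "countable C" "C \<subseteq> P"
      "pairwise (\<lambda>i j. disjnt (cball (cen i) (rad i)) (cball (cen j) (rad j))) C"
      "negligible (?Z \<inter> {u<..<v} - (\<Union>i \<in> C. cball (cen i) (rad i)))"
      by (rule Vitali_covering_theorem_cballs[of P rad "?Z \<inter> {u<..<v}" cen, OF rad0 cover]) auto
    define lo where "lo = (\<lambda>(x::real,y::real). min x y)"
    define hi where "hi = (\<lambda>(x::real,y::real). max x y)"
    have cb: "cball (cen i) (rad i) = {lo i..hi i}" for i
      by (cases i) (auto simp: cen_def rad_def lo_def hi_def dist_real_def min_def max_def abs_if field_simps split: if_splits)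
    have fin: "measure lebesgue (\<Union>i\<in>F. {lo i..hi i}) \<le> 1 / K" if F: "F \<subseteq> C" "finite F" for F
    proof -
      have FP: "i \<in> P" if "i \<in> F" for i using F C that by blast
      have le: "lo i \<le> hi i" "u \<le> lo i" "hi i \<le> v" if "i \<in> F" for i
        using FP[OF that] by (auto simp: P_def lo_def hi_def)
      have pw: "pairwise (\<lambda>i j. disjnt {lo i..hi i} {lo j..hi j}) F"
        using C(3) F(1) by (simp add: cb pairwise_subset)
      have eq: "measure lebesgue (\<Union>i\<in>F. {lo i..hi i}) = (\<Sum>i\<in>F. hi i - lo i)"
        using measure_UNION'[OF F(2), of "\<lambda>i. {lo i..hi i}" lebesgue] pw le by simp
      also have "\<dots> \<le> v - u"
      proof -
        have "measure lebesgue (\<Union>i\<in>F. {lo i..hi i}) \<le> measure lebesgue {u..v}"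
        proof (rule measure_mono_fmeasurable)
          show "(\<Union>i\<in>F. {lo i..hi i}) \<subseteq> {u..v}" by (intro UN_least) (simp add: le)
        qed (use F in auto)
        then show ?thesis using eq uv by simp
      qed
      finally have m: "(\<Sum>i\<in>F. hi i - lo i) < \<delta>" using eq uv by simp
      have "disjoint_family_on (\<lambda>i. {lo i<..<hi i}) F"
        unfolding disjoint_family_on_def
      proof (intro ballI impI)
        fix i j assume "i \<in> F" "j \<in> F" "i \<noteq> j"
        then have "disjnt {lo i..hi i} {lo j..hi j}" using pw by (auto simp: pairwise_def)
        moreover have "{lo i<..<hi i} \<subseteq> {lo i..hi i}" "{lo j<..<hi j} \<subseteq> {lo j..hi j}" by auto
        ultimately show "{lo i<..<hi i} \<inter> {lo j<..<hi j} = {}" unfolding disjnt_def by blast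
      qed
      then have "(\<Sum>i\<in>F. cmod (f (hi i) - f (lo i))) < 1"
        using d[of F lo hi] m le F(2) uv by force
      moreover have "K * (\<Sum>i\<in>F. hi i - lo i) \<le> (\<Sum>i\<in>F. cmod (f (hi i) - f (lo i)))"
        unfolding sum_distrib_left
      proof (rule sum_mono)
        fix i assume "i \<in> F"
        then show "real K * (hi i - lo i) \<le> cmod (f (hi i) - f (lo i))"
          using FP[of i] by (cases i) (auto simp: P_def lo_def hi_def min_def max_def norm_minus_commute)
      qed
      ultimately have "K * (\<Sum>i\<in>F. hi i - lo i) \<le> 1" by linarith
      then show ?thesis using eq K by (simp add: field_simps)
    qed
    let ?U = "\<Union>i\<in>C. {lo i..hi i}"
    have U: "?U \<in> lmeasurable" "measure lebesgue ?U \<le> 1 / K"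
      using fmeasurable_UN_bound[OF C(1), of "\<lambda>i. {lo i..hi i}" lebesgue "1/K"]
            measure_UN_bound[OF C(1), of "\<lambda>i. {lo i..hi i}" lebesgue "1/K"] fin by auto
    let ?N = "?Z \<inter> {u<..<v} - ?U"
    have N: "negligible ?N" using C(4) by (simp add: cb)
    show "\<exists>T. ?Z \<inter> {u<..<v} \<subseteq> T \<and> T \<in> lmeasurable \<and> measure lebesgue T \<le> e"
    proof (intro exI conjI)
      show "?Z \<inter> {u<..<v} \<subseteq> ?U \<union> ?N" by blast
      show "?U \<union> ?N \<in> lmeasurable" using U(1) negligible_imp_measurable[OF N] by (rule fmeasurable.Un)
      have "measure lebesgue (?U \<union> ?N) \<le> measure lebesgue ?U + measure lebesgue ?N"
        using U(1) negligible_imp_measurable[OF N] by (intro measure_Un_le) (auto dest: fmeasurableD)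
      then show "measure lebesgue (?U \<union> ?N) \<le> e" using U K negligible_imp_measure0[OF N] by linarith
    qed
  qed
  \<comment> \<open>Pieces with rational left end and length at most \<open>\<delta> / 2\<close>
    suffice, so that only countably many null sets are united.\<close>
  have "?Z \<subseteq> (\<Union>r\<in>\<rat>. ?Z \<inter> {max a r<..<min b (r + \<delta>/2)})"
  proof
    fix x assume x: "x \<in> ?Z"
    obtain r where "r \<in> \<rat>" "x - \<delta>/2 < r" "r < x" using Rats_dense_in_real[of "x - \<delta>/2" x] d0 by auto
    then show "x \<in> (\<Union>r\<in>\<rat>. ?Z \<inter> {max a r<..<min b (r + \<delta>/2)})"
      using x by (auto intro!: bexI[of _ r])
  qed
  moreover have "negligible (\<Union>r\<in>\<rat>. ?Z \<inter> {max a r<..<min b (r + \<delta>/2)})"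
  proof (rule negligible_countable_Union)
    fix S assume "S \<in> (\<lambda>r. ?Z \<inter> {max a r<..<min b (r + \<delta>/2)}) ` \<rat>"
    then obtain r where r: "S = ?Z \<inter> {max a r<..<min b (r + \<delta>/2)}" by blast
    show "negligible S"
    proof (cases "max a r < min b (r + \<delta>/2)")
      case True then show ?thesis unfolding r using d0 by (intro cell) auto
    next
      case False
      then have "S = {}" unfolding r by auto
      then show ?thesis by simp
    qed
  qed (auto intro: countable_rat)
  ultimately show ?thesis by (rule negligible_subset[rotated])
qed

text \<open>The gauge integral lets the null set be handled by the gauge alone. Cells tagged at good
  points are compared with the differential; cells tagged in the null set lie in an open set of
  measure below \<open>\<delta>\<close>, where absolute continuity makes the sum of the increments
  small. Integrability of \<open>\<phi>\<close> is part of the conclusion.\<close>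

lemma abs_continuous_has_integral:
  assumes ac: "abs_continuous_on_interval a b q" and ab: "a \<le> b" and N: "negligible N"
    and der: "\<And>x. x \<in> {a<..<b} - N \<Longrightarrow> (q has_vector_derivative \<phi> x) (at x)"
  shows "(\<phi> has_integral (q b - q a)) {a..b}"
proof -
  \<comment> \<open>The end points join the exceptional set because derivatives are given at
    interior points only.\<close>
  define Z where "Z = N \<union> {a, b}"
  define \<psi> where "\<psi> x = (if x \<in> Z then 0 else \<phi> x)" for x
  have negZ: "negligible Z" using N by (simp add: Z_def)
  have "(\<psi> has_integral (q b - q a)) (cbox a b)"
    unfolding has_integral
  proof (intro allI impI)
    fix e :: real assume "e > 0"
    define e' where "e' = e / (2 * (b - a + 1))"
    have e': "e' > 0" "e' * (b - a) \<le> e / 2"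
      using \<open>e > 0\<close> ab by (auto simp: e'_def field_simps)
    have "\<forall>x. \<exists>d>0. x \<in> {a<..<b} - N \<longrightarrow>
        (\<forall>y. \<bar>y - x\<bar> < d \<longrightarrow> norm (q y - q x - (y - x) *\<^sub>R \<phi> x) \<le> e' * \<bar>y - x\<bar>)"
    proof
      fix x
      show "\<exists>d>0. x \<in> {a<..<b} - N \<longrightarrow>
        (\<forall>y. \<bar>y - x\<bar> < d \<longrightarrow> norm (q y - q x - (y - x) *\<^sub>R \<phi> x) \<le> e' * \<bar>y - x\<bar>)"
      proof (cases "x \<in> {a<..<b} - N")
        case True
        then show ?thesis
          using der[OF True] e'(1) unfolding has_vector_derivative_def has_derivative_within_alt by auto
      qed (auto intro: exI[of _ 1])
    qed
    then obtain d where d: "\<And>x. d x > 0" "\<And>x y. x \<in> {a<..<b} - N \<Longrightarrow> \<bar>y - x\<bar> < d x \<Longrightarrow>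
        norm (q y - q x - (y - x) *\<^sub>R \<phi> x) \<le> e' * \<bar>y - x\<bar>"
      by metis
    have "e / 2 > 0" using \<open>e > 0\<close> by simp
    then obtain \<delta> where d0: "0 < \<delta>" and del: "\<And>(I::(real \<times> real set) set) u v. finite I \<Longrightarrow>
       (\<And>i. i \<in> I \<Longrightarrow> a \<le> u i \<and> u i \<le> v i \<and> v i \<le> b) \<Longrightarrow>
       disjoint_family_on (\<lambda>i. {u i<..<v i}) I \<Longrightarrow> (\<Sum>i\<in>I. v i - u i) < \<delta> \<Longrightarrow>
       (\<Sum>i\<in>I. cmod (q (v i) - q (u i))) < e / 2"
      by (rule abs_continuous_finite_family[OF ac, where ?'i = "real \<times> real set"]) blast
    have Zs: "Z \<in> sets lebesgue" "emeasure lebesgue Z = 0"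
      using negZ by (auto simp: negligible_iff_null_sets)
    obtain U where U: "open U" "Z \<subseteq> U" "(U - Z) \<in> lmeasurable" "emeasure lebesgue (U - Z) < ennreal \<delta>"
      using sets_lebesgue_outer_open[OF Zs(1) d0] by blast
    have Um: "U \<in> lmeasurable" "measure lebesgue U < \<delta>"
    proof -
      have Ueq: "U = (U - Z) \<union> Z" using U by blast
      have eU: "emeasure lebesgue U = emeasure lebesgue (U - Z)"
        by (subst Ueq, rule emeasure_Un_null_set) (use U Zs in \<open>auto intro: null_setsI\<close>)
      show "U \<in> lmeasurable" using eU U Zs by (subst Ueq, intro fmeasurable.Un) (auto simp: fmeasurable_def)
      then have "ennreal (measure lebesgue U) < ennreal \<delta>"
        using eU U(4) by (simp add: emeasure_eq_measure2)
      then show "measure lebesgue U < \<delta>" by (simp add: ennreal_less_iff)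
    qed
    define \<gamma> where "\<gamma> x = (if x \<in> Z then U else ball x (d x))" for x
    show "\<exists>\<gamma>. gauge \<gamma> \<and> (\<forall>\<D>. \<D> tagged_division_of cbox a b \<and> \<gamma> fine \<D> \<longrightarrow>
        norm ((\<Sum>(x, k)\<in>\<D>. measure lborel k *\<^sub>R \<psi> x) - (q b - q a)) < e)"
    proof (intro exI conjI allI impI)
      show "gauge \<gamma>" using U d by (auto simp: gauge_def \<gamma>_def)
    next
      fix p assume "p tagged_division_of cbox a b \<and> \<gamma> fine p"
      then have p: "p tagged_division_of cbox a b" and fine: "\<gamma> fine p" by auto
      note pD = tagged_division_ofD[OF p]
      have ba: "(\<Sum>(x,K)\<in>p. Sup K - Inf K) = b - a" "(\<Sum>(x,K)\<in>p. q (Sup K) - q (Inf K)) = q b - q a"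
        using additive_tagged_division_1[OF ab, of p "\<lambda>x. x"] additive_tagged_division_1[OF ab, of p q] p by auto
      have K: "Inf K \<le> x" "x \<le> Sup K" "a \<le> Inf K" "Sup K \<le> b" "K = {Inf K..Sup K}"
          "measure lborel K = Sup K - Inf K" "K \<subseteq> \<gamma> x" if xK: "(x, K) \<in> p" for x K
      proof -
        obtain l r where lr: "K = cbox l r" using pD(4)[OF xK] by blast
        have "x \<in> K" "K \<subseteq> cbox a b" using pD(2,3)[OF xK] by auto
        then show "Inf K \<le> x" "x \<le> Sup K" "a \<le> Inf K" "Sup K \<le> b" "K = {Inf K..Sup K}"
          "measure lborel K = Sup K - Inf K" by (auto simp: lr)
        show "K \<subseteq> \<gamma> x" using fine xK by (auto simp: fine_def)
      qed
      let ?G = "{z \<in> p. fst z \<notin> Z}" and ?B = "{z \<in> p. fst z \<in> Z}"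
      let ?t = "\<lambda>(x, K). measure lborel K *\<^sub>R \<psi> x - (q (Sup K) - q (Inf K))"
      have fp: "finite p" by (rule pD(1))
      have "(\<Sum>(x, k)\<in>p. measure lborel k *\<^sub>R \<psi> x) - (q b - q a) = (\<Sum>z\<in>p. ?t z)"
        unfolding ba(2)[symmetric] sum_subtractf[symmetric] by (intro sum.cong) auto
      also have "\<dots> = (\<Sum>z\<in>?G. ?t z) + (\<Sum>z\<in>?B. ?t z)"
        using fp by (subst sum.union_disjoint[symmetric]) (auto intro!: sum.cong)
      finally have eq: "(\<Sum>(x, k)\<in>p. measure lborel k *\<^sub>R \<psi> x) - (q b - q a) = (\<Sum>z\<in>?G. ?t z) + (\<Sum>z\<in>?B. ?t z)" .
      have "norm (\<Sum>z\<in>?G. ?t z) \<le> (\<Sum>(x,K)\<in>?G. e' * (Sup K - Inf K))"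
      proof (rule sum_norm_le, clarsimp)
        fix x K assume xK: "(x, K) \<in> p" "x \<notin> Z"
        have x: "x \<in> {a<..<b} - N" using K(1-4)[OF xK(1)] xK(2) by (auto simp: Z_def)
        have sub: "K \<subseteq> ball x (d x)" using K(7)[OF xK(1)] xK(2) by (simp add: \<gamma>_def)
        have "Inf K \<in> K" "Sup K \<in> K"
          using K(1,2,5)[OF xK(1)] by (metis atLeastAtMost_iff order_refl order_trans)+
        then have "\<bar>Inf K - x\<bar> < d x" "\<bar>Sup K - x\<bar> < d x" using sub by (auto simp: dist_real_def abs_minus_commute)
        note A = d(2)[OF x this(1)] d(2)[OF x this(2)]
        have "norm (measure lborel K *\<^sub>R \<psi> x - (q (Sup K) - q (Inf K)))
           = norm ((q (Inf K) - q x - (Inf K - x) *\<^sub>R \<phi> x) - (q (Sup K) - q x - (Sup K - x) *\<^sub>R \<phi> x))"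
        proof -
          have c: "measure lborel K *\<^sub>R \<psi> x = (Sup K - Inf K) *\<^sub>R \<phi> x"
            using xK K(6)[OF xK(1)] by (simp add: \<psi>_def)
          show ?thesis unfolding c by (simp add: algebra_simps)
        qed
        also have "\<dots> \<le> e' * \<bar>Inf K - x\<bar> + e' * \<bar>Sup K - x\<bar>"
          using A norm_triangle_ineq4 by (meson add_mono order_trans)
        also have "\<dots> = e' * (Sup K - Inf K)"
          using K(1,2)[OF xK(1)] by (simp add: algebra_simps)
        finally show "norm (measure lborel K *\<^sub>R \<psi> x - (q (Sup K) - q (Inf K))) \<le> e' * (Sup K - Inf K)" .
      qed
      also have "\<dots> \<le> (\<Sum>(x,K)\<in>p. e' * (Sup K - Inf K))"
      proof (rule sum_mono2[OF fp])
        fix z assume "z \<in> p - ?G"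
        then obtain x K where "z = (x, K)" "(x, K) \<in> p" by (cases z) auto
        then show "0 \<le> (case z of (x, K) \<Rightarrow> e' * (Sup K - Inf K))"
          using e'(1) K(1,2)[of x K] by simp
      qed auto
      also have "\<dots> = e' * (b - a)" unfolding ba(1)[symmetric] sum_distrib_left by (intro sum.cong) auto
      finally have G: "norm (\<Sum>z\<in>?G. ?t z) \<le> e / 2" using e' by linarith
      define lo where "lo = (\<lambda>z::real \<times> real set. Inf (snd z))"
      define hi where "hi = (\<lambda>z::real \<times> real set. Sup (snd z))"
      have lohi: "a \<le> lo z \<and> lo z \<le> hi z \<and> hi z \<le> b" if "z \<in> p" for z
        using K[of "fst z" "snd z"] that unfolding lo_def hi_def by auto
      have int: "interior (snd z) = {lo z<..<hi z}" if "z \<in> p" for z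
        using K(5)[of "fst z" "snd z"] that unfolding lo_def hi_def
        by (metis interior_atLeastAtMost_real prod.collapse)
      have dj: "disjoint_family_on (\<lambda>z. {lo z<..<hi z}) ?B"
        unfolding disjoint_family_on_def
      proof (intro ballI impI)
        fix y z assume yz: "y \<in> ?B" "z \<in> ?B" "y \<noteq> z"
        then have "interior (snd y) \<inter> interior (snd z) = {}"
          using pD(5)[of "fst y" "snd y" "fst z" "snd z"] by auto
        then show "{lo y<..<hi y} \<inter> {lo z<..<hi z} = {}" using int yz by auto
      qed
      have "(\<Sum>z\<in>?B. hi z - lo z) = measure lebesgue (\<Union>z\<in>?B. {lo z<..<hi z})"
      proof (subst measure_UNION')
        show "pairwise (\<lambda>i j. disjnt {lo i<..<hi i} {lo j<..<hi j}) ?B"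
          using dj unfolding disjoint_family_on_def pairwise_def disjnt_def by blast
      qed (use fp lohi in \<open>auto intro!: sum.cong\<close>)
      also have "\<dots> \<le> measure lebesgue U"
      proof (rule measure_mono_fmeasurable)
        show "(\<Union>z\<in>?B. {lo z<..<hi z}) \<subseteq> U"
        proof
          fix y assume "y \<in> (\<Union>z\<in>?B. {lo z<..<hi z})"
          then obtain z where z: "z \<in> p" "fst z \<in> Z" "y \<in> {lo z<..<hi z}" by auto
          then have "y \<in> snd z" using int[OF z(1)] interior_subset by blast
          then show "y \<in> U" using K(7)[of "fst z" "snd z"] z by (auto simp: \<gamma>_def)
        qed
      qed (use Um fp in auto)
      finally have "(\<Sum>z\<in>?B. hi z - lo z) < \<delta>" using Um by linarith
      then have "(\<Sum>z\<in>?B. cmod (q (hi z) - q (lo z))) < e / 2"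
        using del[of ?B lo hi] fp lohi dj by simp
      moreover have "norm (\<Sum>z\<in>?B. ?t z) \<le> (\<Sum>z\<in>?B. cmod (q (hi z) - q (lo z)))"
        by (rule sum_norm_le) (auto simp: \<psi>_def lo_def hi_def norm_minus_commute)
      ultimately have B: "norm (\<Sum>z\<in>?B. ?t z) < e / 2" by linarith
      show "norm ((\<Sum>(x, k)\<in>p. measure lborel k *\<^sub>R \<psi> x) - (q b - q a)) < e"
        unfolding eq using G B norm_triangle_ineq[of "\<Sum>z\<in>?G. ?t z" "\<Sum>z\<in>?B. ?t z"] by linarith
    qed
  qed
  then have "(\<phi> has_integral (q b - q a)) (cbox a b)"
    by (rule has_integral_spike[OF negZ, rotated]) (simp add: \<psi>_def)
  then show ?thesis by simp
qed

section \<open>Differentiation of indefinite integrals, Lipschitz functions and absolutely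
  continuous functions\<close>

text \<open>The averaging theorem concerns cells to the right of \<open>x\<close> only. Left-hand
  quotients at \<open>x\<close> are right-hand averages of the reflected integrand at
  \<open>- x\<close>, hence the image of the second null set under negation.\<close>

lemma has_derivative_indefinite_integral_AE:
  fixes f F :: "real \<Rightarrow> real"
  assumes F: "\<And>x y. x \<le> y \<Longrightarrow> (f has_integral (F y - F x)) {x..y}"
  shows "\<exists>N. negligible N \<and> (\<forall>x. x \<notin> N \<longrightarrow> (F has_real_derivative f x) (at x))"
proof -
  have int: "f integrable_on cbox a b" for a b
    using F[of a b] by (cases "a \<le> b") (auto intro: has_integral_integrable)
  obtain N1 where N1: "negligible N1" "\<And>x e. x \<notin> N1 \<Longrightarrow> 0 < e \<Longrightarrow>
      \<exists>d>0. \<forall>h. 0 < h \<and> h < d \<longrightarrow> norm (integral (cbox x (x + h *\<^sub>R One)) f /\<^sub>R h ^ DIM(real) - f x) < e"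
    using integrable_ccontinuous_explicit[OF int] by blast
  have R: "((\<lambda>x. f (- x)) has_integral (F (- x) - F (- y))) {x..y}" if "x \<le> y" for x y
    using F[of "- y" "- x"] that has_integral_reflect_real[of f "F (- x) - F (- y)" "-x" "-y"] by simp
  have intR: "(\<lambda>x. f (- x)) integrable_on cbox a b" for a b
    using R[of a b] by (cases "a \<le> b") (auto intro: has_integral_integrable)
  obtain N2 where N2: "negligible N2" "\<And>x e. x \<notin> N2 \<Longrightarrow> 0 < e \<Longrightarrow>
      \<exists>d>0. \<forall>h. 0 < h \<and> h < d \<longrightarrow>
        norm (integral (cbox x (x + h *\<^sub>R One)) (\<lambda>x. f (- x)) /\<^sub>R h ^ DIM(real) - f (- x)) < e"
    using integrable_ccontinuous_explicit[OF intR] by blast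
  show ?thesis
  proof (intro exI conjI allI impI)
    show "negligible (N1 \<union> uminus ` N2)"
      using N1(1) N2(1)
      by (auto intro!: negligible_locally_Lipschitz_image exI[of _ UNIV] exI[of _ "1::real"] simp: abs_minus_commute)
    fix x assume "x \<notin> N1 \<union> uminus ` N2"
    then have x: "x \<notin> N1" "- x \<notin> N2" by force+
    show "(F has_real_derivative f x) (at x)"
      unfolding DERIV_def LIM_eq
    proof (intro allI impI)
      fix e :: real assume "e > 0"
      obtain d1 where d1: "d1 > 0" "\<And>h. 0 < h \<Longrightarrow> h < d1 \<Longrightarrow> \<bar>(F (x + h) - F x) / h - f x\<bar> < e"
      proof -
        obtain d where d: "d > 0" "\<forall>h. 0 < h \<and> h < d \<longrightarrow> norm (integral (cbox x (x + h *\<^sub>R One)) f /\<^sub>R h ^ DIM(real) - f x) < e"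
          using N1(2)[OF x(1) \<open>e > 0\<close>] by blast
        have "\<bar>(F (x + h) - F x) / h - f x\<bar> < e" if "0 < h" "h < d" for h
          using d(2)[rule_format, of h] that integral_unique[OF F[of x "x + h"]] by (simp add: divide_inverse mult.commute)
        then show ?thesis using that d(1) by blast
      qed
      obtain d2 where d2: "d2 > 0" "\<And>h. 0 < h \<Longrightarrow> h < d2 \<Longrightarrow> \<bar>(F x - F (x - h)) / h - f x\<bar> < e"
      proof -
        obtain d where d: "d > 0" "\<forall>h. 0 < h \<and> h < d \<longrightarrow> norm (integral (cbox (- x) (- x + h *\<^sub>R One)) (\<lambda>x. f (- x)) /\<^sub>R h ^ DIM(real) - f (- (- x))) < e"
          using N2(2)[OF x(2) \<open>e > 0\<close>] by blast
        have "\<bar>(F x - F (x - h)) / h - f x\<bar> < e" if "0 < h" "h < d" for h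
          using d(2)[rule_format, of h] that integral_unique[OF R[of "- x" "- x + h"]] by (simp add: divide_inverse mult.commute)
        then show ?thesis using that d(1) by blast
      qed
      show "\<exists>s>0. \<forall>h. h \<noteq> 0 \<and> norm (h - 0) < s \<longrightarrow> norm ((F (x + h) - F x) / h - f x) < e"
      proof (intro exI conjI allI impI)
        show "min d1 d2 > 0" using d1 d2 by simp
        fix h :: real assume h: "h \<noteq> 0 \<and> norm (h - 0) < min d1 d2"
        show "norm ((F (x + h) - F x) / h - f x) < e"
        proof (cases "h > 0")
          case True then show ?thesis using d1(2)[of h] h by simp
        next
          case False
          have "(F x - F (x - (- h))) / (- h) = (F (x + h) - F x) / h"
            using h by (simp add: field_simps)
          then show ?thesis using d2(2)[of "- h"] h False by simp
        qed
      qed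
    qed
  qed
qed

text \<open>A bi-Lipschitz increasing homeomorphism pulls Lebesgue measure back to an absolutely
  continuous measure, whose density is the derivative.\<close>

lemma lipschitz_differentiable_AE:
  fixes g :: "real \<Rightarrow> real"
  assumes lip: "\<And>x y. \<bar>g x - g y\<bar> \<le> L * \<bar>x - y\<bar>"
  shows "negligible {x. \<not> g differentiable (at x)}"
proof -
  have L0: "L \<ge> 0" using lip[of 0 1] by simp
  \<comment> \<open>Adding \<open>(L + 1) * x\<close> brings all slopes between 1 and
    \<open>2 * L + 1\<close>: \<open>F\<close> is a homeomorphism with non-expansive inverse and
    differs from \<open>g\<close> by a linear function.\<close>
  define F where "F x = g x + (L + 1) * x" for x
  have incr: "y - x \<le> F y - F x" if "x \<le> y" for x y
    using lip[of y x] that L0 by (simp add: F_def algebra_simps abs_le_iff)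
  have Flip: "\<bar>F y - F x\<bar> \<le> (2 * L + 1) * \<bar>y - x\<bar>" for x y
  proof -
    have "\<bar>F y - F x\<bar> \<le> \<bar>g y - g x\<bar> + \<bar>(L + 1) * (y - x)\<bar>"
      unfolding F_def by (simp add: algebra_simps abs_le_iff) (smt (verit))
    also have "\<dots> \<le> L * \<bar>y - x\<bar> + (L + 1) * \<bar>y - x\<bar>" using lip[of y x] L0 by (simp add: abs_mult)
    finally show ?thesis by (simp add: algebra_simps)
  qed
  have contF: "continuous_on UNIV F"
    by (rule lipschitz_on_continuous_on[of "2 * L + 1"]) (use Flip L0 in \<open>auto intro!: lipschitz_onI simp: dist_real_def\<close>)
  have exp: "\<bar>y - x\<bar> \<le> \<bar>F y - F x\<bar>" for x y
    using incr[of x y] incr[of y x] by (cases "x \<le> y") auto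
  have "inj F" by (rule injI) (use exp in \<open>metis abs_0 abs_le_zero_iff diff_self eq_iff_diff_eq_0 right_minus_eq\<close>)
  moreover have "surj F"
  proof (unfold surj_def, rule allI)
    fix y
    define r where "r = \<bar>y - F 0\<bar>"
    have r: "r \<ge> 0" "F (- r) \<le> y" "y \<le> F r"
      using incr[of "- r" 0] incr[of 0 r] by (auto simp: r_def abs_if split: if_splits)
    obtain x where "F x = y"
      using IVT'[of F "- r" y r] r continuous_on_subset[OF contF] by auto
    then show "\<exists>x. y = F x" by blast
  qed
  ultimately have bij: "bij F" by (simp add: bij_def)
  define G where "G = inv F"
  have FG: "F (G y) = y" and GF: "G (F x) = x" for x y
    using bij by (simp_all add: G_def bij_is_surj surj_f_inv_f bij_is_inj)
  have contG: "continuous_on UNIV G"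
    by (rule lipschitz_on_continuous_on[of 1])
       (use exp[of "G _" "G _"] in \<open>auto intro!: lipschitz_onI simp: dist_real_def FG\<close>)
  then have Gm[measurable]: "G \<in> borel_measurable borel" by (rule borel_measurable_continuous_onI)
  have Fm[measurable]: "F \<in> borel_measurable borel" using contF by (rule borel_measurable_continuous_onI)
  have vim: "G -` A = F ` A" for A
    using FG GF by (auto simp: image_iff) (metis FG)
  \<comment> \<open>\<open>D\<close> assigns to a Borel set the length of its image under
    \<open>F\<close>. The Lipschitz bound sends null sets to null sets, so \<open>D\<close> has a
    Radon-Nikodym density, and \<open>F\<close> is an indefinite integral of it.\<close>
  define D where "D = distr lborel borel G"
  have emD: "emeasure D A = emeasure lborel (F ` A)" if "A \<in> sets borel" for A
    using that by (simp add: D_def emeasure_distr vim)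
  have ac: "absolutely_continuous lborel D"
    unfolding absolutely_continuous_def
  proof
    fix A :: "real set" assume A: "A \<in> null_sets lborel"
    then have Ab: "A \<in> sets borel" and "negligible A"
      by (auto simp: negligible_iff_null_sets null_sets_completionI)
    then have "negligible (F ` A)"
      by (intro negligible_locally_Lipschitz_image)
         (auto intro!: exI[of _ UNIV] exI[of _ "2 * L + 1"] Flip)
    moreover have Fb: "F ` A \<in> sets borel"
      using measurable_sets_borel[OF Gm Ab] by (simp add: vim)
    ultimately have "emeasure lborel (F ` A) = 0"
      by (simp add: negligible_iff_null_sets null_sets_completion_iff null_sets_def)
    then show "A \<in> null_sets D" using emD[OF Ab] Ab by (auto simp: null_sets_def D_def)
  qed
  have sD: "sets D = sets lborel" by (simp add: D_def)
  obtain f where f[measurable]: "f \<in> borel_measurable lborel" and fD: "density lborel f = D"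
    using sigma_finite_measure.Radon_Nikodym[OF sigma_finite_lborel ac sD] by blast
  \<comment> \<open>The density may be infinite on a null set; \<open>enn2real\<close> replaces it
    by 0 there.\<close>
  define f' where "f' x = enn2real (f x)" for x
  have f'm[measurable]: "f' \<in> borel_measurable borel" unfolding f'_def by measurable
  have I: "(f' has_integral (F y - F x)) {x..y}" if xy: "x \<le> y" for x y
  proof -
    have img: "F ` {x..y} = {F x..F y}"
    proof (intro equalityI subsetI)
      fix z assume "z \<in> F ` {x..y}"
      then show "z \<in> {F x..F y}" using incr by force
    next
      fix z assume z: "z \<in> {F x..F y}"
      have "x \<le> G z" using incr[of "G z" x] z FG[of z] by fastforce
      moreover have "G z \<le> y" using incr[of y "G z"] z FG[of z] by fastforce
      ultimately show "z \<in> F ` {x..y}" using FG[of z] by (auto simp: image_iff intro!: bexI[of _ "G z"])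
    qed
    have le: "F x \<le> F y" using incr[OF xy] xy by linarith
    have eq: "(\<integral>\<^sup>+t. f t * indicator {x..y} t \<partial>lborel) = ennreal (F y - F x)"
      using emD[of "{x..y}"] le emeasure_density[OF f, of "{x..y}"] by (simp add: fD img)
    then have "AE t in lborel. f t * indicator {x..y} t \<noteq> \<infinity>"
      by (intro nn_integral_PInf_AE) auto
    then have "(\<integral>\<^sup>+t. ennreal (f' t * indicator {x..y} t) \<partial>lborel) = (\<integral>\<^sup>+t. f t * indicator {x..y} t \<partial>lborel)"
      by (intro nn_integral_cong_AE) (auto simp: f'_def indicator_def less_top)
    then have "((\<lambda>t. f' t * indicator {x..y} t) has_integral (F y - F x)) UNIV"
      using eq le by (intro nn_integral_has_integral) (auto simp: f'_def)
    moreover have "(\<lambda>t. f' t * indicator {x..y} t) = (\<lambda>t. if t \<in> {x..y} then f' t else 0)"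
      by (auto simp: indicator_def)
    ultimately show ?thesis by (simp only: has_integral_restrict_UNIV)
  qed
  obtain N where N: "negligible N" "\<And>x. x \<notin> N \<Longrightarrow> (F has_real_derivative f' x) (at x)"
    using has_derivative_indefinite_integral_AE[OF I] by blast
  have "g differentiable (at x)" if "x \<notin> N" for x
  proof -
    have "((\<lambda>x. F x - (L + 1) * x) has_real_derivative f' x - (L + 1)) (at x)"
      using N(2)[OF that] by (auto intro!: derivative_eq_intros)
    moreover have "(\<lambda>x. F x - (L + 1) * x) = g" by (simp add: F_def fun_eq_iff)
    ultimately have "(g has_real_derivative f' x - (L + 1)) (at x)" by simp
    then show ?thesis unfolding real_differentiable_def by blast
  qed
  then have "{x. \<not> g differentiable (at x)} \<subseteq> N" by blast
  then show ?thesis by (rule negligible_subset[OF N(1)])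
qed

text \<open>Maly's argument for Stepanov's theorem: where the difference quotients are bounded by \<open>L\<close>,
  the function is squeezed between its largest \<open>L\<close>-Lipschitz minorant and smallest majorant.\<close>

lemma bounded_quotients_differentiable_AE:
  fixes f :: "real \<Rightarrow> real"
  assumes E: "E = {x \<in> {u<..<v}. \<forall>y\<in>{u<..<v}. \<bar>f y - f x\<bar> \<le> L * \<bar>y - x\<bar>}"
  shows "negligible {x \<in> E. \<not> f differentiable (at x)}"
proof (cases "E = {}")
  case False
  then obtain x0 where x0: "x0 \<in> E" by blast
  have L0: "L \<ge> 0"
  proof -
    have "(x0 + v) / 2 \<in> {u<..<v}" "(x0 + v) / 2 \<noteq> x0" using x0 E by auto
    then have p: "0 < \<bar>(x0 + v) / 2 - x0\<bar>" and "\<bar>f ((x0 + v) / 2) - f x0\<bar> \<le> L * \<bar>(x0 + v) / 2 - x0\<bar>"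
      using x0 unfolding E by (simp, blast)
    then have "0 \<le> L * \<bar>(x0 + v) / 2 - x0\<bar>" by linarith
    then show ?thesis using p by (simp add: zero_le_mult_iff)
  qed
  have Eb: "\<bar>f x - f y\<bar> \<le> L * \<bar>x - y\<bar>" if "x \<in> E" "y \<in> {u<..<v}" for x y
    using that unfolding E by (auto simp: abs_minus_commute)
  have EI: "x \<in> {u<..<v}" if "x \<in> E" for x using that E by auto
  define lo where "lo y = (SUP x\<in>E. f x - L * \<bar>y - x\<bar>)" for y
  define hi where "hi y = (INF x\<in>E. f x + L * \<bar>y - x\<bar>)" for y
  have tri: "L * \<bar>a - c\<bar> \<le> L * \<bar>a - b\<bar> + L * \<bar>b - c\<bar>" for a b c
    using mult_left_mono[OF abs_triangle_ineq[of "a - b" "b - c"] L0] by (simp add: algebra_simps)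
  have ba: "bdd_above ((\<lambda>x. f x - L * \<bar>y - x\<bar>) ` E)" for y
  proof (rule bdd_aboveI2)
    fix x assume "x \<in> E"
    then show "f x - L * \<bar>y - x\<bar> \<le> f x0 + L * \<bar>y - x0\<bar>"
      using Eb[of x x0] EI[OF x0] tri[of x x0 y] by (auto simp: abs_minus_commute)
  qed
  have bb: "bdd_below ((\<lambda>x. f x + L * \<bar>y - x\<bar>) ` E)" for y
  proof (rule bdd_belowI2)
    fix x assume "x \<in> E"
    then show "f x0 - L * \<bar>y - x0\<bar> \<le> f x + L * \<bar>y - x\<bar>"
      using Eb[of x x0] EI[OF x0] tri[of x x0 y] by (auto simp: abs_minus_commute)
  qed
  have lo1: "lo y \<le> lo z + L * \<bar>y - z\<bar>" for y z
    unfolding lo_def[of y]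
  proof (rule cSUP_least[OF False])
    fix x assume "x \<in> E"
    then have "f x - L * \<bar>z - x\<bar> \<le> lo z" unfolding lo_def by (intro cSUP_upper ba)
    then show "f x - L * \<bar>y - x\<bar> \<le> lo z + L * \<bar>y - z\<bar>"
      using tri[of z x y] by (simp add: abs_minus_commute)
  qed
  have hi1: "hi y - L * \<bar>y - z\<bar> \<le> hi z" for y z
    unfolding hi_def[of z]
  proof (rule cINF_greatest[OF False])
    fix x assume "x \<in> E"
    then have "hi y \<le> f x + L * \<bar>y - x\<bar>" unfolding hi_def by (intro cINF_lower bb)
    then show "hi y - L * \<bar>y - z\<bar> \<le> f x + L * \<bar>z - x\<bar>"
      using tri[of y x z] by (simp add: abs_minus_commute)
  qed
  have "\<bar>lo y - lo z\<bar> \<le> L * \<bar>y - z\<bar>" for y z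
    using lo1[of y z] lo1[of z y] by (simp add: abs_minus_commute abs_le_iff)
  then have Nlo: "negligible {x. \<not> lo differentiable (at x)}" by (rule lipschitz_differentiable_AE)
  have "\<bar>hi y - hi z\<bar> \<le> L * \<bar>y - z\<bar>" for y z
    using hi1[of y z] hi1[of z y] by (simp add: abs_minus_commute abs_le_iff)
  then have Nhi: "negligible {x. \<not> hi differentiable (at x)}" by (rule lipschitz_differentiable_AE)
  have lof: "lo y \<le> f y" and fhi: "f y \<le> hi y" if y: "y \<in> {u<..<v}" for y
  proof -
    show "lo y \<le> f y" unfolding lo_def
      by (rule cSUP_least[OF False]) (use Eb y in \<open>fastforce simp: abs_minus_commute\<close>)
    show "f y \<le> hi y" unfolding hi_def
      by (rule cINF_greatest[OF False]) (use Eb y in \<open>fastforce simp: abs_minus_commute\<close>)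
  qed
  have eqs: "lo x = f x" "hi x = f x" if x: "x \<in> E" for x
  proof -
    have "f x \<le> lo x" using cSUP_upper[OF x ba[of x]] by (simp add: lo_def)
    then show "lo x = f x" using lof[OF EI[OF x]] by linarith
    have "hi x \<le> f x" using cINF_lower[OF bb[of x] x] by (simp add: hi_def)
    then show "hi x = f x" using fhi[OF EI[OF x]] by linarith
  qed
  have "f differentiable (at x)" if x: "x \<in> E" and dl: "lo differentiable (at x)" and dh: "hi differentiable (at x)" for x
  proof -
    obtain l where l: "(lo has_real_derivative l) (at x)" using dl by (auto simp: real_differentiable_def)
    obtain h where h: "(hi has_real_derivative h) (at x)" using dh by (auto simp: real_differentiable_def)
    define r where "r = min (x - u) (v - x)"
    have r: "r > 0" "\<And>y. \<bar>x - y\<bar> < r \<Longrightarrow> y \<in> {u<..<v}" using EI[OF x] by (auto simp: r_def)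
    \<comment> \<open>\<open>hi - lo\<close> is nonnegative near \<open>x\<close> and 0 at
      \<open>x\<close>, so its derivative vanishes and both envelopes have the same slope;
      \<open>f\<close> is caught between them.\<close>
    have "h - l = 0"
    proof (rule DERIV_local_min[of "\<lambda>y. hi y - lo y" _ x r])
      show "((\<lambda>y. hi y - lo y) has_real_derivative h - l) (at x)" using l h by (auto intro!: derivative_intros)
      show "\<forall>y. \<bar>x - y\<bar> < r \<longrightarrow> hi x - lo x \<le> hi y - lo y"
        using lof fhi r eqs[OF x] by (metis diff_ge_0_iff_ge diff_self order_trans)
    qed (rule r(1))
    then have "h = l" by simp
    have "(f has_derivative (\<lambda>t. l * t)) (at x)"
      unfolding has_derivative_within_alt
    proof (intro conjI allI impI)
      show "bounded_linear ((*) l)" by (rule bounded_linear_mult_right)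
      fix e :: real assume "e > 0"
      obtain d1 where d1: "d1 > 0" "\<And>y. norm (y - x) < d1 \<Longrightarrow> norm (lo y - lo x - l * (y - x)) \<le> e * norm (y - x)"
        using l \<open>e > 0\<close> unfolding has_field_derivative_def has_derivative_within_alt by auto
      obtain d2 where d2: "d2 > 0" "\<And>y. norm (y - x) < d2 \<Longrightarrow> norm (hi y - hi x - l * (y - x)) \<le> e * norm (y - x)"
        using h \<open>e > 0\<close> unfolding has_field_derivative_def has_derivative_within_alt \<open>h = l\<close> by auto
      show "\<exists>d>0. \<forall>y\<in>UNIV. norm (y - x) < d \<longrightarrow> norm (f y - f x - l * (y - x)) \<le> e * norm (y - x)"
      proof (intro exI conjI ballI impI)
        show "min r (min d1 d2) > 0" using r d1 d2 by simp
        fix y assume y: "norm (y - x) < min r (min d1 d2)"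
        have "y \<in> {u<..<v}" using y by (intro r) (auto simp: abs_minus_commute)
        then show "norm (f y - f x - l * (y - x)) \<le> e * norm (y - x)"
          using lof[of y] fhi[of y] d1(2)[of y] d2(2)[of y] y eqs[OF x] by (simp add: abs_le_iff)
      qed
    qed
    then show ?thesis by (auto simp: differentiable_def)
  qed
  then have "{x \<in> E. \<not> f differentiable (at x)} \<subseteq> {x. \<not> lo differentiable (at x)} \<union> {x. \<not> hi differentiable (at x)}"
    by blast
  then show ?thesis by (rule negligible_subset[OF negligible_Un[OF Nlo Nhi]])
qed auto

text \<open>Off \<open>Z\<close> some natural \<open>L\<close> bounds the quotients at
  \<open>x\<close> within distance \<open>1 / (L + 1)\<close>. On a cell of half that length with
  rational left end this is a bound against every point of the cell, as the preceding lemma demands,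
  and the cells are countable in number.\<close>

lemma abs_continuous_real_differentiable_AE:
  fixes f :: "real \<Rightarrow> real"
  assumes Z: "negligible Z" "Z = {x \<in> {a<..<b}. \<forall>L::nat. \<exists>y\<in>{a<..<b}.
           \<bar>y - x\<bar> < 1 / (real L + 1) \<and> real L * \<bar>y - x\<bar> < \<bar>f y - f x\<bar>}"
  shows "negligible {x \<in> {a<..<b}. \<not> f differentiable (at x)}"
proof -
  define cell where "cell L r = {max a r<..<min b (r + 1 / (2 * (real L + 1)))}" for L :: nat and r
  define E where "E L r = {x \<in> cell L r. \<forall>y\<in>cell L r. \<bar>f y - f x\<bar> \<le> real L * \<bar>y - x\<bar>}" for L r
  have "negligible (\<Union>p\<in>UNIV \<times> \<rat>. {x \<in> E (fst p) (snd p). \<not> f differentiable (at x)})"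
  proof (rule negligible_countable_Union)
    fix S assume "S \<in> (\<lambda>p. {x \<in> E (fst p) (snd p). \<not> f differentiable (at x)}) ` (UNIV \<times> \<rat>)"
    then obtain L r where "S = {x \<in> E L r. \<not> f differentiable (at x)}" by auto
    then show "negligible S"
      using bounded_quotients_differentiable_AE[OF E_def[unfolded cell_def]] by simp
  qed (auto intro!: countable_SIGMA countable_rat)
  then have "negligible (Z \<union> (\<Union>p\<in>UNIV \<times> \<rat>. {x \<in> E (fst p) (snd p). \<not> f differentiable (at x)}))"
    using Z by simp
  then show ?thesis
  proof (rule negligible_subset, safe)
    fix x assume x: "x \<in> {a<..<b}" "\<not> f differentiable (at x)"
      "x \<notin> (\<Union>p\<in>UNIV \<times> \<rat>. {x \<in> E (fst p) (snd p). \<not> f differentiable (at x)})"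
    show "x \<in> Z"
    proof (rule ccontr)
      assume "x \<notin> Z"
      then obtain L :: nat where "\<not> (\<exists>y\<in>{a<..<b}. \<bar>y - x\<bar> < 1 / (real L + 1) \<and> real L * \<bar>y - x\<bar> < \<bar>f y - f x\<bar>)"
        using x(1) unfolding Z(2) by blast
      then have L: "\<And>y. y \<in> {a<..<b} \<Longrightarrow> \<bar>y - x\<bar> < 1 / (real L + 1) \<Longrightarrow> \<bar>f y - f x\<bar> \<le> real L * \<bar>y - x\<bar>"
        by (meson not_less)
      obtain r where r: "r \<in> \<rat>" "x - 1 / (2 * (real L + 1)) < r" "r < x"
        using Rats_dense_in_real[of "x - 1 / (2 * (real L + 1))" x] by auto
      have xc: "x \<in> cell L r" using x(1) r by (auto simp: cell_def)
      have "\<bar>f y - f x\<bar> \<le> real L * \<bar>y - x\<bar>" if y: "y \<in> cell L r" for y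
      proof (rule L)
        have "\<bar>y - x\<bar> < 1 / (2 * (real L + 1))" using y xc by (auto simp: cell_def)
        also have "\<dots> \<le> 1 / (real L + 1)" by (simp add: field_simps)
        finally show "\<bar>y - x\<bar> < 1 / (real L + 1)" .
      qed (use y in \<open>auto simp: cell_def\<close>)
      then have "x \<in> E L r" using xc by (simp add: E_def)
      then show False using x(2,3) r(1) by force
    qed
  qed
qed

lemma abs_continuous_on_interval_mono:
  assumes "abs_continuous_on_interval a b f" "\<And>x y. cmod (g x - g y) \<le> cmod (f x - f y)"
  shows "abs_continuous_on_interval a b g"
  unfolding abs_continuous_on_interval_def
proof (intro allI impI)
  fix \<epsilon> :: real assume "0 < \<epsilon>"
  then obtain \<delta> where "\<delta> > 0" and D: "\<forall>(N::nat) u v. (\<forall>i<N. a \<le> u i \<and> u i \<le> v i \<and> v i \<le> b) \<longrightarrow>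
        disjoint_family_on (\<lambda>i. {u i<..<v i}) {..<N} \<longrightarrow> (\<Sum>i<N. v i - u i) < \<delta> \<longrightarrow>
        (\<Sum>i<N. cmod (f (v i) - f (u i))) < \<epsilon>"
    using assms(1) unfolding abs_continuous_on_interval_def by meson
  have "(\<Sum>i<N. cmod (g (v i) - g (u i))) \<le> (\<Sum>i<N. cmod (f (v i) - f (u i)))" for N :: nat and u v :: "nat \<Rightarrow> real"
    by (intro sum_mono assms(2))
  then show "\<exists>\<delta>>0. \<forall>(N::nat) u v. (\<forall>i<N. a \<le> u i \<and> u i \<le> v i \<and> v i \<le> b) \<longrightarrow>
        disjoint_family_on (\<lambda>i. {u i<..<v i}) {..<N} \<longrightarrow> (\<Sum>i<N. v i - u i) < \<delta> \<longrightarrow>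
        (\<Sum>i<N. cmod (g (v i) - g (u i))) < \<epsilon>"
    using \<open>\<delta> > 0\<close> D by (meson le_less_trans)
qed

lemma abs_continuous_differentiable_AE:
  assumes ac: "abs_continuous_on_interval a b f"
  shows "negligible {x \<in> {a<..<b}. \<not> f differentiable (at x)}"
proof -
  have part: "negligible {x \<in> {a<..<b}. \<not> g differentiable (at x)}"
    if g: "\<And>x y. \<bar>g x - g y\<bar> \<le> cmod (f x - f y)" for g :: "real \<Rightarrow> real"
  proof (rule abs_continuous_real_differentiable_AE[OF _ refl])
    have "abs_continuous_on_interval a b (\<lambda>x. complex_of_real (g x))"
      by (rule abs_continuous_on_interval_mono[OF ac])
         (use g in \<open>simp flip: of_real_diff\<close>)
    from abs_continuous_quotients_bounded[OF this]
    show "negligible {x \<in> {a<..<b}. \<forall>L::nat. \<exists>y\<in>{a<..<b}.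
           \<bar>y - x\<bar> < 1 / (real L + 1) \<and> real L * \<bar>y - x\<bar> < \<bar>g y - g x\<bar>}"
      by (simp flip: of_real_diff)
  qed
  have Re: "negligible {x \<in> {a<..<b}. \<not> (\<lambda>x. Re (f x)) differentiable (at x)}"
    using abs_Re_le_cmod[of "f _ - f _"] by (intro part) simp
  have Im: "negligible {x \<in> {a<..<b}. \<not> (\<lambda>x. Im (f x)) differentiable (at x)}"
    using abs_Im_le_cmod[of "f _ - f _"] by (intro part) simp
  have "f differentiable (at x)"
    if dR: "(\<lambda>x. Re (f x)) differentiable (at x)" and dI: "(\<lambda>x. Im (f x)) differentiable (at x)" for x
  proof -
    obtain A where A: "((\<lambda>x. Re (f x)) has_derivative A) (at x)" using dR unfolding differentiable_def by blast
    obtain B where B: "((\<lambda>x. Im (f x)) has_derivative B) (at x)" using dI unfolding differentiable_def by blast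
    have "((\<lambda>x. complex_of_real (Re (f x)) + \<i> * complex_of_real (Im (f x)))
        has_derivative (\<lambda>h. complex_of_real (A h) + \<i> * complex_of_real (B h))) (at x)"
      by (intro has_derivative_add has_derivative_mult_right bounded_linear.has_derivative[OF bounded_linear_of_real] A B)
    then have "(f has_derivative (\<lambda>h. complex_of_real (A h) + \<i> * complex_of_real (B h))) (at x)"
      by (simp flip: complex_eq)
    then show ?thesis by (auto simp: differentiable_def)
  qed
  then have "{x \<in> {a<..<b}. \<not> f differentiable (at x)} \<subseteq>
      {x \<in> {a<..<b}. \<not> (\<lambda>x. Re (f x)) differentiable (at x)} \<union> {x \<in> {a<..<b}. \<not> (\<lambda>x. Im (f x)) differentiable (at x)}"
    by blast
  then show ?thesis by (rule negligible_subset[OF negligible_Un[OF Re Im]])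
qed

lemma locally_abs_continuous_differentiable_AE:
  assumes "locally_abs_continuous f"
  shows "negligible {x \<in> {0<..}. \<not> f differentiable (at x)}"
proof -
  have "negligible (\<Union>k::nat. {x \<in> {1 / (real k + 1)<..<real k + 1}. \<not> f differentiable (at x)})"
  proof (rule negligible_countable_Union)
    fix S assume "S \<in> range (\<lambda>k::nat. {x \<in> {1 / (real k + 1)<..<real k + 1}. \<not> f differentiable (at x)})"
    then obtain k :: nat where S: "S = {x \<in> {1 / (real k + 1)<..<real k + 1}. \<not> f differentiable (at x)}" by blast
    have "1 / (real k + 1) \<le> real k + 1" by (simp add: field_simps)
    then have "abs_continuous_on_interval (1 / (real k + 1)) (real k + 1) f"
      using assms unfolding locally_abs_continuous_def by simp
    then show "negligible S" unfolding S by (rule abs_continuous_differentiable_AE)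
  qed auto
  then show ?thesis
  proof (rule negligible_subset, safe)
    fix x :: real assume x: "x > 0" "\<not> f differentiable (at x)"
    obtain k :: nat where k: "max x (1 / x) < k" using reals_Archimedean2 by blast
    then have "1 / x < real k + 1" "x < real k + 1" by auto
    then have "1 / (real k + 1) < x" using x by (simp add: field_simps)
    then show "x \<in> (\<Union>k::nat. {x \<in> {1 / (real k + 1)<..<real k + 1}. \<not> f differentiable (at x)})"
      using x \<open>x < real k + 1\<close> by auto
  qed
qed

section \<open>Stability of absolute continuity\<close>

text \<open>Serves two cases: products of an absolutely continuous function with a locally Lipschitz
  factor, such as \<open>P * prim k\<close> and \<open>p * h'\<close> below, and, with
  \<open>f\<close> constant, Lipschitz functions.\<close>

lemma abs_continuous_comparison:
  assumes ac: "abs_continuous_on_interval a b f" and BL: "0 \<le> B" "0 \<le> L"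
    and le: "\<And>u v. a \<le> u \<Longrightarrow> u \<le> v \<Longrightarrow> v \<le> b \<Longrightarrow> cmod (g v - g u) \<le> B * cmod (f v - f u) + L * (v - u)"
  shows "abs_continuous_on_interval a b g"
  unfolding abs_continuous_on_interval_def
proof (intro allI impI)
  fix \<epsilon> :: real assume e: "0 < \<epsilon>"
  then have "0 < \<epsilon> / (2 * (B + 1))" using BL by simp
  then obtain \<delta> where d: "\<delta> > 0" and D: "\<forall>(N::nat) u v. (\<forall>i<N. a \<le> u i \<and> u i \<le> v i \<and> v i \<le> b) \<longrightarrow>
        disjoint_family_on (\<lambda>i. {u i<..<v i}) {..<N} \<longrightarrow> (\<Sum>i<N. v i - u i) < \<delta> \<longrightarrow>
        (\<Sum>i<N. cmod (f (v i) - f (u i))) < \<epsilon> / (2 * (B + 1))"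
    using ac unfolding abs_continuous_on_interval_def by meson
  show "\<exists>\<delta>>0. \<forall>(N::nat) u v. (\<forall>i<N. a \<le> u i \<and> u i \<le> v i \<and> v i \<le> b) \<longrightarrow>
        disjoint_family_on (\<lambda>i. {u i<..<v i}) {..<N} \<longrightarrow> (\<Sum>i<N. v i - u i) < \<delta> \<longrightarrow>
        (\<Sum>i<N. cmod (g (v i) - g (u i))) < \<epsilon>"
  proof (intro exI conjI allI impI)
    show "0 < min \<delta> (\<epsilon> / (2 * (L + 1)))" using d e BL by simp
    fix N :: nat and u v :: "nat \<Rightarrow> real"
    assume uv: "\<forall>i<N. a \<le> u i \<and> u i \<le> v i \<and> v i \<le> b"
      and dj: "disjoint_family_on (\<lambda>i. {u i<..<v i}) {..<N}"
      and s: "(\<Sum>i<N. v i - u i) < min \<delta> (\<epsilon> / (2 * (L + 1)))"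
    have 1: "(\<Sum>i<N. cmod (f (v i) - f (u i))) < \<epsilon> / (2 * (B + 1))" using D uv dj s by simp
    have 2: "(\<Sum>i<N. v i - u i) < \<epsilon> / (2 * (L + 1))" using s by simp
    have p: "0 \<le> (\<Sum>i<N. cmod (f (v i) - f (u i)))" "0 \<le> (\<Sum>i<N. v i - u i)"
      using uv by (auto intro!: sum_nonneg)
    have "(\<Sum>i<N. cmod (g (v i) - g (u i))) \<le> (\<Sum>i<N. B * cmod (f (v i) - f (u i)) + L * (v i - u i))"
      using uv by (intro sum_mono le) auto
    also have "\<dots> = B * (\<Sum>i<N. cmod (f (v i) - f (u i))) + L * (\<Sum>i<N. v i - u i)"
      by (simp add: sum.distrib sum_distrib_left)
    also have "\<dots> \<le> (B + 1) * (\<Sum>i<N. cmod (f (v i) - f (u i))) + (L + 1) * (\<Sum>i<N. v i - u i)"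
      using p by (intro add_mono mult_right_mono) auto
    also have "\<dots> < \<epsilon> / 2 + \<epsilon> / 2"
    proof (rule add_strict_mono)
      show "(B + 1) * (\<Sum>i<N. cmod (f (v i) - f (u i))) < \<epsilon> / 2"
        using 1 BL by (simp add: field_simps)
      show "(L + 1) * (\<Sum>i<N. v i - u i) < \<epsilon> / 2"
        using 2 BL by (simp add: field_simps)
    qed
    finally show "(\<Sum>i<N. cmod (g (v i) - g (u i))) < \<epsilon>" by simp
  qed
qed

text \<open>\<open>m\<close> is at most \<open>k\<close> plus the excess \<open>s k\<close>. For
  large \<open>k\<close> the excess has a small integral whatever the intervals are, and the bounded
  part is controlled by the total length.\<close>

lemma abs_continuous_dominated:
  fixes m :: "real \<Rightarrow> real"
  assumes m: "integrable lebesgue m" and m0: "\<And>x. 0 \<le> m x"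
    and le: "\<And>u v. a \<le> u \<Longrightarrow> u \<le> v \<Longrightarrow> v \<le> b \<Longrightarrow>
      cmod (g v - g u) \<le> (\<integral>y. indicator {u<..<v} y * m y \<partial>lebesgue)"
  shows "abs_continuous_on_interval a b g"
  unfolding abs_continuous_on_interval_def
proof (intro allI impI)
  fix \<epsilon> :: real assume e: "0 < \<epsilon>"
  define s where "s k y = max (m y - real k) 0" for k y
  have [measurable]: "m \<in> borel_measurable lebesgue" using m by auto
  have sm[measurable]: "s k \<in> borel_measurable lebesgue" for k unfolding s_def by measurable
  have sb: "0 \<le> s k y" "s k y \<le> m y" "m y \<le> real k + s k y" for k y using m0[of y] by (auto simp: s_def)
  have si: "integrable lebesgue (s k)" for k
    by (rule Bochner_Integration.integrable_bound[OF m]) (use sb m0 in auto)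
  have "(\<lambda>k. \<integral>y. s k y \<partial>lebesgue) \<longlonglongrightarrow> (\<integral>y. 0 \<partial>(lebesgue :: real measure))"
  proof (rule integral_dominated_convergence[where w = m])
    show "AE y in lebesgue. (\<lambda>k. s k y) \<longlonglongrightarrow> 0"
    proof (rule AE_I2)
      fix y :: real
      obtain k0 :: nat where "m y < k0" using reals_Archimedean2 by blast
      then have "\<forall>\<^sub>F k in sequentially. s k y = 0"
        by (intro eventually_sequentiallyI[of k0]) (auto simp: s_def)
      then show "(\<lambda>k. s k y) \<longlonglongrightarrow> 0" by (rule tendsto_eventually)
    qed
  qed (use m sb m0 in auto)
  then have "(\<lambda>k. \<integral>y. s k y \<partial>lebesgue) \<longlonglongrightarrow> 0" by simp
  then have "\<forall>\<^sub>F k in sequentially. (\<integral>y. s k y \<partial>lebesgue) < \<epsilon> / 2"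
    by (rule order_tendstoD) (use e in simp)
  then obtain k where k: "(\<integral>y. s k y \<partial>lebesgue) < \<epsilon> / 2" by (auto simp: eventually_sequentially)
  show "\<exists>\<delta>>0. \<forall>(N::nat) u v. (\<forall>i<N. a \<le> u i \<and> u i \<le> v i \<and> v i \<le> b) \<longrightarrow>
        disjoint_family_on (\<lambda>i. {u i<..<v i}) {..<N} \<longrightarrow> (\<Sum>i<N. v i - u i) < \<delta> \<longrightarrow>
        (\<Sum>i<N. cmod (g (v i) - g (u i))) < \<epsilon>"
  proof (intro exI conjI allI impI)
    show "0 < \<epsilon> / (2 * (real k + 1))" using e by simp
    fix N :: nat and u v :: "nat \<Rightarrow> real"
    assume uv: "\<forall>i<N. a \<le> u i \<and> u i \<le> v i \<and> v i \<le> b"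
      and dj: "disjoint_family_on (\<lambda>i. {u i<..<v i}) {..<N}"
      and sml: "(\<Sum>i<N. v i - u i) < \<epsilon> / (2 * (real k + 1))"
    have ii: "integrable lebesgue (\<lambda>y. indicator {u i<..<v i} y * s k y)" for i
      using integrable_mult_indicator[OF _ si[of k], of "{u i<..<v i}"] by simp
    have im: "integrable lebesgue (\<lambda>y. indicator {u i<..<v i} y * m y)" for i
      using integrable_mult_indicator[OF _ m, of "{u i<..<v i}"] by simp
    have "(\<Sum>i<N. cmod (g (v i) - g (u i))) \<le> (\<Sum>i<N. \<integral>y. indicator {u i<..<v i} y * m y \<partial>lebesgue)"
      using uv by (intro sum_mono le) auto
    also have "\<dots> \<le> (\<Sum>i<N. real k * (v i - u i) + (\<integral>y. indicator {u i<..<v i} y * s k y \<partial>lebesgue))"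
    proof (rule sum_mono)
      fix i assume "i \<in> {..<N}"
      then have i: "u i \<le> v i" using uv by simp
      have ik: "integrable lebesgue (\<lambda>y. real k * indicator {u i<..<v i} y)"
        using i by (intro integrable_mult_right) (auto intro!: integrable_real_indicator)
      have "(\<integral>y. indicator {u i<..<v i} y * m y \<partial>lebesgue) \<le>
          (\<integral>y. real k * indicator {u i<..<v i} y + indicator {u i<..<v i} y * s k y \<partial>lebesgue)"
        using ik ii[of i] im[of i] sb by (intro integral_mono) (auto simp: indicator_def)
      also have "\<dots> = real k * (v i - u i) + (\<integral>y. indicator {u i<..<v i} y * s k y \<partial>lebesgue)"
        using ik ii[of i] i by (subst Bochner_Integration.integral_add) auto
      finally show "(\<integral>y. indicator {u i<..<v i} y * m y \<partial>lebesgue) \<le>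
        real k * (v i - u i) + (\<integral>y. indicator {u i<..<v i} y * s k y \<partial>lebesgue)" .
    qed
    also have "\<dots> = real k * (\<Sum>i<N. v i - u i) + (\<integral>y. (\<Sum>i<N. indicator {u i<..<v i} y * s k y) \<partial>lebesgue)"
      unfolding sum.distrib sum_distrib_left
      by (subst Bochner_Integration.integral_sum[OF ii]) (rule refl)
    also have "(\<integral>y. (\<Sum>i<N. indicator {u i<..<v i} y * s k y) \<partial>lebesgue) \<le> (\<integral>y. s k y \<partial>lebesgue)"
    proof (rule integral_mono)
      fix y
      have "(\<Sum>i<N. indicator {u i<..<v i} y) = (indicator (\<Union>i<N. {u i<..<v i}) y :: real)"
        by (rule indicator_UN_disjoint[OF finite_lessThan dj, symmetric])
      then show "(\<Sum>i<N. indicator {u i<..<v i} y * s k y) \<le> s k y"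
        using sb(1)[of k y] by (auto simp: indicator_def simp flip: sum_distrib_right)
    qed (rule Bochner_Integration.integrable_sum[OF ii] si)+
    also have "real k * (\<Sum>i<N. v i - u i) + (\<integral>y. s k y \<partial>lebesgue) < \<epsilon>"
    proof -
      have "0 \<le> (\<Sum>i<N. v i - u i)" using uv by (auto intro!: sum_nonneg)
      then have "real k * (\<Sum>i<N. v i - u i) \<le> (real k + 1) * (\<Sum>i<N. v i - u i)" by (intro mult_right_mono) auto
      also have "\<dots> < \<epsilon> / 2" using sml by (simp add: field_simps)
      finally show ?thesis using k by simp
    qed
    finally show "(\<Sum>i<N. cmod (g (v i) - g (u i))) < \<epsilon>" by simp
  qed
qed

lemma abs_continuous_imp_continuous_on:
  assumes "abs_continuous_on_interval a b f"
  shows "continuous_on {a..b} f"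
  unfolding continuous_on_iff
proof (intro ballI allI impI)
  fix x :: real and e :: real assume x: "x \<in> {a..b}" and "e > 0"
  then obtain \<delta> where d: "\<delta> > 0" and D: "\<forall>(N::nat) u v. (\<forall>i<N. a \<le> u i \<and> u i \<le> v i \<and> v i \<le> b) \<longrightarrow>
        disjoint_family_on (\<lambda>i. {u i<..<v i}) {..<N} \<longrightarrow> (\<Sum>i<N. v i - u i) < \<delta> \<longrightarrow>
        (\<Sum>i<N. cmod (f (v i) - f (u i))) < e"
    using assms unfolding abs_continuous_on_interval_def by meson
  have S: "cmod (f v - f u) < e" if "a \<le> u" "u \<le> v" "v \<le> b" "v - u < \<delta>" for u v
    using D[rule_format, of 1 "\<lambda>_. u" "\<lambda>_. v"] that by (simp add: disjoint_family_on_def)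
  show "\<exists>d>0. \<forall>x'\<in>{a..b}. dist x' x < d \<longrightarrow> dist (f x') (f x) < e"
  proof (intro exI[of _ \<delta>] conjI ballI impI d)
    fix y assume y: "y \<in> {a..b}" "dist y x < \<delta>"
    show "dist (f y) (f x) < e"
      using S[of x y] S[of y x] x y by (cases "x \<le> y") (auto simp: dist_norm norm_minus_commute)
  qed
qed

lemma has_vector_derivative_indefinite_integral_AE:
  fixes f F :: "real \<Rightarrow> complex"
  assumes F: "\<And>x y. x \<le> y \<Longrightarrow> (f has_integral (F y - F x)) {x..y}"
  shows "\<exists>N. negligible N \<and> (\<forall>x. x \<notin> N \<longrightarrow> (F has_vector_derivative f x) (at x))"
proof -
  have "((\<lambda>x. Re (f x)) has_integral (Re (F y) - Re (F x))) {x..y}" if "x \<le> y" for x y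
    using has_integral_linear[OF F[OF that] bounded_linear_Re] by (simp add: o_def)
  from has_derivative_indefinite_integral_AE[OF this] obtain N1 where N1: "negligible N1"
    "\<And>x. x \<notin> N1 \<Longrightarrow> ((\<lambda>x. Re (F x)) has_real_derivative Re (f x)) (at x)" by blast
  have "((\<lambda>x. Im (f x)) has_integral (Im (F y) - Im (F x))) {x..y}" if "x \<le> y" for x y
    using has_integral_linear[OF F[OF that] bounded_linear_Im] by (simp add: o_def)
  from has_derivative_indefinite_integral_AE[OF this] obtain N2 where N2: "negligible N2"
    "\<And>x. x \<notin> N2 \<Longrightarrow> ((\<lambda>x. Im (F x)) has_real_derivative Im (f x)) (at x)" by blast
  have "(F has_vector_derivative f x) (at x)" if x: "x \<notin> N1 \<union> N2" for x
  proof -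
    have "((\<lambda>x. complex_of_real (Re (F x)) + \<i> * complex_of_real (Im (F x)))
      has_vector_derivative (complex_of_real (Re (f x)) + \<i> * complex_of_real (Im (f x)))) (at x)"
      using N1(2)[of x] N2(2)[of x] x
      by (intro has_vector_derivative_add has_vector_derivative_mult_right has_vector_derivative_of_real)
         (auto simp: has_real_derivative_iff_has_vector_derivative)
    then show ?thesis by (simp flip: complex_eq)
  qed
  then show ?thesis using negligible_Un[OF N1(1) N2(1)] by blast
qed

section \<open>Resolvents of positive operators\<close>

lemma power_integral_add_sq:
  "(cmod (a + b))\<^sup>2 \<le> 2 * (cmod a)\<^sup>2 + 2 * (cmod b)\<^sup>2"
proof -
  have "(cmod (a + b))\<^sup>2 \<le> (cmod a + cmod b)\<^sup>2"
    by (intro power_mono norm_triangle_ineq) auto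
  also have "\<dots> \<le> 2 * (cmod a)\<^sup>2 + 2 * (cmod b)\<^sup>2"
    using sum_squares_bound[of "cmod a" "cmod b"] by (simp add: power2_sum)
  finally show ?thesis .
qed

definition square_integrable :: "'a measure \<Rightarrow> ('a \<Rightarrow> complex) \<Rightarrow> bool" where
  "square_integrable M f \<longleftrightarrow> f \<in> borel_measurable M \<and> integrable M (\<lambda>x. (cmod (f x))\<^sup>2)"

lemma square_integrable_measurable[measurable_dest]: "square_integrable M f \<Longrightarrow> f \<in> borel_measurable M"
  by (simp add: square_integrable_def)

lemma square_integrable_sq: "square_integrable M f \<Longrightarrow> integrable M (\<lambda>x. (cmod (f x))\<^sup>2)"
  by (simp add: square_integrable_def)

lemma square_integrable_bound:
  assumes "square_integrable M f" "g \<in> borel_measurable M" "AE x in M. cmod (g x) \<le> C * cmod (f x)"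
  shows "square_integrable M g"
  unfolding square_integrable_def
proof (intro conjI assms(2))
  have "integrable M (\<lambda>x. C\<^sup>2 * (cmod (f x))\<^sup>2)" using assms(1) by (simp add: square_integrable_def)
  then show "integrable M (\<lambda>x. (cmod (g x))\<^sup>2)"
  proof (rule Bochner_Integration.integrable_bound)
    show "AE x in M. norm ((cmod (g x))\<^sup>2) \<le> norm (C\<^sup>2 * (cmod (f x))\<^sup>2)"
      using assms(3)
    proof eventually_elim
      fix x assume "cmod (g x) \<le> C * cmod (f x)"
      then have "(cmod (g x))\<^sup>2 \<le> (C * cmod (f x))\<^sup>2" by (intro power_mono) auto
      then show "norm ((cmod (g x))\<^sup>2) \<le> norm (C\<^sup>2 * (cmod (f x))\<^sup>2)" by (simp add: power_mult_distrib)
    qed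
  qed (use assms in measurable)
qed

lemma square_integrable_add:
  assumes "square_integrable M f" "square_integrable M g"
  shows "square_integrable M (\<lambda>x. f x + g x)"
  unfolding square_integrable_def
proof
  have "integrable M (\<lambda>x. 2 * (cmod (f x))\<^sup>2 + 2 * (cmod (g x))\<^sup>2)"
    using assms by (auto simp: square_integrable_def)
  then show "integrable M (\<lambda>x. (cmod (f x + g x))\<^sup>2)"
    by (rule Bochner_Integration.integrable_bound) (use assms in \<open>auto intro!: power_integral_add_sq dest!: square_integrable_measurable\<close>)
qed (use assms in \<open>auto simp: square_integrable_def\<close>)

lemma square_integrable_cmult:
  "square_integrable M f \<Longrightarrow> square_integrable M (\<lambda>x. c * f x)"
  by (rule square_integrable_bound[where C = "cmod c"]) (auto simp: norm_mult dest: square_integrable_measurable)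

lemma square_integrable_diff:
  "square_integrable M f \<Longrightarrow> square_integrable M g \<Longrightarrow> square_integrable M (\<lambda>x. f x - g x)"
  using square_integrable_add[of M f "\<lambda>x. (-1) * g x"] square_integrable_cmult[of M g "-1"] by simp

lemma borel_measurable_cnj[measurable (raw)]:
  "f \<in> borel_measurable M \<Longrightarrow> (\<lambda>x. cnj (f x)) \<in> borel_measurable M"
  by (rule measurable_compose[OF _ borel_measurable_continuous_onI]) (auto intro: continuous_intros)

lemma square_integrable_cnj_mult:
  assumes "square_integrable M f" "square_integrable M g"
  shows "integrable M (\<lambda>x. f x * cnj (g x))"
proof -
  have "integrable M (\<lambda>x. (cmod (f x))\<^sup>2 + (cmod (g x))\<^sup>2)"
    using assms by (auto simp: square_integrable_def)
  then show ?thesis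
  proof (rule Bochner_Integration.integrable_bound)
    show "AE x in M. norm (f x * cnj (g x)) \<le> norm ((cmod (f x))\<^sup>2 + (cmod (g x))\<^sup>2)"
    proof (rule AE_I2)
      fix x
      have "2 * (cmod (f x) * cmod (g x)) \<le> (cmod (f x))\<^sup>2 + (cmod (g x))\<^sup>2"
        using sum_squares_bound[of "cmod (f x)" "cmod (g x)"] by simp
      moreover have "0 \<le> cmod (f x) * cmod (g x)" by simp
      ultimately have "cmod (f x) * cmod (g x) \<le> (cmod (f x))\<^sup>2 + (cmod (g x))\<^sup>2" by linarith
      then show "norm (f x * cnj (g x)) \<le> norm ((cmod (f x))\<^sup>2 + (cmod (g x))\<^sup>2)"
        by (simp add: norm_mult)
    qed
  qed (use assms in \<open>auto dest!: square_integrable_measurable\<close>)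
qed

text \<open>The segment joining \<open>1\<close> to \<open>1 + \<delta> / a\<close> avoids \<open>0\<close>, so it lies in an open half plane.\<close>

lemma segment_half_plane:
  fixes \<delta> :: complex and a :: real
  assumes a: "a > 0" and d: "Im \<delta> \<noteq> 0 \<or> - a < Re \<delta>"
  obtains z \<epsilon> where "\<epsilon> > 0" "\<And>m s. 0 \<le> s \<Longrightarrow> a * s \<le> m \<Longrightarrow> \<epsilon> * m \<le> Re (z * (complex_of_real m + \<delta> * complex_of_real s))"
proof (cases "Im \<delta> = 0")
  case True
  show thesis
  \<comment> \<open>For real \<open>\<delta>\<close>, \<open>m > 0\<close> and
    \<open>0 <= s <= m / a\<close>, the quotient \<open>(m + \<delta> * s) / m\<close> lies between
    1 and \<open>1 + \<delta> / a\<close>.\<close>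
  proof (rule that[of "min 1 (1 + Re \<delta> / a)" 1])
    show "min 1 (1 + Re \<delta> / a) > 0" using d True a by (auto simp: field_simps)
    fix m s :: real assume s: "0 \<le> s" "a * s \<le> m"
    then have m0: "0 \<le> m" using a by (meson mult_nonneg_nonneg order_less_imp_le order_trans)
    show "min 1 (1 + Re \<delta> / a) * m \<le> Re (1 * (complex_of_real m + \<delta> * complex_of_real s))"
    proof (cases "Re \<delta> \<ge> 0")
      case True
      then show ?thesis using s a m0 by (simp add: min_def)
    next
      case False
      have "s \<le> m / a" using s a by (simp add: field_simps)
      then have "Re \<delta> * (m / a) \<le> Re \<delta> * s" using False by (intro mult_left_mono_neg) auto
      then have "(1 + Re \<delta> / a) * m \<le> m + Re \<delta> * s" by (simp add: algebra_simps)
      moreover have "min 1 (1 + Re \<delta> / a) * m \<le> (1 + Re \<delta> / a) * m" using m0 by (intro mult_right_mono) auto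
      ultimately show ?thesis by simp
    qed
  qed
next
  case False
  show thesis
  \<comment> \<open>This \<open>z\<close> turns \<open>\<delta>\<close> onto the imaginary axis: the
    term with \<open>s\<close> contributes nothing to the real part, while \<open>Re z\<close> is
    the modulus of \<open>Im \<delta>\<close>.\<close>
  proof (rule that[of "\<bar>Im \<delta>\<bar>" "complex_of_real (sgn (Im \<delta>)) * (\<i> * cnj \<delta>)"])
    show "\<bar>Im \<delta>\<bar> > 0" using False by simp
    fix m s :: real
    show "\<bar>Im \<delta>\<bar> * m \<le> Re (complex_of_real (sgn (Im \<delta>)) * (\<i> * cnj \<delta>) * (complex_of_real m + \<delta> * complex_of_real s))"
      by (simp add: algebra_simps sgn_if)
  qed
qed

text \<open>Here \<open>G\<close> is a positive operator of norm at most \<open>1 / a\<close>; \<open>I - t z (I + \<delta> G)\<close> is a strict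
  contraction for a small step \<open>t\<close>.\<close>

locale positive_operator =
  fixes M :: "'a measure" and G :: "('a \<Rightarrow> complex) \<Rightarrow> 'a \<Rightarrow> complex" and a :: real
  assumes a_pos: "a > 0"
    and G_sq: "square_integrable M k \<Longrightarrow> square_integrable M (G k)"
    and G_bound: "square_integrable M k \<Longrightarrow> a\<^sup>2 * (\<integral>x. (cmod (G k x))\<^sup>2 \<partial>M) \<le> (\<integral>x. (cmod (k x))\<^sup>2 \<partial>M)"
    and G_nonneg: "square_integrable M k \<Longrightarrow> \<exists>s\<ge>0. (\<integral>x. G k x * cnj (k x) \<partial>M) = complex_of_real s"
    \<comment> \<open>Linearity and continuity enter in this single pointwise form: elements are
      functions and not classes, and the series to which \<open>G\<close> is applied converge almost
      everywhere with a geometric majorant.\<close>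
    and G_suminf: "(\<And>j. square_integrable M (K j)) \<Longrightarrow> square_integrable M H \<Longrightarrow> square_integrable M l \<Longrightarrow> 0 < q \<Longrightarrow> q < 1 \<Longrightarrow>
        (AE x in M. (\<forall>j::nat. cmod (K j x) \<le> q ^ j * cmod (H x)) \<and> (\<lambda>j. K j x) sums l x) \<Longrightarrow>
        AE x in M. (\<lambda>j. G (K j) x) sums G l x"
begin

text \<open>Cauchy-Schwarz in the form \<open>2 u v <= u^2 + v^2\<close> with
  \<open>u = a * cmod (G k x)\<close> and \<open>v = cmod (k x)\<close>; the norm bound then absorbs
  the first square.\<close>

lemma G_inner:
  assumes k: "square_integrable M k"
  obtains s where "(\<integral>x. G k x * cnj (k x) \<partial>M) = complex_of_real s" "0 \<le> s" "a * s \<le> (\<integral>x. (cmod (k x))\<^sup>2 \<partial>M)"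
proof -
  obtain s where s: "s \<ge> 0" "(\<integral>x. G k x * cnj (k x) \<partial>M) = complex_of_real s" using G_nonneg[OF k] by blast
  note Gk = G_sq[OF k]
  have "a * s = a * cmod (\<integral>x. G k x * cnj (k x) \<partial>M)" using s by simp
  also have "\<dots> \<le> a * (\<integral>x. cmod (G k x * cnj (k x)) \<partial>M)"
    using a_pos by (intro mult_left_mono integral_norm_bound) auto
  also have "\<dots> \<le> (\<integral>x. (a\<^sup>2 * (cmod (G k x))\<^sup>2 + (cmod (k x))\<^sup>2) / 2 \<partial>M)"
    unfolding integral_mult_right_zero[symmetric]
  proof (rule integral_mono)
    show "integrable M (\<lambda>x. a * cmod (G k x * cnj (k x)))"
      using square_integrable_cnj_mult[OF Gk k] by simp
    show "integrable M (\<lambda>x. (a\<^sup>2 * (cmod (G k x))\<^sup>2 + (cmod (k x))\<^sup>2) / 2)"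
      using Gk k by (auto simp: square_integrable_def)
    show "a * cmod (G k x * cnj (k x)) \<le> (a\<^sup>2 * (cmod (G k x))\<^sup>2 + (cmod (k x))\<^sup>2) / 2" for x
      using sum_squares_bound[of "a * cmod (G k x)" "cmod (k x)"]
      by (simp add: norm_mult power_mult_distrib)
  qed
  also have "\<dots> = (a\<^sup>2 * (\<integral>x. (cmod (G k x))\<^sup>2 \<partial>M) + (\<integral>x. (cmod (k x))\<^sup>2 \<partial>M)) / 2"
    using Gk k by (simp add: square_integrable_def)
  also have "\<dots> \<le> (\<integral>x. (cmod (k x))\<^sup>2 \<partial>M)" using G_bound[OF k] by simp
  finally show thesis using that s by blast
qed

lemma shifted_sq: "square_integrable M k \<Longrightarrow> square_integrable M (\<lambda>x. k x + \<delta> * G k x)"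
  by (intro square_integrable_add square_integrable_cmult G_sq)

lemma shifted_inner:
  assumes k: "square_integrable M k"
  obtains s where "(\<integral>x. (k x + \<delta> * G k x) * cnj (k x) \<partial>M) = complex_of_real (\<integral>x. (cmod (k x))\<^sup>2 \<partial>M) + \<delta> * complex_of_real s"
    "0 \<le> s" "a * s \<le> (\<integral>x. (cmod (k x))\<^sup>2 \<partial>M)"
proof -
  obtain s where s: "(\<integral>x. G k x * cnj (k x) \<partial>M) = complex_of_real s" "0 \<le> s" "a * s \<le> (\<integral>x. (cmod (k x))\<^sup>2 \<partial>M)"
    using G_inner[OF k] by blast
  note i1 = square_integrable_cnj_mult[OF k k] and i2 = square_integrable_cnj_mult[OF G_sq[OF k] k]
  have "(\<integral>x. k x * cnj (k x) \<partial>M) = (\<integral>x. complex_of_real ((cmod (k x))\<^sup>2) \<partial>M)"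
    by (intro Bochner_Integration.integral_cong refl) (metis complex_norm_square)
  also have "\<dots> = complex_of_real (\<integral>x. (cmod (k x))\<^sup>2 \<partial>M)" by (rule integral_complex_of_real)
  finally have kk: "(\<integral>x. k x * cnj (k x) \<partial>M) = complex_of_real (\<integral>x. (cmod (k x))\<^sup>2 \<partial>M)" .
  have "(\<integral>x. (k x + \<delta> * G k x) * cnj (k x) \<partial>M) = (\<integral>x. k x * cnj (k x) + \<delta> * (G k x * cnj (k x)) \<partial>M)"
    by (intro Bochner_Integration.integral_cong refl) (simp add: algebra_simps)
  also have "\<dots> = (\<integral>x. k x * cnj (k x) \<partial>M) + \<delta> * (\<integral>x. G k x * cnj (k x) \<partial>M)"
    using i1 i2 by simp
  finally show thesis by (intro that[of s] s(2,3)) (simp add: s(1) kk)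
qed

text \<open>Pairing the equation with \<open>k\<close> and multiplying by \<open>z\<close> leaves a
  real part of at least \<open>\<epsilon>\<close> times the squared norm of
  \<open>k\<close>.\<close>

lemma shifted_injective:
  assumes d: "Im \<delta> \<noteq> 0 \<or> - a < Re \<delta>" and k: "square_integrable M k"
    and eq: "AE x in M. k x + \<delta> * G k x = 0"
  shows "AE x in M. k x = 0"
proof -
  obtain z \<epsilon> where z: "\<epsilon> > 0" "\<And>m s. 0 \<le> s \<Longrightarrow> a * s \<le> m \<Longrightarrow> \<epsilon> * m \<le> Re (z * (complex_of_real m + \<delta> * complex_of_real s))"
    by (rule segment_half_plane[OF a_pos d]) blast
  obtain s where s: "(\<integral>x. (k x + \<delta> * G k x) * cnj (k x) \<partial>M) = complex_of_real (\<integral>x. (cmod (k x))\<^sup>2 \<partial>M) + \<delta> * complex_of_real s"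
    "0 \<le> s" "a * s \<le> (\<integral>x. (cmod (k x))\<^sup>2 \<partial>M)" using shifted_inner[OF k] by blast
  have "(\<integral>x. (k x + \<delta> * G k x) * cnj (k x) \<partial>M) = 0"
    by (rule integral_eq_zero_AE) (use eq in eventually_elim, simp)
  then have "\<epsilon> * (\<integral>x. (cmod (k x))\<^sup>2 \<partial>M) \<le> 0" using z(2)[OF s(2,3)] s(1) by simp
  then have "(\<integral>x. (cmod (k x))\<^sup>2 \<partial>M) \<le> 0" using z(1) by (simp add: mult_le_0_iff)
  then have "(\<integral>x. (cmod (k x))\<^sup>2 \<partial>M) = 0" by (simp add: antisym)
  then have "AE x in M. (cmod (k x))\<^sup>2 = 0"
    using k by (subst (asm) integral_nonneg_eq_0_iff_AE) (auto simp: square_integrable_def)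
  then show ?thesis by eventually_elim simp
qed

lemma step_contraction:
  assumes d: "Im \<delta> \<noteq> 0 \<or> - a < Re \<delta>"
  obtains w q where "w \<noteq> 0" "0 < q" "q < 1"
    "\<And>k. square_integrable M k \<Longrightarrow>
      (\<integral>x. (cmod (k x - w * (k x + \<delta> * G k x)))\<^sup>2 \<partial>M) \<le> q ^ 4 * (\<integral>x. (cmod (k x))\<^sup>2 \<partial>M)"
proof -
  obtain z \<epsilon> where z: "\<epsilon> > 0" "\<And>m s. 0 \<le> s \<Longrightarrow> a * s \<le> m \<Longrightarrow> \<epsilon> * m \<le> Re (z * (complex_of_real m + \<delta> * complex_of_real s))"
    by (rule segment_half_plane[OF a_pos d]) blast
  have "\<epsilon> \<le> Re z" using z(2)[of 0 1] by simp
  then have z0: "\<epsilon> \<le> cmod z" using complex_Re_le_cmod[of z] by linarith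
  \<comment> \<open>\<open>C\<close> bounds the squared norm of
    \<open>z * (I + \<delta> * G)\<close>. The quadratic
    \<open>1 - 2 * t * \<epsilon> + t^2 * C\<close> has its least value
    \<open>1 - \<epsilon>^2 / C\<close> at \<open>t = \<epsilon> / C\<close>.\<close>
  define C where "C = 2 * (cmod z)\<^sup>2 * (1 + (cmod \<delta>)\<^sup>2 / a\<^sup>2)"
  have C: "\<epsilon>\<^sup>2 < C"
  proof -
    have "\<epsilon>\<^sup>2 \<le> (cmod z)\<^sup>2" using z0 z(1) by (intro power_mono) auto
    moreover have "(cmod z)\<^sup>2 > 0" using z0 z(1) by auto
    moreover have "(cmod z)\<^sup>2 * 1 \<le> (cmod z)\<^sup>2 * (1 + (cmod \<delta>)\<^sup>2 / a\<^sup>2)" by (intro mult_left_mono) auto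
    ultimately have "\<epsilon>\<^sup>2 < 2 * ((cmod z)\<^sup>2 * (1 + (cmod \<delta>)\<^sup>2 / a\<^sup>2))" by linarith
    then show ?thesis by (simp only: C_def mult.assoc)
  qed
  then have C0: "C > 0" using z(1) by (meson order_le_less_trans zero_le_power2)
  define t where "t = \<epsilon> / C"
  \<comment> \<open>A fourth root, because squared norms will decay like \<open>q^(4 j)\<close>:
    after division by \<open>q^(2 j)\<close>, which buys a pointwise geometric bound, a summable
    \<open>q^(2 j)\<close> is left.\<close>
  define q where "q = sqrt (sqrt (1 - \<epsilon>\<^sup>2 / C))"
  have Q: "0 < 1 - \<epsilon>\<^sup>2 / C" "1 - \<epsilon>\<^sup>2 / C < 1" using C C0 z(1) by (auto simp: field_simps)
  have q: "0 < q" "q < 1" using Q by (auto simp: q_def)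
  have q4: "q ^ 4 = 1 - \<epsilon>\<^sup>2 / C"
  proof -
    have "q ^ 4 = (q\<^sup>2)\<^sup>2" by simp
    also have "\<dots> = 1 - \<epsilon>\<^sup>2 / C" using Q by (simp add: q_def)
    finally show ?thesis .
  qed
  show thesis
  proof (rule that[of "complex_of_real t * z" q])
    show "complex_of_real t * z \<noteq> 0" using z(1) C0 z0 by (auto simp: t_def)
    show "0 < q" "q < 1" by fact+
    fix k assume k: "square_integrable M k"
    let ?m = "\<integral>x. (cmod (k x))\<^sup>2 \<partial>M"
    define A where "A x = k x + \<delta> * G k x" for x
    have A: "square_integrable M A" unfolding A_def by (rule shifted_sq[OF k])
    obtain s where s: "(\<integral>x. A x * cnj (k x) \<partial>M) = complex_of_real ?m + \<delta> * complex_of_real s"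
      "0 \<le> s" "a * s \<le> ?m" using shifted_inner[OF k] unfolding A_def by blast
    have iA: "integrable M (\<lambda>x. A x * cnj (k x))" by (rule square_integrable_cnj_mult[OF A k])
    have e: "(cmod (k x - complex_of_real t * z * A x))\<^sup>2
        = (cmod (k x))\<^sup>2 - 2 * t * Re (z * (A x * cnj (k x))) + t\<^sup>2 * (cmod z)\<^sup>2 * (cmod (A x))\<^sup>2" for x
    proof -
      have "(cmod (u - complex_of_real t * v))\<^sup>2 = (cmod u)\<^sup>2 - 2 * t * Re (v * cnj u) + t\<^sup>2 * (cmod v)\<^sup>2" for u v
        by (simp add: cmod_power2 power2_diff power_mult_distrib algebra_simps)
      from this[of "k x" "z * A x"] show ?thesis by (simp add: norm_mult power_mult_distrib mult.assoc)
    qed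
    have "(\<integral>x. (cmod (k x - complex_of_real t * z * A x))\<^sup>2 \<partial>M) =
        ?m - 2 * t * (\<integral>x. Re (z * (A x * cnj (k x))) \<partial>M) + t\<^sup>2 * (cmod z)\<^sup>2 * (\<integral>x. (cmod (A x))\<^sup>2 \<partial>M)"
    proof -
      define r where "r x = Re (z * (A x * cnj (k x)))" for x
      have ir: "integrable M r" unfolding r_def by (intro integrable_Re integrable_mult_right iA)
      show ?thesis unfolding e r_def[symmetric]
        using square_integrable_sq[OF k] square_integrable_sq[OF A] ir by simp
    qed
    also have "(\<integral>x. Re (z * (A x * cnj (k x))) \<partial>M) = Re (z * (\<integral>x. A x * cnj (k x) \<partial>M))"
      using iA by (subst integral_Re) auto
    also have "?m - 2 * t * Re (z * (\<integral>x. A x * cnj (k x) \<partial>M)) + t\<^sup>2 * (cmod z)\<^sup>2 * (\<integral>x. (cmod (A x))\<^sup>2 \<partial>M)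
        \<le> ?m - 2 * t * (\<epsilon> * ?m) + t\<^sup>2 * (cmod z)\<^sup>2 * (2 * ?m + 2 * (cmod \<delta>)\<^sup>2 * (?m / a\<^sup>2))"
    proof -
      have "\<epsilon> * ?m \<le> Re (z * (\<integral>x. A x * cnj (k x) \<partial>M))" using z(2)[OF s(2,3)] s(1) by simp
      then have 1: "2 * t * (\<epsilon> * ?m) \<le> 2 * t * Re (z * (\<integral>x. A x * cnj (k x) \<partial>M))"
        using z(1) C0 by (intro mult_left_mono) (auto simp: t_def)
      have "(\<integral>x. (cmod (A x))\<^sup>2 \<partial>M) \<le> (\<integral>x. 2 * (cmod (k x))\<^sup>2 + 2 * (cmod \<delta>)\<^sup>2 * (cmod (G k x))\<^sup>2 \<partial>M)"
      proof (rule integral_mono)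
        show "(cmod (A x))\<^sup>2 \<le> 2 * (cmod (k x))\<^sup>2 + 2 * (cmod \<delta>)\<^sup>2 * (cmod (G k x))\<^sup>2" for x
          using power_integral_add_sq[of "k x" "\<delta> * G k x"] by (simp add: A_def norm_mult power_mult_distrib)
      qed (use square_integrable_sq[OF A] square_integrable_sq[OF k] square_integrable_sq[OF G_sq[OF k]] in auto)
      also have "\<dots> = 2 * ?m + 2 * (cmod \<delta>)\<^sup>2 * (\<integral>x. (cmod (G k x))\<^sup>2 \<partial>M)"
        using square_integrable_sq[OF k] square_integrable_sq[OF G_sq[OF k]] by simp
      also have "\<dots> \<le> 2 * ?m + 2 * (cmod \<delta>)\<^sup>2 * (?m / a\<^sup>2)"
        using G_bound[OF k] a_pos by (intro add_left_mono mult_left_mono) (auto simp: field_simps)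
      finally have "t\<^sup>2 * (cmod z)\<^sup>2 * (\<integral>x. (cmod (A x))\<^sup>2 \<partial>M) \<le> t\<^sup>2 * (cmod z)\<^sup>2 * (2 * ?m + 2 * (cmod \<delta>)\<^sup>2 * (?m / a\<^sup>2))"
        by (intro mult_left_mono) auto
      then show ?thesis using 1 by linarith
    qed
    also have "\<dots> = (1 - 2 * t * \<epsilon> + t\<^sup>2 * C) * ?m" by (simp add: C_def algebra_simps)
    also have "1 - 2 * t * \<epsilon> + t\<^sup>2 * C = q ^ 4"
      unfolding q4 using C0 by (simp add: t_def power2_eq_square field_simps)
    finally show "(\<integral>x. (cmod (k x - complex_of_real t * z * (k x + \<delta> * G k x)))\<^sup>2 \<partial>M) \<le> q ^ 4 * ?m"
      by (simp add: A_def)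
  qed
qed

text \<open>Neumann series: with \<open>T = I - w * (I + \<delta> * G)\<close> the solution is the
  sum of the iterates \<open>T^j (w * g)\<close>. Decay in norm is first upgraded to almost
  everywhere domination by \<open>q^j * H\<close> with \<open>H\<close> square integrable, the form
  in which \<open>G\<close> may be applied term by term.\<close>

lemma shifted_surjective:
  assumes d: "Im \<delta> \<noteq> 0 \<or> - a < Re \<delta>"
  obtains C where "\<And>g. square_integrable M g \<Longrightarrow> \<exists>k. square_integrable M k \<and>
      (AE x in M. k x + \<delta> * G k x = g x) \<and>
      (\<integral>x. (cmod (k x))\<^sup>2 \<partial>M) \<le> C * (\<integral>x. (cmod (g x))\<^sup>2 \<partial>M)"
proof -
  obtain w q where w: "w \<noteq> 0" and q: "0 < q" "q < 1" and contr:
    "\<And>k. square_integrable M k \<Longrightarrow>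
      (\<integral>x. (cmod (k x - w * (k x + \<delta> * G k x)))\<^sup>2 \<partial>M) \<le> q ^ 4 * (\<integral>x. (cmod (k x))\<^sup>2 \<partial>M)"
    by (rule step_contraction[OF d]) blast
  show thesis
  proof (rule that[of "(1 / (1 - q))\<^sup>2 * ((cmod w)\<^sup>2 / (1 - q\<^sup>2))"])
    fix g assume g: "square_integrable M g"
    define D where "D = rec_nat (\<lambda>x. w * g x) (\<lambda>_ k x. k x - w * (k x + \<delta> * G k x))"
    have D0: "D 0 = (\<lambda>x. w * g x)" and DS: "D (Suc j) = (\<lambda>x. D j x - w * (D j x + \<delta> * G (D j) x))" for j
      by (simp_all add: D_def)
    have D: "square_integrable M (D j)" for j
    proof (induction j)
      case 0 then show ?case unfolding D0 by (intro square_integrable_cmult g)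
    next
      case (Suc j) then show ?case unfolding DS
        by (intro square_integrable_diff square_integrable_cmult shifted_sq)
    qed
    have [measurable]: "D j \<in> borel_measurable M" for j using D by (rule square_integrable_measurable)
    define m0 where "m0 = (cmod w)\<^sup>2 * (\<integral>x. (cmod (g x))\<^sup>2 \<partial>M)"
    have m0: "m0 \<ge> 0" by (simp add: m0_def)
    have bound: "(\<integral>x. (cmod (D j x))\<^sup>2 \<partial>M) \<le> q ^ (4 * j) * m0" for j
    proof (induction j)
      case 0 then show ?case by (simp add: D0 m0_def norm_mult power_mult_distrib)
    next
      case (Suc j)
      have "(\<integral>x. (cmod (D (Suc j) x))\<^sup>2 \<partial>M) \<le> q ^ 4 * (\<integral>x. (cmod (D j x))\<^sup>2 \<partial>M)"
        unfolding DS by (rule contr[OF D])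
      also have "\<dots> \<le> q ^ 4 * (q ^ (4 * j) * m0)" using Suc q by (intro mult_left_mono) auto
      finally show ?case by (simp add: power_add mult.assoc)
    qed
    \<comment> \<open>The weighted squares have summable integrals, so their sum \<open>h\<close> is
      finite almost everywhere, and its square root majorises every term up to the factor
      \<open>q^j\<close>.\<close>
    define f where "f j x = (cmod (D j x))\<^sup>2 / q ^ (2 * j)" for j x
    have f0: "0 \<le> f j x" for j x using q by (simp add: f_def)
    have fint: "integrable M (f j)" for j
      unfolding f_def using square_integrable_sq[OF D] by simp
    have [measurable]: "f j \<in> borel_measurable M" for j unfolding f_def by measurable
    have fb: "(\<integral>x. f j x \<partial>M) \<le> (q\<^sup>2) ^ j * m0" for j
    proof -
      have "(\<integral>x. f j x \<partial>M) = (\<integral>x. (cmod (D j x))\<^sup>2 \<partial>M) / q ^ (2 * j)" by (simp add: f_def)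
      also have "\<dots> \<le> q ^ (4 * j) * m0 / q ^ (2 * j)" using bound q by (intro divide_right_mono) auto
      also have "\<dots> = (q\<^sup>2) ^ j * m0"
      proof -
        have "q ^ (4 * j) = q ^ (2 * j) * (q\<^sup>2) ^ j" by (simp flip: power_mult power_add)
        then show ?thesis using q by simp
      qed
      finally show ?thesis .
    qed
    have q2: "q\<^sup>2 < 1" using q by (simp add: power_less_one_iff)
    have geo: "(\<lambda>j. (q\<^sup>2) ^ j * m0) sums (m0 / (1 - q\<^sup>2))"
      using sums_mult2[OF geometric_sums[of "q\<^sup>2"], of m0] q q2 by simp
    have sumf: "summable (\<lambda>j. \<integral>x. f j x \<partial>M)"
      using fb f0 by (intro summable_comparison_test'[OF sums_summable[OF geo]]) auto
    have AEs: "AE x in M. summable (\<lambda>j. f j x)"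
    proof -
      have "(\<integral>\<^sup>+x. (\<Sum>j. ennreal (f j x)) \<partial>M) = (\<Sum>j. \<integral>\<^sup>+x. ennreal (f j x) \<partial>M)"
        by (rule nn_integral_suminf) auto
      also have "\<dots> = (\<Sum>j. ennreal (\<integral>x. f j x \<partial>M))"
        using fint f0 by (intro suminf_cong nn_integral_eq_integral) auto
      also have "\<dots> = ennreal (\<Sum>j. \<integral>x. f j x \<partial>M)"
        using sumf f0 by (intro suminf_ennreal2) auto
      finally have "(\<integral>\<^sup>+x. (\<Sum>j. ennreal (f j x)) \<partial>M) \<noteq> \<infinity>" by simp
      then have "AE x in M. (\<Sum>j. ennreal (f j x)) \<noteq> \<infinity>" by (intro nn_integral_PInf_AE) auto
      then show ?thesis by eventually_elim (use f0 in \<open>auto intro: summable_suminf_not_top\<close>)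
    qed
    define h where "h x = (\<Sum>j. f j x)" for x
    have hint: "integrable M h" unfolding h_def
      by (rule integrable_suminf) (use fint AEs sumf f0 in auto)
    have hI: "(\<integral>x. h x \<partial>M) \<le> m0 / (1 - q\<^sup>2)"
    proof -
      have "(\<integral>x. h x \<partial>M) = (\<Sum>j. \<integral>x. f j x \<partial>M)" unfolding h_def
        by (rule integral_suminf) (use fint AEs sumf f0 in auto)
      also have "\<dots> \<le> (\<Sum>j. (q\<^sup>2) ^ j * m0)" by (intro suminf_le fb sumf sums_summable[OF geo])
      also have "\<dots> = m0 / (1 - q\<^sup>2)" using geo by (simp add: sums_iff)
      finally show ?thesis .
    qed
    have h0: "0 \<le> h x" if "summable (\<lambda>j. f j x)" for x unfolding h_def by (intro suminf_nonneg that f0)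
    define H where "H x = complex_of_real (sqrt \<bar>h x\<bar>)" for x
    have [measurable]: "h \<in> borel_measurable M" using hint by auto
    have Hsq: "square_integrable M H" unfolding square_integrable_def H_def using hint by simp
    define l where "l x = (\<Sum>j. D j x)" for x
    have lm[measurable]: "l \<in> borel_measurable M" unfolding l_def by measurable
    have dom: "AE x in M. (\<forall>j. cmod (D j x) \<le> q ^ j * cmod (H x)) \<and> (\<lambda>j. D j x) sums l x"
      using AEs
    proof eventually_elim
      fix x assume s: "summable (\<lambda>j. f j x)"
      have 1: "cmod (D j x) \<le> q ^ j * cmod (H x)" for j
      proof -
        have "f j x \<le> h x" unfolding h_def using sum_le_suminf[OF s, of "{j}"] f0 by simp
        then have "(cmod (D j x))\<^sup>2 \<le> (q ^ j)\<^sup>2 * h x" using q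
          by (simp add: f_def field_simps flip: power_mult)
        also have "\<dots> = (q ^ j * cmod (H x))\<^sup>2" using h0[OF s] by (simp add: H_def power_mult_distrib)
        finally show ?thesis by (rule power2_le_imp_le) (use q in auto)
      qed
      have "summable (\<lambda>j. q ^ j * cmod (H x))" using q by (intro summable_mult2 summable_geometric) auto
      then have "summable (\<lambda>j. D j x)" by (rule summable_comparison_test') (use 1 in auto)
      then show "(\<forall>j. cmod (D j x) \<le> q ^ j * cmod (H x)) \<and> (\<lambda>j. D j x) sums l x"
        using 1 by (auto simp: l_def summable_sums)
    qed
    have lb: "AE x in M. cmod (l x) \<le> 1 / (1 - q) * cmod (H x)"
      using dom
    proof eventually_elim
      fix x assume *: "(\<forall>j. cmod (D j x) \<le> q ^ j * cmod (H x)) \<and> (\<lambda>j. D j x) sums l x"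
      have g: "(\<lambda>j. q ^ j * cmod (H x)) sums (1 / (1 - q) * cmod (H x))"
        using q by (intro sums_mult2 geometric_sums) auto
      have "cmod (\<Sum>j. D j x) \<le> (\<Sum>j. q ^ j * cmod (H x))"
        using * by (intro norm_suminf_le sums_summable[OF g]) auto
      then show "cmod (l x) \<le> 1 / (1 - q) * cmod (H x)" using g * by (simp add: sums_iff)
    qed
    have lsq: "square_integrable M l" by (rule square_integrable_bound[OF Hsq lm lb])
    have "AE x in M. (\<lambda>j. G (D j) x) sums G l x" by (rule G_suminf[OF D Hsq lsq q dom])
    then have sol: "AE x in M. l x + \<delta> * G l x = g x"
      using dom
    proof eventually_elim
      fix x assume Gs: "(\<lambda>j. G (D j) x) sums G l x"
        and *: "(\<forall>j. cmod (D j x) \<le> q ^ j * cmod (H x)) \<and> (\<lambda>j. D j x) sums l x"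
      \<comment> \<open>Applying \<open>T\<close> shifts the series by one index; comparison with
        the series itself leaves the first term \<open>w * g\<close>.\<close>
      have "(\<lambda>j. D j x - w * (D j x + \<delta> * G (D j) x)) sums (l x - w * (l x + \<delta> * G l x))"
        using Gs * by (intro sums_diff sums_add sums_mult) auto
      then have "(\<lambda>j. D (Suc j) x) sums (l x - w * (l x + \<delta> * G l x))" by (simp add: DS)
      moreover have "(\<lambda>j. D (Suc j) x) sums (l x - D 0 x)" using * by (subst sums_Suc_iff) simp
      ultimately have "l x - w * (l x + \<delta> * G l x) = l x - w * g x" by (metis sums_unique2 D0)
      then show "l x + \<delta> * G l x = g x" using w by simp
    qed
    have "(\<integral>x. (cmod (l x))\<^sup>2 \<partial>M) \<le> (\<integral>x. (1 / (1 - q))\<^sup>2 * h x \<partial>M)"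
    proof (rule integral_mono_AE)
      show "AE x in M. (cmod (l x))\<^sup>2 \<le> (1 / (1 - q))\<^sup>2 * h x" using lb AEs
      proof eventually_elim
        fix x assume "cmod (l x) \<le> 1 / (1 - q) * cmod (H x)" and s: "summable (\<lambda>j. f j x)"
        then have "(cmod (l x))\<^sup>2 \<le> (1 / (1 - q) * cmod (H x))\<^sup>2" by (intro power_mono) auto
        then show "(cmod (l x))\<^sup>2 \<le> (1 / (1 - q))\<^sup>2 * h x"
          using h0[OF s] by (simp add: H_def power_mult_distrib power_divide)
      qed
    qed (use square_integrable_sq[OF lsq] hint in auto)
    also have "\<dots> = (1 / (1 - q))\<^sup>2 * (\<integral>x. h x \<partial>M)" by simp
    also have "\<dots> \<le> (1 / (1 - q))\<^sup>2 * (m0 / (1 - q\<^sup>2))" using hI by (intro mult_left_mono) auto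
    finally have "(\<integral>x. (cmod (l x))\<^sup>2 \<partial>M) \<le> (1 / (1 - q))\<^sup>2 * ((cmod w)\<^sup>2 / (1 - q\<^sup>2)) * (\<integral>x. (cmod (g x))\<^sup>2 \<partial>M)"
      by (simp add: m0_def)
    then show "\<exists>k. square_integrable M k \<and> (AE x in M. k x + \<delta> * G k x = g x) \<and>
      (\<integral>x. (cmod (k x))\<^sup>2 \<partial>M) \<le> (1 / (1 - q))\<^sup>2 * ((cmod w)\<^sup>2 / (1 - q\<^sup>2)) * (\<integral>x. (cmod (g x))\<^sup>2 \<partial>M)"
      using lsq sol by blast
  qed
qed

end

section \<open>Green's operator\<close>

lemma sums_integral_geometric:
  fixes f :: "nat \<Rightarrow> 'a \<Rightarrow> complex"
  assumes [measurable]: "\<And>j. f j \<in> borel_measurable N" "l \<in> borel_measurable N"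
    and g: "integrable N g" and q: "0 < q" "q < 1"
    and dom: "AE x in N. (\<forall>j. cmod (f j x) \<le> q ^ j * g x) \<and> (\<lambda>j. f j x) sums l x"
  shows "(\<lambda>j. integral\<^sup>L N (f j)) sums integral\<^sup>L N l"
proof -
  have bd: "AE x in N. cmod (f j x) \<le> q ^ j * g x" for j using dom by eventually_elim blast
  have int: "integrable N (f j)" for j
  proof (rule Bochner_Integration.integrable_bound)
    show "integrable N (\<lambda>x. q ^ j * g x)" using g by simp
    show "AE x in N. norm (f j x) \<le> norm (q ^ j * g x)" using bd[of j] by eventually_elim (metis abs_ge_self order_trans real_norm_def)
  qed simp
  have geo: "(\<lambda>j. q ^ j * c) sums (1 / (1 - q) * c)" for c :: real
    using q by (intro sums_mult2 geometric_sums) auto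
  have 1: "AE x in N. summable (\<lambda>j. norm (f j x))" using dom
  proof eventually_elim
    fix x assume "(\<forall>j. cmod (f j x) \<le> q ^ j * g x) \<and> (\<lambda>j. f j x) sums l x"
    then show "summable (\<lambda>j. norm (f j x))"
      by (intro summable_comparison_test'[OF sums_summable[OF geo[of "g x"]]]) auto
  qed
  have 2: "summable (\<lambda>j. \<integral>x. norm (f j x) \<partial>N)"
  proof (rule summable_comparison_test'[OF sums_summable[OF geo[of "\<integral>x. g x \<partial>N"]]])
    fix j :: nat
    have "(\<integral>x. norm (f j x) \<partial>N) \<le> (\<integral>x. q ^ j * g x \<partial>N)"
      using int g bd by (intro integral_mono_AE) auto
    then show "norm (\<integral>x. norm (f j x) \<partial>N) \<le> q ^ j * (\<integral>x. g x \<partial>N)" by simp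
  qed
  have "(\<lambda>j. integral\<^sup>L N (f j)) sums (\<integral>x. (\<Sum>j. f j x) \<partial>N)" by (rule sums_integral[OF int 1 2])
  also have "(\<integral>x. (\<Sum>j. f j x) \<partial>N) = integral\<^sup>L N l"
    by (rule integral_cong_AE) (use dom in \<open>auto simp: sums_iff elim!: eventually_mono\<close>)
  finally show ?thesis .
qed

text \<open>If \<open>f\<close> is not integrable, the left side is the default value 0.\<close>

lemma cmod_set_integral_le:
  "ennreal (cmod (\<integral>x. f x \<partial>M)) \<le> (\<integral>\<^sup>+x. ennreal (cmod (f x)) \<partial>M)"
  by (cases "integrable M f") (auto intro: integral_norm_bound_ennreal simp: not_integrable_integral_eq)

text \<open>Cauchy-Schwarz for the measure with density \<open>K x\<close> against \<open>M\<close>,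
  where \<open>f\<close> is split as \<open>sqrt \<psi>\<close> times
  \<open>f / sqrt \<psi>\<close>. The row bound disposes of the first factor; Tonelli's theorem and
  the column bound dispose of the second.\<close>

lemma schur_test:
  fixes K :: "'a \<Rightarrow> 'a \<Rightarrow> ennreal" and \<theta> \<psi> f :: "'a \<Rightarrow> real" and C1 C2 :: ennreal
  assumes "sigma_finite_measure M"
    and [measurable]: "case_prod K \<in> borel_measurable (M \<Otimes>\<^sub>M M)"
      "\<theta> \<in> borel_measurable M" "\<psi> \<in> borel_measurable M" "f \<in> borel_measurable M"
    and pos: "\<And>x. x \<in> space M \<Longrightarrow> 0 < \<theta> x" "\<And>x. x \<in> space M \<Longrightarrow> 0 < \<psi> x" "\<And>x. x \<in> space M \<Longrightarrow> 0 \<le> f x"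
    and row: "\<And>x. x \<in> space M \<Longrightarrow> (\<integral>\<^sup>+y. K x y * \<psi> y \<partial>M) \<le> C1 * \<theta> x"
    and col: "\<And>y. y \<in> space M \<Longrightarrow> (\<integral>\<^sup>+x. K x y * \<theta> x \<partial>M) \<le> C2 * \<psi> y"
  shows "(\<integral>\<^sup>+x. (\<integral>\<^sup>+y. K x y * f y \<partial>M)\<^sup>2 \<partial>M) \<le> C1 * C2 * (\<integral>\<^sup>+x. (ennreal (f x))\<^sup>2 \<partial>M)"
proof -
  interpret M: sigma_finite_measure M by fact
  interpret MM: pair_sigma_finite M M ..
  have Kx[measurable]: "K x \<in> borel_measurable M" if "x \<in> space M" for x
    using measurable_Pair2[OF assms(2) that] by simp
  have Ky[measurable]: "(\<lambda>x. K x y) \<in> borel_measurable M" if "y \<in> space M" for y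
    using measurable_Pair1[OF assms(2) that] by simp
  have cs: "(\<integral>\<^sup>+y. K x y * f y \<partial>M)\<^sup>2 \<le> C1 * \<theta> x * (\<integral>\<^sup>+y. K x y * ((f y)\<^sup>2 / \<psi> y) \<partial>M)" if x: "x \<in> space M" for x
  proof -
    note [measurable] = Kx[OF x]
    define D where "D = density M (K x)"
    have [measurable]: "g \<in> borel_measurable D \<longleftrightarrow> g \<in> borel_measurable M" for g :: "'a \<Rightarrow> real"
      by (simp add: D_def)
    have nn: "(\<integral>\<^sup>+y. ennreal (g y) \<partial>D) = (\<integral>\<^sup>+y. K x y * ennreal (g y) \<partial>M)"
      if "g \<in> borel_measurable M" for g :: "'a \<Rightarrow> real"
      unfolding D_def using that by (subst nn_integral_density) auto
    have sp: "space D = space M" by (simp add: D_def)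
    have "(\<integral>\<^sup>+y. K x y * f y \<partial>M)\<^sup>2 = (\<integral>\<^sup>+y. ennreal (f y) \<partial>D)\<^sup>2" by (simp add: nn)
    also have "(\<integral>\<^sup>+y. ennreal (f y) \<partial>D) = (\<integral>\<^sup>+y. ennreal (sqrt (\<psi> y)) * ennreal (f y / sqrt (\<psi> y)) \<partial>D)"
    proof (intro nn_integral_cong)
      fix y assume "y \<in> space D"
      then have "0 < sqrt (\<psi> y)" "0 \<le> f y" using pos by (auto simp: sp)
      then show "ennreal (f y) = ennreal (sqrt (\<psi> y)) * ennreal (f y / sqrt (\<psi> y))"
        by (subst ennreal_mult[symmetric]) auto
    qed
    also have "\<dots>\<^sup>2 \<le> (\<integral>\<^sup>+y. (ennreal (sqrt (\<psi> y)))\<^sup>2 \<partial>D) * (\<integral>\<^sup>+y. (ennreal (f y / sqrt (\<psi> y)))\<^sup>2 \<partial>D)"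
      by (rule Cauchy_Schwarz_nn_integral) (simp_all add: D_def)
    also have "(\<integral>\<^sup>+y. (ennreal (sqrt (\<psi> y)))\<^sup>2 \<partial>D) = (\<integral>\<^sup>+y. ennreal (\<psi> y) \<partial>D)"
      by (intro nn_integral_cong) (use pos in \<open>auto simp: sp ennreal_power less_imp_le\<close>)
    also have "\<dots> = (\<integral>\<^sup>+y. K x y * \<psi> y \<partial>M)" by (simp add: nn)
    also have "(\<integral>\<^sup>+y. (ennreal (f y / sqrt (\<psi> y)))\<^sup>2 \<partial>D) = (\<integral>\<^sup>+y. ennreal ((f y)\<^sup>2 / \<psi> y) \<partial>D)"
      by (intro nn_integral_cong) (use pos in \<open>auto simp: sp ennreal_power power_divide less_imp_le\<close>)
    also have "\<dots> = (\<integral>\<^sup>+y. K x y * ((f y)\<^sup>2 / \<psi> y) \<partial>M)" by (simp add: nn)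
    also have "(\<integral>\<^sup>+y. K x y * \<psi> y \<partial>M) * \<dots> \<le> C1 * \<theta> x * \<dots>"
      using row[OF x] by (intro mult_right_mono) auto
    finally show ?thesis .
  qed
  have "(\<integral>\<^sup>+x. (\<integral>\<^sup>+y. K x y * f y \<partial>M)\<^sup>2 \<partial>M) \<le> (\<integral>\<^sup>+x. C1 * \<theta> x * (\<integral>\<^sup>+y. K x y * ((f y)\<^sup>2 / \<psi> y) \<partial>M) \<partial>M)"
    by (intro nn_integral_mono cs)
  also have "\<dots> = (\<integral>\<^sup>+x. (\<integral>\<^sup>+y. C1 * \<theta> x * (K x y * ((f y)\<^sup>2 / \<psi> y)) \<partial>M) \<partial>M)"
    by (intro nn_integral_cong nn_integral_cmult[symmetric]) simp
  also have "\<dots> = (\<integral>\<^sup>+y. (\<integral>\<^sup>+x. C1 * \<theta> x * (K x y * ((f y)\<^sup>2 / \<psi> y)) \<partial>M) \<partial>M)"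
    by (rule MM.Fubini'[symmetric]) simp
  also have "\<dots> = (\<integral>\<^sup>+y. C1 * ((f y)\<^sup>2 / \<psi> y) * (\<integral>\<^sup>+x. K x y * \<theta> x \<partial>M) \<partial>M)"
    by (intro nn_integral_cong, subst nn_integral_cmult[symmetric])
       (auto intro!: nn_integral_cong simp: ac_simps)
  also have "\<dots> \<le> (\<integral>\<^sup>+y. C1 * ((f y)\<^sup>2 / \<psi> y) * (C2 * \<psi> y) \<partial>M)"
    by (intro nn_integral_mono mult_left_mono col) auto
  also have "\<dots> = (\<integral>\<^sup>+y. C1 * C2 * (ennreal (f y))\<^sup>2 \<partial>M)"
  proof (intro nn_integral_cong)
    fix y assume y: "y \<in> space M"
    have "ennreal ((f y)\<^sup>2 / \<psi> y) * ennreal (\<psi> y) = (ennreal (f y))\<^sup>2"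
      using pos[OF y] by (simp add: ennreal_power flip: ennreal_mult)
    then show "C1 * ennreal ((f y)\<^sup>2 / \<psi> y) * (C2 * ennreal (\<psi> y)) = C1 * C2 * (ennreal (f y))\<^sup>2"
      by (metis (no_types, lifting) mult.assoc mult.commute)
  qed
  also have "\<dots> = C1 * C2 * (\<integral>\<^sup>+x. (ennreal (f x))\<^sup>2 \<partial>M)" by (rule nn_integral_cmult) simp
  finally show ?thesis .
qed

text \<open>Green's operator of \<open>f \<mapsto> - d/dM (1/P df/dx)\<close> with \<open>f'/P\<close> vanishing at the left end and \<open>f\<close>
  vanishing at infinity.  The positive eigenfunction \<open>\<phi>\<close> serves as the weight in the Schur test.\<close>

locale green_operator =
  fixes M :: "real measure" and P \<phi> :: "real \<Rightarrow> real" and a :: real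
  assumes sigma_finite: "sigma_finite_measure M"
    and ident[measurable]: "(\<lambda>x. x) \<in> borel_measurable M"
    and fin: "emeasure M {y \<in> space M. y < t} < \<infinity>"
    and P[measurable]: "P \<in> borel_measurable borel" and P0: "0 \<le> P t"
    and phi[measurable]: "\<phi> \<in> borel_measurable M" and phi_pos: "x \<in> space M \<Longrightarrow> 0 < \<phi> x"
    and apos: "a > 0"
    and eigen: "x \<in> space M \<Longrightarrow> ennreal (\<phi> x) = ennreal a * (\<integral>\<^sup>+t. (if x < t then ennreal (P t) * (\<integral>\<^sup>+y. (if y < t then ennreal (\<phi> y) else 0) \<partial>M) else 0) \<partial>lborel)"
begin

interpretation M: sigma_finite_measure M by (rule sigma_finite)
interpretation LM: pair_sigma_finite lborel M ..
interpretation M_lborel: pair_sigma_finite M lborel ..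
interpretation MM: pair_sigma_finite M M ..

definition prim :: "(real \<Rightarrow> complex) \<Rightarrow> real \<Rightarrow> complex" where
  "prim k t = (\<integral>y. (if y < t then k y else 0) \<partial>M)"

definition G :: "(real \<Rightarrow> complex) \<Rightarrow> real \<Rightarrow> complex" where
  "G k x = (\<integral>t. (if x < t then P t *\<^sub>R prim k t else 0) \<partial>lborel)"

text \<open>Counterpart of \<open>G\<close> on extended nonnegative functions. Applied to
  \<open>cmod \<circ> k\<close> it dominates \<open>cmod (G k x)\<close>, so that integrability can
  be settled by Tonelli's theorem.\<close>

definition A :: "(real \<Rightarrow> ennreal) \<Rightarrow> real \<Rightarrow> ennreal" where
  "A f x = (\<integral>\<^sup>+t. (if x < t then P t * (\<integral>\<^sup>+y. (if y < t then f y else 0) \<partial>M) else 0) \<partial>lborel)"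

text \<open>The integral of \<open>P\<close> from the larger of \<open>x\<close> and
  \<open>y\<close> to infinity. Its symmetry lets the one weight \<open>\<phi>\<close> serve for
  rows and for columns.\<close>

definition kern :: "real \<Rightarrow> real \<Rightarrow> ennreal" where
  "kern x y = (\<integral>\<^sup>+t. (if x < t \<and> y < t then ennreal (P t) else 0) \<partial>lborel)"

lemma ident_fst[measurable]: "fst \<in> borel_measurable (M \<Otimes>\<^sub>M N)"
  using measurable_compose[OF measurable_fst ident] by simp

lemma ident_snd[measurable]: "snd \<in> borel_measurable (N \<Otimes>\<^sub>M M)"
  using measurable_compose[OF measurable_snd ident] by simp

lemma A_kern:
  assumes [measurable]: "f \<in> borel_measurable M"
  shows "A f x = (\<integral>\<^sup>+y. kern x y * f y \<partial>M)"
proof -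
  have "A f x = (\<integral>\<^sup>+t. (\<integral>\<^sup>+y. (if x < t \<and> y < t then P t * f y else 0) \<partial>M) \<partial>lborel)"
    unfolding A_def
  proof (intro nn_integral_cong)
    fix t :: real
    have "ennreal (P t) * (\<integral>\<^sup>+y. (if y < t then f y else 0) \<partial>M) = (\<integral>\<^sup>+y. P t * (if y < t then f y else 0) \<partial>M)"
      by (subst nn_integral_cmult) auto
    then show "(if x < t then P t * (\<integral>\<^sup>+y. (if y < t then f y else 0) \<partial>M) else 0) = (\<integral>\<^sup>+y. (if x < t \<and> y < t then P t * f y else 0) \<partial>M)"
      by (auto intro!: nn_integral_cong)
  qed
  also have "\<dots> = (\<integral>\<^sup>+y. (\<integral>\<^sup>+t. (if x < t \<and> y < t then P t * f y else 0) \<partial>lborel) \<partial>M)"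
    by (rule LM.Fubini'[symmetric]) measurable
  also have "\<dots> = (\<integral>\<^sup>+y. kern x y * f y \<partial>M)"
    unfolding kern_def by (intro nn_integral_cong, subst nn_integral_multc[symmetric]) (auto intro!: nn_integral_cong)
  finally show ?thesis .
qed

lemma kern_measurable[measurable]: "case_prod kern \<in> borel_measurable (M \<Otimes>\<^sub>M M)"
  unfolding kern_def by measurable

lemma kern_sym: "kern x y = kern y x"
  unfolding kern_def by (intro nn_integral_cong) auto

lemma A_square:
  assumes [measurable]: "f \<in> borel_measurable M" and f0: "\<And>x. 0 \<le> f x"
  shows "(\<integral>\<^sup>+x. (A (\<lambda>y. ennreal (f y)) x)\<^sup>2 \<partial>M) \<le> ennreal (1 / a\<^sup>2) * (\<integral>\<^sup>+x. ennreal ((f x)\<^sup>2) \<partial>M)"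
proof -
  have row: "(\<integral>\<^sup>+y. kern x y * \<phi> y \<partial>M) \<le> ennreal (1 / a) * \<phi> x" if x: "x \<in> space M" for x
  proof -
    have A: "ennreal (\<phi> x) = a * A (\<lambda>y. ennreal (\<phi> y)) x" using eigen[OF x] unfolding A_def by simp
    have "ennreal (1 / a) * \<phi> x = (ennreal (1 / a) * ennreal a) * A (\<lambda>y. ennreal (\<phi> y)) x"
      unfolding A by (simp add: mult.assoc)
    also have "ennreal (1 / a) * ennreal a = 1" using apos by (simp flip: ennreal_mult)
    finally show ?thesis by (subst A_kern[symmetric]) auto
  qed
  have "(\<integral>\<^sup>+x. (\<integral>\<^sup>+y. kern x y * f y \<partial>M)\<^sup>2 \<partial>M) \<le> ennreal (1 / a) * ennreal (1 / a) * (\<integral>\<^sup>+x. (ennreal (f x))\<^sup>2 \<partial>M)"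
  proof (rule schur_test[OF sigma_finite kern_measurable phi phi assms(1)])
    fix y assume "y \<in> space M"
    then show "(\<integral>\<^sup>+x. kern x y * \<phi> x \<partial>M) \<le> ennreal (1 / a) * \<phi> y"
      using row by (subst kern_sym) auto
  qed (use f0 phi_pos row in auto)
  then show ?thesis
    using apos f0 by (subst A_kern) (auto simp: ennreal_power power2_eq_square simp flip: ennreal_mult)
qed

text \<open>Initial segments have finite mass, and \<open>cmod k <= 1 + (cmod k)^2\<close>.\<close>

lemma prim_integrable:
  assumes k: "square_integrable M k"
  shows "integrable M (\<lambda>y. if y < t then k y else 0)"
proof (rule Bochner_Integration.integrable_bound)
  have "integrable M (indicator {y \<in> space M. y < t} :: real \<Rightarrow> real)" using fin by simp
  then show "integrable M (\<lambda>y. indicator {y \<in> space M. y < t} y + (cmod (k y))\<^sup>2)"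
    using square_integrable_sq[OF k] by (intro Bochner_Integration.integrable_add)
  show "AE y in M. norm (if y < t then k y else 0) \<le> norm (indicator {y \<in> space M. y < t} y + (cmod (k y))\<^sup>2)"
  proof (rule AE_I2)
    fix y assume "y \<in> space M"
    moreover have "cmod (k y) \<le> 1 + (cmod (k y))\<^sup>2"
    proof -
      have "2 * cmod (k y) \<le> (cmod (k y))\<^sup>2 + 1" using sum_squares_bound[of "cmod (k y)" 1] by simp
      then show ?thesis using norm_ge_zero[of "k y"] by linarith
    qed
    ultimately show "norm (if y < t then k y else 0) \<le> norm (indicator {y \<in> space M. y < t} y + (cmod (k y))\<^sup>2)"
      by auto
  qed
qed (use square_integrable_measurable[OF k] in measurable)

lemma prim_measurable[measurable]:
  assumes [measurable]: "k \<in> borel_measurable M"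
  shows "prim k \<in> borel_measurable borel"
proof -
  have "(\<lambda>t. \<integral>y. (if y < t then k y else 0) \<partial>M) \<in> borel_measurable lborel" by measurable
  then show ?thesis unfolding prim_def[abs_def] by simp
qed

lemma G_measurable[measurable]:
  assumes [measurable]: "k \<in> borel_measurable M"
  shows "G k \<in> borel_measurable M"
  unfolding G_def[abs_def] by measurable

lemma prim_le: "ennreal (cmod (prim k t)) \<le> (\<integral>\<^sup>+y. (if y < t then ennreal (cmod (k y)) else 0) \<partial>M)"
  unfolding prim_def by (rule order_trans[OF cmod_set_integral_le]) (auto intro!: nn_integral_mono)

lemma G_integrand_le:
  "(\<integral>\<^sup>+t. ennreal (cmod (if x < t then P t *\<^sub>R prim k t else 0)) \<partial>lborel) \<le> A (\<lambda>y. ennreal (cmod (k y))) x"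
  unfolding A_def
proof (intro nn_integral_mono)
  fix t :: real
  have "ennreal (cmod (P t *\<^sub>R prim k t)) = ennreal (P t) * ennreal (cmod (prim k t))"
    using P0 by (simp add: ennreal_mult)
  also have "\<dots> \<le> ennreal (P t) * (\<integral>\<^sup>+y. (if y < t then ennreal (cmod (k y)) else 0) \<partial>M)"
    by (intro mult_left_mono prim_le) auto
  finally show "ennreal (cmod (if x < t then P t *\<^sub>R prim k t else 0))
    \<le> (if x < t then P t * (\<integral>\<^sup>+y. (if y < t then ennreal (cmod (k y)) else 0) \<partial>M) else 0)" by simp
qed

lemma G_le: "ennreal (cmod (G k x)) \<le> A (\<lambda>y. ennreal (cmod (k y))) x"
  unfolding G_def by (rule order_trans[OF cmod_set_integral_le G_integrand_le])

lemma A_measurable[measurable]: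
  assumes [measurable]: "f \<in> borel_measurable M"
  shows "A f \<in> borel_measurable M"
  unfolding A_def[abs_def] by measurable

lemma A_finite_AE:
  assumes k: "square_integrable M k"
  shows "AE x in M. A (\<lambda>y. ennreal (cmod (k y))) x < \<infinity>"
proof -
  note [measurable] = square_integrable_measurable[OF k]
  have "(\<integral>\<^sup>+x. (A (\<lambda>y. ennreal (cmod (k y))) x)\<^sup>2 \<partial>M) \<le> ennreal (1 / a\<^sup>2) * (\<integral>\<^sup>+x. ennreal ((cmod (k x))\<^sup>2) \<partial>M)"
    by (rule A_square) auto
  also have "\<dots> < \<infinity>"
    using square_integrable_sq[OF k] by (simp add: nn_integral_eq_integral ennreal_mult_less_top)
  finally have "AE x in M. (A (\<lambda>y. ennreal (cmod (k y))) x)\<^sup>2 \<noteq> \<infinity>"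
    by (intro nn_integral_PInf_AE) auto
  then show ?thesis by eventually_elim (auto simp: power_eq_top_ennreal less_top)
qed

lemma G_square:
  assumes k: "square_integrable M k"
  shows "square_integrable M (G k)" "a\<^sup>2 * (\<integral>x. (cmod (G k x))\<^sup>2 \<partial>M) \<le> (\<integral>x. (cmod (k x))\<^sup>2 \<partial>M)"
proof -
  note [measurable] = square_integrable_measurable[OF k]
  have "(\<integral>\<^sup>+x. ennreal ((cmod (G k x))\<^sup>2) \<partial>M) \<le> (\<integral>\<^sup>+x. (A (\<lambda>y. ennreal (cmod (k y))) x)\<^sup>2 \<partial>M)"
    by (intro nn_integral_mono) (simp flip: ennreal_power add: G_le power_mono)
  also have "\<dots> \<le> ennreal (1 / a\<^sup>2) * (\<integral>\<^sup>+x. ennreal ((cmod (k x))\<^sup>2) \<partial>M)"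
    by (rule A_square) auto
  also have "\<dots> = ennreal (1 / a\<^sup>2 * (\<integral>x. (cmod (k x))\<^sup>2 \<partial>M))"
    using square_integrable_sq[OF k] by (subst ennreal_mult) (auto simp: nn_integral_eq_integral)
  finally have le: "(\<integral>\<^sup>+x. ennreal ((cmod (G k x))\<^sup>2) \<partial>M) \<le> ennreal (1 / a\<^sup>2 * (\<integral>x. (cmod (k x))\<^sup>2 \<partial>M))" .
  then have int: "integrable M (\<lambda>x. (cmod (G k x))\<^sup>2)"
    by (intro integrableI_bounded) (auto intro: le_less_trans)
  then show "square_integrable M (G k)" by (simp add: square_integrable_def)
  have "(\<integral>x. (cmod (G k x))\<^sup>2 \<partial>M) \<le> 1 / a\<^sup>2 * (\<integral>x. (cmod (k x))\<^sup>2 \<partial>M)"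
    using le int by (simp add: nn_integral_eq_integral)
  then show "a\<^sup>2 * (\<integral>x. (cmod (G k x))\<^sup>2 \<partial>M) \<le> (\<integral>x. (cmod (k x))\<^sup>2 \<partial>M)"
    using apos by (simp add: field_simps)
qed

text \<open>By Fubini the form equals the integral of \<open>P t * (cmod (prim k t))^2\<close>.
  Integrability on the product space follows from \<open>A_square\<close> and
  \<open>u v <= u^2 + v^2\<close>.\<close>

lemma G_inner_nonneg:
  assumes k: "square_integrable M k"
  shows "\<exists>s\<ge>0. (\<integral>x. G k x * cnj (k x) \<partial>M) = complex_of_real s"
proof -
  note [measurable] = square_integrable_measurable[OF k]
  define J where "J x t = (if x < t then P t *\<^sub>R prim k t * cnj (k x) else 0)" for x t
  have Jm[measurable]: "case_prod J \<in> borel_measurable (M \<Otimes>\<^sub>M lborel)" unfolding J_def by measurable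
  have J: "integrable (M \<Otimes>\<^sub>M lborel) (case_prod J)"
  proof (rule integrableI_bounded[OF Jm])
    have "(\<integral>\<^sup>+z. ennreal (norm (case_prod J z)) \<partial>(M \<Otimes>\<^sub>M lborel)) = (\<integral>\<^sup>+x. (\<integral>\<^sup>+t. ennreal (norm (J x t)) \<partial>lborel) \<partial>M)"
      by (subst lborel.nn_integral_fst[symmetric]) auto
    also have "\<dots> \<le> (\<integral>\<^sup>+x. (A (\<lambda>y. ennreal (cmod (k y))) x)\<^sup>2 + ennreal ((cmod (k x))\<^sup>2) \<partial>M)"
    proof (intro nn_integral_mono)
      fix x
      have "(\<integral>\<^sup>+t. ennreal (norm (J x t)) \<partial>lborel) = (\<integral>\<^sup>+t. ennreal (cmod (if x < t then P t *\<^sub>R prim k t else 0)) * ennreal (cmod (k x)) \<partial>lborel)"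
        by (intro nn_integral_cong) (auto simp: J_def norm_mult ennreal_mult mult.assoc)
      also have "\<dots> = (\<integral>\<^sup>+t. ennreal (cmod (if x < t then P t *\<^sub>R prim k t else 0)) \<partial>lborel) * ennreal (cmod (k x))"
        by (subst nn_integral_multc) simp_all
      also have "\<dots> \<le> A (\<lambda>y. ennreal (cmod (k y))) x * ennreal (cmod (k x))"
        by (intro mult_right_mono G_integrand_le) auto
      also have "\<dots> \<le> (A (\<lambda>y. ennreal (cmod (k y))) x)\<^sup>2 + ennreal ((cmod (k x))\<^sup>2)"
      proof (cases "A (\<lambda>y. ennreal (cmod (k y))) x")
        case (real r)
        have "r * cmod (k x) \<le> r\<^sup>2 + (cmod (k x))\<^sup>2"
          using sum_squares_bound[of r "cmod (k x)"] mult_nonneg_nonneg[OF real(1) norm_ge_zero[of "k x"]] by linarith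
        then show ?thesis using real by (simp add: ennreal_power flip: ennreal_mult ennreal_plus)
      qed (simp add: ennreal_top_mult power2_eq_square)
      finally show "(\<integral>\<^sup>+t. ennreal (norm (J x t)) \<partial>lborel) \<le> (A (\<lambda>y. ennreal (cmod (k y))) x)\<^sup>2 + ennreal ((cmod (k x))\<^sup>2)" .
    qed
    also have "\<dots> = (\<integral>\<^sup>+x. (A (\<lambda>y. ennreal (cmod (k y))) x)\<^sup>2 \<partial>M) + (\<integral>\<^sup>+x. ennreal ((cmod (k x))\<^sup>2) \<partial>M)"
      by (rule nn_integral_add) auto
    also have "\<dots> \<le> ennreal (1 / a\<^sup>2) * (\<integral>\<^sup>+x. ennreal ((cmod (k x))\<^sup>2) \<partial>M) + (\<integral>\<^sup>+x. ennreal ((cmod (k x))\<^sup>2) \<partial>M)"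
      by (intro add_right_mono A_square) auto
    also have "\<dots> < \<infinity>"
      using square_integrable_sq[OF k] by (simp add: nn_integral_eq_integral ennreal_mult_less_top)
    finally show "(\<integral>\<^sup>+z. ennreal (norm (case_prod J z)) \<partial>(M \<Otimes>\<^sub>M lborel)) < \<infinity>" .
  qed
  have "(\<integral>x. G k x * cnj (k x) \<partial>M) = (\<integral>x. (\<integral>t. J x t \<partial>lborel) \<partial>M)"
  proof (intro Bochner_Integration.integral_cong refl)
    fix x
    have "G k x * cnj (k x) = (\<integral>t. (if x < t then P t *\<^sub>R prim k t else 0) * cnj (k x) \<partial>lborel)"
      unfolding G_def by simp
    also have "\<dots> = (\<integral>t. J x t \<partial>lborel)"
      by (intro Bochner_Integration.integral_cong refl) (simp add: J_def)
    finally show "G k x * cnj (k x) = (\<integral>t. J x t \<partial>lborel)" .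
  qed
  also have "\<dots> = (\<integral>t. (\<integral>x. J x t \<partial>M) \<partial>lborel)" by (rule M_lborel.Fubini_integral[OF J, symmetric])
  also have "\<dots> = (\<integral>t. complex_of_real (P t * (cmod (prim k t))\<^sup>2) \<partial>lborel)"
  proof (intro Bochner_Integration.integral_cong refl)
    fix t :: real
    have "(\<integral>x. J x t \<partial>M) = (\<integral>x. (P t *\<^sub>R prim k t) * cnj (if x < t then k x else 0) \<partial>M)"
      by (intro Bochner_Integration.integral_cong refl) (simp add: J_def)
    also have "\<dots> = (P t *\<^sub>R prim k t) * cnj (prim k t)"
      unfolding prim_def[of k t] by simp
    also have "\<dots> = complex_of_real (P t * (cmod (prim k t))\<^sup>2)"
      by (simp only: of_real_mult complex_norm_square scaleR_conv_of_real mult.assoc)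
    finally show "(\<integral>x. J x t \<partial>M) = complex_of_real (P t * (cmod (prim k t))\<^sup>2)" .
  qed
  also have "\<dots> = complex_of_real (\<integral>t. P t * (cmod (prim k t))\<^sup>2 \<partial>lborel)" by (rule integral_complex_of_real)
  finally show ?thesis using P0 by (intro exI[of _ "\<integral>t. P t * (cmod (prim k t))\<^sup>2 \<partial>lborel"]) auto
qed

text \<open>Two passages to the limit: under the integral that defines \<open>prim\<close>, for
  every \<open>t\<close>, and under the one that defines \<open>G\<close>, for those
  \<open>x\<close> at which \<open>A\<close> of the majorant is finite.\<close>

lemma G_sums:
  assumes K: "\<And>j. square_integrable M (K j)" and H: "square_integrable M H" and l: "square_integrable M l"
    and q: "0 < q" "q < 1"
    and dom: "AE x in M. (\<forall>j::nat. cmod (K j x) \<le> q ^ j * cmod (H x)) \<and> (\<lambda>j. K j x) sums l x"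
  shows "AE x in M. (\<lambda>j. G (K j) x) sums G l x"
proof -
  note [measurable] = square_integrable_measurable[OF K] square_integrable_measurable[OF H] square_integrable_measurable[OF l]
  define Fa where "Fa t = (\<integral>y. (if y < t then cmod (H y) else 0) \<partial>M)" for t
  have Hi: "integrable M (\<lambda>y. if y < t then cmod (H y) else 0)" for t
    using integrable_norm[OF prim_integrable[OF H, of t]] by (simp add: if_distrib cong: if_cong)
  have [measurable]: "Fa \<in> borel_measurable borel"
  proof -
    have "(\<lambda>t. \<integral>y. (if y < t then cmod (H y) else 0) \<partial>M) \<in> borel_measurable lborel" by measurable
    then show ?thesis unfolding Fa_def[abs_def] by simp
  qed
  have F: "(\<lambda>j. prim (K j) t) sums prim l t" for t
    unfolding prim_def
  proof (rule sums_integral_geometric[OF _ _ Hi[of t] q])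
    show "AE y in M. (\<forall>j. cmod (if y < t then K j y else 0) \<le> q ^ j * (if y < t then cmod (H y) else 0)) \<and>
        (\<lambda>j. if y < t then K j y else 0) sums (if y < t then l y else 0)"
      using dom by eventually_elim auto
  qed simp_all
  have Fb: "cmod (prim (K j) t) \<le> q ^ j * Fa t" for j t
  proof -
    have "cmod (prim (K j) t) \<le> (\<integral>y. norm (if y < t then K j y else 0) \<partial>M)"
      unfolding prim_def by (rule integral_norm_bound)
    also have "\<dots> \<le> (\<integral>y. q ^ j * (if y < t then cmod (H y) else 0) \<partial>M)"
    proof (rule integral_mono_AE)
      show "AE y in M. norm (if y < t then K j y else 0) \<le> q ^ j * (if y < t then cmod (H y) else 0)"
        using dom by eventually_elim auto
    qed (use integrable_norm[OF prim_integrable[OF K, of t]] Hi[of t] in auto)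
    finally show ?thesis by (simp add: Fa_def)
  qed
  show ?thesis using A_finite_AE[OF H]
  proof eventually_elim
    fix x assume fin: "A (\<lambda>y. ennreal (cmod (H y))) x < \<infinity>"
    have Fa_nn: "ennreal (Fa t) = (\<integral>\<^sup>+y. (if y < t then ennreal (cmod (H y)) else 0) \<partial>M)" for t
      unfolding Fa_def by (subst nn_integral_eq_integral[OF Hi, symmetric]) (auto intro!: nn_integral_cong)
    have Fa0: "0 \<le> Fa t" for t unfolding Fa_def by simp
    have int: "integrable lborel (\<lambda>t. if x < t then P t * Fa t else 0)"
    proof (rule integrableI_bounded)
      have "(\<integral>\<^sup>+t. ennreal (norm (if x < t then P t * Fa t else 0)) \<partial>lborel) = A (\<lambda>y. ennreal (cmod (H y))) x"
        unfolding A_def by (intro nn_integral_cong) (use Fa0 P0 in \<open>auto simp: ennreal_mult Fa_nn\<close>)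
      then show "(\<integral>\<^sup>+t. ennreal (norm (if x < t then P t * Fa t else 0)) \<partial>lborel) < \<infinity>" using fin by simp
    qed simp
    show "(\<lambda>j. G (K j) x) sums G l x"
      unfolding G_def
    proof (rule sums_integral_geometric[OF _ _ int q])
      show "AE t in lborel. (\<forall>j. cmod (if x < t then P t *\<^sub>R prim (K j) t else 0) \<le> q ^ j * (if x < t then P t * Fa t else 0)) \<and>
         (\<lambda>j. if x < t then P t *\<^sub>R prim (K j) t else 0) sums (if x < t then P t *\<^sub>R prim l t else 0)"
      proof (intro AE_I2 conjI allI)
        fix t :: real and j
        show "cmod (if x < t then P t *\<^sub>R prim (K j) t else 0) \<le> q ^ j * (if x < t then P t * Fa t else 0)"
          using mult_left_mono[OF Fb[of j t] P0[of t]] P0[of t] by (simp add: ac_simps)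
        show "(\<lambda>j. if x < t then P t *\<^sub>R prim (K j) t else 0) sums (if x < t then P t *\<^sub>R prim l t else 0)"
          using sums_scaleR_right[OF F, of "P t" t] by simp
      qed
    qed simp_all
  qed
qed

sublocale positive_operator M G a
  by unfold_locales (use apos G_square G_inner_nonneg G_sums in auto)

end

section \<open>The two-phase operator\<close>

lemma nn_integral_FTC_open:
  fixes F f :: "real \<Rightarrow> real"
  assumes "a \<le> b" "finite S" "continuous_on {a..b} F"
    and der: "\<And>x. x \<in> {a<..<b} - S \<Longrightarrow> (F has_real_derivative f x) (at x)"
    and nonneg: "\<And>x. x \<in> {a<..<b} \<Longrightarrow> 0 \<le> f x"
  shows "(\<integral>\<^sup>+x. (if a < x \<and> x < b then ennreal (f x) else 0) \<partial>lborel) = ennreal (F b - F a)"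
proof -
  have "(f has_integral (F b - F a)) {a..b}"
    using assms by (intro fundamental_theorem_of_calculus_interior_strong[of S])
                   (auto simp: has_real_derivative_iff_has_vector_derivative)
  then have "(f has_integral (F b - F a)) {a<..<b}" by (simp add: has_integral_Icc_iff_Ioo)
  then have "(\<integral>\<^sup>+x. ennreal (indicat_real {a<..<b} x * f x) \<partial>lborel) = ennreal (F b - F a)"
    by (intro nn_integral_has_integral_lebesgue nonneg)
  then show ?thesis by (auto intro!: nn_integral_cong simp: indicator_def elim!: trans[rotated])
qed

locale two_phase =
  fixes n r1 r2 c :: real
  assumes n: "0 < n" "n < 2" and r: "0 < r1" "r1 < r2" and c: "0 < c"
begin

abbreviation R :: "real \<Rightarrow> real" where "R \<equiv> ell r1 r2 c"

text \<open>Closed form, for \<open>x > 0\<close>, of the integral of \<open>v / R v\<close> over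
  \<open>(0, x)\<close>.\<close>

definition Phi :: "real \<Rightarrow> real" where
  "Phi x = (if x \<le> c then x\<^sup>2 / (2 * r1) else c\<^sup>2 / (2 * r1) + (x\<^sup>2 - c\<^sup>2) / (2 * r2))"

text \<open>The integrating factor: since \<open>p' / p = (n - 1) / x + x / R x\<close> off
  \<open>c\<close>, one has \<open>W * L f = (p * f')'\<close> with
  \<open>W = p / R\<close>.\<close>

definition p :: "real \<Rightarrow> real" where "p x = x powr (n - 1) * exp (Phi x)"

definition W :: "real \<Rightarrow> real" where "W x = p x / R x"

abbreviation M :: "real measure" where "M \<equiv> weight_measure n R"

abbreviation P :: "real \<Rightarrow> real" where "P \<equiv> \<lambda>x. 1 / p x"

lemma R_bounds: "0 < R x" "r1 \<le> R x" "R x \<le> r2"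
  using r by (auto simp: ell_def)

lemma R_measurable[measurable]: "R \<in> borel_measurable borel"
  unfolding ell_def[abs_def] by measurable

lemma Phi_measurable[measurable]: "Phi \<in> borel_measurable borel"
  unfolding Phi_def[abs_def] by measurable

lemma p_measurable[measurable]: "p \<in> borel_measurable borel"
  unfolding p_def[abs_def] by measurable

lemma W_measurable[measurable]: "W \<in> borel_measurable borel"
  unfolding W_def[abs_def] by measurable

lemma W_measurable_lebesgue[measurable]: "W \<in> borel_measurable lebesgue"
  by (rule measurable_completion) simp

lemma p_pos: "0 < x \<Longrightarrow> 0 < p x" by (simp add: p_def)

lemma p_nonneg: "0 \<le> p x" by (simp add: p_def)

lemma W_pos: "0 < x \<Longrightarrow> 0 < W x" using R_bounds by (simp add: W_def p_pos)

lemma W_nonneg: "0 \<le> W x" using R_bounds p_nonneg by (simp add: W_def less_imp_le)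

section \<open>Calculus of the exponent and of the integrating factor\<close>

lemma Phi_deriv:
  assumes "x \<noteq> c"
  shows "(Phi has_real_derivative x / R x) (at x)"
proof (cases "x < c")
  case True
  have "((\<lambda>x. x\<^sup>2 / (2 * r1)) has_real_derivative x / R x) (at x)"
    using True r by (auto intro!: derivative_eq_intros simp: ell_def)
  then show ?thesis
    by (rule has_field_derivative_transform_within_open[of _ _ _ "{..<c}"]) (use True in \<open>auto simp: Phi_def\<close>)
next
  case False
  have "((\<lambda>x. c\<^sup>2 / (2 * r1) + (x\<^sup>2 - c\<^sup>2) / (2 * r2)) has_real_derivative x / R x) (at x)"
    using False assms r by (auto intro!: derivative_eq_intros simp: ell_def)
  then show ?thesis
    by (rule has_field_derivative_transform_within_open[of _ _ _ "{c<..}"]) (use False assms in \<open>auto simp: Phi_def\<close>)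
qed

lemma Phi_alt: "Phi x = (min x c)\<^sup>2 / (2 * r1) + ((max x c)\<^sup>2 - c\<^sup>2) / (2 * r2)"
  by (auto simp: Phi_def min_def max_def)

lemma Phi_cont: "continuous_on S Phi"
  unfolding Phi_alt[abs_def] using r by (intro continuous_intros) auto

lemma Phi_0: "Phi 0 = 0" using c by (simp add: Phi_def)

lemma Phi_increment:
  assumes "0 \<le> u" "u \<le> v"
  shows "(v\<^sup>2 - u\<^sup>2) / (2 * r2) \<le> Phi v - Phi u" "Phi v - Phi u \<le> (v\<^sup>2 - u\<^sup>2) / (2 * r1)"
proof -
  have e: "Phi v - Phi u = ((min v c)\<^sup>2 - (min u c)\<^sup>2) / (2 * r1) + ((max v c)\<^sup>2 - (max u c)\<^sup>2) / (2 * r2)"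
    by (simp add: Phi_alt diff_divide_distrib add_divide_distrib)
  have s: "v\<^sup>2 - u\<^sup>2 = ((min v c)\<^sup>2 - (min u c)\<^sup>2) + ((max v c)\<^sup>2 - (max u c)\<^sup>2)"
    by (auto simp: min_def max_def)
  have 1: "0 \<le> (min v c)\<^sup>2 - (min u c)\<^sup>2" "0 \<le> (max v c)\<^sup>2 - (max u c)\<^sup>2"
    using assms c by (auto intro!: power_mono)
  have D: "A / (2 * r2) \<le> A / (2 * r1)" if "0 \<le> A" for A
    using that r by (intro divide_left_mono) auto
  show "(v\<^sup>2 - u\<^sup>2) / (2 * r2) \<le> Phi v - Phi u" "Phi v - Phi u \<le> (v\<^sup>2 - u\<^sup>2) / (2 * r1)"
    unfolding e s add_divide_distrib using D[OF 1(1)] D[OF 1(2)] by auto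
qed

lemma Phi_mono: "0 \<le> u \<Longrightarrow> u \<le> v \<Longrightarrow> Phi u \<le> Phi v"
  using Phi_increment(1)[of u v] r by (smt (verit) divide_nonneg_pos power_mono)

lemma p_deriv:
  assumes "0 < x" "x \<noteq> c"
  shows "(p has_real_derivative p x * ((n - 1) / x + x / R x)) (at x)"
proof -
  have pw: "x powr (n - 2) = x powr (n - 1) / x" using assms powr_diff[of x "n - 1" 1] by simp
  show ?thesis
    unfolding p_def[abs_def] using assms
    by (auto intro!: derivative_eq_intros Phi_deriv simp: pw algebra_simps)
qed

lemma P_deriv:
  assumes "0 < x" "x \<noteq> c"
  shows "(P has_real_derivative - (P x * ((n - 1) / x + x / R x))) (at x)"
proof -
  have p0: "p x \<noteq> 0" using p_pos[OF assms(1)] by simp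
  define q where "q = (n - 1) / x + x / R x"
  have "(P has_real_derivative (0 * p x - 1 * (p x * q)) / (p x * p x)) (at x)"
    using p_deriv[OF assms] p0 unfolding q_def by (intro DERIV_divide) auto
  also have "(0 * p x - 1 * (p x * q)) / (p x * p x) = - (P x * q)" using p0 by simp
  finally show ?thesis by (simp add: q_def)
qed

lemma p_cont: "continuous_on {0<..} p"
  unfolding p_def[abs_def] by (intro continuous_intros Phi_cont) auto

lemma P_cont: "continuous_on {0<..} P"
  using p_cont p_pos by (intro continuous_intros) (auto simp: less_le)

section \<open>The weighted measure\<close>

lemma weight_eq: "weight n R x = W x" if x: "0 < x"
proof -
  have "(\<integral>\<^sup>+v. (if 0 < v \<and> v < x then ennreal (v / R v) else 0) \<partial>lborel) = ennreal (Phi x - Phi 0)"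
    by (rule nn_integral_FTC_open[of _ _ "{c}"]) (use x R_bounds in \<open>auto intro!: Phi_deriv Phi_cont simp: less_imp_le\<close>)
  then have nn: "(\<integral>\<^sup>+v. ennreal (indicat_real {0<..<x} v *\<^sub>R (v / R v)) \<partial>lborel) = ennreal (Phi x)"
    by (auto intro!: nn_integral_cong simp: Phi_0 indicator_def elim!: trans[rotated])
  have "0 \<le> Phi x" using Phi_mono[of 0 x] x by (simp add: Phi_0)
  then have "(LINT v:{0<..<x}|lborel. v / R v) = Phi x"
    unfolding set_lebesgue_integral_def
    by (subst integral_eq_nn_integral) (use nn R_bounds in \<open>auto simp: indicator_def less_imp_le\<close>)
  then show ?thesis by (simp add: weight_def W_def p_def)
qed

lemma M_eq: "M = density (lebesgue_on {0<..}) (\<lambda>x. ennreal (W x))"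
  unfolding weight_measure_def
proof (rule density_cong)
  show "(\<lambda>x. ennreal (W x)) \<in> borel_measurable (lebesgue_on {0<..})"
    by (intro measurable_compose[OF measurable_restrict_space1 measurable_ennreal]) auto
  then have "(\<lambda>x. ennreal (weight n R x)) \<in> borel_measurable (lebesgue_on {0<..}) \<longleftrightarrow> True"
    by (subst measurable_cong[of _ _ "\<lambda>x. ennreal (W x)"]) (auto simp: weight_eq)
  then show "(\<lambda>x. ennreal (weight n R x)) \<in> borel_measurable (lebesgue_on {0<..})" by simp
qed (auto simp: weight_eq)

lemma space_M: "space M = {0<..}" by (simp add: M_eq)

lemma sets_M: "sets M = sets (lebesgue_on {0<..})" by (simp add: M_eq)

lemma measurable_M: "f \<in> M \<rightarrow>\<^sub>M N \<longleftrightarrow> f \<in> lebesgue_on {0<..} \<rightarrow>\<^sub>M N"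
  by (simp add: M_eq)

lemma borel_measurable_M:
  assumes "f \<in> borel \<rightarrow>\<^sub>M N"
  shows "f \<in> M \<rightarrow>\<^sub>M N"
  unfolding measurable_M using assms
  by (intro measurable_restrict_space1) (auto simp: measurable_completion)

lemma W_measurable_on: "(\<lambda>x. ennreal (W x)) \<in> borel_measurable (lebesgue_on {0<..})"
  by (intro measurable_compose[OF measurable_restrict_space1 measurable_ennreal]) auto

lemma nn_integral_M:
  assumes "f \<in> borel_measurable M"
  shows "(\<integral>\<^sup>+x. f x \<partial>M) = (\<integral>\<^sup>+x. (if 0 < x then ennreal (W x) * f x else 0) \<partial>lborel)"
proof -
  have "(\<integral>\<^sup>+x. f x \<partial>M) = (\<integral>\<^sup>+x. ennreal (W x) * f x \<partial>lebesgue_on {0<..})"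
    using assms unfolding M_eq by (subst nn_integral_density) (auto simp: W_measurable_on)
  also have "\<dots> = (\<integral>\<^sup>+x. ennreal (W x) * f x * indicator {0<..} x \<partial>lebesgue)"
    by (subst nn_integral_restrict_space) auto
  also have "\<dots> = (\<integral>\<^sup>+x. ennreal (W x) * f x * indicator {0<..} x \<partial>lborel)"
    by (rule nn_integral_completion)
  finally show ?thesis by (auto intro!: nn_integral_cong simp: indicator_def)
qed

lemma AE_M: "(AE x in M. Q x) \<longleftrightarrow> (AE x in lebesgue. 0 < x \<longrightarrow> Q x)"
proof -
  have "(AE x in M. Q x) \<longleftrightarrow> (AE x in lebesgue_on {0<..}. 0 < ennreal (W x) \<longrightarrow> Q x)"
    unfolding M_eq by (rule AE_density[OF W_measurable_on])
  also have "\<dots> \<longleftrightarrow> (AE x in lebesgue. x \<in> {0<..} \<longrightarrow> 0 < ennreal (W x) \<longrightarrow> Q x)"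
    by (rule AE_restrict_space_iff) auto
  also have "\<dots> \<longleftrightarrow> (AE x in lebesgue. 0 < x \<longrightarrow> Q x)"
    by (rule AE_cong) (auto simp: W_pos)
  finally show ?thesis .
qed

lemma W_upper: "0 < y \<Longrightarrow> y < t \<Longrightarrow> W y \<le> exp (Phi t) / r1 * y powr (n - 1)"
proof -
  assume y: "0 < y" "y < t"
  have "exp (Phi y) \<le> exp (Phi t)" using Phi_mono[of y t] y by simp
  then have "p y \<le> y powr (n - 1) * exp (Phi t)" unfolding p_def by (intro mult_left_mono) auto
  then have "p y / R y \<le> y powr (n - 1) * exp (Phi t) / r1"
    using R_bounds(2)[of y] r p_nonneg[of y] by (intro frac_le) auto
  then show ?thesis by (simp add: W_def mult.commute)
qed

lemma emeasure_M_initial: "emeasure M {y \<in> space M. y < t} < \<infinity>"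
proof -
  have S: "{y \<in> space M. y < t} \<in> sets M"
    by (auto simp: space_M sets_M sets_restrict_space_iff)
  show ?thesis
  proof (cases "0 < t")
    case True
    have "emeasure M {y \<in> space M. y < t} = (\<integral>\<^sup>+y. indicator {y \<in> space M. y < t} y \<partial>M)"
      using S by simp
    also have "\<dots> = (\<integral>\<^sup>+x. (if 0 < x then ennreal (W x) * indicator {y \<in> space M. y < t} x else 0) \<partial>lborel)"
      using S by (intro nn_integral_M) auto
    also have "\<dots> \<le> (\<integral>\<^sup>+x. (if 0 < x \<and> x < t then ennreal (exp (Phi t) / r1 * x powr (n - 1)) else 0) \<partial>lborel)"
      using W_upper by (intro nn_integral_mono) (auto simp: indicator_def intro!: ennreal_leI)
    also have "\<dots> = ennreal (exp (Phi t) / r1 * (t powr n / n) - exp (Phi t) / r1 * (0 powr n / n))"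
    proof (rule nn_integral_FTC_open[of _ _ "{}"])
      show "continuous_on {0..t} (\<lambda>x. exp (Phi t) / r1 * (x powr n / n))"
        using n r by (intro continuous_on_mult continuous_on_const continuous_on_divide continuous_on_powr' continuous_on_id) auto
      show "((\<lambda>x. exp (Phi t) / r1 * (x powr n / n)) has_real_derivative exp (Phi t) / r1 * x powr (n - 1)) (at x)"
        if "x \<in> {0<..<t} - {}" for x
        using that n r by (auto intro!: derivative_eq_intros)
    qed (use True r in auto)
    finally show ?thesis by (auto intro: le_less_trans)
  next
    case False
    then have e: "{y \<in> space M. y < t} = {}" by (auto simp: space_M)
    show ?thesis unfolding e by simp
  qed
qed

lemma sigma_finite_M: "sigma_finite_measure M"
proof
  let ?A = "range (\<lambda>k::nat. {y \<in> space M. y < real k})"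
  have "?A \<subseteq> sets M" by (auto simp: space_M sets_M sets_restrict_space_iff)
  moreover have "\<Union>?A = space M" using reals_Archimedean2 by auto
  ultimately show "\<exists>A. countable A \<and> A \<subseteq> sets M \<and> \<Union>A = space M \<and> (\<forall>a\<in>A. emeasure M a \<noteq> \<infinity>)"
    using emeasure_M_initial by (intro exI[of _ ?A]) (auto simp: less_top)
qed

lemma L2_space_iff: "f \<in> L2_space n R \<longleftrightarrow> square_integrable M f"
  by (simp add: L2_space_def square_integrable_def)

lemma emeasure_M_pos: "0 < t \<Longrightarrow> 0 < emeasure M {y \<in> space M. y < t}"
proof (rule ccontr)
  assume t: "0 < t" and "\<not> 0 < emeasure M {y \<in> space M. y < t}"
  then have "{y \<in> space M. y < t} \<in> null_sets M"
    by (auto simp: null_sets_def space_M sets_M sets_restrict_space_iff)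
  then have "AE y in M. \<not> y < t" by (rule AE_I') (auto simp: space_M)
  then have "AE y in lebesgue. 0 < y \<longrightarrow> \<not> y < t" by (simp add: AE_M)
  then obtain N where "negligible N" "{y. 0 < y \<and> y < t} \<subseteq> N"
    by (auto simp: eventually_ae_filter_negligible)
  moreover have "{0<..<t} = {y. 0 < y \<and> y < t}" by auto
  ultimately have "negligible {0<..<t}" by (metis negligible_subset)
  then show False using t negligible_interval(2)[of 0 t] by (simp add: box_real)
qed

text \<open>Infinite mass excludes nonzero constants from the space, which later fixes the additive
  constant when a function is recovered from its derivative. The mass diverges because
  \<open>W x\<close> is at least a multiple of \<open>x\<close> for \<open>x > 1\<close>.\<close>

lemma emeasure_M_infinite: "emeasure M (space M) = \<infinity>"
proof (rule ccontr)
  assume "emeasure M (space M) \<noteq> \<infinity>"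
  have lower: "1 / (2 * r2 * r2) * x \<le> W x" if "1 < x" for x
  proof -
    have "x\<^sup>2 / (2 * r2) \<le> Phi x" using Phi_increment(1)[of 0 x] that by (simp add: Phi_0)
    then have "x\<^sup>2 / (2 * r2) \<le> exp (Phi x)" using exp_ge_add_one_self[of "Phi x"] by linarith
    moreover have "x powr (- 1) \<le> x powr (n - 1)" using that n by (intro powr_mono) auto
    ultimately have "x powr (- 1) * (x\<^sup>2 / (2 * r2)) \<le> p x"
      unfolding p_def using r by (intro mult_mono) auto
    moreover have "x powr (- 1) * (x\<^sup>2 / (2 * r2)) = x / (2 * r2)"
      using that by (simp add: powr_minus power2_eq_square field_simps)
    ultimately have "x / (2 * r2) / r2 \<le> p x / R x"
      using R_bounds(1,3)[of x] that r by (intro frac_le) (auto simp: p_nonneg)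
    then show ?thesis by (simp add: W_def field_simps)
  qed
  have b: "ennreal ((T\<^sup>2 - 1) / (4 * r2 * r2)) \<le> emeasure M (space M)" if T: "1 < T" for T
  proof -
    have "ennreal (1 / (4 * r2 * r2) * T\<^sup>2 - 1 / (4 * r2 * r2) * 1\<^sup>2) =
        (\<integral>\<^sup>+x. (if 1 < x \<and> x < T then ennreal (1 / (2 * r2 * r2) * x) else 0) \<partial>lborel)"
      by (rule nn_integral_FTC_open[of _ _ "{}", symmetric])
         (use T r in \<open>auto intro!: derivative_eq_intros continuous_intros simp: field_simps\<close>)
    also have "\<dots> \<le> (\<integral>\<^sup>+x. (if 0 < x then ennreal (W x) * 1 else 0) \<partial>lborel)"
      using lower by (intro nn_integral_mono) (auto intro!: ennreal_leI)
    also have "\<dots> = emeasure M (space M)" by (subst nn_integral_M[symmetric]) auto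
    finally show ?thesis by (simp add: diff_divide_distrib)
  qed
  obtain B where B: "emeasure M (space M) = ennreal B" "B \<ge> 0"
    using \<open>emeasure M (space M) \<noteq> \<infinity>\<close> by (cases "emeasure M (space M)") auto
  define T where "T = 2 + B * (4 * r2 * r2)"
  have "1 < T" using B r by (simp add: T_def add_pos_nonneg)
  then have "(T\<^sup>2 - 1) / (4 * r2 * r2) \<le> B" using b[of T] B by simp
  then have "T\<^sup>2 - 1 \<le> B * (4 * r2 * r2)" using r by (simp add: field_simps)
  moreover have "T * 1 \<le> T\<^sup>2" using \<open>1 < T\<close> unfolding power2_eq_square by (intro mult_left_mono) auto
  ultimately show False by (simp add: T_def)
qed

end

context two_phase
begin

text \<open>\<open>P\<close> has a corner at \<open>c\<close>, so the Lipschitz constant is obtained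
  by integrating the derivative that exists off \<open>c\<close>.\<close>

lemma P_bounds:
  assumes "0 < l" "l \<le> u"
  obtains B where "0 \<le> B" "\<And>x. x \<in> {l..u} \<Longrightarrow> \<bar>P x\<bar> \<le> B"
    "\<And>x y. l \<le> x \<Longrightarrow> x \<le> y \<Longrightarrow> y \<le> u \<Longrightarrow> \<bar>P y - P x\<bar> \<le> B * (y - x)"
proof -
  have cP: "continuous_on {l..u} P" using assms by (intro continuous_on_subset[OF P_cont]) auto
  obtain B0 where "\<forall>y\<in>P ` {l..u}. norm y \<le> B0"
    using compact_imp_bounded[OF compact_continuous_image[OF cP compact_Icc]] unfolding bounded_iff by blast
  then have B0: "\<And>x. x \<in> {l..u} \<Longrightarrow> norm (P x) \<le> B0" by blast
  have B00: "0 \<le> B0" using B0[of l] assms norm_ge_zero[of "P l"] by (meson atLeastAtMost_iff order_refl order_trans)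
  define B where "B = B0 + B0 * (\<bar>n - 1\<bar> / l + u / r1)"
  have nn: "0 \<le> \<bar>n - 1\<bar> / l + u / r1" using assms r by simp
  have "0 \<le> B0 * (\<bar>n - 1\<bar> / l + u / r1)" using B00 nn by simp
  then have BB: "0 \<le> B" "B0 \<le> B" "B0 * (\<bar>n - 1\<bar> / l + u / r1) \<le> B" using B00 by (auto simp: B_def)
  show thesis
  proof (rule that[OF BB(1)])
    show "\<bar>P x\<bar> \<le> B" if "x \<in> {l..u}" for x using B0[OF that] BB by simp
    fix x y assume xy: "l \<le> x" "x \<le> y" "y \<le> u"
    have hi: "((\<lambda>x. - (P x * ((n - 1) / x + x / R x))) has_integral (P y - P x)) (cbox x y)"
      unfolding cbox_interval
    proof (rule fundamental_theorem_of_calculus_interior_strong[of "{c}"])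
      show "continuous_on {x..y} P" using cP by (rule continuous_on_subset) (use xy in auto)
      show "(P has_vector_derivative - (P z * ((n - 1) / z + z / R z))) (at z)" if "z \<in> {x<..<y} - {c}" for z
        using P_deriv[of z] that xy assms by (simp add: has_real_derivative_iff_has_vector_derivative)
    qed (use xy in auto)
    have bd: "norm (- (P z * ((n - 1) / z + z / R z))) \<le> B" if z: "z \<in> cbox x y" for z
    proof -
      have z': "l \<le> z" "z \<le> u" "0 < z" using z xy assms by auto
      have "\<bar>(n - 1) / z\<bar> \<le> \<bar>n - 1\<bar> / l" using z' assms by (simp add: frac_le)
      moreover have "\<bar>z / R z\<bar> \<le> u / r1" using z' R_bounds[of z] r by (auto intro!: frac_le)
      ultimately have "\<bar>(n - 1) / z + z / R z\<bar> \<le> \<bar>n - 1\<bar> / l + u / r1" by linarith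
      then have "\<bar>P z\<bar> * \<bar>(n - 1) / z + z / R z\<bar> \<le> B0 * (\<bar>n - 1\<bar> / l + u / r1)"
        using B0[of z] z' B00 by (intro mult_mono) auto
      then show ?thesis using BB by (simp add: abs_mult)
    qed
    show "\<bar>P y - P x\<bar> \<le> B * (y - x)"
      using has_integral_bound[OF BB(1) hi bd] xy by simp
  qed
qed

lemma ennreal_mult_mono:
  "0 \<le> u \<Longrightarrow> 0 \<le> v \<Longrightarrow> 0 \<le> w \<Longrightarrow> u * v \<le> w * z \<Longrightarrow> ennreal u * ennreal v \<le> ennreal w * ennreal z"
  by (subst (1 2) ennreal_mult'[symmetric]) (auto intro: ennreal_leI)

section \<open>Weighted estimates for the first-order term\<close>

text \<open>\<open>U\<close> is a barrier whose derivative dominates the integrand. Its factor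
  \<open>y^n / (D + y^2)\<close> behaves like \<open>y^n\<close> at 0 and like
  \<open>y^(n - 2)\<close> at infinity, the powers with which the integral itself behaves in the two
  regimes.\<close>

lemma initial_weight_bound:
  fixes \<alpha> m D
  defines "\<alpha> \<equiv> 1 / (4 * r2)" and "D \<equiv> 8 * r2" and "m \<equiv> min (n / D) (1 / (4 * r2))"
  assumes x: "0 < x"
  shows "(\<integral>\<^sup>+y. (if 0 < y \<and> y < x then ennreal (y powr (n - 1) * exp (Phi y - \<alpha> * y\<^sup>2)) else 0) \<partial>lborel)
     \<le> ennreal (1 / m * x powr (n - 2) * exp (Phi x - \<alpha> * x\<^sup>2))"
proof -
  \<comment> \<open>As \<open>2 * \<alpha> = 1 / (2 * r2)\<close>, subtracting
    \<open>\<alpha> * y^2\<close> leaves the exponent a slope of at least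
    \<open>y / (2 * r2)\<close>. The choice \<open>D = 8 * r2\<close> spends at most half of it on
    differentiating \<open>1 / (D + y^2)\<close>, and \<open>m\<close> makes the remainder
    \<open>n + y^2 / (4 * r2)\<close> at least \<open>m * (D + y^2)\<close>.\<close>
  have D: "D > 0" and m: "m > 0" using r n by (auto simp: D_def m_def)
  define U where "U y = 1 / m * (y powr n / (D + y\<^sup>2) * exp (Phi y - \<alpha> * y\<^sup>2))" for y
  define U' where "U' y = 1 / m * (y powr (n - 1) / (D + y\<^sup>2)) * (n - 2 * y\<^sup>2 / (D + y\<^sup>2) + (1 / R y - 2 * \<alpha>) * y\<^sup>2) * exp (Phi y - \<alpha> * y\<^sup>2)" for y
  have Dy: "D + y\<^sup>2 > 0" for y using D by (simp add: add_pos_nonneg)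
  have der: "(U has_real_derivative U' y) (at y)" if y: "y \<in> {0<..<x} - {c}" for y
  proof -
    have pw: "y powr n = y powr (n - 1) * y" using y powr_add[of y "n - 1" 1] by simp
    have A: "((\<lambda>y. y powr n) has_real_derivative n * y powr (n - 1)) (at y)"
      using y by (auto intro!: derivative_eq_intros)
    have B: "((\<lambda>y. D + y\<^sup>2) has_real_derivative 2 * y) (at y)"
      by (auto intro!: derivative_eq_intros)
    have C: "((\<lambda>y. exp (Phi y - \<alpha> * y\<^sup>2)) has_real_derivative exp (Phi y - \<alpha> * y\<^sup>2) * (y / R y - \<alpha> * (2 * y))) (at y)"
      using y by (auto intro!: derivative_eq_intros Phi_deriv)
    have d: "D + y\<^sup>2 \<noteq> 0" using Dy[of y] by simp
    have "(U has_real_derivative 1 / m * ((n * y powr (n - 1) * (D + y\<^sup>2) - y powr n * (2 * y)) / ((D + y\<^sup>2) * (D + y\<^sup>2)) * exp (Phi y - \<alpha> * y\<^sup>2)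
        + exp (Phi y - \<alpha> * y\<^sup>2) * (y / R y - \<alpha> * (2 * y)) * (y powr n / (D + y\<^sup>2)))) (at y)"
      unfolding U_def[abs_def] by (rule DERIV_cmult[OF DERIV_mult[OF DERIV_divide[OF A B d] C]])
    also have "1 / m * ((n * y powr (n - 1) * (D + y\<^sup>2) - y powr n * (2 * y)) / ((D + y\<^sup>2) * (D + y\<^sup>2)) * exp (Phi y - \<alpha> * y\<^sup>2)
        + exp (Phi y - \<alpha> * y\<^sup>2) * (y / R y - \<alpha> * (2 * y)) * (y powr n / (D + y\<^sup>2))) = U' y"
    proof -
      define E where "E = exp (Phi y - \<alpha> * y\<^sup>2)"
      define q where "q = y powr (n - 1)"
      define d where "d = D + y\<^sup>2"
      define s where "s = 1 / R y"
      have d0: "d \<noteq> 0" using Dy[of y] by (simp add: d_def)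
      have yR: "y / R y = y * s" by (simp add: s_def)
      show ?thesis
        unfolding U'_def pw yR E_def[symmetric] q_def[symmetric] d_def[symmetric] s_def[symmetric]
        using d0 m by (simp add: field_simps power2_eq_square)
    qed
    finally show ?thesis .
  qed
  have low: "y powr (n - 1) * exp (Phi y - \<alpha> * y\<^sup>2) \<le> U' y" if y: "0 < y" for y
  proof -
    have "1 / r2 \<le> 1 / R y" using R_bounds[of y] r by (intro divide_left_mono) auto
    moreover have "1 / r2 - 2 * \<alpha> = 1 / (2 * r2)" using r by (simp add: \<alpha>_def field_simps)
    ultimately have "1 / (2 * r2) \<le> 1 / R y - 2 * \<alpha>" by linarith
    then have 1: "1 / (2 * r2) * y\<^sup>2 \<le> (1 / R y - 2 * \<alpha>) * y\<^sup>2" by (intro mult_right_mono) auto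
    have 2: "2 * y\<^sup>2 / (D + y\<^sup>2) \<le> 1 / (4 * r2) * y\<^sup>2"
    proof -
      have "2 * y\<^sup>2 / (D + y\<^sup>2) \<le> 2 * y\<^sup>2 / D" using D by (intro divide_left_mono) (auto simp: add_pos_nonneg)
      then show ?thesis by (simp add: D_def)
    qed
    have "m * D \<le> n" using D by (simp add: m_def min_def field_simps split: if_splits)
    moreover have "m * y\<^sup>2 \<le> 1 / (4 * r2) * y\<^sup>2" by (intro mult_right_mono) (auto simp: m_def)
    moreover have "1 / (2 * r2) * y\<^sup>2 = 1 / (4 * r2) * y\<^sup>2 + 1 / (4 * r2) * y\<^sup>2" using r by (simp add: field_simps)
    ultimately have "m * (D + y\<^sup>2) \<le> n - 2 * y\<^sup>2 / (D + y\<^sup>2) + (1 / R y - 2 * \<alpha>) * y\<^sup>2"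
      using 1 2 by (simp add: distrib_left)
    then have "1 / m * (y powr (n - 1) / (D + y\<^sup>2)) * (m * (D + y\<^sup>2)) * exp (Phi y - \<alpha> * y\<^sup>2) \<le> U' y"
      unfolding U'_def using m Dy[of y] by (intro mult_right_mono mult_left_mono) auto
    also have "1 / m * (y powr (n - 1) / (D + y\<^sup>2)) * (m * (D + y\<^sup>2)) = y powr (n - 1)"
    proof -
      have "1 / m * (q / d) * (m * d) = q" if "m \<noteq> 0" "d \<noteq> 0" for m d q :: real using that by simp
      then show ?thesis using m Dy[of y] by simp
    qed
    finally show ?thesis .
  qed
  have "(\<integral>\<^sup>+y. (if 0 < y \<and> y < x then ennreal (y powr (n - 1) * exp (Phi y - \<alpha> * y\<^sup>2)) else 0) \<partial>lborel)
      \<le> (\<integral>\<^sup>+y. (if 0 < y \<and> y < x then ennreal (U' y) else 0) \<partial>lborel)"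
    using low by (intro nn_integral_mono) (auto intro!: ennreal_leI)
  also have "\<dots> = ennreal (U x - U 0)"
  proof (rule nn_integral_FTC_open[of _ _ "{c}"])
    show "continuous_on {0..x} U" unfolding U_def using n Dy m
      by (intro continuous_on_mult continuous_on_const continuous_on_divide continuous_on_powr' continuous_on_id
          continuous_on_exp continuous_on_diff Phi_cont continuous_on_add continuous_on_power) (auto simp: less_imp_neq[symmetric])
    show "0 \<le> U' y" if "y \<in> {0<..<x}" for y using low[of y] that by (auto intro: order_trans[rotated])
  qed (use x der in auto)
  also have "\<dots> = ennreal (U x)" by (simp add: U_def)
  also have "\<dots> \<le> ennreal (1 / m * x powr (n - 2) * exp (Phi x - \<alpha> * x\<^sup>2))"
  proof (rule ennreal_leI)
    have pw: "x powr n = x powr (n - 2) * x\<^sup>2" using x powr_add[of x "n - 2" 2] by simp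
    have "x powr n / (D + x\<^sup>2) \<le> x powr (n - 2)"
      unfolding pw using D Dy[of x] by (simp add: field_simps)
    then show "U x \<le> 1 / m * x powr (n - 2) * exp (Phi x - \<alpha> * x\<^sup>2)"
      unfolding U_def mult.assoc using m by (intro mult_right_mono mult_left_mono) auto
  qed
  finally show ?thesis .
qed

lemma gauss_tail:
  fixes \<alpha> y :: real
  assumes "0 < \<alpha>" "0 < y"
  shows "(\<integral>\<^sup>+x. (if y < x then ennreal (x * exp (- (\<alpha> * x\<^sup>2))) else 0) \<partial>lborel) \<le> ennreal (exp (- (\<alpha> * y\<^sup>2)) / (2 * \<alpha>))"
proof -
  have "(\<integral>\<^sup>+x. ennreal (x * exp (- (\<alpha> * x\<^sup>2))) * indicator {y..} x \<partial>lborel) = ennreal (0 - (- exp (- (\<alpha> * y\<^sup>2)) / (2 * \<alpha>)))"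
  proof (rule nn_integral_FTC_atLeast)
    show "DERIV (\<lambda>x. - exp (- (\<alpha> * x\<^sup>2)) / (2 * \<alpha>)) x :> x * exp (- (\<alpha> * x\<^sup>2))" for x
      using assms by (auto intro!: derivative_eq_intros)
    have "filterlim (\<lambda>x::real. \<alpha> * x\<^sup>2) at_top at_top"
      using assms by (intro filterlim_tendsto_pos_mult_at_top[OF tendsto_const] filterlim_pow_at_top filterlim_ident) auto
    then have "((\<lambda>x::real. exp (- (\<alpha> * x\<^sup>2))) \<longlongrightarrow> 0) at_top"
      by (intro filterlim_compose[OF exp_at_bot] filterlim_compose[OF filterlim_uminus_at_bot_at_top])
    then show "((\<lambda>x. - exp (- (\<alpha> * x\<^sup>2)) / (2 * \<alpha>)) \<longlongrightarrow> 0) at_top"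
      using tendsto_mult_left[of "\<lambda>x. exp (- (\<alpha> * x\<^sup>2))" 0 at_top "- 1 / (2 * \<alpha>)"] by simp
  qed (use assms in auto)
  moreover have "(\<integral>\<^sup>+x. (if y < x then ennreal (x * exp (- (\<alpha> * x\<^sup>2))) else 0) \<partial>lborel)
      \<le> (\<integral>\<^sup>+x. ennreal (x * exp (- (\<alpha> * x\<^sup>2))) * indicator {y..} x \<partial>lborel)"
    by (intro nn_integral_mono) (auto simp: indicator_def)
  ultimately show ?thesis by simp
qed

text \<open>Up to sign \<open>x * P x * prim k x\<close> is \<open>x\<close> times the derivative of
  \<open>G k\<close>, the term that separates \<open>Delta n (G k)\<close> from
  \<open>L_op n R (G k)\<close>. Schur's test is applied to the kernel \<open>x * P x\<close> on
  \<open>y < x\<close> with a Gaussian weight: rows are bounded by the barrier, columns by the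
  Gaussian tail, where \<open>W x * P x = 1 / R x\<close> removes the exponential growth.\<close>

lemma weighted_primitive_square:
  assumes k: "square_integrable M k"
  shows "(\<integral>\<^sup>+x. (ennreal (x * P x) * (\<integral>\<^sup>+y. (if y < x then ennreal (cmod (k y)) else 0) \<partial>M))\<^sup>2 \<partial>M) < \<infinity>"
proof -
  interpret M: sigma_finite_measure M by (rule sigma_finite_M)
  have gm1: "(\<lambda>y. if 0 < y \<and> y < x then ennreal (y powr (n - 1) * exp (Phi y - \<alpha> * y\<^sup>2)) else 0) \<in> borel_measurable lborel"
    for x \<alpha> :: real by measurable
  have gm2: "(\<lambda>x. if y < x then ennreal (x * exp (- (\<alpha> * x\<^sup>2))) else 0) \<in> borel_measurable lborel" for y \<alpha> :: real
    by measurable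
  have KM: "(\<lambda>x. (if y < x then ennreal (x * P x) else 0) * ennreal (exp (- (\<alpha> * x\<^sup>2)))) \<in> borel_measurable borel" for y \<alpha> :: real
    by measurable
  have xP: "(\<lambda>x. x * P x) \<in> borel_measurable borel" by measurable
  have idM[measurable]: "(\<lambda>x. x) \<in> borel_measurable M" by (rule borel_measurable_M) simp
  have [measurable]: "k \<in> borel_measurable M" using square_integrable_measurable[OF k] .
  have f1[measurable]: "fst \<in> borel_measurable (M \<Otimes>\<^sub>M M)" using measurable_compose[OF measurable_fst idM] by simp
  have f2[measurable]: "snd \<in> borel_measurable (M \<Otimes>\<^sub>M M)" using measurable_compose[OF measurable_snd idM] by simp
  define \<alpha> where "\<alpha> = 1 / (4 * r2)"
  define m where "m = min (n / (8 * r2)) (1 / (4 * r2))"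
  have \<alpha>: "\<alpha> > 0" and m: "m > 0" using r n by (auto simp: \<alpha>_def m_def)
  define \<psi> where "\<psi> x = exp (- (\<alpha> * x\<^sup>2))" for x :: real
  have \<psi>b[measurable]: "\<psi> \<in> borel_measurable borel" unfolding \<psi>_def[abs_def] by measurable
  have \<psi>m[measurable]: "\<psi> \<in> borel_measurable M" by (rule borel_measurable_M) simp
  define K where "K x y = (if y < x then ennreal (x * P x) else 0)" for x y
  have Km[measurable]: "case_prod K \<in> borel_measurable (M \<Otimes>\<^sub>M M)"
    unfolding K_def using measurable_compose[OF f1 xP] by measurable
  have ifm: "(\<lambda>y. if y < x then ennreal (g y) else 0) \<in> borel_measurable M" if "g \<in> borel_measurable M" for g :: "real \<Rightarrow> real" and x
    using that by measurable
  have row: "(\<integral>\<^sup>+y. K x y * \<psi> y \<partial>M) \<le> ennreal (1 / (m * r1)) * \<psi> x" if "x \<in> space M" for x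
  proof -
    have x: "0 < x" using that by (simp add: space_M)
    have "(\<integral>\<^sup>+y. (if y < x then ennreal (\<psi> y) else 0) \<partial>M)
        = (\<integral>\<^sup>+y. (if 0 < y then ennreal (W y) * (if y < x then ennreal (\<psi> y) else 0) else 0) \<partial>lborel)"
      by (intro nn_integral_M ifm \<psi>m)
    also have "\<dots> \<le> (\<integral>\<^sup>+y. ennreal (1 / r1) * (if 0 < y \<and> y < x then ennreal (y powr (n - 1) * exp (Phi y - \<alpha> * y\<^sup>2)) else 0) \<partial>lborel)"
    proof (intro nn_integral_mono)
      fix y :: real
      have "W y * \<psi> y \<le> 1 / r1 * (y powr (n - 1) * exp (Phi y - \<alpha> * y\<^sup>2))"
      proof -
        have "W y \<le> p y / r1" unfolding W_def using R_bounds[of y] r p_nonneg[of y] by (intro divide_left_mono) auto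
        then have "W y * \<psi> y \<le> p y / r1 * \<psi> y" by (intro mult_right_mono) (auto simp: \<psi>_def)
        then show ?thesis by (simp add: p_def \<psi>_def exp_diff exp_minus field_simps)
      qed
      then have le: "ennreal (W y) * ennreal (\<psi> y) \<le> ennreal (1 / r1) * ennreal (y powr (n - 1) * exp (Phi y - \<alpha> * y\<^sup>2))"
        using r by (intro ennreal_mult_mono W_nonneg) (auto simp: \<psi>_def)
      show "(if 0 < y then ennreal (W y) * (if y < x then ennreal (\<psi> y) else 0) else 0)
        \<le> ennreal (1 / r1) * (if 0 < y \<and> y < x then ennreal (y powr (n - 1) * exp (Phi y - \<alpha> * y\<^sup>2)) else 0)"
      proof (cases "0 < y \<and> y < x")
        case True
        then show ?thesis using le by (simp only: if_True simp_thms)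
      next
        case False
        then have "(if 0 < y then ennreal (W y) * (if y < x then ennreal (\<psi> y) else 0) else 0) = 0" by auto
        then show ?thesis by (simp only: zero_le)
      qed
    qed
    also have "\<dots> = ennreal (1 / r1) * (\<integral>\<^sup>+y. (if 0 < y \<and> y < x then ennreal (y powr (n - 1) * exp (Phi y - \<alpha> * y\<^sup>2)) else 0) \<partial>lborel)"
      by (rule nn_integral_cmult[OF gm1])
    also have "\<dots> \<le> ennreal (1 / r1) * ennreal (1 / m * x powr (n - 2) * exp (Phi x - \<alpha> * x\<^sup>2))"
      using initial_weight_bound[OF x] unfolding \<alpha>_def m_def by (intro mult_left_mono) auto
    finally have B: "(\<integral>\<^sup>+y. (if y < x then ennreal (\<psi> y) else 0) \<partial>M)
      \<le> ennreal (1 / r1) * ennreal (1 / m * x powr (n - 2) * exp (Phi x - \<alpha> * x\<^sup>2))" .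
    have "(\<integral>\<^sup>+y. K x y * \<psi> y \<partial>M) = (\<integral>\<^sup>+y. ennreal (x * P x) * (if y < x then ennreal (\<psi> y) else 0) \<partial>M)"
      by (intro nn_integral_cong) (simp add: K_def)
    also have "\<dots> = ennreal (x * P x) * (\<integral>\<^sup>+y. (if y < x then ennreal (\<psi> y) else 0) \<partial>M)"
      by (intro nn_integral_cmult ifm \<psi>m)
    also have "\<dots> \<le> ennreal (x * P x) * (ennreal (1 / r1) * ennreal (1 / m * x powr (n - 2) * exp (Phi x - \<alpha> * x\<^sup>2)))"
      by (rule mult_left_mono[OF B]) simp
    also have "\<dots> = ennreal (1 / (m * r1)) * \<psi> x"
    proof -
      have pw: "x powr (n - 1) = x * x powr (n - 2)" using x powr_add[of x "n - 2" 1] by simp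
      have "x * P x * (1 / r1 * (1 / m * x powr (n - 2) * exp (Phi x - \<alpha> * x\<^sup>2))) = 1 / (m * r1) * \<psi> x"
        unfolding p_def pw \<psi>_def using x m r by (simp add: exp_diff exp_minus field_simps)
      moreover have "0 \<le> x * P x" "0 \<le> 1 / r1" "0 \<le> 1 / (m * r1)" "0 \<le> 1 / m * x powr (n - 2) * exp (Phi x - \<alpha> * x\<^sup>2)" "0 \<le> \<psi> x"
        using x m r p_nonneg[of x] by (auto simp: \<psi>_def)
      ultimately show ?thesis by (metis ennreal_mult mult_nonneg_nonneg)
    qed
    finally show ?thesis .
  qed
  have col: "(\<integral>\<^sup>+x. K x y * \<psi> x \<partial>M) \<le> ennreal (1 / (2 * \<alpha> * r1)) * \<psi> y" if "y \<in> space M" for y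
  proof -
    have y: "0 < y" using that by (simp add: space_M)
    have "(\<integral>\<^sup>+x. K x y * \<psi> x \<partial>M) = (\<integral>\<^sup>+x. (if 0 < x then ennreal (W x) * (K x y * \<psi> x) else 0) \<partial>lborel)"
      unfolding K_def \<psi>_def by (rule nn_integral_M[OF borel_measurable_M[OF KM]])
    also have "\<dots> \<le> (\<integral>\<^sup>+x. ennreal (1 / r1) * (if y < x then ennreal (x * exp (- (\<alpha> * x\<^sup>2))) else 0) \<partial>lborel)"
    proof (intro nn_integral_mono)
      fix x :: real
      have "W x * (x * P x * \<psi> x) \<le> 1 / r1 * (x * exp (- (\<alpha> * x\<^sup>2)))" if "y < x"
      proof -
        have x: "0 < x" using y that by simp
        have "W x * (x * P x * \<psi> x) = 1 / R x * (x * \<psi> x)" unfolding W_def using p_pos[OF x] by simp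
        also have "\<dots> \<le> 1 / r1 * (x * \<psi> x)"
          using R_bounds[of x] r x by (intro mult_right_mono divide_left_mono) (auto simp: \<psi>_def)
        finally show ?thesis by (simp add: \<psi>_def)
      qed
      then have le: "ennreal (W x) * ennreal (x * P x * \<psi> x) \<le> ennreal (1 / r1) * ennreal (x * exp (- (\<alpha> * x\<^sup>2)))"
        if "y < x" using r y p_nonneg[of x] that by (intro ennreal_mult_mono W_nonneg) (auto simp: \<psi>_def)
      show "(if 0 < x then ennreal (W x) * (K x y * ennreal (\<psi> x)) else 0)
         \<le> ennreal (1 / r1) * (if y < x then ennreal (x * exp (- (\<alpha> * x\<^sup>2))) else 0)"
      proof (cases "y < x")
        case True
        have "ennreal (x * P x) * ennreal (\<psi> x) = ennreal (x * P x * \<psi> x)"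
          by (rule ennreal_mult''[symmetric]) (simp add: \<psi>_def)
        then show ?thesis using le[OF True] True y by (simp only: if_True K_def less_trans[OF y True])
      next
        case False
        then have "(if 0 < x then ennreal (W x) * (K x y * ennreal (\<psi> x)) else 0) = 0" by (auto simp: K_def)
        then show ?thesis by (simp only: zero_le)
      qed
    qed
    also have "\<dots> = ennreal (1 / r1) * (\<integral>\<^sup>+x. (if y < x then ennreal (x * exp (- (\<alpha> * x\<^sup>2))) else 0) \<partial>lborel)"
      by (rule nn_integral_cmult[OF gm2])
    also have "\<dots> \<le> ennreal (1 / r1) * ennreal (exp (- (\<alpha> * y\<^sup>2)) / (2 * \<alpha>))"
      by (intro mult_left_mono gauss_tail \<alpha> y) auto
    also have "\<dots> = ennreal (1 / (2 * \<alpha> * r1)) * \<psi> y"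
      using \<alpha> r by (subst (1 2) ennreal_mult[symmetric]) (auto simp: \<psi>_def mult.commute)
    finally show ?thesis .
  qed
  have "(\<integral>\<^sup>+x. (\<integral>\<^sup>+y. K x y * cmod (k y) \<partial>M)\<^sup>2 \<partial>M)
      \<le> ennreal (1 / (m * r1)) * ennreal (1 / (2 * \<alpha> * r1)) * (\<integral>\<^sup>+x. (ennreal (cmod (k x)))\<^sup>2 \<partial>M)"
    by (rule schur_test[OF sigma_finite_M Km \<psi>m \<psi>m _ _ _ _ row col]) (auto simp: \<psi>_def)
  also have "\<dots> < \<infinity>"
    using square_integrable_sq[OF k] by (simp add: ennreal_power nn_integral_eq_integral ennreal_mult_less_top)
  also have "(\<integral>\<^sup>+x. (\<integral>\<^sup>+y. K x y * cmod (k y) \<partial>M)\<^sup>2 \<partial>M)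
     = (\<integral>\<^sup>+x. (ennreal (x * P x) * (\<integral>\<^sup>+y. (if y < x then ennreal (cmod (k y)) else 0) \<partial>M))\<^sup>2 \<partial>M)"
  proof (intro nn_integral_cong)
    fix x :: real
    have "(\<integral>\<^sup>+y. K x y * cmod (k y) \<partial>M) = (\<integral>\<^sup>+y. ennreal (x * P x) * (if y < x then ennreal (cmod (k y)) else 0) \<partial>M)"
      by (intro nn_integral_cong) (simp add: K_def)
    also have "\<dots> = ennreal (x * P x) * (\<integral>\<^sup>+y. (if y < x then ennreal (cmod (k y)) else 0) \<partial>M)"
      by (intro nn_integral_cmult ifm) auto
    finally show "(\<integral>\<^sup>+y. K x y * cmod (k y) \<partial>M)\<^sup>2 = (ennreal (x * P x) * (\<integral>\<^sup>+y. (if y < x then ennreal (cmod (k y)) else 0) \<partial>M))\<^sup>2"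
      by simp
  qed
  finally show ?thesis .
qed

end

locale two_phase_ground = two_phase +
  fixes \<phi> :: "real \<Rightarrow> real" and a :: real
  assumes phi_measurable: "\<phi> \<in> borel_measurable borel" and phi_pos: "\<And>x. 0 < x \<Longrightarrow> 0 < \<phi> x"
    and phi_square: "(\<integral>\<^sup>+x. (if 0 < x then ennreal (W x * (\<phi> x)\<^sup>2) else 0) \<partial>lborel) < \<infinity>"
    and a_pos: "a > 0"
    and phi_eigen: "\<And>x. 0 < x \<Longrightarrow> ennreal (\<phi> x) = ennreal a *
       (\<integral>\<^sup>+t. (if x < t then ennreal (P t) * (\<integral>\<^sup>+y. (if 0 < y \<and> y < t then ennreal (W y * \<phi> y) else 0) \<partial>lborel) else 0) \<partial>lborel)"
begin

sublocale green_operator M P \<phi> a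
proof (rule green_operator.intro)
  show "sigma_finite_measure M" by (rule sigma_finite_M)
  show "(\<lambda>x. x) \<in> borel_measurable M" by (rule borel_measurable_M) simp
  show "emeasure M {y \<in> space M. y < t} < \<infinity>" for t by (rule emeasure_M_initial)
  show "P \<in> borel_measurable borel" by measurable
  show "0 \<le> P t" for t by (simp add: p_nonneg)
  show phiM: "\<phi> \<in> borel_measurable M" by (rule borel_measurable_M[OF phi_measurable])
  show "0 < \<phi> x" if "x \<in> space M" for x using that by (simp add: space_M phi_pos)
  show "a > 0" by (rule a_pos)
  fix x assume "x \<in> space M"
  then have x: "0 < x" by (simp add: space_M)
  have inner: "(\<integral>\<^sup>+y. (if y < t then ennreal (\<phi> y) else 0) \<partial>M) = (\<integral>\<^sup>+y. (if 0 < y \<and> y < t then ennreal (W y * \<phi> y) else 0) \<partial>lborel)" for t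
  proof -
    have "(\<lambda>y. if y < t then ennreal (\<phi> y) else 0) \<in> borel_measurable borel"
      using phi_measurable by measurable
    from nn_integral_M[OF borel_measurable_M[OF this]]
    have "(\<integral>\<^sup>+y. (if y < t then ennreal (\<phi> y) else 0) \<partial>M) = (\<integral>\<^sup>+y. (if 0 < y then ennreal (W y) * (if y < t then ennreal (\<phi> y) else 0) else 0) \<partial>lborel)" .
    also have "\<dots> = (\<integral>\<^sup>+y. (if 0 < y \<and> y < t then ennreal (W y * \<phi> y) else 0) \<partial>lborel)"
      by (intro nn_integral_cong) (auto simp: ennreal_mult' W_nonneg)
    finally show ?thesis .
  qed
  show "ennreal (\<phi> x) = ennreal a * (\<integral>\<^sup>+t. (if x < t then ennreal (P t) * (\<integral>\<^sup>+y. (if y < t then ennreal (\<phi> y) else 0) \<partial>M) else 0) \<partial>lborel)"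
    unfolding inner by (rule phi_eigen[OF x])
qed

section \<open>The inverse of the two-phase operator\<close>

text \<open>Finiteness almost everywhere becomes finiteness on the whole half line, because
  \<open>A\<close> of a function decreases in \<open>x\<close> and initial segments have positive
  mass.\<close>

lemma A_finite:
  assumes k: "square_integrable M k" and x: "0 < x"
  shows "A (\<lambda>y. ennreal (cmod (k y))) x < \<infinity>"
proof -
  have "\<exists>y. 0 < y \<and> y < x \<and> A (\<lambda>y. ennreal (cmod (k y))) y < \<infinity>"
  proof (rule ccontr)
    assume no: "\<not> (\<exists>y. 0 < y \<and> y < x \<and> A (\<lambda>y. ennreal (cmod (k y))) y < \<infinity>)"
    have "AE y in M. y \<notin> {y \<in> space M. y < x}"
      using A_finite_AE[OF k] by eventually_elim (use no in \<open>auto simp: space_M\<close>)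
    then have "emeasure M {y \<in> space M. y < x} = 0"
      by (subst (asm) AE_iff_measurable[OF _ refl]) (auto simp: space_M sets_M sets_restrict_space_iff cong: conj_cong)
    then show False using emeasure_M_pos[OF x] by simp
  qed
  then obtain y where y: "y < x" "A (\<lambda>y. ennreal (cmod (k y))) y < \<infinity>" by blast
  have "A (\<lambda>y. ennreal (cmod (k y))) x \<le> A (\<lambda>y. ennreal (cmod (k y))) y"
    unfolding A_def using y(1) by (intro nn_integral_mono) auto
  then show ?thesis using y(2) by (rule le_less_trans)
qed

text \<open>Extended by 0 to the line, so that \<open>prim k\<close> is an indefinite integral on
  all of it; its continuity at 0 then gives the boundary condition.\<close>

definition dens :: "(real \<Rightarrow> complex) \<Rightarrow> real \<Rightarrow> complex" where
  "dens k y = (if 0 < y then W y *\<^sub>R k y else 0)"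

lemma prim_dens:
  assumes k: "square_integrable M k"
  shows "integrable lebesgue (\<lambda>y. if y < t then dens k y else 0)"
    and "prim k t = (\<integral>y. (if y < t then dens k y else 0) \<partial>lebesgue)"
proof -
  have Wm: "W \<in> borel_measurable (lebesgue_on {0<..})" by (rule measurable_restrict_space1) simp
  note pi = prim_integrable[OF k, of t]
  have m: "(\<lambda>y. if y < t then k y else 0) \<in> borel_measurable (lebesgue_on {0<..})"
    using borel_measurable_integrable[OF pi] by (simp add: measurable_M)
  have e: "indicat_real {0<..} y *\<^sub>R (W y *\<^sub>R (if y < t then k y else 0)) = (if y < t then dens k y else 0)" for y
    by (simp add: dens_def indicator_def)
  have "integrable (lebesgue_on {0<..}) (\<lambda>y. W y *\<^sub>R (if y < t then k y else 0))"
    using pi integrable_density[OF m Wm] W_nonneg by (simp add: M_eq)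
  then show "integrable lebesgue (\<lambda>y. if y < t then dens k y else 0)"
    by (subst (asm) integrable_restrict_space, simp, simp only: e)
  have "prim k t = (\<integral>y. W y *\<^sub>R (if y < t then k y else 0) \<partial>lebesgue_on {0<..})"
    unfolding prim_def by (subst M_eq, rule integral_density[OF m Wm]) (simp add: W_nonneg)
  also have "\<dots> = (\<integral>y. indicat_real {0<..} y *\<^sub>R (W y *\<^sub>R (if y < t then k y else 0)) \<partial>lebesgue)"
    by (rule integral_restrict_space) auto
  finally show "prim k t = (\<integral>y. (if y < t then dens k y else 0) \<partial>lebesgue)" by (simp only: e)
qed

lemma prim_diff:
  assumes k: "square_integrable M k" and uv: "u \<le> v"
  shows "integrable lebesgue (\<lambda>y. if u \<le> y \<and> y < v then dens k y else 0)"
    and "prim k v - prim k u = (\<integral>y. (if u \<le> y \<and> y < v then dens k y else 0) \<partial>lebesgue)"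
proof -
  have e: "(if y < v then dens k y else 0) - (if y < u then dens k y else 0) = (if u \<le> y \<and> y < v then dens k y else 0)" for y
    using uv by auto
  note d = prim_dens(1)[OF k, of v] prim_dens(1)[OF k, of u]
  show "integrable lebesgue (\<lambda>y. if u \<le> y \<and> y < v then dens k y else 0)"
    using Bochner_Integration.integrable_diff[OF d] by (simp only: e)
  show "prim k v - prim k u = (\<integral>y. (if u \<le> y \<and> y < v then dens k y else 0) \<partial>lebesgue)"
    unfolding prim_dens(2)[OF k] using Bochner_Integration.integral_diff[OF d] by (simp only: e)
qed

lemma dens_has_integral:
  assumes k: "square_integrable M k" and uv: "u \<le> v"
  shows "(dens k has_integral (prim k v - prim k u)) {u..v}"
proof -
  have "((\<lambda>y. if u \<le> y \<and> y < v then dens k y else 0) has_integral (prim k v - prim k u)) UNIV"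
    unfolding prim_diff(2)[OF k uv] by (rule has_integral_integral_lebesgue[OF prim_diff(1)[OF k uv]])
  moreover have "(\<lambda>y. if u \<le> y \<and> y < v then dens k y else 0) = (\<lambda>y. if y \<in> {u..<v} then dens k y else 0)"
    by auto
  ultimately have "(dens k has_integral (prim k v - prim k u)) {u..<v}"
    by (simp only: has_integral_restrict_UNIV)
  moreover have "negligible {x \<in> {u..<v} - {u..v}. dens k x \<noteq> 0}" "negligible {x \<in> {u..v} - {u..<v}. dens k x \<noteq> 0}"
    by (rule negligible_subset[of "{v}"]; force)+
  ultimately show ?thesis using has_integral_spike_set_eq[of "{u..<v}" "{u..v}" "dens k"] by blast
qed

lemma prim_cont:
  assumes k: "square_integrable M k"
  shows "continuous_on UNIV (prim k)"
proof -
  have "isCont (prim k) t" for t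
  proof -
    have e: "prim k x = prim k (t - 1) + integral {t - 1..x} (dens k)" if "x \<in> {t - 1..t + 1}" for x
      using integral_unique[OF dens_has_integral[OF k, of "t - 1" x]] that by simp
    have "continuous_on {t - 1..t + 1} (\<lambda>x. prim k (t - 1) + integral {t - 1..x} (dens k))"
      using dens_has_integral[OF k, of "t - 1" "t + 1"]
      by (intro continuous_intros indefinite_integral_continuous_1) (auto intro: has_integral_integrable)
    then have "continuous_on {t - 1..t + 1} (prim k)" by (rule continuous_on_eq) (rule e[symmetric])
    then show ?thesis by (rule continuous_on_interior) simp
  qed
  then show ?thesis by (simp add: continuous_at_imp_continuous_on)
qed

lemma prim_zero: "prim k 0 = 0"
proof -
  have "prim k 0 = (\<integral>y. 0 \<partial>M)"
    unfolding prim_def by (rule Bochner_Integration.integral_cong) (auto simp: space_M)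
  then show ?thesis by simp
qed

lemma prim_abs_continuous:
  assumes k: "square_integrable M k"
  shows "abs_continuous_on_interval l u (prim k)"
proof (rule abs_continuous_dominated)
  let ?m = "\<lambda>y. norm (if y < u then dens k y else 0)"
  show "integrable lebesgue ?m" by (rule integrable_norm[OF prim_dens(1)[OF k]])
  show "0 \<le> ?m y" for y by simp
  fix x y assume xy: "l \<le> x" "x \<le> y" "y \<le> u"
  have "cmod (prim k y - prim k x) \<le> (\<integral>z. norm (if x \<le> z \<and> z < y then dens k z else 0) \<partial>lebesgue)"
    unfolding prim_diff(2)[OF k xy(2)] by (rule integral_norm_bound)
  also have "\<dots> \<le> (\<integral>z. indicator {x<..<y} z * ?m z \<partial>lebesgue)"
  proof (rule integral_mono_AE)
    show "integrable lebesgue (\<lambda>z. norm (if x \<le> z \<and> z < y then dens k z else 0))"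
      by (rule integrable_norm[OF prim_diff(1)[OF k xy(2)]])
    show "integrable lebesgue (\<lambda>z. indicator {x<..<y} z * ?m z)"
      using integrable_mult_indicator[OF _ integrable_norm[OF prim_dens(1)[OF k, of u]], of "{x<..<y}"] by simp
    have "AE z in lebesgue. z \<noteq> x"
      by (subst eventually_ae_filter_negligible) (auto intro!: exI[of _ "{x}"])
    then show "AE z in lebesgue. norm (if x \<le> z \<and> z < y then dens k z else 0) \<le> indicator {x<..<y} z * ?m z"
      by eventually_elim (use xy in \<open>auto simp: indicator_def\<close>)
  qed
  finally show "cmod (prim k y - prim k x) \<le> (\<integral>z. indicator {x<..<y} z * ?m z \<partial>lebesgue)" .
qed

lemma prim_deriv_AE:
  assumes k: "square_integrable M k"
  shows "\<exists>N. negligible N \<and> (\<forall>x. x \<notin> N \<longrightarrow> (prim k has_vector_derivative dens k x) (at x))"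
  by (rule has_vector_derivative_indefinite_integral_AE[OF dens_has_integral[OF k]])

lemma flux_cont:
  assumes k: "square_integrable M k"
  shows "continuous_on {0<..} (\<lambda>t. P t *\<^sub>R prim k t)"
  by (intro continuous_on_scaleR P_cont continuous_on_subset[OF prim_cont[OF k]]) auto

lemma G_integrable:
  assumes k: "square_integrable M k" and x: "0 < x"
  shows "integrable lborel (\<lambda>t. if x < t then P t *\<^sub>R prim k t else 0)"
proof (rule integrableI_bounded)
  have "prim k \<in> borel_measurable borel"
    by (rule borel_measurable_continuous_onI[OF prim_cont[OF k]])
  then have "(\<lambda>t. P t *\<^sub>R prim k t) \<in> borel_measurable lborel" by (simp add: borel_measurable_scaleR)
  then show "(\<lambda>t. if x < t then P t *\<^sub>R prim k t else 0) \<in> borel_measurable lborel" by (intro measurable_If) auto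
  show "(\<integral>\<^sup>+t. ennreal (norm (if x < t then P t *\<^sub>R prim k t else 0)) \<partial>lborel) < \<infinity>"
    by (rule le_less_trans[OF G_integrand_le A_finite[OF k x]])
qed

lemma G_diff:
  assumes k: "square_integrable M k" and uv: "0 < u" "u \<le> v"
  shows "G k u - G k v = integral {u..v} (\<lambda>t. P t *\<^sub>R prim k t)"
proof -
  let ?q = "\<lambda>t. P t *\<^sub>R prim k t"
  have e: "(if u < t then ?q t else 0) - (if v < t then ?q t else 0) = (if t \<in> {u<..v} then ?q t else 0)" for t
    using uv by auto
  have v0: "0 < v" using uv by simp
  note I2 = G_integrable[OF k uv(1)] G_integrable[OF k v0]
  have "G k u - G k v = (\<integral>t. (if t \<in> {u<..v} then ?q t else 0) \<partial>lborel)"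
    unfolding G_def using Bochner_Integration.integral_diff[OF I2] by (simp only: e)
  moreover have "integrable lborel (\<lambda>t. if t \<in> {u<..v} then ?q t else 0)"
    using Bochner_Integration.integrable_diff[OF I2] by (simp only: e)
  ultimately have "((\<lambda>t. if t \<in> {u<..v} then ?q t else 0) has_integral (G k u - G k v)) UNIV"
    by (simp only: has_integral_integral_lborel)
  then have "(?q has_integral (G k u - G k v)) {u<..v}" by (simp only: has_integral_restrict_UNIV)
  moreover have "negligible {x \<in> {u<..v} - {u..v}. ?q x \<noteq> 0}" "negligible {x \<in> {u..v} - {u<..v}. ?q x \<noteq> 0}"
    by (rule negligible_subset[of "{u}"]; force)+
  ultimately have "(?q has_integral (G k u - G k v)) {u..v}"
    using has_integral_spike_set_eq[of "{u<..v}" "{u..v}" ?q] by blast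
  then show ?thesis by (rule integral_unique[symmetric])
qed

lemma G_deriv:
  assumes k: "square_integrable M k" and x: "0 < x"
  shows "(G k has_vector_derivative - (P x *\<^sub>R prim k x)) (at x)"
proof -
  let ?q = "\<lambda>t. P t *\<^sub>R prim k t"
  have "continuous_on {x / 2..2 * x} ?q" by (rule continuous_on_subset[OF flux_cont[OF k]]) (use x in auto)
  then have "((\<lambda>y. integral {x / 2..y} ?q) has_vector_derivative ?q x) (at x within {x / 2..2 * x})"
    by (rule integral_has_vector_derivative) (use x in auto)
  then have "((\<lambda>y. integral {x / 2..y} ?q) has_vector_derivative ?q x) (at x)"
    using x by (simp add: at_within_Icc_at)
  then have "((\<lambda>y. G k (x / 2) - integral {x / 2..y} ?q) has_vector_derivative 0 - ?q x) (at x)"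
    by (intro has_vector_derivative_diff has_vector_derivative_const)
  then have "((\<lambda>y. G k (x / 2) - integral {x / 2..y} ?q) has_vector_derivative - ?q x) (at x)" by simp
  then show ?thesis
  proof (rule has_vector_derivative_transform_within_open[of _ _ _ "{x / 2<..}"])
    fix y assume "y \<in> {x / 2<..}"
    then show "G k (x / 2) - integral {x / 2..y} ?q = G k y"
      using G_diff[OF k, of "x / 2" y] x by (simp add: algebra_simps)
  qed (use x in auto)
qed

lemma deriv1_G:
  assumes "square_integrable M k" "0 < x"
  shows "deriv1 (G k) x = - (P x *\<^sub>R prim k x)"
  by (rule vector_derivative_at[OF G_deriv[OF assms]])

lemma flux_bounds:
  assumes k: "square_integrable M k" and lu: "0 < l" "l \<le> u"
  obtains C where "0 \<le> C" "\<And>t. t \<in> {l..u} \<Longrightarrow> cmod (prim k t) \<le> C" "\<And>t. t \<in> {l..u} \<Longrightarrow> cmod (P t *\<^sub>R prim k t) \<le> C"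
proof -
  have "continuous_on {l..u} (\<lambda>t. P t *\<^sub>R prim k t)" by (rule continuous_on_subset[OF flux_cont[OF k]]) (use lu in auto)
  from compact_imp_bounded[OF compact_continuous_image[OF this compact_Icc]]
  obtain C1 where C1: "\<forall>y\<in>(\<lambda>t. P t *\<^sub>R prim k t) ` {l..u}. norm y \<le> C1" unfolding bounded_iff by blast
  have "continuous_on {l..u} (prim k)" by (rule continuous_on_subset[OF prim_cont[OF k]]) auto
  from compact_imp_bounded[OF compact_continuous_image[OF this compact_Icc]]
  obtain C2 where C2: "\<forall>y\<in>prim k ` {l..u}. norm y \<le> C2" unfolding bounded_iff by blast
  show thesis
  proof (rule that[of "max 0 (max C1 C2)"])
    fix t assume t: "t \<in> {l..u}"
    have "norm (prim k t) \<le> C2" "norm (P t *\<^sub>R prim k t) \<le> C1" using C1 C2 t by blast+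
    then show "cmod (prim k t) \<le> max 0 (max C1 C2)" "cmod (P t *\<^sub>R prim k t) \<le> max 0 (max C1 C2)" by linarith+
  qed simp
qed

lemma G_abs_continuous:
  assumes k: "square_integrable M k"
  shows "locally_abs_continuous (G k)" "locally_abs_continuous (deriv1 (G k))"
proof -
  have c0: "abs_continuous_on_interval l u (\<lambda>x. 0)" for l u
    unfolding abs_continuous_on_interval_def by (auto intro: exI[of _ 1])
  show "locally_abs_continuous (G k)"
    unfolding locally_abs_continuous_def
  proof (intro allI impI)
    fix l u :: real assume lu: "0 < l" "l \<le> u"
    obtain C where C: "0 \<le> C" "\<And>t. t \<in> {l..u} \<Longrightarrow> cmod (prim k t) \<le> C" "\<And>t. t \<in> {l..u} \<Longrightarrow> cmod (P t *\<^sub>R prim k t) \<le> C"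
      by (rule flux_bounds[OF k lu]) blast
    show "abs_continuous_on_interval l u (G k)"
    proof (rule abs_continuous_comparison[OF c0 C(1) C(1)])
      fix x y assume xy: "l \<le> x" "x \<le> y" "y \<le> u"
      have "norm (integral {x..y} (\<lambda>t. P t *\<^sub>R prim k t)) \<le> C * (y - x)"
        by (rule integral_bound) (use xy lu C(3) in \<open>auto intro!: continuous_on_subset[OF flux_cont[OF k]]\<close>)
      then show "cmod (G k y - G k x) \<le> C * cmod (0 - 0) + C * (y - x)"
        using G_diff[OF k, of x y] xy lu by (simp add: norm_minus_commute)
    qed
  qed
  show "locally_abs_continuous (deriv1 (G k))"
    unfolding locally_abs_continuous_def
  proof (intro allI impI)
    fix l u :: real assume lu: "0 < l" "l \<le> u"
    obtain C where C: "0 \<le> C" "\<And>t. t \<in> {l..u} \<Longrightarrow> cmod (prim k t) \<le> C" "\<And>t. t \<in> {l..u} \<Longrightarrow> cmod (P t *\<^sub>R prim k t) \<le> C"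
      by (rule flux_bounds[OF k lu]) blast
    obtain B where B: "0 \<le> B" "\<And>x. x \<in> {l..u} \<Longrightarrow> \<bar>P x\<bar> \<le> B"
      "\<And>x y. l \<le> x \<Longrightarrow> x \<le> y \<Longrightarrow> y \<le> u \<Longrightarrow> \<bar>P y - P x\<bar> \<le> B * (y - x)"
      by (rule P_bounds[OF lu]) blast
    show "abs_continuous_on_interval l u (deriv1 (G k))"
    proof (rule abs_continuous_comparison[OF prim_abs_continuous[OF k] B(1)])
      show "0 \<le> B * C" using B C by simp
      fix x y assume xy: "l \<le> x" "x \<le> y" "y \<le> u"
      have "deriv1 (G k) y - deriv1 (G k) x = - (P y *\<^sub>R (prim k y - prim k x) + (P y - P x) *\<^sub>R prim k x)"
        using deriv1_G[OF k, of x] deriv1_G[OF k, of y] xy lu by (simp add: algebra_simps)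
      then have "cmod (deriv1 (G k) y - deriv1 (G k) x) \<le> \<bar>P y\<bar> * cmod (prim k y - prim k x) + \<bar>P y - P x\<bar> * cmod (prim k x)"
        using norm_triangle_ineq[of "P y *\<^sub>R (prim k y - prim k x)" "(P y - P x) *\<^sub>R prim k x"] by (simp only: norm_minus_cancel norm_scaleR)
      also have "\<dots> \<le> B * cmod (prim k y - prim k x) + (B * (y - x)) * C"
        using B(1) B(2)[of y] B(3)[OF xy] C(2)[of x] xy by (intro add_mono mult_mono) auto
      finally show "cmod (deriv1 (G k) y - deriv1 (G k) x) \<le> B * cmod (prim k y - prim k x) + B * C * (y - x)"
        by (simp add: mult_ac)
    qed
  qed
qed

text \<open>\<open>deriv1 (G k) = - P * prim k\<close> is differentiated by the product rule off a
  null set that contains \<open>c\<close>; the terms with \<open>(n - 1) / x\<close> cancel.\<close>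

lemma deriv2_G_AE:
  assumes k: "square_integrable M k"
  shows "AE x in lebesgue. 0 < x \<longrightarrow>
    Delta n (G k) x = (x / R x) *\<^sub>R (P x *\<^sub>R prim k x) - (1 / R x) *\<^sub>R k x"
proof -
  obtain N where N: "negligible N" "\<And>x. x \<notin> N \<Longrightarrow> (prim k has_vector_derivative dens k x) (at x)"
    using prim_deriv_AE[OF k] by blast
  have "Delta n (G k) x = (x / R x) *\<^sub>R (P x *\<^sub>R prim k x) - (1 / R x) *\<^sub>R k x" if x: "0 < x" "x \<notin> N \<union> {c}" for x
  proof -
    have "((\<lambda>x. P x *\<^sub>R prim k x) has_vector_derivative P x *\<^sub>R dens k x + (- (P x * ((n - 1) / x + x / R x))) *\<^sub>R prim k x) (at x)"
      using x by (intro has_vector_derivative_scaleR P_deriv N(2)) auto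
    then have "((\<lambda>x. - (P x *\<^sub>R prim k x)) has_vector_derivative - (P x *\<^sub>R dens k x + (- (P x * ((n - 1) / x + x / R x))) *\<^sub>R prim k x)) (at x)"
      by (rule has_vector_derivative_minus)
    then have "(deriv1 (G k) has_vector_derivative - (P x *\<^sub>R dens k x + (- (P x * ((n - 1) / x + x / R x))) *\<^sub>R prim k x)) (at x)"
      by (rule has_vector_derivative_transform_within_open[of _ _ _ "{0<..}"]) (use x deriv1_G[OF k] in auto)
    then have d2: "deriv1 (deriv1 (G k)) x = - (P x *\<^sub>R dens k x + (- (P x * ((n - 1) / x + x / R x))) *\<^sub>R prim k x)"
      by (rule vector_derivative_at)
    have pw: "P x *\<^sub>R dens k x = (1 / R x) *\<^sub>R k x"
      using p_pos[OF x(1)] x(1) by (simp add: dens_def W_def)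
    show ?thesis
      unfolding Delta_def d2 pw deriv1_G[OF k x(1)]
      by (simp add: algebra_simps scaleR_add_left)
  qed
  then have "{x. \<not> (0 < x \<longrightarrow> Delta n (G k) x = (x / R x) *\<^sub>R (P x *\<^sub>R prim k x) - (1 / R x) *\<^sub>R k x)} \<subseteq> N \<union> {c}" by blast
  moreover have "negligible (N \<union> {c})" using N(1) by simp
  ultimately show ?thesis unfolding eventually_ae_filter_negligible by blast
qed

lemma L_op_G:
  assumes k: "square_integrable M k"
  shows "AE x in M. L_op n R (G k) x = - k x"
  unfolding AE_M using deriv2_G_AE[OF k]
proof eventually_elim
  fix x assume D: "0 < x \<longrightarrow> Delta n (G k) x = (x / R x) *\<^sub>R (P x *\<^sub>R prim k x) - (1 / R x) *\<^sub>R k x"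
  show "0 < x \<longrightarrow> L_op n R (G k) x = - k x"
  proof
    assume x: "0 < x"
    have R0: "R x \<noteq> 0" using R_bounds(1)[of x] by simp
    show "L_op n R (G k) x = - k x"
      unfolding L_op_def D[rule_format, OF x] deriv1_G[OF k x] using R0 by (simp add: scaleR_diff_right)
  qed
qed

text \<open>The preceding identity makes it a combination of \<open>k\<close> and of the first-order
  term, with the bounded coefficient \<open>1 / R\<close>.\<close>

lemma Delta_G_square:
  assumes k: "square_integrable M k"
  shows "square_integrable M (Delta n (G k))"
proof -
  have pm: "prim k \<in> borel_measurable borel"
    by (rule borel_measurable_continuous_onI[OF prim_cont[OF k]])
  define f where "f x = (x * P x) *\<^sub>R prim k x" for x
  have "f \<in> borel_measurable borel"
    unfolding f_def by (intro borel_measurable_scaleR borel_measurable_times borel_measurable_divide pm) auto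
  then have fm: "f \<in> borel_measurable M" by (rule borel_measurable_M)
  have f: "square_integrable M f"
    unfolding square_integrable_def
  proof (intro conjI fm integrableI_bounded)
    show "(\<lambda>x. (cmod (f x))\<^sup>2) \<in> borel_measurable M" using fm by measurable
    have "(\<integral>\<^sup>+x. ennreal (norm ((cmod (f x))\<^sup>2)) \<partial>M) \<le>
        (\<integral>\<^sup>+x. (ennreal (x * P x) * (\<integral>\<^sup>+y. (if y < x then ennreal (cmod (k y)) else 0) \<partial>M))\<^sup>2 \<partial>M)"
    proof (intro nn_integral_mono)
      fix x assume "x \<in> space M"
      then have x: "0 < x" by (simp add: space_M)
      have nn: "0 \<le> x * P x" using x p_nonneg[of x] by simp
      have "cmod (f x) = (x * P x) * cmod (prim k x)"
        using nn by (simp only: f_def norm_scaleR abs_of_nonneg)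
      then have "ennreal (cmod (f x)) = ennreal (x * P x) * ennreal (cmod (prim k x))"
        by (simp only: ennreal_mult'[OF nn])
      also have "\<dots> \<le> ennreal (x * P x) * (\<integral>\<^sup>+y. (if y < x then ennreal (cmod (k y)) else 0) \<partial>M)"
        by (rule mult_left_mono[OF prim_le]) simp
      finally have "(ennreal (cmod (f x)))\<^sup>2 \<le> (ennreal (x * P x) * (\<integral>\<^sup>+y. (if y < x then ennreal (cmod (k y)) else 0) \<partial>M))\<^sup>2"
        by (rule power_mono) simp
      then show "ennreal (norm ((cmod (f x))\<^sup>2)) \<le> (ennreal (x * P x) * (\<integral>\<^sup>+y. (if y < x then ennreal (cmod (k y)) else 0) \<partial>M))\<^sup>2"
        by (simp add: ennreal_power)
    qed
    then show "(\<integral>\<^sup>+x. ennreal (norm ((cmod (f x))\<^sup>2)) \<partial>M) < \<infinity>"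
      using weighted_primitive_square[OF k] by (rule le_less_trans)
  qed
  define e where "e x = (1 / R x) *\<^sub>R (f x - k x)" for x
  have em: "e \<in> borel_measurable M"
    unfolding e_def using fm square_integrable_measurable[OF k] borel_measurable_M[OF R_measurable]
    by (intro borel_measurable_scaleR borel_measurable_divide borel_measurable_diff) auto
  have e: "square_integrable M e"
  proof (rule square_integrable_bound[OF square_integrable_diff[OF f k] em, of "1 / r1"])
    show "AE x in M. cmod (e x) \<le> 1 / r1 * cmod (f x - k x)"
    proof (rule AE_I2)
      fix x
      have "\<bar>1 / R x\<bar> \<le> 1 / r1" using R_bounds[of x] r by (simp add: frac_le)
      then show "cmod (e x) \<le> 1 / r1 * cmod (f x - k x)"
        unfolding e_def norm_scaleR by (intro mult_right_mono) auto
    qed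
  qed
  have eq: "AE x in lebesgue. 0 < x \<longrightarrow> Delta n (G k) x = e x"
    using deriv2_G_AE[OF k] by eventually_elim (simp add: e_def f_def scaleR_diff_right)
  have Dm: "Delta n (G k) \<in> borel_measurable M"
    unfolding measurable_M
  proof (subst borel_measurable_if[symmetric])
    have "(\<lambda>x. if x \<in> {0<..} then e x else 0) \<in> borel_measurable lebesgue"
      using em by (subst borel_measurable_if) (auto simp: measurable_M)
    then show "(\<lambda>x. if x \<in> {0<..} then Delta n (G k) x else 0) \<in> borel_measurable lebesgue"
      by (rule borel_measurable_AE) (use eq in eventually_elim, auto)
  qed auto
  show ?thesis
    by (rule square_integrable_bound[OF e Dm, of 1]) (use eq in \<open>auto simp: AE_M elim: eventually_mono\<close>)
qed

lemma G_domain: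
  assumes k: "square_integrable M k"
  shows "G k \<in> L_domain n R"
proof -
  have lim: "((\<lambda>x. x powr (n - 1) *\<^sub>R deriv1 (G k) x) \<longlongrightarrow> 0) (at_right 0)"
  proof (rule Lim_null_comparison)
    show "\<forall>\<^sub>F x in at_right 0. norm (x powr (n - 1) *\<^sub>R deriv1 (G k) x) \<le> norm (prim k x)"
      using eventually_at_right_less[of "0::real"]
    proof eventually_elim
      fix x :: real assume x: "0 < x"
      \<comment> \<open>\<open>x powr (n - 1) * P x = exp (- Phi x)\<close>, so a nonnegative
        exponent makes the boundary term no larger than \<open>prim k x\<close>.\<close>
      have "0 \<le> Phi x" using Phi_mono[of 0 x] x by (simp add: Phi_0)
      then have le: "x powr (n - 1) * P x \<le> 1" using x by (simp add: p_def field_simps)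
      have eq: "norm (x powr (n - 1) *\<^sub>R deriv1 (G k) x) = (x powr (n - 1) * P x) * norm (prim k x)"
        using deriv1_G[OF k x] p_nonneg[of x] by (simp add: abs_mult)
      have "(x powr (n - 1) * P x) * norm (prim k x) \<le> 1 * norm (prim k x)"
        by (rule mult_right_mono[OF le norm_ge_zero])
      then show "norm (x powr (n - 1) *\<^sub>R deriv1 (G k) x) \<le> norm (prim k x)"
        by (simp only: eq mult_1)
    qed
    have "(prim k \<longlongrightarrow> prim k 0) (at 0)"
      using prim_cont[OF k] by (simp add: continuous_on_eq_continuous_at isCont_def)
    then have "(prim k \<longlongrightarrow> 0) (at_right 0)" by (simp add: prim_zero filterlim_at_split)
    then show "((\<lambda>x. norm (prim k x)) \<longlongrightarrow> 0) (at_right 0)" by (rule tendsto_norm_zero)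
  qed
  have "G k differentiable (at x)" if "0 < x" for x
    using G_deriv[OF k that] by (rule differentiableI_vector)
  then show ?thesis
    unfolding L_domain_def L2_space_iff
    using G_abs_continuous[OF k] Delta_G_square[OF k] G_square(1)[OF k] lim by blast
qed

text \<open>The flux \<open>q = p * h'\<close> is locally absolutely continuous with derivative
  \<open>dens k\<close> almost everywhere, so it differs from \<open>prim k\<close> by a constant,
  and the boundary condition at 0 makes this constant 0. Then \<open>h + G k\<close> has zero
  derivative; being square integrable over infinite mass, it vanishes.\<close>

lemma domain_representation:
  assumes h: "h \<in> L_domain n R" and k: "square_integrable M k" and eq: "AE x in M. L_op n R h x = k x" and x: "0 < x"
  shows "h x = - G k x"
proof -
  have hd: "\<And>x. 0 < x \<Longrightarrow> h differentiable (at x)" and ac: "locally_abs_continuous (deriv1 h)"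
    and lim: "((\<lambda>x. x powr (n - 1) *\<^sub>R deriv1 h x) \<longlongrightarrow> 0) (at_right 0)" and hsq: "square_integrable M h"
    using h unfolding L_domain_def L2_space_iff by auto
  define H where "H = deriv1 h"
  have ac: "locally_abs_continuous H" and lim: "((\<lambda>x. x powr (n - 1) *\<^sub>R H x) \<longlongrightarrow> 0) (at_right 0)"
    using ac lim unfolding H_def .
  define q where "q x = p x *\<^sub>R H x" for x
  obtain N2 where N2: "negligible N2" "{x. \<not> (0 < x \<longrightarrow> L_op n R h x = k x)} \<subseteq> N2"
    using eq unfolding AE_M eventually_ae_filter_negligible by blast
  define N where "N = {x \<in> {0<..}. \<not> H differentiable (at x)} \<union> N2 \<union> {c}"
  have N: "negligible N" unfolding N_def using locally_abs_continuous_differentiable_AE[OF ac] N2 by simp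
  have dq: "(q has_vector_derivative dens k x) (at x)" if x: "0 < x" "x \<notin> N" for x
  proof -
    have xc: "x \<noteq> c" and xN: "H differentiable (at x)" and x2: "x \<notin> N2"
      using x unfolding N_def by blast+
    have d1: "(H has_vector_derivative deriv1 H x) (at x)"
      using xN by (simp only: vector_derivative_works)
    have "(q has_vector_derivative p x *\<^sub>R deriv1 H x + (p x * ((n - 1) / x + x / R x)) *\<^sub>R H x) (at x)"
      unfolding q_def by (rule has_vector_derivative_scaleR[OF p_deriv[OF x(1) xc] d1])
    moreover have "dens k x = p x *\<^sub>R deriv1 H x + (p x * ((n - 1) / x + x / R x)) *\<^sub>R H x"
    proof -
      have "\<not> \<not> (0 < x \<longrightarrow> L_op n R h x = k x)" using x2 N2(2) by blast
      then have "L_op n R h x = k x" using x(1) by simp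
      then have "k x = x *\<^sub>R H x + R x *\<^sub>R (((n - 1) / x) *\<^sub>R H x + deriv1 H x)"
        unfolding L_op_def Delta_def H_def by (rule sym)
      moreover have "R x \<noteq> 0" using R_bounds(1)[of x] by simp
      ultimately show ?thesis using x by (simp add: dens_def W_def scaleR_add_right scaleR_add_left distrib_left)
    qed
    ultimately show ?thesis by simp
  qed
  have acq: "abs_continuous_on_interval l u q" if lu: "0 < l" "l \<le> u" for l u
  proof -
    have ach: "abs_continuous_on_interval l u (H)" using ac lu unfolding locally_abs_continuous_def by blast
    obtain B where B: "0 \<le> B" "\<And>x. x \<in> {l..u} \<Longrightarrow> \<bar>P x\<bar> \<le> B"
      "\<And>x y. l \<le> x \<Longrightarrow> x \<le> y \<Longrightarrow> y \<le> u \<Longrightarrow> \<bar>P y - P x\<bar> \<le> B * (y - x)"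
      by (rule P_bounds[OF lu]) blast
    have "continuous_on {l..u} p" by (rule continuous_on_subset[OF p_cont]) (use lu in auto)
    from compact_imp_bounded[OF compact_continuous_image[OF this compact_Icc]]
    obtain C1 where C1: "\<forall>y\<in>p ` {l..u}. norm y \<le> C1" unfolding bounded_iff by blast
    from compact_imp_bounded[OF compact_continuous_image[OF abs_continuous_imp_continuous_on[OF ach] compact_Icc]]
    obtain C2 where C2: "\<forall>y\<in>H ` {l..u}. norm y \<le> C2" unfolding bounded_iff by blast
    have c1: "p x \<le> C1" if "x \<in> {l..u}" for x
    proof -
      have "norm (p x) \<le> C1" using C1 that by blast
      then show ?thesis using p_nonneg[of x] by simp
    qed
    have c2: "cmod (H x) \<le> C2" if "x \<in> {l..u}" for x using C2 that by blast
    have C10: "0 \<le> C1" using c1[of l] p_nonneg[of l] lu by simp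
    have C20: "0 \<le> C2" using c2[of l] norm_ge_zero[of "H l"] lu by (meson atLeastAtMost_iff order_refl order_trans)
    show ?thesis
    proof (rule abs_continuous_comparison[OF ach C10])
      show "0 \<le> C1 * (C1 * B) * C2" using C10 C20 B by simp
      fix x y assume xy: "l \<le> x" "x \<le> y" "y \<le> u"
      have "0 < p x" "0 < p y" using p_pos xy lu by auto
      \<comment> \<open>The Lipschitz bound for \<open>p\<close> on a compact interval is drawn from
        the one for its reciprocal \<open>P\<close>.\<close>
      then have "p y - p x = p x * (p y * (P x - P y))" by (simp add: right_diff_distrib)
      then have "\<bar>p y - p x\<bar> = p x * (p y * \<bar>P y - P x\<bar>)" using p_nonneg by (simp add: abs_mult abs_minus_commute)
      also have "\<dots> \<le> C1 * (C1 * (B * (y - x)))"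
        using c1[of x] c1[of y] B(3)[OF xy] xy p_nonneg C10 by (intro mult_mono) auto
      finally have pp: "\<bar>p y - p x\<bar> \<le> C1 * (C1 * (B * (y - x)))" .
      have "q y - q x = p y *\<^sub>R (H y - H x) + (p y - p x) *\<^sub>R H x"
        by (simp add: q_def algebra_simps)
      then have "cmod (q y - q x) \<le> p y * cmod (H y - H x) + \<bar>p y - p x\<bar> * cmod (H x)"
        using norm_triangle_ineq[of "p y *\<^sub>R (H y - H x)" "(p y - p x) *\<^sub>R H x"] p_nonneg[of y] by simp
      also have "\<dots> \<le> C1 * cmod (H y - H x) + (C1 * (C1 * (B * (y - x)))) * C2"
        using c1[of y] c2[of x] pp xy B(1) C10 by (intro add_mono mult_mono) auto
      finally show "cmod (q y - q x) \<le> C1 * cmod (H y - H x) + C1 * (C1 * B) * C2 * (y - x)"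
        by (simp add: mult_ac)
    qed
  qed
  have const: "q u - prim k u = q l - prim k l" if lu: "0 < l" "l \<le> u" for l u
  proof -
    have "(dens k has_integral (q u - q l)) {l..u}"
      by (rule abs_continuous_has_integral[OF acq[OF lu] lu(2) N]) (use lu dq in auto)
    then have "q u - q l = prim k u - prim k l"
      using dens_has_integral[OF k lu(2)] by (rule has_integral_unique)
    then show ?thesis by (simp add: algebra_simps)
  qed
  have qp: "q x = prim k x" if x: "0 < x" for x
  proof -
    have "(prim k \<longlongrightarrow> prim k 0) (at 0)"
      using prim_cont[OF k] by (simp add: continuous_on_eq_continuous_at isCont_def)
    then have p0: "(prim k \<longlongrightarrow> 0) (at_right 0)" by (simp add: prim_zero filterlim_at_split)
    have "(Phi \<longlongrightarrow> Phi 0) (at 0)"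
      using Phi_cont[of UNIV] by (simp add: continuous_on_eq_continuous_at isCont_def)
    then have "(Phi \<longlongrightarrow> 0) (at_right 0)" by (simp add: Phi_0 filterlim_at_split)
    then have "((\<lambda>x. exp (Phi x) *\<^sub>R (x powr (n - 1) *\<^sub>R H x)) \<longlongrightarrow> exp 0 *\<^sub>R 0) (at_right 0)"
      by (rule tendsto_scaleR[OF tendsto_exp lim])
    then have "(q \<longlongrightarrow> 0) (at_right 0)" by (simp add: q_def[abs_def] p_def mult.commute)
    then have "((\<lambda>y. q y - prim k y) \<longlongrightarrow> 0 - 0) (at_right 0)" using p0 by (rule tendsto_diff)
    moreover have "((\<lambda>y. q y - prim k y) \<longlongrightarrow> q x - prim k x) (at_right 0)"
    proof (rule tendsto_eventually)
      show "\<forall>\<^sub>F y in at_right 0. q y - prim k y = q x - prim k x"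
        using eventually_at_right_real[OF x]
      proof eventually_elim
        fix y assume "y \<in> {0<..<x}"
        then show "q y - prim k y = q x - prim k x" using const[of y x] by simp
      qed
    qed
    ultimately have "q x - prim k x = 0 - 0" by (rule tendsto_unique[OF trivial_limit_at_right_real, rotated])
    then show ?thesis by simp
  qed
  have d: "((\<lambda>x. h x + G k x) has_vector_derivative 0) (at x within {0<..})" if x: "x \<in> {0<..}" for x
  proof -
    have "(h has_vector_derivative H x) (at x)" using hd[of x] x by (simp add: H_def vector_derivative_works)
    moreover have "H x = P x *\<^sub>R prim k x"
    proof -
      have "prim k x = p x *\<^sub>R H x" using qp[of x] x by (simp add: q_def)
      then show ?thesis using p_pos[of x] x by simp
    qed
    ultimately have "((\<lambda>x. h x + G k x) has_vector_derivative (P x *\<^sub>R prim k x + - (P x *\<^sub>R prim k x))) (at x)"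
      using G_deriv[OF k, of x] x by (intro has_vector_derivative_add) auto
    then show ?thesis by (simp add: has_vector_derivative_at_within)
  qed
  obtain e where e: "\<And>x. x \<in> {0<..} \<Longrightarrow> h x + G k x = e"
    by (rule has_vector_derivative_zero_constant[of "{0<..}" "\<lambda>x. h x + G k x", OF _ d]) auto
  have "integrable M (\<lambda>x. (cmod (h x + G k x))\<^sup>2)"
    by (rule square_integrable_sq[OF square_integrable_add[OF hsq G_square(1)[OF k]]])
  then have int: "(\<integral>\<^sup>+x. ennreal (norm ((cmod (h x + G k x))\<^sup>2)) \<partial>M) < \<infinity>"
    by (simp only: integrable_iff_bounded)
  have "(\<integral>\<^sup>+x. ennreal (norm ((cmod (h x + G k x))\<^sup>2)) \<partial>M) = (\<integral>\<^sup>+x. ennreal (norm ((cmod e)\<^sup>2)) \<partial>M)"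
    by (intro nn_integral_cong) (simp add: e space_M)
  also have "\<dots> = ennreal (norm ((cmod e)\<^sup>2)) * \<infinity>" by (simp add: emeasure_M_infinite)
  finally have "ennreal (norm ((cmod e)\<^sup>2)) * \<infinity> < \<infinity>" using int by simp
  then have "e = 0" by (cases "e = 0") (auto simp: ennreal_mult_top)
  then show ?thesis using e[of x] x by (simp add: eq_neg_iff_add_eq_0)
qed

lemma prim_cmult: "prim (\<lambda>y. w * k y) t = w * prim k t"
proof -
  have "prim (\<lambda>y. w * k y) t = (\<integral>y. w * (if y < t then k y else 0) \<partial>M)"
    unfolding prim_def by (intro Bochner_Integration.integral_cong) auto
  then show ?thesis unfolding prim_def by simp
qed

lemma G_cmult: "G (\<lambda>y. w * k y) x = w * G k x"
proof -
  have "G (\<lambda>y. w * k y) x = (\<integral>t. w * (if x < t then P t *\<^sub>R prim k t else 0) \<partial>lborel)"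
    unfolding G_def prim_cmult by (intro Bochner_Integration.integral_cong) auto
  then show ?thesis unfolding G_def by simp
qed

lemma G_sub:
  assumes k: "square_integrable M k" and l: "square_integrable M l" and x: "0 < x"
  shows "G (\<lambda>y. k y - l y) x = G k x - G l x"
proof -
  have pd: "prim (\<lambda>y. k y - l y) t = prim k t - prim l t" for t
    unfolding prim_def
    by (subst Bochner_Integration.integral_diff[symmetric, OF prim_integrable[OF k] prim_integrable[OF l]])
       (auto intro!: Bochner_Integration.integral_cong)
  show ?thesis
    unfolding G_def pd
    by (subst Bochner_Integration.integral_diff[symmetric, OF G_integrable[OF k x] G_integrable[OF l x]])
       (auto intro!: Bochner_Integration.integral_cong simp: scaleR_diff_right)
qed

lemma G_cong_AE:
  assumes k: "square_integrable M k" and l: "square_integrable M l" and eq: "AE y in M. k y = l y"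
  shows "G k = G l"
proof -
  have "prim k t = prim l t" for t
    unfolding prim_def
  proof (rule integral_cong_AE)
    show "(\<lambda>y. if y < t then k y else 0) \<in> borel_measurable M" "(\<lambda>y. if y < t then l y else 0) \<in> borel_measurable M"
      using prim_integrable[OF k, of t] prim_integrable[OF l, of t] by auto
    show "AE y in M. (if y < t then k y else 0) = (if y < t then l y else 0)"
      using eq by eventually_elim simp
  qed
  then have "prim k = prim l" by (rule ext)
  then show ?thesis unfolding G_def[abs_def] by (simp only:)
qed

lemma AE_pos: "AE x in M. 0 < x"
  by (simp add: AE_M)

section \<open>Resolvent set and top of the spectrum\<close>

text \<open>With \<open>f = - G k\<close> the equation \<open>(L - \<mu>) f = g\<close> reads
  \<open>k + \<mu> * G k = g\<close>. A competitor \<open>h\<close> equals \<open>- G k2\<close>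
  with \<open>k2 = g + \<mu> * h\<close>, which solves the same equation, so injectivity identifies
  \<open>k2\<close> with \<open>k\<close>.\<close>

lemma resolvent_set:
  assumes "Im \<mu> \<noteq> 0 \<or> - a < Re \<mu>"
  shows "\<mu> \<in> L_resolvent_set n R"
proof -
  obtain C where C: "\<And>g. square_integrable M g \<Longrightarrow> \<exists>k. square_integrable M k \<and>
      (AE x in M. k x + \<mu> * G k x = g x) \<and>
      (\<integral>x. (cmod (k x))\<^sup>2 \<partial>M) \<le> C * (\<integral>x. (cmod (g x))\<^sup>2 \<partial>M)"
    by (rule shifted_surjective[OF assms]) blast
  show ?thesis
    unfolding L_resolvent_set_def
  proof (intro CollectI exI[of _ "sqrt (C / a\<^sup>2)"] ballI)
    fix g assume "g \<in> L2_space n R"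
    then have g: "square_integrable M g" by (simp add: L2_space_iff)
    obtain k where k: "square_integrable M k" and keq: "AE x in M. k x + \<mu> * G k x = g x"
      and kb: "(\<integral>x. (cmod (k x))\<^sup>2 \<partial>M) \<le> C * (\<integral>x. (cmod (g x))\<^sup>2 \<partial>M)" using C[OF g] by blast
    define k' where "k' x = (-1) * k x" for x
    have k': "square_integrable M k'" unfolding k'_def by (rule square_integrable_cmult[OF k])
    have Gk': "G k' x = - G k x" for x unfolding k'_def G_cmult by simp
    show "\<exists>f\<in>L_domain n R. (AE x in M. L_op n R f x - \<mu> * f x = g x) \<and>
        L2_norm n R f \<le> sqrt (C / a\<^sup>2) * L2_norm n R g \<and>
        (\<forall>h\<in>L_domain n R. (AE x in M. L_op n R h x - \<mu> * h x = g x) \<longrightarrow> (AE x in M. h x = f x))"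
    proof (intro bexI conjI ballI impI)
      show "G k' \<in> L_domain n R" by (rule G_domain[OF k'])
      show "AE x in M. L_op n R (G k') x - \<mu> * G k' x = g x"
        using L_op_G[OF k'] keq by eventually_elim (simp add: Gk' k'_def)
      have "(\<integral>x. (cmod (G k' x))\<^sup>2 \<partial>M) \<le> (C / a\<^sup>2) * (\<integral>x. (cmod (g x))\<^sup>2 \<partial>M)"
        using G_square(2)[OF k] kb a_pos unfolding Gk' by (simp add: field_simps)
      then show "L2_norm n R (G k') \<le> sqrt (C / a\<^sup>2) * L2_norm n R g"
        unfolding L2_norm_def real_sqrt_mult[symmetric] by (rule real_sqrt_le_mono)
      fix h assume h: "h \<in> L_domain n R" and heq: "AE x in M. L_op n R h x - \<mu> * h x = g x"
      have hsq: "square_integrable M h" using h unfolding L_domain_def L2_space_iff by auto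
      define k2 where "k2 x = g x + \<mu> * h x" for x
      have k2: "square_integrable M k2" unfolding k2_def
        by (rule square_integrable_add[OF g square_integrable_cmult[OF hsq]])
      have "AE x in M. L_op n R h x = k2 x" using heq by eventually_elim (simp add: k2_def algebra_simps)
      then have rep: "h x = - G k2 x" if "0 < x" for x using domain_representation[OF h k2] that by blast
      have "AE x in M. (k2 x - k x) + \<mu> * G (\<lambda>y. k2 y - k y) x = 0"
        using keq AE_pos
      proof eventually_elim
        fix x assume e: "k x + \<mu> * G k x = g x" and x: "0 < x"
        have "k2 x + \<mu> * G k2 x = g x" using rep[OF x] by (simp add: k2_def)
        moreover have "(k2 x - k x) + \<mu> * (G k2 x - G k x) = (k2 x + \<mu> * G k2 x) - (k x + \<mu> * G k x)"
          by (simp add: algebra_simps)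
        ultimately show "(k2 x - k x) + \<mu> * G (\<lambda>y. k2 y - k y) x = 0"
          using e by (simp add: G_sub[OF k2 k x])
      qed
      then have "AE x in M. k2 x - k x = 0"
        by (rule shifted_injective[OF assms square_integrable_diff[OF k2 k]])
      then have "AE x in M. k2 x = k x" by eventually_elim simp
      then have GG: "G k2 = G k" by (rule G_cong_AE[OF k2 k])
      show "AE x in M. h x = G k' x" using AE_pos by eventually_elim (simp add: rep GG Gk')
    qed
  qed
qed

lemma phi_square_integrable: "square_integrable M (\<lambda>x. complex_of_real (\<phi> x))"
  unfolding square_integrable_def
proof (intro conjI integrableI_bounded)
  show m: "(\<lambda>x. complex_of_real (\<phi> x)) \<in> borel_measurable M"
    by (rule borel_measurable_M) (use phi_measurable in measurable)
  show "(\<lambda>x. (cmod (complex_of_real (\<phi> x)))\<^sup>2) \<in> borel_measurable M" using m by measurable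
  have "(\<integral>\<^sup>+x. ennreal (norm ((cmod (complex_of_real (\<phi> x)))\<^sup>2)) \<partial>M) = (\<integral>\<^sup>+x. ennreal ((\<phi> x)\<^sup>2) \<partial>M)"
    by (intro nn_integral_cong) simp
  also have "\<dots> = (\<integral>\<^sup>+x. (if 0 < x then ennreal (W x) * ennreal ((\<phi> x)\<^sup>2) else 0) \<partial>lborel)"
    by (rule nn_integral_M[OF borel_measurable_M]) (use phi_measurable in measurable)
  also have "\<dots> = (\<integral>\<^sup>+x. (if 0 < x then ennreal (W x * (\<phi> x)\<^sup>2) else 0) \<partial>lborel)"
    by (intro nn_integral_cong) (auto simp: ennreal_mult' W_nonneg)
  finally show "(\<integral>\<^sup>+x. ennreal (norm ((cmod (complex_of_real (\<phi> x)))\<^sup>2)) \<partial>M) < \<infinity>" using phi_square by simp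
qed

text \<open>\<open>enn2real\<close> carries the extended eigenvalue identity over to Bochner
  integrals, all integrands being nonnegative.\<close>

lemma G_phi:
  assumes x: "0 < x"
  shows "G (\<lambda>y. complex_of_real a * complex_of_real (\<phi> y)) x = complex_of_real (\<phi> x)"
proof -
  define F where "F t = (\<integral>y. (if y < t then \<phi> y else 0) \<partial>M)" for t
  have ph: "0 \<le> \<phi> y" if "y \<in> space M" for y using phi_pos[of y] that by (simp add: space_M less_imp_le)
  have int: "integrable M (\<lambda>y. if y < t then \<phi> y else 0)" for t
    using integrable_Re[OF prim_integrable[OF phi_square_integrable, of t]] by (simp add: if_distrib cong: if_cong)
  have F0: "0 \<le> F t" for t unfolding F_def by (rule integral_nonneg_AE) (use ph in \<open>auto intro: AE_I2\<close>)
  have Fnn: "ennreal (F t) = (\<integral>\<^sup>+y. (if y < t then ennreal (\<phi> y) else 0) \<partial>M)" for t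
    unfolding F_def by (subst nn_integral_eq_integral[OF int, symmetric]) (use ph in \<open>auto intro!: nn_integral_cong AE_I2\<close>)
  have prF: "prim (\<lambda>y. complex_of_real (\<phi> y)) t = complex_of_real (F t)" for t
    unfolding prim_def F_def integral_complex_of_real[symmetric] by (intro Bochner_Integration.integral_cong) auto
  have "F \<in> borel_measurable borel"
  proof -
    have "(\<lambda>t. Re (prim (\<lambda>y. complex_of_real (\<phi> y)) t)) \<in> borel_measurable borel"
      using borel_measurable_continuous_onI[OF prim_cont[OF phi_square_integrable]] by measurable
    then show ?thesis by (simp add: prF)
  qed
  then have m: "(\<lambda>t. if x < t then P t * F t else 0) \<in> borel_measurable lborel"
    by (intro measurable_If borel_measurable_times borel_measurable_divide) (auto simp flip: greaterThan_def)
  have *: "ennreal (\<phi> x) = ennreal a * (\<integral>\<^sup>+t. ennreal (if x < t then P t * F t else 0) \<partial>lborel)"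
  proof -
    have "(\<integral>\<^sup>+t. ennreal (if x < t then P t * F t else 0) \<partial>lborel)
       = (\<integral>\<^sup>+t. (if x < t then ennreal (P t) * (\<integral>\<^sup>+y. (if y < t then ennreal (\<phi> y) else 0) \<partial>M) else 0) \<partial>lborel)"
    proof (intro nn_integral_cong)
      fix t
      have "ennreal (P t * F t) = ennreal (P t) * ennreal (F t)" by (rule ennreal_mult') (simp add: p_nonneg)
      then show "ennreal (if x < t then P t * F t else 0)
        = (if x < t then ennreal (P t) * (\<integral>\<^sup>+y. (if y < t then ennreal (\<phi> y) else 0) \<partial>M) else 0)"
        by (cases "x < t") (simp_all only: if_True if_False Fnn ennreal_0)
    qed
    then show ?thesis using eigen[of x] x by (simp add: space_M)
  qed
  have "\<phi> x = a * enn2real (\<integral>\<^sup>+t. ennreal (if x < t then P t * F t else 0) \<partial>lborel)"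
  proof -
    have "0 < \<phi> x" using phi_pos[of x] x by (simp add: space_M)
    then have "enn2real (ennreal (\<phi> x)) = \<phi> x" by simp
    moreover have "enn2real (ennreal a) = a" using a_pos by simp
    ultimately show ?thesis using * enn2real_mult by metis
  qed
  also have "enn2real (\<integral>\<^sup>+t. ennreal (if x < t then P t * F t else 0) \<partial>lborel) = (\<integral>t. (if x < t then P t * F t else 0) \<partial>lborel)"
    by (rule integral_eq_nn_integral[symmetric, OF m]) (use F0 p_nonneg in auto)
  finally have ph: "\<phi> x = a * (\<integral>t. (if x < t then P t * F t else 0) \<partial>lborel)" .
  have "G (\<lambda>y. complex_of_real (\<phi> y)) x = complex_of_real (\<integral>t. (if x < t then P t * F t else 0) \<partial>lborel)"
    unfolding G_def prF integral_complex_of_real[symmetric]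
    by (intro Bochner_Integration.integral_cong) (auto simp: scaleR_conv_of_real)
  then show ?thesis unfolding G_cmult by (subst ph) simp
qed

text \<open>Both \<open>\<phi>\<close>, which is \<open>G\<close> of \<open>a * \<phi>\<close>, and
  0 solve the homogeneous equation in the domain, against the uniqueness clause of the resolvent
  set; they differ at every point of the half line.\<close>

lemma eigenvalue_in_spectrum: "complex_of_real (- a) \<in> L_spectrum n R"
  unfolding L_spectrum_def
proof
  assume "complex_of_real (- a) \<in> L_resolvent_set n R"
  then obtain C where C: "\<forall>g\<in>L2_space n R. \<exists>f\<in>L_domain n R.
     (AE x in M. L_op n R f x - complex_of_real (- a) * f x = g x) \<and>
     L2_norm n R f \<le> C * L2_norm n R g \<and>
     (\<forall>h\<in>L_domain n R. (AE x in M. L_op n R h x - complex_of_real (- a) * h x = g x) \<longrightarrow>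
        (AE x in M. h x = f x))"
    unfolding L_resolvent_set_def by blast
  have z: "square_integrable M (\<lambda>x. 0)" by (simp add: square_integrable_def)
  then have zL: "(\<lambda>x. 0) \<in> L2_space n R" by (simp add: L2_space_iff)
  from bspec[OF C zL]
  obtain f where F: "\<forall>h\<in>L_domain n R. (AE x in M. L_op n R h x - complex_of_real (- a) * h x = 0) \<longrightarrow> (AE x in M. h x = f x)"
    by (elim bexE conjE) (rule that)
  have f: "AE x in M. h x = f x"
    if "h \<in> L_domain n R" "AE x in M. L_op n R h x - complex_of_real (- a) * h x = 0" for h
    by (rule mp[OF bspec[OF F that(1)] that(2)])
  define k where "k = (\<lambda>y. complex_of_real a * complex_of_real (\<phi> y))"
  have k: "square_integrable M k" unfolding k_def by (rule square_integrable_cmult[OF phi_square_integrable])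
  have Gk: "G k x = complex_of_real (\<phi> x)" if "0 < x" for x unfolding k_def by (rule G_phi[OF that])
  have G0: "G (\<lambda>x. 0) x = 0" for x using G_cmult[of 0 k x] by simp
  have 1: "AE x in M. G k x = f x"
  proof (rule f[OF G_domain[OF k]])
    show "AE x in M. L_op n R (G k) x - complex_of_real (- a) * G k x = 0"
      using L_op_G[OF k] AE_pos by eventually_elim (simp add: Gk, simp add: k_def)
  qed
  have 2: "AE x in M. G (\<lambda>x. 0) x = f x"
  proof (rule f[OF G_domain[OF z]])
    show "AE x in M. L_op n R (G (\<lambda>x. 0)) x - complex_of_real (- a) * G (\<lambda>x. 0) x = 0"
      using L_op_G[OF z] by eventually_elim (simp add: G0)
  qed
  have "AE x in M. False"
    using 1 2 AE_pos
  proof eventually_elim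
    fix x assume "G k x = f x" "G (\<lambda>x. 0) x = f x" "0 < x"
    then have "complex_of_real (\<phi> x) = 0" by (simp add: Gk G0)
    then show False using phi_pos[of x] \<open>0 < x\<close> by (simp add: space_M)
  qed
  then have "emeasure M (space M) = 0" by (simp only: eventually_False ae_filter_eq_bot_iff)
  then show False using emeasure_M_infinite by simp
qed

theorem is_max_of_spectrum_ground: "is_max_of_spectrum n R (- a)"
  unfolding is_max_of_spectrum_def
proof (intro conjI ballI eigenvalue_in_spectrum)
  fix \<mu> assume "\<mu> \<in> L_spectrum n R"
  then have "\<not> (Im \<mu> \<noteq> 0 \<or> - a < Re \<mu>)" using resolvent_set[of \<mu>] by (auto simp: L_spectrum_def)
  then show "\<mu> \<in> \<real>" "Re \<mu> \<le> - a" by (auto simp: complex_is_Real_iff)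
qed

end

section \<open>Kummer's equation\<close>

text \<open>\<open>kF a b\<close> below is Kummer's function \<open>M(a, b, s)\<close>; \<open>kD\<close> and \<open>kD2\<close> are its first two derivatives.\<close>

definition kc :: "real \<Rightarrow> real \<Rightarrow> nat \<Rightarrow> real" where
  "kc a b k = pochhammer a k / (pochhammer b k * fact k)"

definition kF :: "real \<Rightarrow> real \<Rightarrow> real \<Rightarrow> real" where
  "kF a b s = (\<Sum>k. kc a b k * s ^ k)"

definition kD :: "real \<Rightarrow> real \<Rightarrow> real \<Rightarrow> real" where
  "kD a b s = (\<Sum>k. diffs (kc a b) k * s ^ k)"

definition kD2 :: "real \<Rightarrow> real \<Rightarrow> real \<Rightarrow> real" where
  "kD2 a b s = (\<Sum>k. diffs (diffs (kc a b)) k * s ^ k)"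

section \<open>Power series of Kummer's function\<close>

lemma kc_0 [simp]: "kc a b 0 = 1" by (simp add: kc_def)

lemma kc_Suc:
  assumes b: "0 < b"
  shows "real (Suc k) * kc a b (Suc k) = kc a b k * (a + k) / (b + k)"
proof -
  have g: "S * (x * e / (y * d * (S * f))) = x / (y * f) * e / d"
    if "S \<noteq> 0" "d \<noteq> 0" "y \<noteq> 0" "f \<noteq> 0" for S x e y d f :: real
    using that by simp
  have nz: "b + real k \<noteq> 0" "pochhammer b k \<noteq> 0" using b pochhammer_pos[OF b, of k] by auto
  have f: "fact (Suc k) = real (Suc k) * fact k" by simp
  show ?thesis
    unfolding kc_def pochhammer_Suc f by (rule g[OF _ nz]) (simp_all only: fact_nonzero of_nat_neq_0 not_False_eq_True)
qed

lemma kc_nonneg: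
  assumes "0 \<le> a" "0 < b"
  shows "0 \<le> kc a b k"
proof -
  have "0 \<le> pochhammer a k" unfolding pochhammer_prod using assms by (intro prod_nonneg) auto
  then show ?thesis unfolding kc_def using pochhammer_pos[OF assms(2), of k] by simp
qed

lemma kc_diffs: "0 < b \<Longrightarrow> diffs (kc a b) k = kc a b k * (a + k) / (b + k)"
  using kc_Suc[of b k a] by (simp add: diffs_def)

lemma le_divide_fact_Suc:
  fixes c C :: real
  assumes "real (Suc k) * c \<le> C / fact k"
  shows "c \<le> C / fact (Suc k)"
proof -
  have "c \<le> C / fact k / real (Suc k)"
    using assms by (simp only: pos_le_divide_eq[of "real (Suc k)", OF of_nat_0_less_iff[THEN iffD2, OF zero_less_Suc]] mult.commute)
  then show ?thesis by (simp only: fact_Suc of_nat_mult divide_divide_eq_left mult.commute)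
qed

lemma kc_Suc_le:
  assumes "0 \<le> a" "a \<le> b" "0 < b" "kc a b k \<le> C / fact k" "0 \<le> C"
  shows "kc a b (Suc k) \<le> C / fact (Suc k)"
proof (rule le_divide_fact_Suc)
  have "(a + real k) / (b + real k) \<le> 1" using assms by (simp add: add_pos_nonneg)
  then have "kc a b k * ((a + real k) / (b + real k)) \<le> C / fact k * 1"
    using assms kc_nonneg[of a b k] by (intro mult_mono) auto
  then show "real (Suc k) * kc a b (Suc k) \<le> C / fact k" using kc_Suc[OF assms(3), of k a] by simp
qed

lemma kc_le:
  assumes "0 \<le> a" "a \<le> b" "0 < b"
  shows "kc a b k \<le> 1 / fact k"
proof (induction k)
  case (Suc k)
  then show ?case using kc_Suc_le[OF assms, of k 1] by simp
qed simp

text \<open>The factor \<open>(a + k) / (b + k)\<close> in the recursion is \<open>a / b\<close> at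
  the first step and at most 1 afterwards. Keeping the first one makes \<open>kD\<close> vanish
  linearly as \<open>a\<close> tends to 0.\<close>

lemma kc_Suc_upper:
  assumes "0 \<le> a" "a \<le> b" "0 < b"
  shows "kc a b (Suc k) \<le> a / b / fact (Suc k)"
proof (induction k)
  case 0
  then show ?case using kc_Suc[OF assms(3), of 0 a] by simp
next
  case (Suc k)
  show ?case by (rule kc_Suc_le[OF assms Suc]) (use assms in simp)
qed

lemma kc_summable:
  assumes "0 \<le> a" "0 < b"
  shows "summable (\<lambda>k. kc a b k * s ^ k)"
proof -
  define m where "m = max 1 (a / b)"
  have ratio: "(a + real k) / (b + real k) \<le> m" for k
  proof -
    have "a \<le> m * b" using assms by (simp add: m_def max_def field_simps)
    moreover have "real k \<le> m * real k" using mult_right_mono[of 1 m "real k"] by (simp add: m_def)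
    ultimately have "a + real k \<le> m * (b + real k)" by (simp add: distrib_left)
    then show ?thesis using assms by (simp add: pos_divide_le_eq add_pos_nonneg)
  qed
  obtain N :: nat where N: "2 * m * \<bar>s\<bar> < real N" using reals_Archimedean2 by blast
  show ?thesis
  proof (rule summable_ratio_test[of "1/2" N])
    fix k assume "N \<le> k"
    then have k: "2 * m * \<bar>s\<bar> \<le> real (Suc k)" using N by simp
    have e: "kc a b (Suc k) = kc a b k * ((a + k) / (b + k)) / real (Suc k)"
      using kc_Suc[OF assms(2), of k a] by (metis nonzero_mult_div_cancel_left of_nat_neq_0 times_divide_eq_right)
    have "norm (kc a b (Suc k) * s ^ Suc k) = norm (kc a b k * s ^ k) * (((a + k) / (b + k)) * \<bar>s\<bar> / real (Suc k))"
      unfolding e using assms by (simp add: abs_mult)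
    also have "\<dots> \<le> norm (kc a b k * s ^ k) * (1 / 2)"
    proof (rule mult_left_mono)
      have "((a + k) / (b + k)) * \<bar>s\<bar> \<le> m * \<bar>s\<bar>" by (intro mult_right_mono ratio) auto
      moreover have "m * \<bar>s\<bar> \<le> 1 / 2 * real (Suc k)" using k by simp
      ultimately have "((a + k) / (b + k)) * \<bar>s\<bar> \<le> 1 / 2 * real (Suc k)" by (rule order_trans)
      then show "((a + k) / (b + k)) * \<bar>s\<bar> / real (Suc k) \<le> 1 / 2"
        by (simp only: pos_divide_le_eq[of "real (Suc k)", OF of_nat_0_less_iff[THEN iffD2, OF zero_less_Suc]])
    qed simp
    finally show "norm (kc a b (Suc k) * s ^ Suc k) \<le> 1 / 2 * norm (kc a b k * s ^ k)" by simp
  qed simp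
qed

context
  fixes a b :: real
  assumes a: "0 \<le> a" and b: "0 < b"
begin

lemma kD_summable: "summable (\<lambda>k. diffs (kc a b) k * s ^ k)"
  using termdiff_converges_all[of "kc a b" s] kc_summable[OF a b] by simp

lemma kD2_summable: "summable (\<lambda>k. diffs (diffs (kc a b)) k * s ^ k)"
  using termdiff_converges_all[of "diffs (kc a b)" s] kD_summable by simp

lemma kF_deriv: "(kF a b has_real_derivative kD a b s) (at s)"
  unfolding kF_def[abs_def] kD_def by (rule termdiffs_strong_converges_everywhere[OF kc_summable[OF a b]])

lemma kD_deriv: "(kD a b has_real_derivative kD2 a b s) (at s)"
  unfolding kD_def[abs_def] kD2_def by (rule termdiffs_strong_converges_everywhere[OF kD_summable])

lemma series_shift:
  fixes g :: "nat \<Rightarrow> real"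
  assumes "summable (\<lambda>k. diffs g k * s ^ k)"
  shows "(\<lambda>k. real k * g k * s ^ k) sums (s * (\<Sum>k. diffs g k * s ^ k))"
proof -
  have "(\<lambda>k. s * (real k * g k * s ^ (k - Suc 0))) sums (s * (\<Sum>k. diffs g k * s ^ k))"
    by (rule sums_mult[OF diffs_equiv[OF assms]])
  moreover have "s * (real k * g k * s ^ (k - Suc 0)) = real k * g k * s ^ k" for k by (cases k) auto
  ultimately show ?thesis by simp
qed

text \<open>Comparison of coefficients: those of \<open>kD\<close> and \<open>kF\<close> are related
  by \<open>(b + k) * d k = (a + k) * c k\<close>.\<close>

lemma kummer_equation: "s * kD2 a b s = (s - b) * kD a b s + a * kF a b s"
proof -
  have 1: "(\<lambda>k. real k * diffs (kc a b) k * s ^ k) sums (s * kD2 a b s)"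
    unfolding kD2_def by (rule series_shift[OF kD2_summable])
  have 2: "(\<lambda>k. real k * kc a b k * s ^ k) sums (s * kD a b s)"
    unfolding kD_def by (rule series_shift[OF kD_summable])
  have 3: "(\<lambda>k. diffs (kc a b) k * s ^ k) sums kD a b s" unfolding kD_def by (rule summable_sums[OF kD_summable])
  have 4: "(\<lambda>k. kc a b k * s ^ k) sums kF a b s" unfolding kF_def by (rule summable_sums[OF kc_summable[OF a b]])
  have "(\<lambda>k. real k * kc a b k * s ^ k - b * (diffs (kc a b) k * s ^ k) + a * (kc a b k * s ^ k))
      sums (s * kD a b s - b * kD a b s + a * kF a b s)"
    by (intro sums_add sums_diff sums_mult 2 3 4)
  moreover have "real k * kc a b k * s ^ k - b * (diffs (kc a b) k * s ^ k) + a * (kc a b k * s ^ k)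
      = real k * diffs (kc a b) k * s ^ k" for k
  proof -
    have "(b + real k) * diffs (kc a b) k = kc a b k * (a + k)"
      using b by (simp add: kc_diffs[OF b] add_pos_nonneg less_imp_neq[symmetric])
    then have "real k * kc a b k - b * diffs (kc a b) k + a * kc a b k = real k * diffs (kc a b) k"
      by (simp add: algebra_simps)
    then have "(real k * kc a b k - b * diffs (kc a b) k + a * kc a b k) * s ^ k = real k * diffs (kc a b) k * s ^ k" by simp
    then show ?thesis by (simp add: algebra_simps)
  qed
  ultimately have "s * kD2 a b s = s * kD a b s - b * kD a b s + a * kF a b s"
    using 1 by (simp add: sums_unique2)
  then show ?thesis by (simp add: algebra_simps)
qed

lemma kF_0: "kF a b 0 = 1"
  unfolding kF_def by (subst suminf_finite[of "{0}"]) (auto simp: power_0_left)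

lemma kD_0: "kD a b 0 = a / b"
  unfolding kD_def by (subst suminf_finite[of "{0}"]) (auto simp: power_0_left kc_diffs[OF b])

lemma kF_ge_1: "0 \<le> s \<Longrightarrow> 1 \<le> kF a b s"
  unfolding kF_def using sum_le_suminf[OF kc_summable[OF a b], of "{0}" s] kc_nonneg[OF a b] by simp

lemma kD_nonneg: "0 \<le> s \<Longrightarrow> 0 \<le> kD a b s"
  unfolding kD_def using kc_nonneg[OF a b] a b by (intro suminf_nonneg kD_summable) (auto simp: kc_diffs)

text \<open>Both bounds hold coefficient by coefficient. In the second, the coefficients of
  \<open>kF - kD\<close> are those of \<open>kF\<close> times \<open>(b - a) / (b + k)\<close>, a
  factor that is largest at \<open>k = 0\<close>.\<close>

lemma kD_upper:
  assumes ab: "a \<le> b" and s: "0 \<le> s"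
  shows "kD a b s \<le> a / b * exp s" "kF a b s - kD a b s \<le> (b - a) / b * kF a b s"
proof -
  have dle: "diffs (kc a b) k \<le> a / b / fact k" for k
  proof -
    have "real (Suc k) * kc a b (Suc k) \<le> real (Suc k) * (a / b / fact (Suc k))"
      by (intro mult_left_mono kc_Suc_upper a ab b) simp
    also have "\<dots> = a / b / fact k" by (simp add: fact_Suc del: of_nat_Suc)
    finally show ?thesis by (simp add: diffs_def)
  qed
  have "(\<lambda>k. a / b * (inverse (fact k) * s ^ k)) sums (a / b * exp s)"
    using exp_converges[of s] by (intro sums_mult) (simp add: mult.commute)
  then have E: "(\<lambda>k. a / b / fact k * s ^ k) sums (a / b * exp s)" by (simp add: divide_inverse mult.assoc)
  have le: "diffs (kc a b) k * s ^ k \<le> a / b / fact k * s ^ k" for k using dle s by (intro mult_right_mono) auto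
  show "kD a b s \<le> a / b * exp s"
    unfolding kD_def sums_unique[OF E] by (rule suminf_le[OF le kD_summable sums_summable[OF E]])
  have "(\<Sum>k. kc a b k * s ^ k - diffs (kc a b) k * s ^ k) \<le> (\<Sum>k. (b - a) / b * (kc a b k * s ^ k))"
  proof (rule suminf_le)
    fix k
    have "1 - (a + real k) / (b + real k) \<le> (b - a) / b"
    proof -
      have "1 - (a + real k) / (b + real k) = (b - a) / (b + real k)" using b by (simp add: diff_divide_distrib[symmetric] eq_divide_eq add_pos_nonneg less_imp_neq[symmetric] diff_divide_eq_iff)
      also have "\<dots> \<le> (b - a) / b" using ab b by (intro divide_left_mono) auto
      finally show ?thesis .
    qed
    then have "kc a b k * s ^ k * (1 - (a + real k) / (b + real k)) \<le> kc a b k * s ^ k * ((b - a) / b)"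
      using kc_nonneg[OF a b] s by (intro mult_left_mono) auto
    then show "kc a b k * s ^ k - diffs (kc a b) k * s ^ k \<le> (b - a) / b * (kc a b k * s ^ k)"
      by (simp add: kc_diffs[OF b] algebra_simps)
  qed (intro summable_diff summable_mult kc_summable[OF a b] kD_summable)+
  then show "kF a b s - kD a b s \<le> (b - a) / b * kF a b s"
    unfolding kF_def kD_def
    by (simp only: suminf_diff[OF kc_summable[OF a b] kD_summable] suminf_mult[OF kc_summable[OF a b]])
qed

lemma kD_less_kF:
  assumes ab: "a < b" and s: "0 \<le> s"
  shows "kD a b s < kF a b s"
proof -
  have "0 < (\<Sum>k. kc a b k * s ^ k - diffs (kc a b) k * s ^ k)"
  proof (rule suminf_pos2[of _ 0])
    show "summable (\<lambda>k. kc a b k * s ^ k - diffs (kc a b) k * s ^ k)"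
      by (intro summable_diff kc_summable[OF a b] kD_summable)
    fix k
    have "(a + real k) / (b + real k) \<le> 1" using ab b by (simp add: add_pos_nonneg)
    then have "kc a b k * s ^ k * ((a + real k) / (b + real k)) \<le> kc a b k * s ^ k * 1"
      using kc_nonneg[OF a b] s by (intro mult_left_mono) auto
    then show "0 \<le> kc a b k * s ^ k - diffs (kc a b) k * s ^ k" by (simp add: kc_diffs[OF b] mult_ac)
    show "0 < kc a b 0 * s ^ 0 - diffs (kc a b) 0 * s ^ 0" using ab b by (simp add: kc_diffs[OF b])
  qed
  then show ?thesis unfolding kF_def kD_def
    by (simp add: suminf_diff[OF kc_summable[OF a b] kD_summable, symmetric])
qed

end

text \<open>For \<open>a\<close> in \<open>[0, b]\<close> all coefficients are at most
  \<open>1 / fact k\<close>, so both series converge uniformly in \<open>a\<close>.\<close>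

lemma kF_continuous_param:
  assumes b: "0 < b"
  shows "continuous_on {0..b} (\<lambda>a. kF a b s)" "continuous_on {0..b} (\<lambda>a. kD a b s)"
proof -
  have sm: "summable (\<lambda>k. \<bar>s\<bar> ^ k / fact k)"
    using summable_exp[of "\<bar>s\<bar>"] by (simp add: divide_inverse mult.commute)
  have cont: "continuous_on {0..b} (\<lambda>a. kc a b k)" for k
  proof -
    have "continuous_on {0..b} (\<lambda>a::real. pochhammer a k)"
      unfolding pochhammer_prod by (intro continuous_intros)
    then show ?thesis unfolding kc_def using pochhammer_pos[OF b, of k]
      by (intro continuous_on_divide continuous_on_const) auto
  qed
  have bd: "norm (kc a b k * s ^ k) \<le> \<bar>s\<bar> ^ k / fact k" if "a \<in> {0..b}" for a k
  proof -
    have "kc a b k * \<bar>s\<bar> ^ k \<le> 1 / fact k * \<bar>s\<bar> ^ k" using kc_le[of a b k] that b by (intro mult_right_mono) auto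
    then show ?thesis using kc_nonneg[of a b k] that b by (simp add: abs_mult power_abs)
  qed
  have bd2: "norm (diffs (kc a b) k * s ^ k) \<le> \<bar>s\<bar> ^ k / fact k" if a: "a \<in> {0..b}" for a k
  proof -
    have "(a + k) / (b + k) \<le> 1" using a b by (simp add: add_pos_nonneg)
    then have "norm (kc a b k * s ^ k) * ((a + k) / (b + k)) \<le> \<bar>s\<bar> ^ k / fact k * 1"
      using bd[OF a] a b by (intro mult_mono) auto
    moreover have "norm (diffs (kc a b) k * s ^ k) = norm (kc a b k * s ^ k) * ((a + k) / (b + k))"
      using a b by (simp add: kc_diffs[OF b] abs_mult)
    ultimately show ?thesis by simp
  qed
  show "continuous_on {0..b} (\<lambda>a. kF a b s)"
    unfolding kF_def
    by (rule uniform_limit_theorem[OF _ Weierstrass_m_test[OF bd sm]])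
       (auto intro!: always_eventually continuous_on_sum continuous_on_mult cont continuous_on_const)
  have cont2: "continuous_on {0..b} (\<lambda>a. diffs (kc a b) k)" for k
    unfolding kc_diffs[OF b] using b by (intro continuous_intros cont) (auto simp: add_pos_nonneg less_imp_neq[symmetric])
  show "continuous_on {0..b} (\<lambda>a. kD a b s)"
    unfolding kD_def
    by (rule uniform_limit_theorem[OF _ Weierstrass_m_test[OF bd2 sm]])
       (auto intro!: always_eventually continuous_on_sum continuous_on_mult cont2 continuous_on_const)
qed

section \<open>Tricomi's function as a Laplace integral\<close>

lemma eventually_at_right_0I:
  assumes "\<And>x. 0 < x \<Longrightarrow> P x"
  shows "eventually P (at_right (0::real))"
  using eventually_at_right_less[of "0::real"] by eventually_elim (rule assms)

text \<open>A remainder bound for both signs of \<open>y\<close> that, multiplied by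
  \<open>exp (- s * t)\<close>, is again dominated by a Laplace integrand; it justifies
  differentiating \<open>jint\<close> under the integral sign.\<close>

lemma exp_second_order_bound:
  fixes y :: real
  shows "\<bar>exp y - 1 - y\<bar> \<le> y\<^sup>2 * exp \<bar>y\<bar>"
proof -
  have 0: "0 \<le> exp y - 1 - y" using exp_ge_add_one_self[of y] by linarith
  have "1 - y \<le> exp (- y)" using exp_ge_add_one_self[of "- y"] by simp
  then have "exp y * (1 - y) \<le> exp y * exp (- y)" by (intro mult_left_mono) auto
  then have 1: "exp y - 1 \<le> y * exp y" by (simp add: algebra_simps flip: exp_add)
  have "exp y - 1 - y \<le> y * (exp y - 1)" using 1 by (simp add: algebra_simps)
  also have "\<dots> \<le> y\<^sup>2 * exp \<bar>y\<bar>"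
  proof (cases "0 \<le> y")
    case True
    then have "y * (exp y - 1) \<le> y * (y * exp y)" by (intro mult_left_mono 1)
    then show ?thesis using True by (simp add: power2_eq_square)
  next
    case False
    have "1 - exp y \<le> - y" using exp_ge_add_one_self[of y] by linarith
    then have "(- y) * (1 - exp y) \<le> (- y) * (- y)" using False by (intro mult_left_mono) auto
    also have "\<dots> \<le> y\<^sup>2 * exp \<bar>y\<bar>"
      using mult_left_mono[of 1 "exp \<bar>y\<bar>" "y\<^sup>2"] by (simp add: power2_eq_square)
    finally show ?thesis by (simp add: algebra_simps)
  qed
  finally show ?thesis using 0 by simp
qed

lemma nn_integral_gamma_scaled:
  assumes \<alpha>: "0 < \<alpha>" and l: "0 < l"
  shows "(\<integral>\<^sup>+t. (if 0 < t then ennreal (exp (- (l * t)) * t powr (\<alpha> - 1)) else 0) \<partial>lborel) = ennreal (Gamma \<alpha> / l powr \<alpha>)"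
proof -
  define f where "f t = (if 0 < t then ennreal (exp (- t) * t powr (\<alpha> - 1)) else 0)" for t :: real
  have [measurable]: "f \<in> borel_measurable borel" unfolding f_def[abs_def] by measurable
  have "ennreal (Gamma \<alpha>) = (\<integral>\<^sup>+t. ennreal (indicator {0..} t * t powr (\<alpha> - 1) / exp t) \<partial>lborel)"
    using Gamma_conv_nn_integral_real[OF \<alpha>] by simp
  also have "\<dots> = (\<integral>\<^sup>+t. f t \<partial>lborel)"
  proof (rule nn_integral_cong_AE)
    have "AE t in lborel. (t::real) \<noteq> 0" by (rule AE_lborel_singleton)
    then show "AE t in lborel. ennreal (indicator {0..} t * t powr (\<alpha> - 1) / exp t) = f t"
      by eventually_elim (auto simp: f_def indicator_def exp_minus field_simps)
  qed
  also have "\<dots> = ennreal \<bar>l\<bar> * (\<integral>\<^sup>+t. f (0 + l * t) \<partial>lborel)"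
    using l by (intro nn_integral_real_affine) auto
  also have "\<dots> = (\<integral>\<^sup>+t. ennreal l * f (l * t) \<partial>lborel)"
    using l by (subst nn_integral_cmult) auto
  also have "\<dots> = (\<integral>\<^sup>+t. ennreal (l powr \<alpha>) * (if 0 < t then ennreal (exp (- (l * t)) * t powr (\<alpha> - 1)) else 0) \<partial>lborel)"
  proof (intro nn_integral_cong)
    fix t :: real
    show "ennreal l * f (l * t) = ennreal (l powr \<alpha>) * (if 0 < t then ennreal (exp (- (l * t)) * t powr (\<alpha> - 1)) else 0)"
    proof (cases "0 < t")
      case True
      have "l powr \<alpha> = l * l powr (\<alpha> - 1)" using l powr_add[of l 1 "\<alpha> - 1"] by simp
      then have "l * (exp (- (l * t)) * (l * t) powr (\<alpha> - 1)) = l powr \<alpha> * (exp (- (l * t)) * t powr (\<alpha> - 1))"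
        using True l by (simp add: powr_mult)
      then show ?thesis using True l by (simp add: f_def flip: ennreal_mult)
    next
      case False
      then show ?thesis using l by (simp add: f_def zero_less_mult_iff)
    qed
  qed
  also have "\<dots> = ennreal (l powr \<alpha>) * (\<integral>\<^sup>+t. (if 0 < t then ennreal (exp (- (l * t)) * t powr (\<alpha> - 1)) else 0) \<partial>lborel)"
    by (rule nn_integral_cmult) measurable
  finally have e: "ennreal (Gamma \<alpha>) = ennreal (l powr \<alpha>) * (\<integral>\<^sup>+t. (if 0 < t then ennreal (exp (- (l * t)) * t powr (\<alpha> - 1)) else 0) \<partial>lborel)" .
  have "ennreal (Gamma \<alpha> / l powr \<alpha>) = ennreal (1 / l powr \<alpha>) * ennreal (Gamma \<alpha>)"
    using Gamma_real_pos[OF \<alpha>] by (simp flip: ennreal_mult)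
  also have "\<dots> = (ennreal (1 / l powr \<alpha>) * ennreal (l powr \<alpha>)) * (\<integral>\<^sup>+t. (if 0 < t then ennreal (exp (- (l * t)) * t powr (\<alpha> - 1)) else 0) \<partial>lborel)"
    unfolding e by (simp add: mult.assoc)
  also have "ennreal (1 / l powr \<alpha>) * ennreal (l powr \<alpha>) = 1" using l by (simp flip: ennreal_mult)
  finally show ?thesis by simp
qed

text \<open>\<open>jint a (b - a - 1) s\<close> is \<open>Gamma a\<close> times Tricomi's function \<open>U(a, b, s)\<close>.\<close>

definition jf :: "real \<Rightarrow> real \<Rightarrow> real \<Rightarrow> real \<Rightarrow> real" where
  "jf \<alpha> \<gamma> s t = (if 0 < t then exp (- (s * t)) * t powr (\<alpha> - 1) * (1 + t) powr \<gamma> else 0)"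

definition jint :: "real \<Rightarrow> real \<Rightarrow> real \<Rightarrow> real" where
  "jint \<alpha> \<gamma> s = (\<integral>t. jf \<alpha> \<gamma> s t \<partial>lborel)"

lemma jf_measurable[measurable]: "jf \<alpha> \<gamma> s \<in> borel_measurable borel"
  unfolding jf_def[abs_def] by measurable

lemma jf_nonneg: "0 \<le> jf \<alpha> \<gamma> s t" by (simp add: jf_def)

lemma jf_Suc: "jf (\<alpha> + 1) \<gamma> s t = t * jf \<alpha> \<gamma> s t"
  using powr_add[of t "\<alpha> - 1" 1] by (simp add: jf_def)

lemma powr_le_one_neg: "0 < t \<Longrightarrow> \<gamma> \<le> 0 \<Longrightarrow> (1 + t) powr \<gamma> \<le> (1::real)"
  using powr_mono2'[of "- \<gamma>" 1 "1 + t"] powr_mono[of \<gamma> 0 "1 + t"] by simp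

lemma jf_integrable:
  assumes "0 < \<alpha>" "\<gamma> \<le> 0" "0 < s"
  shows "integrable lborel (jf \<alpha> \<gamma> s)"
proof (rule integrableI_bounded)
  have "(\<integral>\<^sup>+t. ennreal (norm (jf \<alpha> \<gamma> s t)) \<partial>lborel) \<le> (\<integral>\<^sup>+t. (if 0 < t then ennreal (exp (- (s * t)) * t powr (\<alpha> - 1)) else 0) \<partial>lborel)"
  proof (intro nn_integral_mono)
    fix t :: real
    show "ennreal (norm (jf \<alpha> \<gamma> s t)) \<le> (if 0 < t then ennreal (exp (- (s * t)) * t powr (\<alpha> - 1)) else 0)"
      using mult_left_mono[OF powr_le_one_neg[of t \<gamma>], of "exp (- (s * t)) * t powr (\<alpha> - 1)"] assms(2)
      by (auto simp: jf_def abs_mult intro!: ennreal_leI)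
  qed
  also have "\<dots> < \<infinity>" using assms by (simp add: nn_integral_gamma_scaled)
  finally show "(\<integral>\<^sup>+t. ennreal (norm (jf \<alpha> \<gamma> s t)) \<partial>lborel) < \<infinity>" .
qed simp

text \<open>The part \<open>t <= 1\<close> alone produces growth like \<open>1 / \<alpha>\<close> as
  \<open>\<alpha>\<close> tends to 0; this is what later forces the Tricomi ratio down to
  \<open>s\<close>.\<close>

lemma jint_lower:
  assumes "0 < \<alpha>" "\<gamma> \<le> 0" "0 < s"
  shows "exp (- s) * 2 powr \<gamma> / \<alpha> \<le> jint \<alpha> \<gamma> s"
proof -
  have hi: "((\<lambda>t. t powr (\<alpha> - 1)) has_integral (1 powr \<alpha> / \<alpha> - 0 powr \<alpha> / \<alpha>)) {0..1}"
  proof (rule fundamental_theorem_of_calculus_interior_strong[of "{}"])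
    show "continuous_on {0..1} (\<lambda>t. t powr \<alpha> / \<alpha>)"
      using assms by (intro continuous_on_divide continuous_on_powr' continuous_intros) auto
    show "((\<lambda>t. t powr \<alpha> / \<alpha>) has_vector_derivative t powr (\<alpha> - 1)) (at t)" if "t \<in> {0<..<1} - {}" for t
      using that assms by (auto intro!: derivative_eq_intros simp flip: has_real_derivative_iff_has_vector_derivative)
  qed auto
  then have nn: "(\<integral>\<^sup>+t. ennreal (indicat_real {0..1} t * t powr (\<alpha> - 1)) \<partial>lborel) = ennreal (1 / \<alpha>)"
    using nn_integral_has_integral_lebesgue[OF _ hi] assms by simp
  have "ennreal (exp (- s) * 2 powr \<gamma> / \<alpha>) = ennreal (exp (- s) * 2 powr \<gamma>) * ennreal (1 / \<alpha>)"
    using assms by (subst ennreal_mult[symmetric]) auto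
  also have "\<dots> = (\<integral>\<^sup>+t. ennreal (exp (- s) * 2 powr \<gamma>) * ennreal (indicat_real {0..1} t * t powr (\<alpha> - 1)) \<partial>lborel)"
    unfolding nn[symmetric] by (rule nn_integral_cmult[symmetric]) measurable
  also have "\<dots> \<le> (\<integral>\<^sup>+t. ennreal (jf \<alpha> \<gamma> s t) \<partial>lborel)"
  proof (rule nn_integral_mono_AE)
    have "AE t in lborel. (t::real) \<noteq> 0" by (rule AE_lborel_singleton)
    then show "AE t in lborel. ennreal (exp (- s) * 2 powr \<gamma>) * ennreal (indicat_real {0..1} t * t powr (\<alpha> - 1)) \<le> ennreal (jf \<alpha> \<gamma> s t)"
    proof eventually_elim
      fix t :: real assume "t \<noteq> 0"
      show "ennreal (exp (- s) * 2 powr \<gamma>) * ennreal (indicat_real {0..1} t * t powr (\<alpha> - 1)) \<le> ennreal (jf \<alpha> \<gamma> s t)"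
      proof (cases "t \<in> {0..1}")
        case True
        then have t: "0 < t" "t \<le> 1" using \<open>t \<noteq> 0\<close> by auto
        have 1: "exp (- s) \<le> exp (- (s * t))" using t assms by (simp add: mult_left_le)
        have 2: "2 powr \<gamma> \<le> (1 + t) powr \<gamma>" using t assms by (intro powr_mono2') auto
        have "exp (- s) * 2 powr \<gamma> * t powr (\<alpha> - 1) \<le> exp (- (s * t)) * (1 + t) powr \<gamma> * t powr (\<alpha> - 1)"
          by (intro mult_right_mono mult_mono 1 2) auto
        then show ?thesis using t by (simp add: jf_def ennreal_leI mult_ac flip: ennreal_mult)
      qed auto
    qed
  qed
  also have "\<dots> = ennreal (jint \<alpha> \<gamma> s)"
    unfolding jint_def by (rule nn_integral_eq_integral[OF jf_integrable[OF assms]]) (simp add: jf_nonneg)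
  finally show ?thesis unfolding jint_def by (subst (asm) ennreal_le_iff) (auto simp: jf_nonneg)
qed

lemma jint_pos: "0 < \<alpha> \<Longrightarrow> \<gamma> \<le> 0 \<Longrightarrow> 0 < s \<Longrightarrow> 0 < jint \<alpha> \<gamma> s"
  using jint_lower[of \<alpha> \<gamma> s] by (smt (verit) divide_pos_pos exp_gt_zero mult_pos_pos powr_gt_zero)

lemma jint_deriv:
  assumes "0 < \<alpha>" "\<gamma> \<le> 0" "0 < s"
  shows "(jint \<alpha> \<gamma> has_real_derivative - jint (\<alpha> + 1) \<gamma> s) (at s)"
proof -
  \<comment> \<open>For increments below \<open>s / 2\<close> the factor
    \<open>exp (\<bar>h\<bar> * t)\<close> is absorbed by half of the decay, hence the argument
    \<open>s / 2\<close>. The factor \<open>t^2\<close> of the second-order remainder raises the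
    parameter by 2.\<close>
  define C where "C = jint (\<alpha> + 1 + 1) \<gamma> (s / 2)"
  have bound: "\<bar>(jint \<alpha> \<gamma> (s + h) - jint \<alpha> \<gamma> s) / h - (- jint (\<alpha> + 1) \<gamma> s)\<bar> \<le> C * \<bar>h\<bar>"
    if h: "h \<noteq> 0" "\<bar>h\<bar> < s / 2" for h
  proof -
    have sh: "0 < s + h" using h by linarith
    have i: "integrable lborel (jf \<alpha> \<gamma> (s + h))" "integrable lborel (jf \<alpha> \<gamma> s)" "integrable lborel (jf (\<alpha> + 1) \<gamma> s)"
      "integrable lborel (jf (\<alpha> + 1 + 1) \<gamma> (s / 2))"
      using assms sh by (auto intro!: jf_integrable)
    have E: "(jint \<alpha> \<gamma> (s + h) - jint \<alpha> \<gamma> s) / h - (- jint (\<alpha> + 1) \<gamma> s)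
        = (\<integral>t. (jf \<alpha> \<gamma> (s + h) t - jf \<alpha> \<gamma> s t) / h + jf (\<alpha> + 1) \<gamma> s t \<partial>lborel)"
      unfolding jint_def using i by simp
    have "\<bar>(jint \<alpha> \<gamma> (s + h) - jint \<alpha> \<gamma> s) / h - (- jint (\<alpha> + 1) \<gamma> s)\<bar>
        \<le> (\<integral>t. \<bar>(jf \<alpha> \<gamma> (s + h) t - jf \<alpha> \<gamma> s t) / h + jf (\<alpha> + 1) \<gamma> s t\<bar> \<partial>lborel)"
      unfolding E by (rule integral_abs_bound)
    also have "\<dots> \<le> (\<integral>t. \<bar>h\<bar> * jf (\<alpha> + 1 + 1) \<gamma> (s / 2) t \<partial>lborel)"
    proof (rule integral_mono)
      show "integrable lborel (\<lambda>t. \<bar>(jf \<alpha> \<gamma> (s + h) t - jf \<alpha> \<gamma> s t) / h + jf (\<alpha> + 1) \<gamma> s t\<bar>)"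
        using i by (intro integrable_abs Bochner_Integration.integrable_add integrable_divide_zero Bochner_Integration.integrable_diff) auto
      show "integrable lborel (\<lambda>t. \<bar>h\<bar> * jf (\<alpha> + 1 + 1) \<gamma> (s / 2) t)" using i by simp
      fix t :: real
      show "\<bar>(jf \<alpha> \<gamma> (s + h) t - jf \<alpha> \<gamma> s t) / h + jf (\<alpha> + 1) \<gamma> s t\<bar> \<le> \<bar>h\<bar> * jf (\<alpha> + 1 + 1) \<gamma> (s / 2) t"
      proof (cases "0 < t")
        case True
        define w where "w = t powr (\<alpha> - 1) * (1 + t) powr \<gamma>"
        have w: "0 \<le> w" by (simp add: w_def)
        have j: "jf \<alpha> \<gamma> \<sigma> t = exp (- (\<sigma> * t)) * w" for \<sigma> using True by (simp add: jf_def w_def mult.assoc)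
        have e: "(jf \<alpha> \<gamma> (s + h) t - jf \<alpha> \<gamma> s t) / h + jf (\<alpha> + 1) \<gamma> s t
            = exp (- (s * t)) * w * (exp (- (h * t)) - 1 - (- (h * t))) / h"
          unfolding jf_Suc j using h by (simp add: field_simps exp_add exp_diff exp_minus)
        have "\<bar>exp (- (h * t)) - 1 - (- (h * t))\<bar> \<le> (- (h * t))\<^sup>2 * exp \<bar>- (h * t)\<bar>"
          by (rule exp_second_order_bound)
        then have "\<bar>exp (- (h * t)) - 1 - (- (h * t))\<bar> / \<bar>h\<bar> \<le> (h * t)\<^sup>2 * exp (\<bar>h\<bar> * t) / \<bar>h\<bar>"
          using True by (intro divide_right_mono) (auto simp: abs_mult)
        also have "(h * t)\<^sup>2 * exp (\<bar>h\<bar> * t) / \<bar>h\<bar> = \<bar>h\<bar> * (t * t * exp (\<bar>h\<bar> * t))"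
          using h by (cases "0 < h") (auto simp: power2_eq_square)
        finally have "exp (- (s * t)) * w * (\<bar>exp (- (h * t)) - 1 - (- (h * t))\<bar> / \<bar>h\<bar>) \<le> exp (- (s * t)) * w * (\<bar>h\<bar> * (t * t * exp (\<bar>h\<bar> * t)))"
          using w by (intro mult_left_mono) auto
        moreover have "\<bar>exp (- (s * t)) * w * (exp (- (h * t)) - 1 - (- (h * t))) / h\<bar> = exp (- (s * t)) * w * (\<bar>exp (- (h * t)) - 1 - (- (h * t))\<bar> / \<bar>h\<bar>)"
          using w by (simp add: abs_mult)
        moreover have "exp (- (s * t)) * exp (\<bar>h\<bar> * t) \<le> exp (- (s / 2 * t))"
        proof -
          have "\<bar>h\<bar> * t \<le> s / 2 * t" using h True by (intro mult_right_mono) auto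
          then show ?thesis by (simp flip: exp_add)
        qed
        then have "\<bar>h\<bar> * (t * t * w) * (exp (- (s * t)) * exp (\<bar>h\<bar> * t)) \<le> \<bar>h\<bar> * (t * t * w) * exp (- (s / 2 * t))"
          using w True by (intro mult_left_mono) auto
        then have "exp (- (s * t)) * w * (\<bar>h\<bar> * (t * t * exp (\<bar>h\<bar> * t))) \<le> \<bar>h\<bar> * jf (\<alpha> + 1 + 1) \<gamma> (s / 2) t"
          unfolding jf_Suc j by (simp add: mult_ac)
        ultimately show ?thesis unfolding e by linarith
      qed (simp add: jf_def)
    qed
    also have "\<dots> = C * \<bar>h\<bar>" unfolding C_def jint_def by simp
    finally show ?thesis .
  qed
  have "((\<lambda>h. (jint \<alpha> \<gamma> (s + h) - jint \<alpha> \<gamma> s) / h - (- jint (\<alpha> + 1) \<gamma> s)) \<longlongrightarrow> 0) (at 0)"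
  proof (rule Lim_null_comparison)
    have "\<forall>\<^sub>F h in at 0. h \<noteq> 0 \<and> \<bar>h\<bar> < s / 2"
      using assms by (auto simp: eventually_at intro!: exI[of _ "s / 2"] simp: dist_real_def)
    then show "\<forall>\<^sub>F h in at 0. norm ((jint \<alpha> \<gamma> (s + h) - jint \<alpha> \<gamma> s) / h - (- jint (\<alpha> + 1) \<gamma> s)) \<le> C * \<bar>h\<bar>"
      by eventually_elim (use bound in auto)
    show "((\<lambda>h. C * \<bar>h\<bar>) \<longlongrightarrow> 0) (at 0)" by (rule tendsto_eq_intros refl | simp)+
  qed
  then show ?thesis unfolding DERIV_def using Lim_null by blast
qed

text \<open>The integral over \<open>(0, \<infinity>)\<close> of the derivative of
  \<open>exp (- s * t) * t^a * (1 + t)^(b - a)\<close>, a function that vanishes at both ends. Since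
  \<open>- jint (a + 1)\<close> and \<open>jint (a + 2)\<close> are the first two derivatives in
  \<open>s\<close>, the outcome is Kummer's equation for \<open>jint a\<close>.\<close>

lemma jint_relation:
  assumes a: "0 < a" and b: "b - a - 1 \<le> 0" and s: "0 < s"
  defines "\<gamma> \<equiv> b - a - 1"
  shows "s * jint (a + 1 + 1) \<gamma> s = (s - b) * (- jint (a + 1) \<gamma> s) + a * jint a \<gamma> s"
proof -
  have g: "\<gamma> \<le> 0" using b by (simp add: \<gamma>_def)
  have i: "integrable lborel (jf a \<gamma> s)" "integrable lborel (jf (a + 1) \<gamma> s)" "integrable lborel (jf (a + 1 + 1) \<gamma> s)"
    using a g s by (auto intro!: jf_integrable)
  define f where "f t = a * jf a \<gamma> s t + (b - s) * jf (a + 1) \<gamma> s t - s * jf (a + 1 + 1) \<gamma> s t" for t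
  define F where "F t = exp (- (s * t)) * t powr a * (1 + t) powr (\<gamma> + 1)" for t
  have fi: "integrable lborel f" unfolding f_def using i by simp
  have "(LBINT t=ereal 0..\<infinity>. f t) = 0 - 0"
  proof (rule interval_integral_FTC_integrable)
    show "ereal 0 < \<infinity>" by simp
    show "(F has_vector_derivative f t) (at t)" if "ereal 0 < ereal t" "ereal t < \<infinity>" for t
    proof -
      have t: "0 < t" using that by simp
      define w where "w = t powr (a - 1) * (1 + t) powr \<gamma>"
      have p: "t powr a = t * t powr (a - 1)" "(1 + t) powr (\<gamma> + 1) = (1 + t) * (1 + t) powr \<gamma>"
        using t powr_add[of t "a - 1" 1] powr_add[of "1 + t" \<gamma> 1] by auto
      have "(F has_real_derivative
          ((exp (- (s * t)) * - s) * t powr a + a * t powr (a - 1) * exp (- (s * t))) * (1 + t) powr (\<gamma> + 1)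
          + (\<gamma> + 1) * (1 + t) powr \<gamma> * (exp (- (s * t)) * t powr a)) (at t)"
        unfolding F_def[abs_def]
      proof (intro DERIV_mult)
        show "((\<lambda>t. exp (- (s * t))) has_real_derivative exp (- (s * t)) * - s) (at t)"
          by (auto intro!: derivative_eq_intros)
        show "((\<lambda>t. t powr a) has_real_derivative a * t powr (a - 1)) (at t)"
          using t by (auto intro!: derivative_eq_intros)
        show "((\<lambda>t. (1 + t) powr (\<gamma> + 1)) has_real_derivative (\<gamma> + 1) * (1 + t) powr \<gamma>) (at t)"
          using t by (auto intro!: derivative_eq_intros)
      qed
      also have "((exp (- (s * t)) * - s) * t powr a + a * t powr (a - 1) * exp (- (s * t))) * (1 + t) powr (\<gamma> + 1)
          + (\<gamma> + 1) * (1 + t) powr \<gamma> * (exp (- (s * t)) * t powr a) = f t"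
      proof -
        have j: "jf a \<gamma> s t = exp (- (s * t)) * t powr (a - 1) * (1 + t) powr \<gamma>" using t by (simp add: jf_def)
        have bb: "b = \<gamma> + 1 + a" by (simp add: \<gamma>_def)
        show ?thesis unfolding f_def jf_Suc j p bb by (simp add: algebra_simps)
      qed
      finally show ?thesis by (simp add: has_real_derivative_iff_has_vector_derivative)
    qed
    show "isCont f t" if "ereal 0 < ereal t" "ereal t < \<infinity>" for t
    proof -
      have t: "0 < t" using that by simp
      have jc: "isCont (jf a \<gamma> s) t"
      proof -
        have c: "isCont (\<lambda>t. exp (- (s * t)) * t powr (a - 1) * (1 + t) powr \<gamma>) t"
          using t by (intro continuous_intros) auto
        have ev: "\<forall>\<^sub>F x in nhds t. exp (- (s * x)) * x powr (a - 1) * (1 + x) powr \<gamma> = jf a \<gamma> s x"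
          using eventually_nhds_in_open[of "{0<..}" t] t by (auto simp: jf_def elim!: eventually_mono)
        show ?thesis by (rule iffD1[OF isCont_cong[OF ev] c])
      qed
      show ?thesis unfolding f_def jf_Suc by (intro continuous_intros jc)
    qed
    show "set_integrable lborel (einterval (ereal 0) \<infinity>) f"
      unfolding set_integrable_def by (intro integrable_mult_indicator fi) auto
    have "((\<lambda>t. exp (- (s * t)) * t powr a * (1 + t) powr (\<gamma> + 1)) \<longlongrightarrow> exp (- (s * 0)) * 0 powr a * (1 + 0) powr (\<gamma> + 1)) (at_right 0)"
      using a by (intro tendsto_intros) (auto intro!: eventually_at_right_0I)
    then have "(F \<longlongrightarrow> 0) (at_right 0)" unfolding F_def[abs_def] using a by simp
    then show "((F \<circ> real_of_ereal) \<longlongrightarrow> 0) (at_right (ereal 0))" by (simp only: ereal_tendsto_simps)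
    have "(F \<longlongrightarrow> 0) at_top"
    proof -
      obtain k :: nat where k: "a + 1 \<le> real k" using real_arch_simple by blast
      show ?thesis
      proof (rule Lim_null_comparison)
        show "\<forall>\<^sub>F t in at_top. norm (F t) \<le> 2 / s ^ k * ((s * t) ^ k / exp (s * t))"
          using eventually_ge_at_top[of 1]
        proof eventually_elim
          fix t :: real assume t: "1 \<le> t"
          have "(1 + t) powr (\<gamma> + 1) \<le> (1 + t) powr 1" using t g by (intro powr_mono) auto
          then have "t powr a * (1 + t) powr (\<gamma> + 1) \<le> t powr a * (2 * t)" using t by (intro mult_left_mono) auto
          also have "\<dots> = 2 * t powr (a + 1)" using t by (simp add: powr_add)
          also have "\<dots> \<le> 2 * t powr real k" using t k by (intro mult_left_mono powr_mono) auto
          also have "t powr real k = t ^ k" using t by (simp add: powr_realpow)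
          finally have "exp (- (s * t)) * (t powr a * (1 + t) powr (\<gamma> + 1)) \<le> exp (- (s * t)) * (2 * t ^ k)" by (intro mult_left_mono) auto
          then show "norm (F t) \<le> 2 / s ^ k * ((s * t) ^ k / exp (s * t))"
            using s by (simp add: F_def abs_mult exp_minus power_mult_distrib field_simps)
        qed
        have "filterlim (\<lambda>t. s * t) at_top at_top"
          using s by (intro filterlim_tendsto_pos_mult_at_top[OF tendsto_const] filterlim_ident) auto
        then have "((\<lambda>t. (s * t) ^ k / exp (s * t)) \<longlongrightarrow> 0) at_top"
          by (rule filterlim_compose[OF tendsto_power_div_exp_0])
        then show "((\<lambda>t. 2 / s ^ k * ((s * t) ^ k / exp (s * t))) \<longlongrightarrow> 0) at_top"
          by (rule tendsto_mult_right_zero)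
      qed
    qed
    then show "((F \<circ> real_of_ereal) \<longlongrightarrow> 0) (at_left \<infinity>)" by (simp only: ereal_tendsto_simps)
  qed
  then have "(LINT t:{0<..}|lborel. f t) = 0" by (simp add: interval_integral_to_infinity_eq)
  moreover have "(LINT t:{0<..}|lborel. f t) = (\<integral>t. f t \<partial>lborel)"
    unfolding set_lebesgue_integral_def
    by (intro Bochner_Integration.integral_cong) (auto simp: f_def jf_def indicator_def)
  moreover have "(\<integral>t. f t \<partial>lborel) = a * jint a \<gamma> s + (b - s) * jint (a + 1) \<gamma> s - s * jint (a + 1 + 1) \<gamma> s"
    unfolding f_def jint_def using i by simp
  ultimately show ?thesis by (simp add: algebra_simps)
qed

text \<open>Writing \<open>(1 + t)^(- (a + 1 - b))\<close> as a Gamma integral in \<open>z\<close>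
  and integrating over \<open>t\<close> first moves \<open>s\<close> into the factor
  \<open>(s + z)^(- a)\<close>. There \<open>s\<close> may tend to 0 under the majorant
  \<open>exp (- z) * z^(- b)\<close>, integrable because \<open>b < 1\<close>.\<close>

lemma jint_limit_0:
  assumes a: "0 < a" and b: "0 < b" "b < 1"
  shows "((\<lambda>s. Gamma (a + 1 - b) * jint a (b - a - 1) s) \<longlongrightarrow> Gamma a * Gamma (1 - b)) (at_right 0)"
proof -
  have nu: "0 < a + 1 - b" using a b by simp
  define g where "g s z = (if 0 < z then exp (- z) * z powr (a - b) * (s + z) powr (- a) else 0)" for s z :: real
  have gm[measurable]: "g s \<in> borel_measurable borel" for s unfolding g_def[abs_def] by measurable
  have g0: "0 \<le> g s z" for s z by (simp add: g_def)
  have dom: "g s z \<le> g 0 z" if "0 \<le> s" for s z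
    using that a by (auto simp: g_def intro!: mult_left_mono powr_mono2')
  have G0: "(\<integral>\<^sup>+z. ennreal (g 0 z) \<partial>lborel) = ennreal (Gamma (1 - b))"
  proof -
    have "(\<integral>\<^sup>+z. ennreal (g 0 z) \<partial>lborel) = (\<integral>\<^sup>+t. (if 0 < t then ennreal (exp (- (1 * t)) * t powr ((1 - b) - 1)) else 0) \<partial>lborel)"
      by (intro nn_integral_cong) (auto simp: g_def mult.assoc simp flip: powr_add)
    then show ?thesis using b by (subst (asm) nn_integral_gamma_scaled) auto
  qed
  have gi: "integrable lborel (g s)" if "0 \<le> s" for s
  proof (rule integrableI_bounded)
    have "(\<integral>\<^sup>+z. ennreal (norm (g s z)) \<partial>lborel) \<le> (\<integral>\<^sup>+z. ennreal (g 0 z) \<partial>lborel)"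
      using dom[OF that] g0 by (intro nn_integral_mono ennreal_leI) auto
    then show "(\<integral>\<^sup>+z. ennreal (norm (g s z)) \<partial>lborel) < \<infinity>" by (simp add: G0 le_less_trans)
  qed simp
  have key: "Gamma (a + 1 - b) * jint a (b - a - 1) s = Gamma a * (\<integral>z. g s z \<partial>lborel)" if s: "0 < s" for s
  proof -
    define k where "k t z = (if 0 < t \<and> 0 < z then exp (- (s * t)) * t powr (a - 1) * (exp (- ((1 + t) * z)) * z powr (a - b)) else 0)" for t z :: real
    have km[measurable]: "case_prod (\<lambda>t z. ennreal (k t z)) \<in> borel_measurable (lborel \<Otimes>\<^sub>M lborel)"
      unfolding k_def by measurable
    have I1: "(\<integral>\<^sup>+z. ennreal (k t z) \<partial>lborel) = ennreal (Gamma (a + 1 - b) * jf a (b - a - 1) s t)" for t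
    proof (cases "0 < t")
      case True
      have "(\<integral>\<^sup>+z. ennreal (k t z) \<partial>lborel) = (\<integral>\<^sup>+z. ennreal (exp (- (s * t)) * t powr (a - 1)) *
          (if 0 < z then ennreal (exp (- ((1 + t) * z)) * z powr ((a + 1 - b) - 1)) else 0) \<partial>lborel)"
        using True by (intro nn_integral_cong) (auto simp: k_def ennreal_mult)
      also have "\<dots> = ennreal (exp (- (s * t)) * t powr (a - 1)) *
          (\<integral>\<^sup>+z. (if 0 < z then ennreal (exp (- ((1 + t) * z)) * z powr ((a + 1 - b) - 1)) else 0) \<partial>lborel)"
        by (rule nn_integral_cmult) measurable
      also have "(\<integral>\<^sup>+z. (if 0 < z then ennreal (exp (- ((1 + t) * z)) * z powr ((a + 1 - b) - 1)) else 0) \<partial>lborel)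
          = ennreal (Gamma (a + 1 - b) / (1 + t) powr (a + 1 - b))"
        using True nu by (intro nn_integral_gamma_scaled) auto
      also have "ennreal (exp (- (s * t)) * t powr (a - 1)) * ennreal (Gamma (a + 1 - b) / (1 + t) powr (a + 1 - b))
          = ennreal (exp (- (s * t)) * t powr (a - 1) * (Gamma (a + 1 - b) / (1 + t) powr (a + 1 - b)))"
        using Gamma_real_pos[OF nu] by (intro ennreal_mult[symmetric]) auto
      also have "exp (- (s * t)) * t powr (a - 1) * (Gamma (a + 1 - b) / (1 + t) powr (a + 1 - b)) = Gamma (a + 1 - b) * jf a (b - a - 1) s t"
      proof -
        have "(1 + t) powr (b - a - 1) = 1 / (1 + t) powr (a + 1 - b)"
          using powr_minus_divide[of "1 + t" "a + 1 - b"] by (simp add: algebra_simps)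
        then show ?thesis using True by (simp add: jf_def)
      qed
      finally show ?thesis .
    qed (simp add: k_def jf_def)
    have I2: "(\<integral>\<^sup>+t. ennreal (k t z) \<partial>lborel) = ennreal (Gamma a * g s z)" for z
    proof (cases "0 < z")
      case True
      have "(\<integral>\<^sup>+t. ennreal (k t z) \<partial>lborel) = (\<integral>\<^sup>+t. ennreal (exp (- z) * z powr (a - b)) *
          (if 0 < t then ennreal (exp (- ((s + z) * t)) * t powr (a - 1)) else 0) \<partial>lborel)"
      proof (intro nn_integral_cong)
        fix t :: real
        have "exp (- (s * t)) * t powr (a - 1) * (exp (- ((1 + t) * z)) * z powr (a - b))
           = exp (- z) * z powr (a - b) * (exp (- ((s + z) * t)) * t powr (a - 1))"
        proof -
          have "exp (- (s * t)) * exp (- ((1 + t) * z)) = exp (- z) * exp (- ((s + z) * t))"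
            by (simp add: exp_add[symmetric] algebra_simps)
          then have "(exp (- (s * t)) * exp (- ((1 + t) * z))) * (t powr (a - 1) * z powr (a - b))
             = (exp (- z) * exp (- ((s + z) * t))) * (t powr (a - 1) * z powr (a - b))" by simp
          then show ?thesis by (simp only: mult_ac)
        qed
        then show "ennreal (k t z) = ennreal (exp (- z) * z powr (a - b)) * (if 0 < t then ennreal (exp (- ((s + z) * t)) * t powr (a - 1)) else 0)"
          using True by (cases "0 < t") (auto simp: k_def simp flip: ennreal_mult)
      qed
      also have "\<dots> = ennreal (exp (- z) * z powr (a - b)) * (\<integral>\<^sup>+t. (if 0 < t then ennreal (exp (- ((s + z) * t)) * t powr (a - 1)) else 0) \<partial>lborel)"
        by (rule nn_integral_cmult) measurable
      also have "(\<integral>\<^sup>+t. (if 0 < t then ennreal (exp (- ((s + z) * t)) * t powr (a - 1)) else 0) \<partial>lborel) = ennreal (Gamma a / (s + z) powr a)"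
        using True s a by (intro nn_integral_gamma_scaled) auto
      also have "ennreal (exp (- z) * z powr (a - b)) * ennreal (Gamma a / (s + z) powr a) = ennreal (exp (- z) * z powr (a - b) * (Gamma a / (s + z) powr a))"
        using Gamma_real_pos[OF a] by (intro ennreal_mult[symmetric]) auto
      also have "exp (- z) * z powr (a - b) * (Gamma a / (s + z) powr a) = Gamma a * g s z"
        using True by (simp add: g_def powr_minus_divide)
      finally show ?thesis .
    qed (simp add: k_def g_def)
    have "(\<integral>\<^sup>+t. ennreal (Gamma (a + 1 - b) * jf a (b - a - 1) s t) \<partial>lborel) = (\<integral>\<^sup>+z. ennreal (Gamma a * g s z) \<partial>lborel)"
      unfolding I1[symmetric] I2[symmetric] by (rule lborel_pair.Fubini'[OF km, symmetric])
    moreover have "(\<integral>\<^sup>+t. ennreal (Gamma (a + 1 - b) * jf a (b - a - 1) s t) \<partial>lborel) = ennreal (Gamma (a + 1 - b) * jint a (b - a - 1) s)"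
      unfolding jint_def using Gamma_real_pos[OF nu] jf_nonneg jf_integrable[OF a _ s, of "b - a - 1"] a b
      by (subst nn_integral_eq_integral) auto
    moreover have "(\<integral>\<^sup>+z. ennreal (Gamma a * g s z) \<partial>lborel) = ennreal (Gamma a * (\<integral>z. g s z \<partial>lborel))"
      using Gamma_real_pos[OF a] g0 gi[of s] s by (subst nn_integral_eq_integral) auto
    moreover have "0 \<le> Gamma (a + 1 - b) * jint a (b - a - 1) s" "0 \<le> Gamma a * (\<integral>z. g s z \<partial>lborel)"
      using Gamma_real_pos[OF nu] Gamma_real_pos[OF a] jf_nonneg g0 by (auto simp: jint_def less_imp_le)
    ultimately show ?thesis by (simp only: ennreal_inj)
  qed
  have "((\<lambda>s. \<integral>z. g s z \<partial>lborel) \<longlongrightarrow> (\<integral>z. g 0 z \<partial>lborel)) (at_right 0)"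
  proof (rule tendsto_at_iff_sequentially[THEN iffD2], intro allI impI)
    fix X :: "nat \<Rightarrow> real" assume X: "\<forall>i. X i \<in> {0<..} - {0}" "X \<longlonglongrightarrow> 0"
    show "((\<lambda>s. \<integral>z. g s z \<partial>lborel) \<circ> X) \<longlonglongrightarrow> (\<integral>z. g 0 z \<partial>lborel)"
      unfolding o_def
    proof (rule integral_dominated_convergence[where w = "g 0"])
      show "AE z in lborel. (\<lambda>i. g (X i) z) \<longlonglongrightarrow> g 0 z"
      proof (rule AE_I2)
        fix z :: real
        show "(\<lambda>i. g (X i) z) \<longlonglongrightarrow> g 0 z"
        proof (cases "0 < z")
          case True
          have "(\<lambda>i. exp (- z) * z powr (a - b) * (X i + z) powr (- a)) \<longlonglongrightarrow> exp (- z) * z powr (a - b) * (0 + z) powr (- a)"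
            using True by (intro tendsto_intros X) auto
          then show ?thesis using True by (simp add: g_def)
        qed (simp add: g_def)
      qed
      show "AE z in lborel. norm (g (X i) z) \<le> g 0 z" for i
        using X(1) dom[of "X i"] g0 by (auto simp: less_imp_le)
    qed (use gi in auto)
  qed
  moreover have "(\<integral>z. g 0 z \<partial>lborel) = Gamma (1 - b)"
    using G0 g0 Gamma_real_pos[of "1 - b"] b by (subst integral_eq_nn_integral) auto
  ultimately have "((\<lambda>s. Gamma a * (\<integral>z. g s z \<partial>lborel)) \<longlongrightarrow> Gamma a * Gamma (1 - b)) (at_right 0)"
    by (intro tendsto_mult tendsto_const) simp
  then show ?thesis
    by (rule Lim_transform_eventually) (intro eventually_at_right_0I, use key in simp)
qed

text \<open>The substitution \<open>z = s * t\<close> extracts the factor \<open>s^(- b)\<close>;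
  the remaining integrand increases to \<open>exp (- z) * z^(b - 1)\<close> as \<open>s\<close>
  decreases to 0.\<close>

lemma jint_limit_1:
  assumes a: "0 < a" and b: "0 < b" "b < 1"
  shows "((\<lambda>s. s powr b * jint (a + 1) (b - a - 1) s) \<longlongrightarrow> Gamma b) (at_right 0)"
proof -
  define g where "g s z = (if 0 < z then exp (- z) * z powr a * (s + z) powr (b - a - 1) else 0)" for s z :: real
  have gm[measurable]: "g s \<in> borel_measurable borel" for s unfolding g_def[abs_def] by measurable
  have g0: "0 \<le> g s z" for s z by (simp add: g_def)
  have dom: "g s z \<le> g 0 z" if "0 \<le> s" for s z
    using that a b by (auto simp: g_def intro!: mult_left_mono powr_mono2')
  have G0: "(\<integral>\<^sup>+z. ennreal (g 0 z) \<partial>lborel) = ennreal (Gamma b)"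
  proof -
    have "(\<integral>\<^sup>+z. ennreal (g 0 z) \<partial>lborel) = (\<integral>\<^sup>+t. (if 0 < t then ennreal (exp (- (1 * t)) * t powr (b - 1)) else 0) \<partial>lborel)"
      by (intro nn_integral_cong) (auto simp: g_def mult.assoc simp flip: powr_add)
    then show ?thesis using b by (subst (asm) nn_integral_gamma_scaled) auto
  qed
  have gi: "integrable lborel (g 0)"
    by (rule integrableI_bounded) (use g0 G0 in auto)
  have key: "s powr b * jint (a + 1) (b - a - 1) s = (\<integral>z. g s z \<partial>lborel)" if s: "0 < s" for s
  proof -
    have "(\<integral>z. g s z \<partial>lborel) = \<bar>s\<bar> *\<^sub>R (\<integral>t. g s (0 + s * t) \<partial>lborel)"
      using s by (intro lborel_integral_real_affine) auto
    also have "\<dots> = (\<integral>t. s * g s (s * t) \<partial>lborel)" using s by simp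
    also have "\<dots> = (\<integral>t. s powr b * jf (a + 1) (b - a - 1) s t \<partial>lborel)"
    proof (intro Bochner_Integration.integral_cong refl)
      fix t :: real
      show "s * g s (s * t) = s powr b * jf (a + 1) (b - a - 1) s t"
      proof (cases "0 < t")
        case True
        have "(s + s * t) powr (b - a - 1) = s powr (b - a - 1) * (1 + t) powr (b - a - 1)"
          using s True powr_mult[of s "1 + t" "b - a - 1"] by (simp add: distrib_left)
        moreover have "s * (s powr a * s powr (b - a - 1)) = s powr b"
          using s by (simp add: powr_mult_base flip: powr_add)
        ultimately show ?thesis using True s by (simp add: g_def jf_def powr_mult mult_ac)
      next
        case False
        then show ?thesis using s by (simp add: g_def jf_def zero_less_mult_iff)
      qed
    qed
    finally show ?thesis by (simp add: jint_def)
  qed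
  have "((\<lambda>s. \<integral>z. g s z \<partial>lborel) \<longlongrightarrow> (\<integral>z. g 0 z \<partial>lborel)) (at_right 0)"
  proof (rule tendsto_at_iff_sequentially[THEN iffD2], intro allI impI)
    fix X :: "nat \<Rightarrow> real" assume X: "\<forall>i. X i \<in> {0<..} - {0}" "X \<longlonglongrightarrow> 0"
    show "((\<lambda>s. \<integral>z. g s z \<partial>lborel) \<circ> X) \<longlonglongrightarrow> (\<integral>z. g 0 z \<partial>lborel)"
      unfolding o_def
    proof (rule integral_dominated_convergence[where w = "g 0"])
      show "AE z in lborel. (\<lambda>i. g (X i) z) \<longlonglongrightarrow> g 0 z"
      proof (rule AE_I2)
        fix z :: real
        show "(\<lambda>i. g (X i) z) \<longlonglongrightarrow> g 0 z"
        proof (cases "0 < z")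
          case True
          have "(\<lambda>i. exp (- z) * z powr a * (X i + z) powr (b - a - 1)) \<longlonglongrightarrow> exp (- z) * z powr a * (0 + z) powr (b - a - 1)"
            using True by (intro tendsto_intros X) auto
          then show ?thesis using True by (simp add: g_def)
        qed (simp add: g_def)
      qed
      show "AE z in lborel. norm (g (X i) z) \<le> g 0 z" for i
        using X(1) dom[of "X i"] g0 by (auto simp: less_imp_le)
    qed (use gi in auto)
  qed
  moreover have "(\<integral>z. g 0 z \<partial>lborel) = Gamma b"
    using G0 g0 Gamma_real_pos[of b] b by (subst integral_eq_nn_integral) auto
  ultimately have "((\<lambda>s. \<integral>z. g s z \<partial>lborel) \<longlongrightarrow> Gamma b) (at_right 0)" by simp
  then show ?thesis
    by (rule Lim_transform_eventually) (intro eventually_at_right_0I, use key in simp)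
qed

text \<open>Two solutions of Kummer's equation have Wronskian proportional to \<open>s powr (- b) * exp s\<close>; the
  behaviour at \<open>0\<close> forces the constant to vanish.\<close>

lemma kummer_solution_unique:
  fixes y1 y2 :: "real \<Rightarrow> real"
  assumes d1: "\<And>s. 0 < s \<Longrightarrow> (y1 has_real_derivative y1' s) (at s)" "\<And>s. 0 < s \<Longrightarrow> (y1' has_real_derivative y1'' s) (at s)"
    and d2: "\<And>s. 0 < s \<Longrightarrow> (y2 has_real_derivative y2' s) (at s)" "\<And>s. 0 < s \<Longrightarrow> (y2' has_real_derivative y2'' s) (at s)"
    and ode1: "\<And>s. 0 < s \<Longrightarrow> s * y1'' s = (s - b) * y1' s + a * y1 s"
    and ode2: "\<And>s. 0 < s \<Longrightarrow> s * y2'' s = (s - b) * y2' s + a * y2 s"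
    and pos: "\<And>s. 0 < s \<Longrightarrow> 0 < y1 s"
    and lim1: "(y1 \<longlongrightarrow> L) (at_right 0)" "L \<noteq> 0" "((\<lambda>s. s powr b * y1' s) \<longlongrightarrow> 0) (at_right 0)"
    and lim2: "(y2 \<longlongrightarrow> 0) (at_right 0)" "((\<lambda>s. s powr b * y2' s) \<longlongrightarrow> 0) (at_right 0)"
    and s: "0 < s"
  shows "y2 s = 0"
proof -
  have const: "f s = l" if f: "\<And>s. 0 < s \<Longrightarrow> (f has_real_derivative 0) (at s)" and l: "(f \<longlongrightarrow> l) (at_right 0)" and s: "0 < s"
    for f :: "real \<Rightarrow> real" and l s
  proof -
    have "\<exists>c. \<forall>x\<in>{0<..}. f x = c"
      by (rule has_field_derivative_zero_constant) (auto intro: f has_field_derivative_at_within)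
    then obtain c where c: "\<And>x. 0 < x \<Longrightarrow> f x = c" by auto
    have "(f \<longlongrightarrow> c) (at_right 0)"
      by (intro tendsto_eventually eventually_at_right_0I c)
    then have "l = c" using l by (rule tendsto_unique[OF trivial_limit_at_right_real, rotated])
    then show ?thesis using c[OF s] by simp
  qed
  define Wr where "Wr s = s powr b * exp (- s) * (y1 s * y2' s - y1' s * y2 s)" for s
  have Wd: "(Wr has_real_derivative 0) (at s)" if s: "0 < s" for s
  proof -
    have "((\<lambda>s. s powr b * exp (- s) * (y1 s * y2' s - y1' s * y2 s)) has_real_derivative
       (b * s powr (b - 1) * exp (- s) + (exp (- s) * - 1) * s powr b) * (y1 s * y2' s - y1' s * y2 s)
       + ((y1' s * y2' s + y2'' s * y1 s) - (y1'' s * y2 s + y2' s * y1' s)) * (s powr b * exp (- s))) (at s)"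
    proof (intro DERIV_mult DERIV_diff d1 d2 s)
      show "((\<lambda>s. s powr b) has_real_derivative b * s powr (b - 1)) (at s)" using s by (auto intro!: derivative_eq_intros)
      show "((\<lambda>s. exp (- s)) has_real_derivative exp (- s) * - 1) (at s)" by (auto intro!: derivative_eq_intros)
    qed
    also have "(b * s powr (b - 1) * exp (- s) + (exp (- s) * - 1) * s powr b) * (y1 s * y2' s - y1' s * y2 s)
       + ((y1' s * y2' s + y2'' s * y1 s) - (y1'' s * y2 s + y2' s * y1' s)) * (s powr b * exp (- s)) = 0"
    proof -
      have p: "s powr b = s * s powr (b - 1)" using s powr_add[of s 1 "b - 1"] by simp
      have "(b * s powr (b - 1) * exp (- s) + (exp (- s) * - 1) * s powr b) * (y1 s * y2' s - y1' s * y2 s)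
         + ((y1' s * y2' s + y2'' s * y1 s) - (y1'' s * y2 s + y2' s * y1' s)) * (s powr b * exp (- s))
         = s powr (b - 1) * exp (- s) * ((b - s) * (y1 s * y2' s - y1' s * y2 s) + (s * y2'' s) * y1 s - (s * y1'' s) * y2 s)"
        unfolding p by (simp add: algebra_simps)
      also have "\<dots> = 0" unfolding ode1[OF s] ode2[OF s] by (simp add: algebra_simps)
      finally show ?thesis .
    qed
    finally show ?thesis by (simp add: Wr_def[abs_def])
  qed
  have Wl: "(Wr \<longlongrightarrow> 0) (at_right 0)"
  proof -
    have "((\<lambda>s. exp (- s) * (y1 s * (s powr b * y2' s) - (s powr b * y1' s) * y2 s)) \<longlongrightarrow> exp (- 0) * (L * 0 - 0 * 0)) (at_right 0)"
      by (intro tendsto_mult tendsto_diff tendsto_exp tendsto_minus tendsto_ident_at lim1 lim2)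
    then show ?thesis by (simp add: Wr_def[abs_def] algebra_simps)
  qed
  have W0: "y1 s * y2' s - y1' s * y2 s = 0" if "0 < s" for s
    using const[OF Wd Wl that] that by (simp add: Wr_def)
  have "((\<lambda>s. y2 s / y1 s) has_real_derivative 0) (at s)" if s: "0 < s" for s
  proof -
    have "((\<lambda>s. y2 s / y1 s) has_real_derivative (y2' s * y1 s - y2 s * y1' s) / (y1 s * y1 s)) (at s)"
      using pos[OF s] by (intro DERIV_divide d1 d2 s) auto
    moreover have "y2' s * y1 s - y2 s * y1' s = 0" using W0[OF s] by (simp add: mult.commute)
    ultimately show ?thesis by simp
  qed
  moreover have "((\<lambda>s. y2 s / y1 s) \<longlongrightarrow> 0 / L) (at_right 0)" by (intro tendsto_divide lim1 lim2)
  ultimately have "y2 s / y1 s = 0 / L" by (rule const[OF _ _ s])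
  then show ?thesis using pos[OF s] by simp
qed

section \<open>Connection between the solutions at 0 and the one recessive at infinity\<close>

text \<open>The second Frobenius solution of Kummer's equation at 0, with exponent
  \<open>1 - b\<close>; \<open>kB'\<close> is its derivative.\<close>

definition kB :: "real \<Rightarrow> real \<Rightarrow> real \<Rightarrow> real" where
  "kB a b s = s powr (1 - b) * kF (a + 1 - b) (2 - b) s"

definition kB' :: "real \<Rightarrow> real \<Rightarrow> real \<Rightarrow> real" where
  "kB' a b s = (1 - b) * s powr (- b) * kF (a + 1 - b) (2 - b) s + s powr (1 - b) * kD (a + 1 - b) (2 - b) s"

text \<open>The classical expression of \<open>U\<close> through the two solutions at 0, scaled so
  that every Gamma function has a positive argument. The difference \<open>y\<close> of the two
  sides solves Kummer's equation, and the Gamma factors are such that \<open>y\<close> and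
  \<open>s^b * y'\<close> both tend to 0 at 0, so the uniqueness lemma applies. The second identity
  is the derivative of the first.\<close>

theorem connection_formula:
  assumes a: "0 < a" and b: "0 < b" "b < 1" and s: "0 < s"
  defines "C \<equiv> Gamma (a + 1 - b) / (Gamma b * Gamma (1 - b))"
  shows "Gamma a / Gamma b * kF a b s - Gamma (a + 1 - b) / Gamma (2 - b) * kB a b s = C * jint a (b - a - 1) s"
    and "Gamma a / Gamma b * kD a b s - Gamma (a + 1 - b) / Gamma (2 - b) * kB' a b s = - (C * jint (a + 1) (b - a - 1) s)"
proof -
  define g1 where "g1 = Gamma a / Gamma b"
  define g2 where "g2 = Gamma (a + 1 - b) / Gamma (2 - b)"
  have a': "0 \<le> a" "0 \<le> a + 1 - b" "0 < 2 - b" and nu: "0 < a + 1 - b" using a b by auto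
  have Gp: "0 < Gamma a" "0 < Gamma b" "0 < Gamma (1 - b)" "0 < Gamma (a + 1 - b)" "0 < Gamma (2 - b)"
    using a b by (auto intro!: Gamma_real_pos)
  have g1: "0 < g1" using Gp by (simp add: g1_def)
  have gm: "b - a - 1 \<le> 0" using a b by simp
  define kB'' where "kB'' s = (1 - b) * (- b) * s powr (- b - 1) * kF (a + 1 - b) (2 - b) s
      + 2 * (1 - b) * s powr (- b) * kD (a + 1 - b) (2 - b) s + s powr (1 - b) * kD2 (a + 1 - b) (2 - b) s" for s
  have dB: "(kB a b has_real_derivative kB' a b s) (at s)" if s: "0 < s" for s
  proof -
    have "((\<lambda>s. s powr (1 - b) * kF (a + 1 - b) (2 - b) s) has_real_derivative
       (1 - b) * s powr (1 - b - 1) * kF (a + 1 - b) (2 - b) s + kD (a + 1 - b) (2 - b) s * s powr (1 - b)) (at s)"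
      by (intro DERIV_mult kF_deriv a') (use s in \<open>auto intro!: derivative_eq_intros\<close>)
    then show ?thesis by (simp add: kB_def[abs_def] kB'_def mult.commute)
  qed
  have dB': "(kB' a b has_real_derivative kB'' s) (at s)" if s: "0 < s" for s
  proof -
    have "((\<lambda>s. (1 - b) * s powr (- b) * kF (a + 1 - b) (2 - b) s + s powr (1 - b) * kD (a + 1 - b) (2 - b) s) has_real_derivative
       ((1 - b) * (- b * s powr (- b - 1)) * kF (a + 1 - b) (2 - b) s + kD (a + 1 - b) (2 - b) s * ((1 - b) * s powr (- b)))
       + ((1 - b) * s powr (1 - b - 1) * kD (a + 1 - b) (2 - b) s + kD2 (a + 1 - b) (2 - b) s * s powr (1 - b))) (at s)"
      by (intro DERIV_add DERIV_mult kF_deriv kD_deriv a' DERIV_cmult) (use s in \<open>auto intro!: derivative_eq_intros\<close>)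
    then show ?thesis by (simp add: kB'_def[abs_def] kB''_def algebra_simps)
  qed
  have odeB: "s * kB'' s = (s - b) * kB' a b s + a * kB a b s" if s: "0 < s" for s
  proof -
    have p: "s powr (- b - 1) = s powr (- b) / s" "s powr (1 - b) = s * s powr (- b)"
      using s powr_diff[of s "- b" 1] powr_add[of s 1 "- b"] by auto
    have e: "s * kD2 (a + 1 - b) (2 - b) s = (s - (2 - b)) * kD (a + 1 - b) (2 - b) s + (a + 1 - b) * kF (a + 1 - b) (2 - b) s"
      by (rule kummer_equation) (use a' in auto)
    have "s * kB'' s = s powr (- b) * ((1 - b) * (- b) * kF (a + 1 - b) (2 - b) s + 2 * (1 - b) * s * kD (a + 1 - b) (2 - b) s
        + s * (s * kD2 (a + 1 - b) (2 - b) s))"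
      unfolding kB''_def p using s by (simp add: field_simps)
    also have "\<dots> = (s - b) * kB' a b s + a * kB a b s"
      unfolding e kB'_def kB_def p by (simp add: algebra_simps)
    finally show ?thesis .
  qed
  define y where "y s = g1 * kF a b s - g2 * kB a b s - C * jint a (b - a - 1) s" for s
  define y' where "y' s = g1 * kD a b s - g2 * kB' a b s - C * (- jint (a + 1) (b - a - 1) s)" for s
  define y'' where "y'' s = g1 * kD2 a b s - g2 * kB'' s - C * (- (- jint (a + 1 + 1) (b - a - 1) s))" for s
  have dy: "(y has_real_derivative y' s) (at s)" if "0 < s" for s
    unfolding y_def[abs_def] y'_def using that a b gm a'
    by (intro DERIV_diff DERIV_cmult kF_deriv dB jint_deriv) auto
  have dy': "(y' has_real_derivative y'' s) (at s)" if "0 < s" for s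
    unfolding y'_def[abs_def] y''_def using that a b gm a'
    by (intro DERIV_diff DERIV_cmult kD_deriv dB' DERIV_minus jint_deriv) auto
  have odey: "s * y'' s = (s - b) * y' s + a * y s" if s: "0 < s" for s
  proof -
    have "s * y'' s = g1 * (s * kD2 a b s) - g2 * (s * kB'' s) - C * (s * jint (a + 1 + 1) (b - a - 1) s)"
      by (simp add: y''_def algebra_simps)
    also have "\<dots> = (s - b) * y' s + a * y s"
      unfolding kummer_equation[OF a'(1) b(1)] odeB[OF s] jint_relation[OF a gm s] y'_def y_def
      by (simp add: algebra_simps)
    finally show ?thesis .
  qed
  have cont0: "(f \<longlongrightarrow> f 0) (at_right 0)" if "(f has_real_derivative D) (at 0)" for f :: "real \<Rightarrow> real" and D
    using DERIV_isCont[OF that] by (simp add: isCont_def filterlim_at_split)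
  have lF: "(kF a b \<longlongrightarrow> 1) (at_right 0)" using cont0[OF kF_deriv[OF a'(1) b(1)]] kF_0[OF a'(1) b(1)] by simp
  have lD: "(kD a b \<longlongrightarrow> a / b) (at_right 0)" using cont0[OF kD_deriv[OF a'(1) b(1)]] kD_0[OF a'(1) b(1)] by simp
  have lF2: "(kF (a + 1 - b) (2 - b) \<longlongrightarrow> 1) (at_right 0)" using cont0[OF kF_deriv[OF a'(2,3)]] kF_0[OF a'(2,3)] by simp
  have lD2: "(kD (a + 1 - b) (2 - b) \<longlongrightarrow> (a + 1 - b) / (2 - b)) (at_right 0)" using cont0[OF kD_deriv[OF a'(2,3)]] kD_0[OF a'(2,3)] by simp
  have lp: "((\<lambda>s::real. s powr e) \<longlongrightarrow> 0) (at_right 0)" if "0 < e" for e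
  proof -
    have "((\<lambda>s::real. s powr e) \<longlongrightarrow> 0 powr e) (at_right 0)"
      using that by (intro tendsto_powr' tendsto_intros) (auto intro!: eventually_at_right_0I)
    then show ?thesis by simp
  qed
  have lB: "(kB a b \<longlongrightarrow> 0) (at_right 0)"
    unfolding kB_def[abs_def] using tendsto_mult[OF lp lF2, of "1 - b"] b by simp
  have lB': "((\<lambda>s. s powr b * kB' a b s) \<longlongrightarrow> 1 - b) (at_right 0)"
  proof -
    have "((\<lambda>s. (1 - b) * kF (a + 1 - b) (2 - b) s + s * kD (a + 1 - b) (2 - b) s) \<longlongrightarrow> (1 - b) * 1 + 0 * ((a + 1 - b) / (2 - b))) (at_right 0)"
      by (intro tendsto_add tendsto_mult tendsto_const tendsto_ident_at lF2 lD2)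
    then have "((\<lambda>s. (1 - b) * kF (a + 1 - b) (2 - b) s + s * kD (a + 1 - b) (2 - b) s) \<longlongrightarrow> 1 - b) (at_right 0)" by simp
    then show ?thesis
    proof (rule Lim_transform_eventually)
      show "\<forall>\<^sub>F s in at_right 0. (1 - b) * kF (a + 1 - b) (2 - b) s + s * kD (a + 1 - b) (2 - b) s = s powr b * kB' a b s"
        using eventually_at_right_less[of "0::real"]
      proof eventually_elim
        fix s :: real assume s: "0 < s"
        have "s powr b * s powr (- b) = 1" "s powr b * s powr (1 - b) = s" using s by (simp_all flip: powr_add)
        then show "(1 - b) * kF (a + 1 - b) (2 - b) s + s * kD (a + 1 - b) (2 - b) s = s powr b * kB' a b s"
          unfolding kB'_def distrib_left by (simp add: mult.assoc[symmetric] mult.commute[of "s powr b"])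
      qed
    qed
  qed
  have lJ: "((\<lambda>s. C * jint a (b - a - 1) s) \<longlongrightarrow> g1) (at_right 0)"
  proof -
    have "((\<lambda>s. 1 / (Gamma b * Gamma (1 - b)) * (Gamma (a + 1 - b) * jint a (b - a - 1) s)) \<longlongrightarrow> 1 / (Gamma b * Gamma (1 - b)) * (Gamma a * Gamma (1 - b))) (at_right 0)"
      by (intro tendsto_mult tendsto_const jint_limit_0 a b)
    then show ?thesis using Gp by (simp add: C_def g1_def)
  qed
  have ly: "(y \<longlongrightarrow> 0) (at_right 0)"
  proof -
    have "((\<lambda>s. g1 * kF a b s - g2 * kB a b s - C * jint a (b - a - 1) s) \<longlongrightarrow> g1 * 1 - g2 * 0 - g1) (at_right 0)"
      by (intro tendsto_diff tendsto_mult tendsto_const lF lB lJ)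
    then show ?thesis by (simp add: y_def[abs_def])
  qed
  have ly': "((\<lambda>s. s powr b * y' s) \<longlongrightarrow> 0) (at_right 0)"
  proof -
    have "((\<lambda>s. g1 * (s powr b * kD a b s) - g2 * (s powr b * kB' a b s) + C * (s powr b * jint (a + 1) (b - a - 1) s)) \<longlongrightarrow>
        g1 * (0 * (a / b)) - g2 * (1 - b) + C * Gamma b) (at_right 0)"
      by (intro tendsto_diff tendsto_add tendsto_mult tendsto_const lp lD lB' jint_limit_1 a b)
    \<comment> \<open>The singular parts of \<open>kB'\<close> and of \<open>jint (a + 1)\<close>,
      both of order \<open>s^(- b)\<close>, cancel by the recursion of the Gamma function at
      \<open>1 - b\<close>.\<close>
    moreover have "g2 * (1 - b) = C * Gamma b"
    proof -
      have "Gamma (2 - b) = (1 - b) * Gamma (1 - b)"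
      proof -
        have "1 - b \<notin> \<int>\<^sub>\<le>\<^sub>0" using b nonpos_Ints_nonpos[of "1 - b"] by force
        then show ?thesis using Gamma_plus1[of "1 - b"] by (simp add: add.commute)
      qed
      then show ?thesis using Gp b by (simp add: g2_def C_def less_imp_neq[symmetric])
    qed
    ultimately show ?thesis by (simp add: y'_def algebra_simps)
  qed
  have l1: "((\<lambda>s. g1 * kF a b s) \<longlongrightarrow> g1) (at_right 0)" using tendsto_mult[OF tendsto_const lF, of g1] by simp
  have l1': "((\<lambda>s. s powr b * (g1 * kD a b s)) \<longlongrightarrow> 0) (at_right 0)"
    using tendsto_mult[OF lp[OF b(1)] tendsto_mult[OF tendsto_const lD, of g1]] by simp
  have y0: "y s = 0" if "0 < s" for s
  proof (rule kummer_solution_unique[where ?y1.0 = "\<lambda>s. g1 * kF a b s" and y1' = "\<lambda>s. g1 * kD a b s"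
        and y1'' = "\<lambda>s. g1 * kD2 a b s" and ?y2.0 = y and y2' = y' and y2'' = y'' and b = b and a = a and L = g1])
    show "s * (g1 * kD2 a b s) = (s - b) * (g1 * kD a b s) + a * (g1 * kF a b s)" for s
    proof -
      have "s * (g1 * kD2 a b s) = g1 * (s * kD2 a b s)" by simp
      then show ?thesis unfolding kummer_equation[OF a'(1) b(1)] by (simp add: algebra_simps)
    qed
    show "0 < g1 * kF a b s" if "0 < s" for s using g1 kF_ge_1[OF a'(1) b(1), of s] that by simp
  qed (use dy dy' odey ly ly' l1 l1' g1 that a' b kF_deriv kD_deriv in \<open>auto intro!: DERIV_cmult\<close>)
  show "Gamma a / Gamma b * kF a b s - Gamma (a + 1 - b) / Gamma (2 - b) * kB a b s = C * jint a (b - a - 1) s"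
    using y0[OF s] by (simp add: y_def g1_def g2_def)
  have "(y has_real_derivative 0) (at s)"
    by (rule has_field_derivative_transform_within_open[of "\<lambda>_. 0" _ _ "{0<..}"]) (use s y0 in auto)
  then have "y' s = 0" using DERIV_unique[OF dy[OF s]] by simp
  then show "Gamma a / Gamma b * kD a b s - Gamma (a + 1 - b) / Gamma (2 - b) * kB' a b s = - (C * jint (a + 1) (b - a - 1) s)"
    by (simp add: y'_def g1_def g2_def)
qed

section \<open>Riccati equations of the logarithmic derivatives\<close>

text \<open>The equation of \<open>w = s * (1 - y' / y)\<close> for a solution \<open>y\<close> of
  Kummer's equation, with \<open>\<delta> = b - a\<close>.\<close>

locale riccati =
  fixes \<delta> b :: real and w :: "real \<Rightarrow> real"
  assumes riccati_deriv: "0 < s \<Longrightarrow> (w has_real_derivative (s * (\<delta> - w s) + (1 - b) * w s + (w s)\<^sup>2) / s) (at s)"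
    and riccati_pos: "0 < s \<Longrightarrow> 0 < w s" and b_less_1: "b < 1"
begin

text \<open>\<open>exp s * (w s - \<delta>)\<close> has derivative
  \<open>exp s * ((1 - b) * w s + (w s)^2) / s\<close>, which is positive; the level
  \<open>\<delta>\<close> is therefore crossed at most once, and upwards.\<close>

lemma riccati_crossing:
  assumes s: "0 < s0" "s0 < s" and le: "\<delta> \<le> w s0"
  shows "\<delta> < w s"
proof -
  have "exp s0 * (w s0 - \<delta>) < exp s * (w s - \<delta>)"
  proof (rule DERIV_pos_imp_increasing[OF s(2)])
    fix x assume "s0 \<le> x" "x \<le> s"
    then have x: "0 < x" using s by simp
    have "((\<lambda>s. exp s * (w s - \<delta>)) has_real_derivative
        exp x * (w x - \<delta>) + ((x * (\<delta> - w x) + (1 - b) * w x + (w x)\<^sup>2) / x - 0) * exp x) (at x)"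
      by (intro DERIV_mult DERIV_diff riccati_deriv x DERIV_const DERIV_exp)
    moreover have "exp x * (w x - \<delta>) + ((x * (\<delta> - w x) + (1 - b) * w x + (w x)\<^sup>2) / x - 0) * exp x
        = exp x * (((1 - b) * w x + (w x)\<^sup>2) / x)"
      using x by (simp add: field_simps)
    moreover have "0 < exp x * (((1 - b) * w x + (w x)\<^sup>2) / x)"
      using x riccati_pos[OF x] b_less_1 by (intro mult_pos_pos divide_pos_pos add_pos_pos) auto
    ultimately show "\<exists>y. ((\<lambda>s. exp s * (w s - \<delta>)) has_real_derivative y) (at x) \<and> 0 < y" by metis
  qed
  moreover have "0 \<le> exp s0 * (w s0 - \<delta>)" using le by simp
  ultimately have "0 < exp s * (w s - \<delta>)" by linarith
  then show ?thesis by (simp add: zero_less_mult_iff)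
qed

lemma riccati_isCont: "0 < s \<Longrightarrow> isCont w s"
  by (rule DERIV_isCont[OF riccati_deriv])

text \<open>As long as \<open>w\<close> stays below \<open>\<delta>\<close>, the quantity
  \<open>w s * s powr (b - 1)\<close> increases, so \<open>w\<close> grows at least like
  \<open>s powr (1 - b)\<close>.\<close>

lemma riccati_unbounded:
  assumes "0 < \<delta>"
  shows "\<exists>s>0. \<delta> \<le> w s"
proof (rule ccontr)
  assume "\<not> ?thesis"
  then have less: "w s < \<delta>" if "0 < s" for s using that by force
  \<comment> \<open>The point at which the lower bound \<open>w 1 * s powr (1 - b)\<close> reaches
    \<open>\<delta>\<close>.\<close>
  define s where "s = (\<delta> / w 1) powr (1 / (1 - b))"
  have w1: "0 < w 1" "w 1 < \<delta>" using riccati_pos less by auto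
  have s1: "1 < s" unfolding s_def using w1 b_less_1 by (intro gr_one_powr) auto
  have "w 1 * 1 powr (b - 1) < w s * s powr (b - 1)"
  proof (rule DERIV_pos_imp_increasing[OF s1])
    fix x assume "1 \<le> x" "x \<le> s"
    then have x: "0 < x" by simp
    have d: "((\<lambda>s. w s * s powr (b - 1)) has_real_derivative
        ((x * (\<delta> - w x) + (1 - b) * w x + (w x)\<^sup>2) / x) * x powr (b - 1) + ((b - 1) * x powr (b - 1 - 1)) * w x) (at x)"
      by (intro DERIV_mult riccati_deriv x) (use x in \<open>auto intro!: derivative_eq_intros\<close>)
    have pw: "x powr (b - 1 - 1) = x powr (b - 1) / x" using x powr_diff[of x "b - 1" 1] by simp
    have e: "((x * (\<delta> - w x) + (1 - b) * w x + (w x)\<^sup>2) / x) * x powr (b - 1) + ((b - 1) * x powr (b - 1 - 1)) * w x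
        = x powr (b - 1) * ((x * (\<delta> - w x) + (w x)\<^sup>2) / x)"
      unfolding pw using x by (simp add: field_simps power2_eq_square)
    have "0 < x powr (b - 1) * ((x * (\<delta> - w x) + (w x)\<^sup>2) / x)"
      using x riccati_pos[OF x] less[OF x] by (intro mult_pos_pos divide_pos_pos add_pos_pos) auto
    then show "\<exists>y. ((\<lambda>s. w s * s powr (b - 1)) has_real_derivative y) (at x) \<and> 0 < y" using d[unfolded e] by blast
  qed
  then have "w 1 < w s * s powr (b - 1)" by simp
  also have "s powr (b - 1) = w 1 / \<delta>"
  proof -
    have "1 / (1 - b) * (b - 1) = - 1" using b_less_1 by (simp add: field_simps)
    then have "s powr (b - 1) = (\<delta> / w 1) powr (- 1)" by (simp add: s_def powr_powr)
    then show ?thesis using w1 by (simp add: powr_minus_divide)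
  qed
  finally have "\<delta> < w s" using w1 assms by (simp add: field_simps)
  then show False using less[of s] s1 by simp
qed

end

lemma riccati_of_kummer:
  fixes y y' :: "real \<Rightarrow> real"
  assumes s: "0 < s" and y: "y s \<noteq> 0"
    and d: "(y has_real_derivative y' s) (at s)" "(y' has_real_derivative y'') (at s)"
    and ode: "s * y'' = (s - b) * y' s + a * y s"
  defines "u \<equiv> s * (1 - y' s / y s)"
  shows "((\<lambda>s. s * (1 - y' s / y s)) has_real_derivative (s * ((b - a) - u) + (1 - b) * u + u\<^sup>2) / s) (at s)"
proof -
  define m where "m = y' s / y s"
  have "((\<lambda>s. s * (1 - y' s / y s)) has_real_derivative
      1 * (1 - y' s / y s) + (0 - (y'' * y s - y' s * y' s) / (y s * y s)) * s) (at s)"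
    by (intro DERIV_mult DERIV_diff DERIV_const DERIV_divide DERIV_ident d y)
  moreover have "1 * (1 - y' s / y s) + (0 - (y'' * y s - y' s * y' s) / (y s * y s)) * s
      = (s * ((b - a) - u) + (1 - b) * u + u\<^sup>2) / s"
  proof -
    have e1: "(y'' * y s - y' s * y' s) / (y s * y s) * s = (s * y'') / y s - s * m\<^sup>2"
      using y by (simp add: m_def field_simps power2_eq_square)
    have e2: "(s * y'') / y s = (s - b) * m + a" unfolding ode using y by (simp add: m_def field_simps)
    have "s * (1 - m - ((s - b) * m + a - s * m\<^sup>2)) = s * ((b - a) - u) + (1 - b) * u + u\<^sup>2"
      unfolding u_def m_def[symmetric] by (simp add: algebra_simps power2_eq_square)
    then have "1 - m - ((s - b) * m + a - s * m\<^sup>2) = (s * ((b - a) - u) + (1 - b) * u + u\<^sup>2) / s"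
      using s by (simp add: field_simps)
    then show ?thesis using e1 e2 by (simp add: m_def algebra_simps)
  qed
  ultimately show ?thesis by simp
qed

section \<open>Bounds and comparison for the two ratios\<close>

text \<open>For \<open>f x = exp (- s) * kF a b s\<close> with \<open>s = x^2 / (2 * r)\<close> this
  is \<open>- x * f' / (2 * f)\<close>. The Tricomi ratio is the same expression for
  \<open>jint a (b - a - 1)\<close>, whose derivative is
  \<open>- jint (a + 1) (b - a - 1)\<close>.\<close>

definition kummer_ratio :: "real \<Rightarrow> real \<Rightarrow> real \<Rightarrow> real" where
  "kummer_ratio a b s = s * (1 - kD a b s / kF a b s)"

definition tricomi_ratio :: "real \<Rightarrow> real \<Rightarrow> real \<Rightarrow> real" where
  "tricomi_ratio a b s = s * (1 + jint (a + 1) (b - a - 1) s / jint a (b - a - 1) s)"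

lemma kF_pos: "0 \<le> a \<Longrightarrow> 0 < b \<Longrightarrow> 0 \<le> s \<Longrightarrow> 0 < kF a b s"
  using kF_ge_1[of a b s] by simp

lemma kummer_ratio_pos:
  assumes "0 \<le> a" "a < b" "0 < b" "0 < s"
  shows "0 < kummer_ratio a b s"
  using kD_less_kF[of a b s] kF_pos[of a b s] assms by (simp add: kummer_ratio_def)

lemma kummer_ratio_le:
  assumes "0 \<le> a" "a \<le> b" "0 < b" "0 \<le> s"
  shows "kummer_ratio a b s \<le> s * ((b - a) / b)"
proof -
  have p: "0 < kF a b s" using kF_pos assms by auto
  have "1 - kD a b s / kF a b s = (kF a b s - kD a b s) / kF a b s" using p by (simp add: field_simps)
  also have "\<dots> \<le> (b - a) / b" using kD_upper(2)[of a b s] p assms by (simp add: pos_divide_le_eq)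
  finally show ?thesis unfolding kummer_ratio_def using assms by (intro mult_left_mono) auto
qed

text \<open>With the companion bounds, each ratio is pinned to its argument as \<open>a\<close>
  tends to 0; since the errors are linear in \<open>a\<close>, the later sign conditions reduce to
  affine inequalities.\<close>

lemma kummer_ratio_ge:
  assumes "0 \<le> a" "a \<le> b" "0 < b" "0 \<le> s"
  shows "s - a * (s / b * exp s) \<le> kummer_ratio a b s"
proof -
  have p: "1 \<le> kF a b s" using kF_ge_1 assms by auto
  have "kD a b s / kF a b s \<le> kD a b s / 1" using p kD_nonneg[of a b s] assms by (intro divide_left_mono) auto
  also have "\<dots> \<le> a / b * exp s" using kD_upper(1)[of a b s] assms by simp
  finally have "s * (1 - a / b * exp s) \<le> s * (1 - kD a b s / kF a b s)" using assms by (intro mult_left_mono) auto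
  then show ?thesis by (simp add: kummer_ratio_def algebra_simps)
qed

lemma tricomi_ratio_ge:
  assumes "0 < a" "b < 1" "0 < s"
  shows "s \<le> tricomi_ratio a b s"
proof (cases "b - a - 1 \<le> 0")
  case True
  then have "0 < jint a (b - a - 1) s" "0 < jint (a + 1) (b - a - 1) s" using assms by (auto intro!: jint_pos)
  then show ?thesis unfolding tricomi_ratio_def using assms by simp
qed (use assms in simp)

lemma riccati_kummer_ratio:
  assumes "0 < a" "a < b" "b < 1"
  shows "riccati (b - a) b (kummer_ratio a b)"
proof
  show "(kummer_ratio a b has_real_derivative (s * ((b - a) - kummer_ratio a b s) + (1 - b) * kummer_ratio a b s + (kummer_ratio a b s)\<^sup>2) / s) (at s)"
    if "0 < s" for s
    unfolding kummer_ratio_def[abs_def]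
  proof (rule riccati_of_kummer)
    show "kF a b s \<noteq> 0" using kF_pos[of a b s] assms that by simp
    show "s * kD2 a b s = (s - b) * kD a b s + a * kF a b s" by (rule kummer_equation) (use assms in auto)
  qed (use that assms in \<open>auto intro!: kF_deriv kD_deriv\<close>)
qed (use assms kummer_ratio_pos in auto)

lemma riccati_tricomi_ratio:
  assumes "0 < a" "a < b" "b < 1"
  shows "riccati (b - a) b (tricomi_ratio a b)"
proof
  have g: "b - a - 1 \<le> 0" using assms by simp
  have e: "tricomi_ratio a b = (\<lambda>s. s * (1 - (- jint (a + 1) (b - a - 1) s) / jint a (b - a - 1) s))"
    by (simp add: tricomi_ratio_def fun_eq_iff)
  show "(tricomi_ratio a b has_real_derivative (s * ((b - a) - tricomi_ratio a b s) + (1 - b) * tricomi_ratio a b s + (tricomi_ratio a b s)\<^sup>2) / s) (at s)"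
    if "0 < s" for s
    unfolding e
  proof (rule riccati_of_kummer)
    show "jint a (b - a - 1) s \<noteq> 0" using jint_pos[of a "b - a - 1" s] assms that by simp
    show "s * (- (- jint (a + 1 + 1) (b - a - 1) s)) = (s - b) * (- jint (a + 1) (b - a - 1) s) + a * jint a (b - a - 1) s"
      using jint_relation[OF assms(1) g that] by simp
    show "((\<lambda>s. - jint (a + 1) (b - a - 1) s) has_real_derivative - (- jint (a + 1 + 1) (b - a - 1) s)) (at s)"
      using assms g that by (intro DERIV_minus jint_deriv) auto
  qed (use that assms g in \<open>auto intro!: jint_deriv\<close>)
  show "0 < tricomi_ratio a b s" if "0 < s" for s using tricomi_ratio_ge[of a b s] assms that by simp
qed (use assms in auto)

text \<open>The weight in \<open>Z\<close> below is chosen so that all terms of the Riccati equations that do not contain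
  \<open>(1 - \<theta>)\<close> cancel in its derivative.\<close>

lemma ratio_comparison:
  assumes a: "0 < a" "a < b" "b < 1" and \<theta>: "0 < \<theta>" "\<theta> < 1" and s0: "0 < s0"
    and eq: "kummer_ratio a b s0 = b - a" "tricomi_ratio a b (\<theta> * s0) = b - a"
    and s: "0 < s" "s \<noteq> s0"
  shows "kummer_ratio a b s < tricomi_ratio a b (\<theta> * s)"
proof -
  interpret u: riccati "b - a" b "kummer_ratio a b" by (rule riccati_kummer_ratio[OF a])
  interpret v: riccati "b - a" b "tricomi_ratio a b" by (rule riccati_tricomi_ratio[OF a])
  define u where "u = kummer_ratio a b"
  define v where "v s = tricomi_ratio a b (\<theta> * s)" for s
  define J where "J = jint a (b - a - 1)"
  define M where "M s = kF a b s * J (\<theta> * s) * (s powr (b - 1) * exp (- (\<theta> * s)))" for s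
  define Z where "Z s = (v s - u s) * M s" for s
  have g: "b - a - 1 \<le> 0" using a by simp
  have Jp: "0 < J (\<theta> * s)" if "0 < s" for s unfolding J_def using that \<theta> a g by (intro jint_pos) auto
  have Mp: "0 < M s" if "0 < s" for s using that Jp[OF that] kF_pos[of a b s] a by (simp add: M_def)
  have dZ: "(Z has_real_derivative M s * ((1 - \<theta>) * (v s - (b - a)))) (at s)" if s: "0 < s" for s
  proof -
    have ts: "0 < \<theta> * s" using s \<theta> by simp
    have lin: "((\<lambda>s. \<theta> * s) has_real_derivative \<theta>) (at s)" by (auto intro!: derivative_eq_intros)
    define v' where "v' = ((\<theta> * s) * ((b - a) - v s) + (1 - b) * v s + (v s)\<^sup>2) / (\<theta> * s) * \<theta>"
    define u' where "u' = (s * ((b - a) - u s) + (1 - b) * u s + (u s)\<^sup>2) / s"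
    define M' where "M' = (kD a b s * J (\<theta> * s) + (- jint (a + 1) (b - a - 1) (\<theta> * s) * \<theta>) * kF a b s) * (s powr (b - 1) * exp (- (\<theta> * s)))
        + (((b - 1) * s powr (b - 1 - 1)) * exp (- (\<theta> * s)) + (exp (- (\<theta> * s)) * - \<theta>) * s powr (b - 1)) * (kF a b s * J (\<theta> * s))"
    have dv: "(v has_real_derivative v') (at s)"
      using DERIV_chain2[OF v.riccati_deriv[OF ts] lin] unfolding v_def[abs_def] v'_def .
    have du: "(u has_real_derivative u') (at s)" using u.riccati_deriv[OF s] unfolding u_def u'_def .
    have dJ: "((\<lambda>s. J (\<theta> * s)) has_real_derivative - jint (a + 1) (b - a - 1) (\<theta> * s) * \<theta>) (at s)"
      unfolding J_def by (rule DERIV_chain2[OF jint_deriv[OF a(1) g ts] lin])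
    have dM: "(M has_real_derivative M') (at s)"
      unfolding M_def[abs_def] M'_def
    proof (intro DERIV_mult dJ)
      show "(kF a b has_real_derivative kD a b s) (at s)" using a by (intro kF_deriv) auto
      show "((\<lambda>s. s powr (b - 1)) has_real_derivative (b - 1) * s powr (b - 1 - 1)) (at s)"
        using s by (auto intro!: derivative_eq_intros)
      show "((\<lambda>s. exp (- (\<theta> * s))) has_real_derivative exp (- (\<theta> * s)) * - \<theta>) (at s)"
        by (auto intro!: derivative_eq_intros)
    qed
    have kp: "0 < kF a b s" using kF_pos[of a b s] a s by simp
    have kd: "kD a b s = kF a b s * (1 - u s / s)" using kp s by (simp add: u_def kummer_ratio_def)
    have jd: "jint (a + 1) (b - a - 1) (\<theta> * s) = J (\<theta> * s) * (v s / (\<theta> * s) - 1)"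
      using Jp[OF s] s \<theta> unfolding v_def tricomi_ratio_def J_def by simp
    have pw: "s powr (b - 1 - 1) = s powr (b - 1) / s" using s powr_diff[of s "b - 1" 1] by simp
    have M'e: "M' = M s * ((1 - u s / s) - (v s / (\<theta> * s) - 1) * \<theta> + (b - 1) / s - \<theta>)"
      unfolding M'_def kd jd pw M_def by (simp add: algebra_simps)
    have "(v' - u') + (v s - u s) * ((1 - u s / s) - (v s / (\<theta> * s) - 1) * \<theta> + (b - 1) / s - \<theta>) = (1 - \<theta>) * (v s - (b - a))"
      unfolding v'_def u'_def using s \<theta> by (simp add: field_simps power2_eq_square)
    then have "M s * (v' - u') + (v s - u s) * M' = M s * ((1 - \<theta>) * (v s - (b - a)))"
      unfolding M'e by (metis (no_types, opaque_lifting) distrib_left mult.left_commute)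
    moreover have "(Z has_real_derivative (v' - u') * M s + M' * (v s - u s)) (at s)"
      unfolding Z_def[abs_def] by (intro DERIV_mult DERIV_diff dv du dM)
    ultimately show ?thesis by (simp add: mult.commute)
  qed
  have Z0: "Z s0 = 0" using eq by (simp add: Z_def u_def v_def)
  \<comment> \<open>The Tricomi ratio crosses \<open>b - a\<close> upwards at \<open>s0\<close>, so
    \<open>Z\<close> decreases before \<open>s0\<close> and increases after it: its value 0 there is
    a strict minimum.\<close>
  have "0 < Z s"
  proof (cases "s0 < s")
    case True
    have vs: "b - a < v x" if "s0 < x" for x
      unfolding v_def using v.riccati_crossing[of "\<theta> * s0" "\<theta> * x"] that s0 \<theta> eq by simp
    have "Z s0 < Z s"
    proof (rule DERIV_pos_imp_increasing_open[OF True])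
      show "\<exists>y. (Z has_real_derivative y) (at x) \<and> 0 < y" if "s0 < x" "x < s" for x
        using dZ[of x] vs[of x] Mp[of x] that s0 \<theta> by (intro exI[of _ "M x * ((1 - \<theta>) * (v x - (b - a)))"] conjI) auto
      show "continuous_on {s0..s} Z"
        using dZ[OF order.strict_trans2[OF s0]] by (intro DERIV_atLeastAtMost_imp_continuous_on) blast
    qed
    then show ?thesis using Z0 by simp
  next
    case False
    then have l: "s < s0" using s by simp
    have vs: "v x < b - a" if "0 < x" "x < s0" for x
      unfolding v_def using v.riccati_crossing[of "\<theta> * x" "\<theta> * s0"] that s0 \<theta> eq by force
    have "Z s0 < Z s"
    proof (rule DERIV_neg_imp_decreasing_open[OF l])
      show "\<exists>y. (Z has_real_derivative y) (at x) \<and> y < 0" if "s < x" "x < s0" for x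
        using dZ[of x] vs[of x] Mp[of x] that s \<theta> by (intro exI[of _ "M x * ((1 - \<theta>) * (v x - (b - a)))"] conjI) (auto intro!: mult_pos_neg)
      show "continuous_on {s..s0} Z"
        using dZ[OF order.strict_trans2[OF s(1)]] by (intro DERIV_atLeastAtMost_imp_continuous_on) blast
    qed
    then show ?thesis using Z0 by simp
  qed
  then show ?thesis using Mp[OF s(1)] by (simp add: Z_def u_def v_def zero_less_mult_iff)
qed

section \<open>Dependence on the parameter and existence of the coincidence\<close>

text \<open>Raising \<open>a\<close> in both exponents multiplies the integrand by a nonnegative
  power of \<open>t / (1 + t)\<close>, hence by at most 1; the integrand at the smallest parameter
  dominates all the others.\<close>

lemma jf_antimono_param:
  assumes "a1 \<le> a"
  shows "jf (a + k) (c - a) s t \<le> jf (a1 + k) (c - a1) s t"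
proof (cases "0 < t")
  case True
  have e: "t powr (a + k - 1) = t powr (a1 + k - 1) * t powr (a - a1)"
    "(1 + t) powr (c - a) = (1 + t) powr (c - a1) / (1 + t) powr (a - a1)"
    using True powr_add[of t "a1 + k - 1" "a - a1"] powr_diff[of "1 + t" "c - a1" "a - a1"] by (simp_all add: algebra_simps)
  have "t powr (a - a1) \<le> (1 + t) powr (a - a1)" using True assms by (intro powr_mono2) auto
  then have "t powr (a - a1) / (1 + t) powr (a - a1) \<le> 1" using True by (simp add: divide_le_eq_1)
  then have "exp (- (s * t)) * t powr (a1 + k - 1) * (1 + t) powr (c - a1) * (t powr (a - a1) / (1 + t) powr (a - a1))
      \<le> exp (- (s * t)) * t powr (a1 + k - 1) * (1 + t) powr (c - a1) * 1"
    by (intro mult_left_mono) auto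
  then show ?thesis using True unfolding jf_def e by (simp add: mult_ac)
qed (simp add: jf_def)

lemma jint_continuous_param:
  assumes "0 \<le> k" "c \<le> 0" "0 < s"
  shows "continuous_on {0<..} (\<lambda>a. jint (a + k) (c - a) s)"
  unfolding continuous_on_eq_continuous_at[OF open_greaterThan]
proof
  fix a0 :: real assume "a0 \<in> {0<..}"
  then have a0: "0 < a0" by simp
  define a1 where "a1 = a0 / 2"
  have a1: "0 < a1" "a1 < a0" using a0 by (auto simp: a1_def)
  have "continuous_on {a1..} (\<lambda>a. jint (a + k) (c - a) s)"
  proof (rule continuous_on_sequentiallyI)
    fix u a assume u: "\<forall>n. u n \<in> {a1..}" "a \<in> {a1..}" "u \<longlonglongrightarrow> a"
    show "(\<lambda>n. jint (u n + k) (c - u n) s) \<longlonglongrightarrow> jint (a + k) (c - a) s"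
      unfolding jint_def
    proof (rule integral_dominated_convergence[where w = "jf (a1 + k) (c - a1) s"])
      show "integrable lborel (jf (a1 + k) (c - a1) s)" using a1 assms by (intro jf_integrable) auto
      show "AE t in lborel. norm (jf (u n + k) (c - u n) s t) \<le> jf (a1 + k) (c - a1) s t" for n
        using jf_antimono_param[of a1 "u n" k c s] u(1) jf_nonneg by auto
      show "AE t in lborel. (\<lambda>n. jf (u n + k) (c - u n) s t) \<longlonglongrightarrow> jf (a + k) (c - a) s t"
      proof (rule AE_I2)
        fix t :: real
        show "(\<lambda>n. jf (u n + k) (c - u n) s t) \<longlonglongrightarrow> jf (a + k) (c - a) s t"
        proof (cases "0 < t")
          case True
          have "(\<lambda>n. exp (- (s * t)) * t powr (u n + k - 1) * (1 + t) powr (c - u n)) \<longlonglongrightarrow> exp (- (s * t)) * t powr (a + k - 1) * (1 + t) powr (c - a)"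
            using True by (intro tendsto_intros u) auto
          then show ?thesis using True by (simp add: jf_def)
        qed (simp add: jf_def)
      qed
    qed auto
  qed
  then show "isCont (\<lambda>a. jint (a + k) (c - a) s) a0"
    by (rule continuous_on_interior) (use a1 in simp)
qed

lemma kummer_ratio_continuous_param:
  assumes "0 < b" "0 < s"
  shows "continuous_on {0<..b} (\<lambda>a. kummer_ratio a b s)"
proof -
  have "continuous_on {0<..b} (\<lambda>a. kF a b s)" "continuous_on {0<..b} (\<lambda>a. kD a b s)"
    using kF_continuous_param[OF assms(1), of s] by (auto elim!: continuous_on_subset)
  then show ?thesis unfolding kummer_ratio_def
    using kF_pos[of _ b s] assms by (intro continuous_intros) (auto simp: less_imp_neq[symmetric])
qed

lemma tricomi_ratio_continuous_param:
  assumes "b < 1" "0 < s"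
  shows "continuous_on {0<..b} (\<lambda>a. tricomi_ratio a b s)"
proof -
  have e: "b - a - 1 = b - 1 - a" for a by simp
  have "continuous_on {0<..b} (\<lambda>a. jint (a + 0) (b - 1 - a) s)" "continuous_on {0<..b} (\<lambda>a. jint (a + 1) (b - 1 - a) s)"
    using jint_continuous_param[of 0 "b - 1" s] jint_continuous_param[of 1 "b - 1" s] assms by (auto elim!: continuous_on_subset)
  then have c: "continuous_on {0<..b} (\<lambda>a. jint a (b - a - 1) s)" "continuous_on {0<..b} (\<lambda>a. jint (a + 1) (b - a - 1) s)"
    unfolding e by simp_all
  have "jint a (b - a - 1) s \<noteq> 0" if "a \<in> {0<..b}" for a
    using jint_pos[of a "b - a - 1" s] that assms by auto
  then show ?thesis unfolding tricomi_ratio_def by (intro continuous_intros c) auto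
qed

text \<open>Comparison with the integrand at \<open>a = 0\<close>, which is at most
  \<open>exp (- s * t)\<close>, gives a bound independent of \<open>a\<close>.\<close>

lemma jint_upper:
  assumes "0 < a" "b - a - 1 \<le> 0" "b \<le> 1" "0 < s"
  shows "jint (a + 1) (b - a - 1) s \<le> 1 / s"
proof -
  have "ennreal (jint (a + 1) (b - a - 1) s) = (\<integral>\<^sup>+t. ennreal (jf (a + 1) (b - a - 1) s t) \<partial>lborel)"
    unfolding jint_def using assms by (intro nn_integral_eq_integral[symmetric] jf_integrable) (auto simp: jf_nonneg)
  also have "\<dots> \<le> (\<integral>\<^sup>+t. (if 0 < t then ennreal (exp (- (s * t)) * t powr (1 - 1)) else 0) \<partial>lborel)"
  proof (intro nn_integral_mono)
    fix t :: real
    have "jf (a + 1) (b - 1 - a) s t \<le> jf (0 + 1) (b - 1 - 0) s t" using assms by (intro jf_antimono_param) auto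
    also have "\<dots> \<le> exp (- (s * t)) * 1" if "0 < t"
      using that assms powr_mono[of "b - 1" 0 "1 + t"] by (auto simp: jf_def)
    finally show "ennreal (jf (a + 1) (b - a - 1) s t) \<le> (if 0 < t then ennreal (exp (- (s * t)) * t powr (1 - 1)) else 0)"
      by (auto simp: jf_def algebra_simps intro!: ennreal_leI)
  qed
  also have "\<dots> = ennreal (Gamma 1 / s powr 1)" using assms by (intro nn_integral_gamma_scaled) auto
  finally show ?thesis using assms by (simp add: ennreal_le_iff)
qed

text \<open>The integral in the numerator stays below \<open>1 / s\<close>, while the one in the
  denominator is at least \<open>exp (- s) / (2 * a)\<close>.\<close>

lemma tricomi_ratio_le:
  assumes "0 < a" "a \<le> b" "b < 1" "0 < s"
  shows "tricomi_ratio a b s \<le> s + a * (2 * exp s)"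
proof -
  have g: "b - a - 1 \<le> 0" using assms by simp
  have "exp (- s) * 2 powr (-1) / a \<le> exp (- s) * 2 powr (b - a - 1) / a"
    using assms by (intro divide_right_mono mult_left_mono powr_mono) auto
  also have "\<dots> \<le> jint a (b - a - 1) s" by (rule jint_lower[OF assms(1) g assms(4)])
  finally have l: "exp (- s) / (2 * a) \<le> jint a (b - a - 1) s" by (simp add: powr_minus_divide)
  have "jint (a + 1) (b - a - 1) s / jint a (b - a - 1) s \<le> (1 / s) / (exp (- s) / (2 * a))"
    using jint_upper[OF assms(1) g _ assms(4)] l assms by (intro frac_le) auto
  also have "\<dots> = a * (2 * exp s) / s" using assms by (simp add: exp_minus field_simps)
  finally have "s * (1 + jint (a + 1) (b - a - 1) s / jint a (b - a - 1) s) \<le> s * (1 + a * (2 * exp s) / s)"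
    using assms by (intro mult_left_mono add_left_mono) auto
  then show ?thesis using assms by (simp add: tricomi_ratio_def distrib_left)
qed

lemma eventually_affine_pos:
  fixes A B :: real
  assumes "0 < A"
  shows "\<forall>\<^sub>F a in at_right 0. 0 < A + a * B"
proof -
  have "((\<lambda>a. A + a * B) \<longlongrightarrow> A + 0 * B) (at_right 0)" by (intro tendsto_intros)
  then show ?thesis using assms by (auto dest: order_tendstoD)
qed

text \<open>Intermediate values in \<open>a\<close>: near 0 the Kummer ratio is close to
  \<open>s\<close> and the Tricomi ratio close to the smaller \<open>\<theta> * s\<close>, the
  reverse of the order assumed at \<open>B\<close>.\<close>

lemma exists_ratio_match:
  assumes b: "b < 1" and \<theta>: "0 < \<theta>" "\<theta> < 1" and s: "0 < s" and B: "0 < B" "B \<le> b"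
    and less: "kummer_ratio B b s < tricomi_ratio B b (\<theta> * s)"
  shows "\<exists>a. 0 < a \<and> a < B \<and> kummer_ratio a b s = tricomi_ratio a b (\<theta> * s)"
proof -
  have b0: "0 < b" using B by simp
  have ts: "0 < \<theta> * s" using \<theta> s by simp
  have "0 < (1 - \<theta>) * s" using \<theta> s by simp
  then have "\<forall>\<^sub>F a in at_right 0. 0 < (1 - \<theta>) * s + a * (- (s / b * exp s) - 2 * exp (\<theta> * s))"
    by (rule eventually_affine_pos)
  moreover have "\<forall>\<^sub>F a in at_right 0. a < B" using B by (auto simp: eventually_at_right)
  moreover have "\<forall>\<^sub>F a in at_right 0. (0::real) < a" by (rule eventually_at_right_less)
  ultimately have "\<forall>\<^sub>F a in at_right 0. 0 < a \<and> a < B \<and> 0 < (1 - \<theta>) * s + a * (- (s / b * exp s) - 2 * exp (\<theta> * s))"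
    by eventually_elim simp
  then obtain a0 where a0: "0 < a0" "a0 < B" "0 < (1 - \<theta>) * s + a0 * (- (s / b * exp s) - 2 * exp (\<theta> * s))"
    using eventually_happens[of _ "at_right (0::real)"] by (auto simp: trivial_limit_at_right_real)
  have "tricomi_ratio a0 b (\<theta> * s) - kummer_ratio a0 b s \<le> 0"
    using tricomi_ratio_le[of a0 b "\<theta> * s"] kummer_ratio_ge[of a0 b s] a0 B b ts s b0 by (simp add: algebra_simps)
  moreover have "0 \<le> tricomi_ratio B b (\<theta> * s) - kummer_ratio B b s" using less by simp
  moreover have "continuous_on {a0..B} (\<lambda>a. tricomi_ratio a b (\<theta> * s) - kummer_ratio a b s)"
    by (rule continuous_on_subset[of "{0<..b}"], intro continuous_on_diff tricomi_ratio_continuous_param kummer_ratio_continuous_param b b0 s ts)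
      (use a0 B in auto)
  ultimately obtain a where a: "a0 \<le> a" "a \<le> B" "tricomi_ratio a b (\<theta> * s) - kummer_ratio a b s = 0"
    using IVT'[of "\<lambda>a. tricomi_ratio a b (\<theta> * s) - kummer_ratio a b s" a0 0 B] a0 by auto
  then show ?thesis using a0 less by (intro exI[of _ a]) (auto simp: order.order_iff_strict)
qed

text \<open>Connectedness in \<open>a\<close> replaces a study of how the crossing points move.
  \<open>U\<close> collects the parameters for which some \<open>s\<close> has the Kummer ratio
  above and the Tricomi ratio below \<open>b - a\<close>, and \<open>W\<close> those with the
  opposite. Both are open and nonempty, and single upward crossing makes them disjoint, so some
  parameter lies in neither; for it the two crossings coincide.\<close>

lemma exists_double_match:
  assumes b: "0 < b" "b < 1" and \<theta>: "0 < \<theta>" "\<theta> < 1"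
  shows "\<exists>a s. 0 < a \<and> a < b \<and> 0 < s \<and> kummer_ratio a b s = b - a \<and> tricomi_ratio a b (\<theta> * s) = b - a"
proof -
  define I where "I = {0<..<b}"
  define U where "U = (\<Union>s\<in>{0<..}. {a\<in>I. b - a < kummer_ratio a b s \<and> tricomi_ratio a b (\<theta> * s) < b - a})"
  define W where "W = (\<Union>s\<in>{0<..}. {a\<in>I. kummer_ratio a b s < b - a \<and> b - a < tricomi_ratio a b (\<theta> * s)})"
  have cu: "continuous_on I (\<lambda>a. kummer_ratio a b s)" if "0 < s" for s
    by (rule continuous_on_subset[OF kummer_ratio_continuous_param[OF b(1) that]]) (auto simp: I_def)
  have cv: "continuous_on I (\<lambda>a. tricomi_ratio a b s)" if "0 < s" for s
    by (rule continuous_on_subset[OF tricomi_ratio_continuous_param[OF b(2) that]]) (auto simp: I_def)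
  have oI: "open I" by (simp add: I_def)
  have open2: "open {a\<in>I. f a < g a \<and> h a < k a}"
    if "continuous_on I f" "continuous_on I g" "continuous_on I h" "continuous_on I k" for f g h k :: "real \<Rightarrow> real"
  proof -
    have "open (I \<inter> (\<lambda>a. g a - f a) -` {0<..})" "open (I \<inter> (\<lambda>a. k a - h a) -` {0<..})"
      by (intro continuous_open_preimage continuous_on_diff that oI open_greaterThan)+
    then have "open ((I \<inter> (\<lambda>a. g a - f a) -` {0<..}) \<inter> (I \<inter> (\<lambda>a. k a - h a) -` {0<..}))" by (rule open_Int)
    moreover have "(I \<inter> (\<lambda>a. g a - f a) -` {0<..}) \<inter> (I \<inter> (\<lambda>a. k a - h a) -` {0<..}) = {a\<in>I. f a < g a \<and> h a < k a}" by auto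
    ultimately show ?thesis by simp
  qed
  have oU: "open U" unfolding U_def using \<theta>
    by (intro open_UN ballI open2 cu cv continuous_intros) auto
  have oW: "open W" unfolding W_def using \<theta>
    by (intro open_UN ballI open2 cu cv continuous_intros) auto
  have Un: "I \<inter> U \<noteq> {}"
  proof -
    \<comment> \<open>The mean of \<open>b\<close> and \<open>b / \<theta>\<close>: for small
      \<open>a\<close> the ratios are close to \<open>s > b\<close> and to
      \<open>\<theta> * s < b\<close>.\<close>
    define s where "s = b * ((1 + 1 / \<theta>) / 2)"
    have "1 < (1 + 1 / \<theta>) / 2" "\<theta> * ((1 + 1 / \<theta>) / 2) < 1" using \<theta> by (simp_all add: field_simps)
    then have s: "b < s" "\<theta> * s < b" using b mult_strict_left_mono[of 1 "(1 + 1 / \<theta>) / 2" b] mult_strict_left_mono[of "\<theta> * ((1 + 1 / \<theta>) / 2)" 1 b]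
      by (simp_all add: s_def mult_ac)
    have "\<forall>\<^sub>F a in at_right 0. 0 < (s - b) + a * (- (s / b * exp s) + 1)" by (rule eventually_affine_pos) (use s in simp)
    moreover have "\<forall>\<^sub>F a in at_right 0. 0 < (b - \<theta> * s) + a * (- 1 - 2 * exp (\<theta> * s))" by (rule eventually_affine_pos) (use s in simp)
    moreover have "\<forall>\<^sub>F a in at_right 0. a < b" using b by (auto simp: eventually_at_right)
    moreover have "\<forall>\<^sub>F a in at_right 0. (0::real) < a" by (rule eventually_at_right_less)
    ultimately have "\<forall>\<^sub>F a in at_right 0. 0 < a \<and> a < b \<and> 0 < (s - b) + a * (- (s / b * exp s) + 1) \<and> 0 < (b - \<theta> * s) + a * (- 1 - 2 * exp (\<theta> * s))"
      by eventually_elim simp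
    then obtain a where a: "0 < a" "a < b" "0 < (s - b) + a * (- (s / b * exp s) + 1)" "0 < (b - \<theta> * s) + a * (- 1 - 2 * exp (\<theta> * s))"
      using eventually_happens[of _ "at_right (0::real)"] by (auto simp: trivial_limit_at_right_real)
    have s0: "0 < s" "0 < \<theta> * s" using s b \<theta> by auto
    have "b - a < kummer_ratio a b s" using kummer_ratio_ge[of a b s] a s0 b by (simp add: algebra_simps)
    moreover have "tricomi_ratio a b (\<theta> * s) < b - a" using tricomi_ratio_le[of a b "\<theta> * s"] a s0 b by (simp add: algebra_simps)
    ultimately show ?thesis using a s0 by (auto simp: U_def I_def)
  qed
  have Wn: "I \<inter> W \<noteq> {}"
  proof -
    \<comment> \<open>So close to \<open>b\<close> that \<open>b - a\<close> is below
      \<open>\<theta> * (b / 2)\<close>, a lower bound of the Tricomi ratio for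
      \<open>s = b / 2\<close>, where the Kummer ratio is at most
      \<open>(b - a) / 2\<close>.\<close>
    define a where "a = b - b * \<theta> / 4"
    have t: "b * \<theta> < b * 1" "0 < b * \<theta>" using b \<theta> by (auto intro!: mult_strict_left_mono)
    then have a: "0 < a" "a < b" "b - a < \<theta> * (b / 2)" using \<theta> by (auto simp: a_def mult.commute)
    have "kummer_ratio a b (b / 2) \<le> b / 2 * ((b - a) / b)" using a b by (intro kummer_ratio_le) auto
    also have "\<dots> < b - a" using a b by simp
    finally have "kummer_ratio a b (b / 2) < b - a" .
    moreover have "b - a < tricomi_ratio a b (\<theta> * (b / 2))" using tricomi_ratio_ge[of a b "\<theta> * (b / 2)"] a b \<theta> by simp
    ultimately have "a \<in> W" unfolding W_def using a b by (intro UN_I[of "b / 2"]) (auto simp: I_def)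
    then show ?thesis using a by (auto simp: I_def)
  qed
  have disj: "U \<inter> W \<inter> I = {}"
  proof (rule ccontr)
    assume "U \<inter> W \<inter> I \<noteq> {}"
    then obtain a s s' where a: "0 < a" "a < b" and s: "0 < s" "0 < s'"
      and u: "b - a < kummer_ratio a b s" "kummer_ratio a b s' < b - a"
      and v: "tricomi_ratio a b (\<theta> * s) < b - a" "b - a < tricomi_ratio a b (\<theta> * s')"
      by (auto simp: U_def W_def I_def)
    interpret u: riccati "b - a" b "kummer_ratio a b" by (rule riccati_kummer_ratio[OF a b(2)])
    interpret v: riccati "b - a" b "tricomi_ratio a b" by (rule riccati_tricomi_ratio[OF a b(2)])
    have "\<not> s < s'" using u.riccati_crossing[of s s'] u s by auto
    moreover have "\<not> s' < s" using v.riccati_crossing[of "\<theta> * s'" "\<theta> * s"] v s \<theta> by auto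
    ultimately have "s = s'" by simp
    then show False using u by simp
  qed
  have "connected I" by (simp add: I_def)
  then have "\<not> I \<subseteq> U \<union> W" using connectedD[OF _ oU oW disj] Un Wn by auto
  then obtain a where aI: "a \<in> I" and nU: "a \<notin> U" and nW: "a \<notin> W" by auto
  then have a: "0 < a" "a < b" by (auto simp: I_def)
  interpret u: riccati "b - a" b "kummer_ratio a b" by (rule riccati_kummer_ratio[OF a b(2)])
  interpret v: riccati "b - a" b "tricomi_ratio a b" by (rule riccati_tricomi_ratio[OF a b(2)])
  obtain sh where sh: "0 < sh" "b - a \<le> kummer_ratio a b sh" using u.riccati_unbounded a by auto
  have "kummer_ratio a b (b / 2) \<le> b / 2 * ((b - a) / b)" using a b by (intro kummer_ratio_le) auto
  also have "\<dots> < b - a" using a b by simp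
  finally have lo: "kummer_ratio a b (b / 2) < b - a" .
  have "b / 2 \<le> sh" using u.riccati_crossing[of sh "b / 2"] sh lo by (cases "b / 2 \<le> sh") auto
  moreover have "continuous_on {b / 2..sh} (kummer_ratio a b)"
    using u.riccati_isCont b by (intro continuous_at_imp_continuous_on) auto
  ultimately have "\<exists>s\<ge>b / 2. s \<le> sh \<and> kummer_ratio a b s = b - a"
    using lo sh by (intro IVT') auto
  then obtain s where s: "b / 2 \<le> s" "kummer_ratio a b s = b - a" by blast
  have s0: "0 < s" "0 < \<theta> * s" using s b \<theta> by auto
  have c: "isCont (\<lambda>x. tricomi_ratio a b (\<theta> * x)) s"
    by (rule isCont_o2[where f = "\<lambda>x. \<theta> * x" and g = "tricomi_ratio a b"]) (auto intro!: v.riccati_isCont s0 continuous_intros)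
  \<comment> \<open>Otherwise a point slightly to the right of the Kummer crossing would put
    \<open>a\<close> into \<open>U\<close>; in the opposite case one slightly to the left would put
    it into \<open>W\<close>.\<close>
  have "\<not> tricomi_ratio a b (\<theta> * s) < b - a"
  proof
    assume "tricomi_ratio a b (\<theta> * s) < b - a"
    then have "\<forall>\<^sub>F x in at s. tricomi_ratio a b (\<theta> * x) < b - a" using c by (auto simp: isCont_def dest: order_tendstoD)
    then have "\<forall>\<^sub>F x in at_right s. tricomi_ratio a b (\<theta> * x) < b - a" by (simp add: eventually_at_split)
    moreover have "\<forall>\<^sub>F x in at_right s. s < x" by (rule eventually_at_right_less)
    ultimately have "\<forall>\<^sub>F x in at_right s. s < x \<and> tricomi_ratio a b (\<theta> * x) < b - a" by eventually_elim simp
    then obtain x where x: "s < x" "tricomi_ratio a b (\<theta> * x) < b - a"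
      using eventually_happens[of _ "at_right s"] by (auto simp: trivial_limit_at_right_real)
    then have "b - a < kummer_ratio a b x" using u.riccati_crossing[OF s0(1) x(1)] s by simp
    then show False using nU x s0 aI by (auto simp: U_def)
  qed
  moreover have "\<not> b - a < tricomi_ratio a b (\<theta> * s)"
  proof
    assume "b - a < tricomi_ratio a b (\<theta> * s)"
    then have "\<forall>\<^sub>F x in at s. b - a < tricomi_ratio a b (\<theta> * x)" using c by (auto simp: isCont_def dest: order_tendstoD)
    then have "\<forall>\<^sub>F x in at_left s. b - a < tricomi_ratio a b (\<theta> * x)" by (simp add: eventually_at_split)
    moreover have "\<forall>\<^sub>F x in at_left s. x \<in> {0<..<s}" by (rule eventually_at_leftI[OF _ s0(1)]) simp
    ultimately have "\<forall>\<^sub>F x in at_left s. x \<in> {0<..<s} \<and> b - a < tricomi_ratio a b (\<theta> * x)" by eventually_elim simp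
    then obtain x where x: "0 < x" "x < s" "b - a < tricomi_ratio a b (\<theta> * x)"
      using eventually_happens[of _ "at_left s"] by (auto simp: trivial_limit_at_left_real)
    then have "kummer_ratio a b x < b - a" using u.riccati_crossing[OF x(1,2)] s by force
    then show False using nW x aI by (auto simp: W_def)
  qed
  ultimately have "tricomi_ratio a b (\<theta> * s) = b - a" by simp
  then show ?thesis using a s0(1) s(2) by blast
qed

section \<open>The positive eigenfunction\<close>

lemma gauss_profile_deriv:
  assumes "(y has_real_derivative y') (at (x\<^sup>2 / (2 * r)))" "0 < r"
  shows "((\<lambda>x. exp (- (x\<^sup>2 / (2 * r))) * y (x\<^sup>2 / (2 * r))) has_real_derivative
      x / r * exp (- (x\<^sup>2 / (2 * r))) * (y' - y (x\<^sup>2 / (2 * r)))) (at x)"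
proof -
  have d: "((\<lambda>x. x\<^sup>2 / (2 * r)) has_real_derivative x / r) (at x)"
    using assms(2) by (auto intro!: derivative_eq_intros)
  have "((\<lambda>x. exp (- (x\<^sup>2 / (2 * r))) * y (x\<^sup>2 / (2 * r))) has_real_derivative
      (exp (- (x\<^sup>2 / (2 * r))) * - (x / r)) * y (x\<^sup>2 / (2 * r)) + (y' * (x / r)) * exp (- (x\<^sup>2 / (2 * r)))) (at x)"
    by (intro DERIV_mult DERIV_chain2[OF DERIV_exp] DERIV_minus d DERIV_chain2[where f = y and g = "\<lambda>x. x\<^sup>2 / (2 * r)", OF assms(1) d])
  then show ?thesis by (simp add: algebra_simps diff_divide_distrib)
qed

text \<open>Within one phase \<open>x^n * (y' - y)\<close> is, up to a constant factor, the flux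
  \<open>p * f'\<close> of \<open>f = exp (- s) * y\<close>; this is the eigenvalue equation
  \<open>(p * f')' = (2 * a - n) * W * f\<close>.\<close>

lemma gauss_flux_deriv:
  fixes y y' :: "real \<Rightarrow> real"
  defines "s \<equiv> \<lambda>x r. x\<^sup>2 / (2 * r)"
  assumes r: "0 < r" and x: "0 < x"
    and d: "(y has_real_derivative y' (s x r)) (at (s x r))" "(y' has_real_derivative y'') (at (s x r))"
    and ode: "s x r * y'' = (s x r - n / 2) * y' (s x r) + a * y (s x r)"
  shows "((\<lambda>x. x powr n * (y' (s x r) - y (s x r))) has_real_derivative (2 * a - n) * x powr (n - 1) * y (s x r)) (at x)"
proof -
  have ds: "((\<lambda>x. s x r) has_real_derivative x / r) (at x)"
    unfolding s_def using r by (auto intro!: derivative_eq_intros)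
  have "((\<lambda>x. x powr n * (y' (s x r) - y (s x r))) has_real_derivative
      (n * x powr (n - 1)) * (y' (s x r) - y (s x r)) + (y'' * (x / r) - y' (s x r) * (x / r)) * x powr n) (at x)"
    by (intro DERIV_mult DERIV_diff DERIV_chain2[OF d(1) ds] DERIV_chain2[OF d(2) ds])
      (use x in \<open>auto intro!: derivative_eq_intros\<close>)
  moreover have "(n * x powr (n - 1)) * (y' (s x r) - y (s x r)) + (y'' * (x / r) - y' (s x r) * (x / r)) * x powr n
      = x powr (n - 1) * (n * (y' (s x r) - y (s x r)) + 2 * (s x r * y'') - 2 * s x r * y' (s x r))"
  proof -
    have p: "x powr n = x * x powr (n - 1)" using x powr_add[of x 1 "n - 1"] by simp
    have q: "x / r * x = 2 * s x r" using r by (simp add: s_def power2_eq_square)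
    have "(y'' * (x / r) - y' (s x r) * (x / r)) * x powr n = (y'' - y' (s x r)) * (x / r * x) * x powr (n - 1)"
      unfolding p by (simp add: algebra_simps)
    then show ?thesis unfolding q by (simp add: algebra_simps)
  qed
  moreover have "n * (y' (s x r) - y (s x r)) + 2 * (s x r * y'') - 2 * s x r * y' (s x r) = (2 * a - n) * y (s x r)"
    unfolding ode by (simp add: algebra_simps)
  ultimately show ?thesis by (simp add: mult_ac)
qed

lemma nn_integral_FTC_tail:
  fixes F f :: "real \<Rightarrow> real"
  assumes x: "0 < x" "0 < c" and cont: "continuous_on {x..} F" and f[measurable]: "f \<in> borel_measurable borel"
    and der: "\<And>t. x < t \<Longrightarrow> t \<noteq> c \<Longrightarrow> (F has_real_derivative f t) (at t)"
    and nonneg: "\<And>t. x < t \<Longrightarrow> 0 \<le> f t" and lim: "(F \<longlongrightarrow> T) at_top"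
  shows "(\<integral>\<^sup>+t. (if x < t then ennreal (f t) else 0) \<partial>lborel) = ennreal (T - F x)"
proof -
  define m where "m = max x c + 1"
  have m: "x < m" "c < m" by (auto simp: m_def)
  have A: "(\<integral>\<^sup>+t. (if x < t \<and> t < m then ennreal (f t) else 0) \<partial>lborel) = ennreal (F m - F x)"
    using m der nonneg continuous_on_subset[OF cont, of "{x..m}"] by (intro nn_integral_FTC_open[of x m "{c}"]) auto
  have B: "(\<integral>\<^sup>+t. ennreal (f t) * indicator {m..} t \<partial>lborel) = ennreal (T - F m)"
    using m der nonneg lim by (intro nn_integral_FTC_atLeast) auto
  have mono: "F u \<le> F v" if "x \<le> u" "u \<le> v" for u v
  proof -
    have "(f has_integral (F v - F u)) {u..v}"
      using that der continuous_on_subset[OF cont, of "{u..v}"]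
      by (intro fundamental_theorem_of_calculus_interior_strong[of "{c}"])
         (auto simp: has_real_derivative_iff_has_vector_derivative)
    then have "(f has_integral (F v - F u)) {u<..<v}" by (simp add: has_integral_Icc_iff_Ioo)
    then have "0 \<le> F v - F u" by (rule has_integral_nonneg) (use nonneg that in auto)
    then show ?thesis by simp
  qed
  have "F m \<le> T"
    by (rule tendsto_lowerbound[OF lim]) (use mono m in \<open>auto simp: eventually_at_top_linorder intro!: exI[of _ m]\<close>)
  have "(\<integral>\<^sup>+t. (if x < t then ennreal (f t) else 0) \<partial>lborel)
     = (\<integral>\<^sup>+t. (if x < t \<and> t < m then ennreal (f t) else 0) + ennreal (f t) * indicator {m..} t \<partial>lborel)"
    using m by (intro nn_integral_cong) (auto simp: indicator_def)
  also have "\<dots> = ennreal (F m - F x) + ennreal (T - F m)"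
    unfolding A[symmetric] B[symmetric] by (rule nn_integral_add) measurable
  also have "\<dots> = ennreal (T - F x)"
    using mono[of x m] m \<open>F m \<le> T\<close> by (simp flip: ennreal_plus)
  finally show ?thesis .
qed

lemma jint_measurable [measurable]: "jint \<alpha> \<gamma> \<in> borel_measurable borel"
proof -
  have "case_prod (jf \<alpha> \<gamma>) \<in> borel_measurable (borel \<Otimes>\<^sub>M lborel)" unfolding jf_def by measurable
  then show ?thesis unfolding jint_def[abs_def] by (rule lborel.borel_measurable_lebesgue_integral)
qed

lemma jint_antimono:
  assumes "0 < \<alpha>" "\<gamma> \<le> 0" "0 < s" "s \<le> s'"
  shows "jint \<alpha> \<gamma> s' \<le> jint \<alpha> \<gamma> s"
  unfolding jint_def
proof (rule integral_mono)
  show "jf \<alpha> \<gamma> s' t \<le> jf \<alpha> \<gamma> s t" for t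
    using assms by (auto simp: jf_def intro!: mult_right_mono)
qed (use assms in \<open>auto intro!: jf_integrable\<close>)

locale matched_profile = two_phase +
  fixes a :: real
  assumes a: "0 < a" "a < n / 2"
    and ratios_match: "kummer_ratio a (n / 2) (c\<^sup>2 / (2 * r1)) = tricomi_ratio a (n / 2) (c\<^sup>2 / (2 * r2))"
begin

definition J0 :: "real \<Rightarrow> real" where "J0 = jint a (n / 2 - a - 1)"

definition J1 :: "real \<Rightarrow> real" where "J1 = jint (a + 1) (n / 2 - a - 1)"

definition f1 :: "real \<Rightarrow> real" where "f1 x = exp (- (x\<^sup>2 / (2 * r1))) * kF a (n / 2) (x\<^sup>2 / (2 * r1))"

definition f2 :: "real \<Rightarrow> real" where "f2 x = exp (- (x\<^sup>2 / (2 * r2))) * J0 (x\<^sup>2 / (2 * r2))"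

definition g1 :: "real \<Rightarrow> real" where
  "g1 x = x powr n * (kD a (n / 2) (x\<^sup>2 / (2 * r1)) - kF a (n / 2) (x\<^sup>2 / (2 * r1)))"

definition g2 :: "real \<Rightarrow> real" where
  "g2 x = x powr n * (- J1 (x\<^sup>2 / (2 * r2)) - J0 (x\<^sup>2 / (2 * r2)))"

text \<open>The constant quotient of \<open>exp (Phi x)\<close> and
  \<open>exp (x^2 / (2 * r2))\<close> beyond \<open>c\<close>.\<close>

definition E :: real where "E = exp (c\<^sup>2 / (2 * r1) - c\<^sup>2 / (2 * r2))"

text \<open>Both pieces are normalised to 1 at \<open>c\<close>, so continuity is built in and only
  the flux remains to be matched.\<close>

definition \<phi> :: "real \<Rightarrow> real" where "\<phi> x = (if x \<le> c then f1 x / f1 c else f2 x / f2 c)"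

text \<open>Equals \<open>p * \<phi>'\<close> for positive \<open>x\<close> off \<open>c\<close>,
  with the exponentials already cancelled.\<close>

definition flux :: "real \<Rightarrow> real" where "flux x = (if x \<le> c then g1 x / (r1 * f1 c) else E * g2 x / (r2 * f2 c))"

lemma b01: "0 < n / 2" "n / 2 < 1" "0 \<le> a" "a \<le> n / 2" "n / 2 - a - 1 \<le> 0" "0 < r2"
  using n a r by auto

lemma s_pos: "0 < x \<Longrightarrow> 0 < r \<Longrightarrow> 0 < x\<^sup>2 / (2 * r)" for x r :: real by simp

lemma J0_pos: "0 < s \<Longrightarrow> 0 < J0 s" unfolding J0_def by (intro jint_pos a b01)

lemma J1_pos: "0 < s \<Longrightarrow> 0 < J1 s" unfolding J1_def using a by (intro jint_pos b01) auto

lemma J0_deriv: "0 < s \<Longrightarrow> (J0 has_real_derivative - J1 s) (at s)"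
  unfolding J0_def J1_def by (intro jint_deriv a b01)

lemma J1_deriv: "0 < s \<Longrightarrow> ((\<lambda>s. - J1 s) has_real_derivative - (- jint (a + 1 + 1) (n / 2 - a - 1) s)) (at s)"
  unfolding J1_def using a by (intro DERIV_minus jint_deriv b01) auto

lemma f1_pos: "0 < f1 x"
  unfolding f1_def using kF_pos[OF b01(3,1), of "x\<^sup>2 / (2 * r1)"] r by simp

lemma f2_pos: "0 < x \<Longrightarrow> 0 < f2 x"
  unfolding f2_def using J0_pos[OF s_pos[OF _ b01(6)]] by simp

lemma f1_deriv: "(f1 has_real_derivative x / r1 * exp (- (x\<^sup>2 / (2 * r1))) *
    (kD a (n / 2) (x\<^sup>2 / (2 * r1)) - kF a (n / 2) (x\<^sup>2 / (2 * r1)))) (at x)"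
  unfolding f1_def[abs_def] by (intro gauss_profile_deriv kF_deriv b01 r)

lemma f2_deriv: "0 < x \<Longrightarrow> (f2 has_real_derivative x / r2 * exp (- (x\<^sup>2 / (2 * r2))) *
    (- J1 (x\<^sup>2 / (2 * r2)) - J0 (x\<^sup>2 / (2 * r2)))) (at x)"
  unfolding f2_def[abs_def] by (intro gauss_profile_deriv J0_deriv s_pos b01)

lemma g1_deriv: "0 < x \<Longrightarrow> (g1 has_real_derivative (2 * a - n) * x powr (n - 1) * kF a (n / 2) (x\<^sup>2 / (2 * r1))) (at x)"
  unfolding g1_def[abs_def]
  by (rule gauss_flux_deriv[OF r(1) _ kF_deriv[OF b01(3,1)] kD_deriv[OF b01(3,1)] kummer_equation[OF b01(3,1)]])

lemma g2_deriv:
  assumes "0 < x"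
  shows "(g2 has_real_derivative (2 * a - n) * x powr (n - 1) * J0 (x\<^sup>2 / (2 * r2))) (at x)"
proof -
  note s = s_pos[OF assms b01(6)]
  have "((\<lambda>x. x powr n * ((\<lambda>s. - J1 s) (x\<^sup>2 / (2 * r2)) - J0 (x\<^sup>2 / (2 * r2)))) has_real_derivative (2 * a - n) * x powr (n - 1) * J0 (x\<^sup>2 / (2 * r2))) (at x)"
    by (rule gauss_flux_deriv[OF b01(6) assms J0_deriv[OF s] J1_deriv[OF s]])
      (use jint_relation[OF a(1) b01(5) s] in \<open>simp add: J0_def J1_def\<close>)
  then show ?thesis unfolding g2_def[abs_def] .
qed

text \<open>After elimination of \<open>r1\<close> and \<open>r2\<close> the two sides are the
  Kummer and the Tricomi ratio at \<open>c\<close>, each times the same factor.\<close>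

lemma flux_match: "g1 c / (r1 * f1 c) = E * g2 c / (r2 * f2 c)"
proof -
  define s1 s2 where "s1 = c\<^sup>2 / (2 * r1)" "s2 = c\<^sup>2 / (2 * r2)"
  have s: "0 < s1" "0 < s2" using c r by (auto simp: s1_s2_def)
  have kp: "0 < kF a (n / 2) s1" using kF_pos[OF b01(3,1)] s by simp
  have jp: "0 < J0 s2" using J0_pos s by simp
  have rr: "r1 = c\<^sup>2 / (2 * s1)" "r2 = c\<^sup>2 / (2 * s2)" using c r by (auto simp: s1_s2_def)
  have "g1 c / (r1 * f1 c) = - (2 * c powr n * exp s1 / c\<^sup>2) * kummer_ratio a (n / 2) s1"
    unfolding g1_def f1_def kummer_ratio_def s1_s2_def(1)[symmetric] unfolding rr(1) using kp s c
    by (simp add: exp_minus field_simps)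
  moreover have "E * g2 c / (r2 * f2 c) = - (2 * c powr n * exp s1 / c\<^sup>2) * tricomi_ratio a (n / 2) s2"
    unfolding g2_def f2_def E_def tricomi_ratio_def s1_s2_def[symmetric] J0_def[symmetric] J1_def[symmetric] unfolding rr(2) using jp s c
    by (simp add: exp_minus exp_diff field_simps)
  ultimately show ?thesis using ratios_match by (simp add: s1_s2_def)
qed

lemma W_phi:
  assumes "0 < x"
  shows "W x * \<phi> x = (if x \<le> c then x powr (n - 1) * kF a (n / 2) (x\<^sup>2 / (2 * r1)) / (r1 * f1 c)
     else E * (x powr (n - 1) * J0 (x\<^sup>2 / (2 * r2))) / (r2 * f2 c))"
proof (cases "x \<le> c")
  case True
  then show ?thesis by (simp add: W_def p_def Phi_def ell_def \<phi>_def f1_def[of x] exp_minus)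
next
  case False
  have "exp (Phi x) = E * exp (x\<^sup>2 / (2 * r2))"
    using False by (simp add: Phi_def E_def diff_divide_distrib flip: exp_add)
  then show ?thesis using False by (simp add: W_def p_def ell_def \<phi>_def f2_def[of x] exp_minus)
qed

lemma flux_P:
  assumes "0 < x"
  shows "P x * flux x = (if x \<le> c then x / r1 * exp (- (x\<^sup>2 / (2 * r1))) *
      (kD a (n / 2) (x\<^sup>2 / (2 * r1)) - kF a (n / 2) (x\<^sup>2 / (2 * r1))) / f1 c
     else x / r2 * exp (- (x\<^sup>2 / (2 * r2))) * (- J1 (x\<^sup>2 / (2 * r2)) - J0 (x\<^sup>2 / (2 * r2))) / f2 c)"
proof -
  have pw: "x powr n = x * x powr (n - 1)" using assms powr_add[of x 1 "n - 1"] by simp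
  have q: "0 < x powr (n - 1)" using assms by simp
  have E: "0 < E" by (simp add: E_def)
  show ?thesis
  proof (cases "x \<le> c")
    case True
    then show ?thesis using q unfolding flux_def g1_def pw by (simp add: p_def Phi_def exp_minus divide_simps)
  next
    case False
    have "exp (Phi x) = E * exp (x\<^sup>2 / (2 * r2))"
      using False by (simp add: Phi_def E_def diff_divide_distrib flip: exp_add)
    then show ?thesis using q False E unfolding flux_def g2_def pw by (simp add: p_def exp_minus divide_simps)
  qed
qed

lemma flux_deriv:
  assumes "0 < x" "x \<noteq> c"
  shows "(flux has_real_derivative - (n - 2 * a) * (W x * \<phi> x)) (at x)"
proof (cases "x < c")
  case True
  have "((\<lambda>x. g1 x / (r1 * f1 c)) has_real_derivative (2 * a - n) * x powr (n - 1) * kF a (n / 2) (x\<^sup>2 / (2 * r1)) / (r1 * f1 c)) (at x)"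
    by (intro DERIV_cdivide g1_deriv assms)
  then have "(flux has_real_derivative (2 * a - n) * x powr (n - 1) * kF a (n / 2) (x\<^sup>2 / (2 * r1)) / (r1 * f1 c)) (at x)"
    by (rule has_field_derivative_transform_within_open[of _ _ _ "{..<c}"]) (use True in \<open>auto simp: flux_def\<close>)
  then show ?thesis using True by (simp add: W_phi[OF assms(1)] algebra_simps)
next
  case False
  then have c: "c < x" using assms by simp
  have "((\<lambda>x. E * g2 x / (r2 * f2 c)) has_real_derivative E * ((2 * a - n) * x powr (n - 1) * J0 (x\<^sup>2 / (2 * r2))) / (r2 * f2 c)) (at x)"
    by (intro DERIV_cdivide DERIV_cmult g2_deriv assms)
  then have "(flux has_real_derivative E * ((2 * a - n) * x powr (n - 1) * J0 (x\<^sup>2 / (2 * r2))) / (r2 * f2 c)) (at x)"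
    by (rule has_field_derivative_transform_within_open[of _ _ _ "{c<..}"]) (use c in \<open>auto simp: flux_def\<close>)
  moreover have "E * ((2 * a - n) * x powr (n - 1) * J0 (x\<^sup>2 / (2 * r2))) / (r2 * f2 c) = - (n - 2 * a) * (W x * \<phi> x)"
    using c by (simp add: W_phi[OF assms(1)] algebra_simps)
  ultimately show ?thesis by simp
qed

lemma phi_deriv:
  assumes "0 < x" "x \<noteq> c"
  shows "(\<phi> has_real_derivative P x * flux x) (at x)"
proof (cases "x < c")
  case True
  have "((\<lambda>x. f1 x / f1 c) has_real_derivative P x * flux x) (at x)"
    using DERIV_cdivide[OF f1_deriv[of x], of "f1 c"] True unfolding flux_P[OF assms(1)] by simp
  then show ?thesis
    by (rule has_field_derivative_transform_within_open[of _ _ _ "{..<c}"]) (use True in \<open>auto simp: \<phi>_def\<close>)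
next
  case False
  then have c: "c < x" using assms by simp
  have "((\<lambda>x. f2 x / f2 c) has_real_derivative P x * flux x) (at x)"
    using DERIV_cdivide[OF f2_deriv[OF assms(1)], of "f2 c"] c unfolding flux_P[OF assms(1)] by simp
  then show ?thesis
    by (rule has_field_derivative_transform_within_open[of _ _ _ "{c<..}"]) (use c in \<open>auto simp: \<phi>_def\<close>)
qed

lemma flux_continuous: "continuous_on {0..} flux"
proof -
  have c1: "continuous_on {0..c} (\<lambda>x. g1 x / (r1 * f1 c))"
  proof -
    have kc: "continuous_on UNIV (kF a (n / 2))" "continuous_on UNIV (kD a (n / 2))"
      using kF_deriv[OF b01(3,1)] kD_deriv[OF b01(3,1)] by (auto intro!: continuous_at_imp_continuous_on DERIV_isCont)
    show ?thesis unfolding g1_def using n r f1_pos[of c]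
      by (intro continuous_intros continuous_on_powr' continuous_on_compose2[OF kc(1)] continuous_on_compose2[OF kc(2)]) auto
  qed
  have c2: "continuous_on {c..} (\<lambda>x. E * g2 x / (r2 * f2 c))"
  proof (rule continuous_at_imp_continuous_on, rule ballI)
    fix x assume "x \<in> {c..}"
    then have "0 < x" using c by simp
    then show "isCont (\<lambda>x. E * g2 x / (r2 * f2 c)) x"
      by (intro DERIV_isCont[OF DERIV_cdivide[OF DERIV_cmult[OF g2_deriv]]])
  qed
  have "continuous_on ({0..c} \<union> {c..}) flux"
    unfolding flux_def[abs_def] by (rule continuous_on_If) (use c1 c2 flux_match in auto)
  moreover have "{0..c} \<union> {c..} = {0..}" using c by auto
  ultimately show ?thesis by simp
qed

lemma phi_continuous: "continuous_on {0..} \<phi>"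
proof -
  have c1: "continuous_on {0..c} (\<lambda>x. f1 x / f1 c)"
    by (rule continuous_at_imp_continuous_on) (intro ballI DERIV_isCont[OF DERIV_cdivide[OF f1_deriv]])
  have c2: "continuous_on {c..} (\<lambda>x. f2 x / f2 c)"
  proof (rule continuous_at_imp_continuous_on, rule ballI)
    fix x assume "x \<in> {c..}"
    then have "0 < x" using c by simp
    then show "isCont (\<lambda>x. f2 x / f2 c) x" by (intro DERIV_isCont[OF DERIV_cdivide[OF f2_deriv]])
  qed
  have "continuous_on ({0..c} \<union> {c..}) \<phi>"
    unfolding \<phi>_def[abs_def] by (rule continuous_on_If) (use c1 c2 f1_pos[of c] f2_pos[OF c] in auto)
  moreover have "{0..c} \<union> {c..} = {0..}" using c by auto
  ultimately show ?thesis by simp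
qed

lemma phi_measurable [measurable]: "\<phi> \<in> borel_measurable borel"
proof -
  have "continuous_on UNIV f1" using f1_deriv by (intro continuous_at_imp_continuous_on ballI DERIV_isCont)
  then have [measurable]: "f1 \<in> borel_measurable borel" by (rule borel_measurable_continuous_onI)
  have [measurable]: "f2 \<in> borel_measurable borel" unfolding f2_def[abs_def] J0_def by measurable
  show ?thesis unfolding \<phi>_def[abs_def] by measurable
qed

lemma flux_measurable [measurable]: "flux \<in> borel_measurable borel"
proof -
  have kc: "continuous_on UNIV (kF a (n / 2))" "continuous_on UNIV (kD a (n / 2))"
    using kF_deriv[OF b01(3,1)] kD_deriv[OF b01(3,1)] by (auto intro!: continuous_at_imp_continuous_on DERIV_isCont)
  note [measurable] = kc[THEN borel_measurable_continuous_onI]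
  have [measurable]: "g1 \<in> borel_measurable borel" "g2 \<in> borel_measurable borel"
    unfolding g1_def[abs_def] g2_def[abs_def] J0_def J1_def by measurable
  show ?thesis unfolding flux_def[abs_def] by measurable
qed

lemma phi_pos: "0 < x \<Longrightarrow> 0 < \<phi> x" using f1_pos f2_pos c by (simp add: \<phi>_def)

lemma W_phi_nonneg: "0 < x \<Longrightarrow> 0 \<le> W x * \<phi> x" using phi_pos[of x] W_nonneg[of x] by simp

lemma flux_nonpos: "0 < x \<Longrightarrow> flux x \<le> 0"
proof -
  assume x: "0 < x"
  have "kD a (n / 2) (x\<^sup>2 / (2 * r1)) \<le> kF a (n / 2) (x\<^sup>2 / (2 * r1))"
    using kD_less_kF[OF b01(3,1) a(2), of "x\<^sup>2 / (2 * r1)"] r by simp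
  then have "g1 x \<le> 0" by (simp add: g1_def mult_nonneg_nonpos)
  moreover have "g2 x \<le> 0"
    using J0_pos[OF s_pos[OF x b01(6)]] J1_pos[OF s_pos[OF x b01(6)]] by (simp add: g2_def mult_nonneg_nonpos)
  ultimately show ?thesis using f1_pos[of c] f2_pos[OF c] r
    by (auto simp: flux_def E_def intro!: divide_nonpos_pos mult_nonneg_nonpos)
qed

lemma phi_decay: "c \<le> x \<Longrightarrow> \<phi> x \<le> J0 (c\<^sup>2 / (2 * r2)) / f2 c * exp (- (x\<^sup>2 / (2 * r2)))"
proof -
  assume x: "c \<le> x"
  have e: "\<phi> x = f2 x / f2 c" using x f1_pos[of c] f2_pos[OF c] by (cases "x = c") (auto simp: \<phi>_def)
  have "J0 (x\<^sup>2 / (2 * r2)) \<le> J0 (c\<^sup>2 / (2 * r2))"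
    unfolding J0_def using x c r by (intro jint_antimono a b01 divide_right_mono power_mono) auto
  then have "exp (- (x\<^sup>2 / (2 * r2))) * J0 (x\<^sup>2 / (2 * r2)) \<le> exp (- (x\<^sup>2 / (2 * r2))) * J0 (c\<^sup>2 / (2 * r2))"
    by (intro mult_left_mono) auto
  then have "f2 x / f2 c \<le> exp (- (x\<^sup>2 / (2 * r2))) * J0 (c\<^sup>2 / (2 * r2)) / f2 c"
    unfolding f2_def[of x] using f2_pos[OF c] by (intro divide_right_mono) auto
  then show ?thesis unfolding e by (simp add: mult.commute)
qed

lemma phi_tendsto_0: "(\<phi> \<longlongrightarrow> 0) at_top"
proof (rule Lim_null_comparison)
  show "\<forall>\<^sub>F x in at_top. norm (\<phi> x) \<le> J0 (c\<^sup>2 / (2 * r2)) / f2 c * exp (- (x\<^sup>2 / (2 * r2)))"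
    using eventually_ge_at_top[of c]
  proof eventually_elim
    fix x assume "c \<le> x"
    then show "norm (\<phi> x) \<le> J0 (c\<^sup>2 / (2 * r2)) / f2 c * exp (- (x\<^sup>2 / (2 * r2)))"
      using phi_decay[of x] phi_pos[of x] c by simp
  qed
  have "filterlim (\<lambda>x::real. 1 / (2 * r2) * x\<^sup>2) at_top at_top"
    using r by (intro filterlim_tendsto_pos_mult_at_top[OF tendsto_const] filterlim_pow_at_top filterlim_ident) auto
  then have "((\<lambda>x::real. exp (- (x\<^sup>2 / (2 * r2)))) \<longlongrightarrow> 0) at_top"
    by (intro filterlim_compose[OF exp_at_bot] filterlim_compose[OF filterlim_uminus_at_bot_at_top]) simp
  then show "((\<lambda>x. J0 (c\<^sup>2 / (2 * r2)) / f2 c * exp (- (x\<^sup>2 / (2 * r2)))) \<longlongrightarrow> 0) at_top"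
    by (rule tendsto_mult_right_zero)
qed

text \<open>\<open>W * \<phi>\<close> is the derivative of \<open>- flux / (n - 2 * a)\<close> off
  \<open>c\<close>, and the flux is continuous with value 0 at 0.\<close>

lemma nn_integral_W_phi:
  assumes "0 < t"
  shows "(\<integral>\<^sup>+y. (if 0 < y \<and> y < t then ennreal (W y * \<phi> y) else 0) \<partial>lborel) = ennreal (- flux t / (n - 2 * a))"
proof -
  have G0: "flux 0 = 0" using c n by (simp add: flux_def g1_def)
  have "(\<integral>\<^sup>+y. (if 0 < y \<and> y < t then ennreal (W y * \<phi> y) else 0) \<partial>lborel) = ennreal (- flux t / (n - 2 * a) - - flux 0 / (n - 2 * a))"
  proof (rule nn_integral_FTC_open[of 0 t "{c}"])
    show "continuous_on {0..t} (\<lambda>x. - flux x / (n - 2 * a))"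
      using continuous_on_subset[OF flux_continuous, of "{0..t}"] a by (intro continuous_intros) auto
    show "((\<lambda>x. - flux x / (n - 2 * a)) has_real_derivative W x * \<phi> x) (at x)" if "x \<in> {0<..<t} - {c}" for x
    proof -
      have e: "- (- l * w) / l = w" if "l \<noteq> 0" for l w :: real using that by simp
      have l: "n - 2 * a \<noteq> 0" using a by simp
      have "(flux has_real_derivative - (n - 2 * a) * (W x * \<phi> x)) (at x)" by (rule flux_deriv) (use that in auto)
      from DERIV_cdivide[OF DERIV_minus[OF this], of "n - 2 * a"] show ?thesis unfolding e[OF l] .
    qed
  qed (use assms W_phi_nonneg in auto)
  then show ?thesis by (simp add: G0)
qed

text \<open>Up to \<open>c\<close> the profile is bounded and \<open>W * \<phi>\<close> integrable.
  Beyond \<open>c\<close> the Gaussian decay of \<open>\<phi>\<close> enters twice and the growth of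
  \<open>W\<close> once, which leaves a multiple of
  \<open>x * exp (- x^2 / (2 * r2))\<close>.\<close>

lemma nn_integral_W_phi_square: "(\<integral>\<^sup>+x. (if 0 < x then ennreal (W x * (\<phi> x)\<^sup>2) else 0) \<partial>lborel) < \<infinity>"
proof -
  have "compact (\<phi> ` {0..c})"
    by (intro compact_continuous_image continuous_on_subset[OF phi_continuous]) auto
  then obtain B where B: "\<And>x. x \<in> {0..c} \<Longrightarrow> \<bar>\<phi> x\<bar> \<le> B"
    using compact_imp_bounded bounded_iff by (metis (no_types, lifting) image_eqI real_norm_def)
  have B0: "0 \<le> B" using B[of c] c by force
  define K where "K = E * (J0 (c\<^sup>2 / (2 * r2)) / f2 c)\<^sup>2 * c powr (n - 2) / r2"
  have K0: "0 \<le> K" unfolding K_def E_def using r by simp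
  have le: "(if 0 < x then ennreal (W x * (\<phi> x)\<^sup>2) else 0) \<le>
      ennreal B * (if 0 < x \<and> x < c + 1 then ennreal (W x * \<phi> x) else 0)
      + ennreal K * (if c / 2 < x then ennreal (x * exp (- (1 / (2 * r2) * x\<^sup>2))) else 0)" for x
  proof (cases "0 < x")
    case x: True
    show ?thesis
    proof (cases "x \<le> c")
      case True
      have "\<phi> x \<le> B" using B[of x] x True by simp
      then have "(W x * \<phi> x) * \<phi> x \<le> (W x * \<phi> x) * B" by (intro mult_left_mono W_phi_nonneg x)
      then have "ennreal (W x * (\<phi> x)\<^sup>2) \<le> ennreal B * ennreal (W x * \<phi> x)"
        using B0 W_phi_nonneg[OF x] by (subst ennreal_mult[symmetric]) (auto simp: power2_eq_square mult_ac intro!: ennreal_leI)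
      then show ?thesis using True x by (simp add: add_increasing2)
    next
      case False
      then have cx: "c < x" by simp
      have e: "exp (Phi x) = E * exp (x\<^sup>2 / (2 * r2))"
        using False by (simp add: Phi_def E_def diff_divide_distrib flip: exp_add)
      have "(\<phi> x)\<^sup>2 \<le> (J0 (c\<^sup>2 / (2 * r2)) / f2 c * exp (- (x\<^sup>2 / (2 * r2))))\<^sup>2"
        using phi_decay[of x] phi_pos[OF x] cx by (intro power_mono) auto
      then have "W x * (\<phi> x)\<^sup>2 \<le> W x * (J0 (c\<^sup>2 / (2 * r2)) / f2 c * exp (- (x\<^sup>2 / (2 * r2))))\<^sup>2"
        using W_nonneg[of x] x by (intro mult_left_mono) auto
      also have "\<dots> = E * (J0 (c\<^sup>2 / (2 * r2)) / f2 c)\<^sup>2 / r2 * (x powr (n - 1) * exp (- (x\<^sup>2 / (2 * r2))))"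
        using cx by (simp add: W_def p_def e ell_def power_mult_distrib power2_eq_square exp_minus field_simps)
      also have "x powr (n - 1) = x powr (n - 2) * x" using x powr_add[of x "n - 2" 1] by simp
      also have "E * (J0 (c\<^sup>2 / (2 * r2)) / f2 c)\<^sup>2 / r2 * (x powr (n - 2) * x * exp (- (x\<^sup>2 / (2 * r2))))
         \<le> E * (J0 (c\<^sup>2 / (2 * r2)) / f2 c)\<^sup>2 / r2 * (c powr (n - 2) * x * exp (- (x\<^sup>2 / (2 * r2))))"
        using cx c n r by (intro mult_left_mono mult_right_mono powr_mono2') (auto simp: E_def)
      also have "\<dots> = K * (x * exp (- (1 / (2 * r2) * x\<^sup>2)))" by (simp add: K_def)
      finally have "ennreal (W x * (\<phi> x)\<^sup>2) \<le> ennreal K * ennreal (x * exp (- (1 / (2 * r2) * x\<^sup>2)))"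
        using K0 x by (subst ennreal_mult[symmetric]) (auto intro!: ennreal_leI)
      then show ?thesis using x cx c by (simp add: add_increasing)
    qed
  qed simp
  have "(\<integral>\<^sup>+x. (if 0 < x then ennreal (W x * (\<phi> x)\<^sup>2) else 0) \<partial>lborel) \<le>
      (\<integral>\<^sup>+x. ennreal B * (if 0 < x \<and> x < c + 1 then ennreal (W x * \<phi> x) else 0)
      + ennreal K * (if c / 2 < x then ennreal (x * exp (- (1 / (2 * r2) * x\<^sup>2))) else 0) \<partial>lborel)"
    by (intro nn_integral_mono le)
  also have "\<dots> = ennreal B * (\<integral>\<^sup>+x. (if 0 < x \<and> x < c + 1 then ennreal (W x * \<phi> x) else 0) \<partial>lborel)
      + ennreal K * (\<integral>\<^sup>+x. (if c / 2 < x then ennreal (x * exp (- (1 / (2 * r2) * x\<^sup>2))) else 0) \<partial>lborel)"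
    by (subst nn_integral_add) (simp_all add: nn_integral_cmult)
  also have "\<dots> < \<infinity>"
  proof -
    have "(\<integral>\<^sup>+x. (if c / 2 < x then ennreal (x * exp (- (1 / (2 * r2) * x\<^sup>2))) else 0) \<partial>lborel) < \<infinity>"
      using le_less_trans[OF gauss_tail[of "1 / (2 * r2)" "c / 2"]] c r by simp
    moreover have "(\<integral>\<^sup>+x. (if 0 < x \<and> x < c + 1 then ennreal (W x * \<phi> x) else 0) \<partial>lborel) < \<infinity>"
      using nn_integral_W_phi[of "c + 1"] c by simp
    ultimately show ?thesis by (simp add: ennreal_mult_less_top)
  qed
  finally show ?thesis .
qed

text \<open>Two integrations: the inner integral is \<open>- flux / (n - 2 * a)\<close>, and then
  \<open>P * flux = \<phi>'\<close> is integrated up to infinity, where \<open>\<phi>\<close> tends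
  to 0.\<close>

lemma phi_eigen:
  assumes x: "0 < x"
  shows "ennreal (\<phi> x) = ennreal (n - 2 * a) *
       (\<integral>\<^sup>+t. (if x < t then ennreal (P t) * (\<integral>\<^sup>+y. (if 0 < y \<and> y < t then ennreal (W y * \<phi> y) else 0) \<partial>lborel) else 0) \<partial>lborel)"
proof -
  have l: "0 < n - 2 * a" using a by simp
  have "(\<integral>\<^sup>+t. (if x < t then ennreal (P t) * (\<integral>\<^sup>+y. (if 0 < y \<and> y < t then ennreal (W y * \<phi> y) else 0) \<partial>lborel) else 0) \<partial>lborel)
      = (\<integral>\<^sup>+t. (if x < t then ennreal (- (P t * flux t) / (n - 2 * a)) else 0) \<partial>lborel)"
  proof (intro nn_integral_cong)
    fix t
    have "ennreal (P t) * ennreal (- flux t / (n - 2 * a)) = ennreal (- (P t * flux t) / (n - 2 * a))" if "0 < t"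
      using flux_nonpos[OF that] p_nonneg[of t] l by (subst ennreal_mult[symmetric]) (auto simp: divide_nonpos_pos)
    then show "(if x < t then ennreal (P t) * (\<integral>\<^sup>+y. (if 0 < y \<and> y < t then ennreal (W y * \<phi> y) else 0) \<partial>lborel) else 0)
        = (if x < t then ennreal (- (P t * flux t) / (n - 2 * a)) else 0)"
      using x nn_integral_W_phi[of t] by auto
  qed
  also have "\<dots> = ennreal (- 0 / (n - 2 * a) - - \<phi> x / (n - 2 * a))"
  proof (rule nn_integral_FTC_tail[where c = c])
    show "continuous_on {x..} (\<lambda>x. - \<phi> x / (n - 2 * a))"
      using continuous_on_subset[OF phi_continuous, of "{x..}"] x l by (intro continuous_intros) auto
    show "((\<lambda>x. - \<phi> x / (n - 2 * a)) has_real_derivative - (P t * flux t) / (n - 2 * a)) (at t)" if "x < t" "t \<noteq> c" for t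
      using x that by (intro DERIV_cdivide DERIV_minus phi_deriv) auto
    show "0 \<le> - (P t * flux t) / (n - 2 * a)" if "x < t" for t
      using flux_nonpos[of t] p_nonneg[of t] l that x by (auto intro!: divide_nonneg_nonneg simp: divide_nonpos_nonneg)
    show "((\<lambda>x. - \<phi> x / (n - 2 * a)) \<longlongrightarrow> - 0 / (n - 2 * a)) at_top"
      using l by (intro tendsto_intros phi_tendsto_0) auto
  qed (use x c in auto)
  finally show ?thesis using l phi_pos[OF x] by (simp flip: ennreal_mult)
qed

theorem is_max_of_spectrum_matched: "is_max_of_spectrum n (ell r1 r2 c) (2 * a - n)"
proof -
  interpret two_phase_ground n r1 r2 c \<phi> "n - 2 * a"
    by unfold_locales (use phi_measurable phi_pos nn_integral_W_phi_square phi_eigen a in auto)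
  show ?thesis using is_max_of_spectrum_ground by simp
qed

end

section \<open>Gaussian integrals of Bessel functions\<close>

text \<open>Euler's Gamma integral under the substitution \<open>t = z^2 / 2\<close>.\<close>

lemma nn_integral_gauss_moment:
  assumes \<alpha>: "0 < \<alpha>"
  shows "(\<integral>\<^sup>+z. (if 0 < z then ennreal (z powr (2 * \<alpha> - 1) * exp (- (z\<^sup>2 / 2))) else 0) \<partial>lborel)
     = ennreal (2 powr (\<alpha> - 1) * Gamma \<alpha>)"
proof -
  define f where "f t = t powr (\<alpha> - 1) / exp t" for t :: real
  define g where "g z = z\<^sup>2 / 2" for z :: real
  have im: "g ` {0<..} = {0<..}"
  proof (intro equalityI subsetI)
    fix y :: real assume "y \<in> {0<..}"
    then have "y = g (sqrt (2 * y))" "sqrt (2 * y) \<in> {0<..}" by (auto simp: g_def)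
    then show "y \<in> g ` {0<..}" by blast
  qed (auto simp: g_def)
  have hi: "(f has_integral Gamma \<alpha>) {0<..}"
  proof -
    have "(f has_integral Gamma \<alpha>) {0..} \<longleftrightarrow> (f has_integral Gamma \<alpha>) {0<..}"
      by (rule has_integral_spike_set_eq) (auto intro!: negligible_subset[OF negligible_sing[of 0]])
    then show ?thesis unfolding f_def using Gamma_integral_real[OF \<alpha>] by simp
  qed
  then have "f absolutely_integrable_on {0<..}"
    by (intro nonnegative_absolutely_integrable_1) (auto simp: f_def integrable_on_def)
  then have "f absolutely_integrable_on g ` {0<..} \<and> integral (g ` {0<..}) f = Gamma \<alpha>"
    using hi unfolding im by (simp add: integral_unique)
  moreover have "(\<lambda>z. \<bar>z\<bar> * f (g z)) absolutely_integrable_on {0<..} \<and> integral {0<..} (\<lambda>z. \<bar>z\<bar> * f (g z)) = Gamma \<alpha>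
     \<longleftrightarrow> f absolutely_integrable_on g ` {0<..} \<and> integral (g ` {0<..}) f = Gamma \<alpha>"
  proof (rule has_absolute_integral_change_of_variables_1')
    show "(g has_field_derivative z) (at z within {0<..})" for z
      unfolding g_def[abs_def] by (auto intro!: derivative_eq_intros)
    show "inj_on g {0<..}" by (auto simp: inj_on_def g_def)
  qed simp
  ultimately have A: "(\<lambda>z. \<bar>z\<bar> * f (g z)) absolutely_integrable_on {0<..}" "integral {0<..} (\<lambda>z. \<bar>z\<bar> * f (g z)) = Gamma \<alpha>"
    by auto
  have "((\<lambda>z. \<bar>z\<bar> * f (g z)) has_integral Gamma \<alpha>) {0<..}"
    using A set_lebesgue_integral_eq_integral(1)[OF A(1)] by (auto simp: has_integral_iff)
  then have "((\<lambda>z. 2 powr (\<alpha> - 1) * (\<bar>z\<bar> * f (g z))) has_integral 2 powr (\<alpha> - 1) * Gamma \<alpha>) {0<..}"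
    by (rule has_integral_mult_right)
  then have "((\<lambda>z. z powr (2 * \<alpha> - 1) * exp (- (z\<^sup>2 / 2))) has_integral 2 powr (\<alpha> - 1) * Gamma \<alpha>) {0<..}"
  proof (rule has_integral_eq[rotated])
    fix z :: real assume "z \<in> {0<..}"
    then have z: "0 < z" by simp
    have "(z\<^sup>2 / 2) powr (\<alpha> - 1) = z powr (2 * (\<alpha> - 1)) / 2 powr (\<alpha> - 1)"
      using z powr_powr[of z 2 "\<alpha> - 1"] by (simp add: powr_divide)
    moreover have "z powr (2 * \<alpha> - 1) = z * z powr (2 * (\<alpha> - 1))"
      using z powr_add[of z 1 "2 * (\<alpha> - 1)"] by (simp add: algebra_simps)
    ultimately show "2 powr (\<alpha> - 1) * (\<bar>z\<bar> * f (g z)) = z powr (2 * \<alpha> - 1) * exp (- (z\<^sup>2 / 2))"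
      using z by (simp add: f_def g_def exp_minus field_simps)
  qed
  then have "(\<integral>\<^sup>+z. ennreal (indicat_real {0<..} z * (z powr (2 * \<alpha> - 1) * exp (- (z\<^sup>2 / 2)))) \<partial>lborel) = ennreal (2 powr (\<alpha> - 1) * Gamma \<alpha>)"
    by (intro nn_integral_has_integral_lebesgue) auto
  moreover have "ennreal (indicat_real {0<..} z * (z powr (2 * \<alpha> - 1) * exp (- (z\<^sup>2 / 2)))) = (if 0 < z then ennreal (z powr (2 * \<alpha> - 1) * exp (- (z\<^sup>2 / 2))) else 0)" for z
    by simp
  ultimately show ?thesis by simp
qed

lemma Gamma_shift: "0 < z \<Longrightarrow> Gamma (z + real k) = Gamma z * pochhammer z k"
proof -
  assume z: "0 < z"
  then have "z \<notin> \<int>\<^sub>\<le>\<^sub>0" using nonpos_Ints_nonpos[of z] by auto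
  then show ?thesis using pochhammer_Gamma[of z k] Gamma_real_pos[OF z] by simp
qed

lemma bessel_I_summable:
  assumes \<mu>: "- 1 < \<mu>" and y: "0 < y"
  shows "summable (\<lambda>k. (y / 2) powr (2 * real k + \<mu>) * rGamma (real k + \<mu> + 1) / fact k)"
proof -
  have e: "(y / 2) powr (2 * real k + \<mu>) * rGamma (real k + \<mu> + 1) / fact k
      = ((y / 2) powr \<mu> / Gamma (\<mu> + 1)) * (kc 1 (\<mu> + 1) k / fact k * ((y / 2)\<^sup>2) ^ k)" for k
  proof -
    have "rGamma (real k + \<mu> + 1) = 1 / (Gamma (\<mu> + 1) * pochhammer (\<mu> + 1) k)"
      using Gamma_shift[of "\<mu> + 1" k] \<mu> by (simp add: rGamma_inverse_Gamma inverse_eq_divide add_ac)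
    moreover have "(y / 2) powr (2 * real k + \<mu>) = ((y / 2)\<^sup>2) ^ k * (y / 2) powr \<mu>"
      using y powr_realpow[of "y / 2" "2 * k"] by (simp add: powr_add power_mult)
    moreover have "kc 1 (\<mu> + 1) k = 1 / pochhammer (\<mu> + 1) k"
      by (simp add: kc_def pochhammer_fact[symmetric])
    ultimately show ?thesis by (simp add: mult_ac)
  qed
  have "summable (\<lambda>k. kc 1 (\<mu> + 1) k / fact k * ((y / 2)\<^sup>2) ^ k)"
  proof (rule summable_comparison_test')
    show "summable (\<lambda>k. kc 1 (\<mu> + 1) k * ((y / 2)\<^sup>2) ^ k)" using \<mu> by (intro kc_summable) auto
    show "norm (kc 1 (\<mu> + 1) k / fact k * ((y / 2)\<^sup>2) ^ k) \<le> kc 1 (\<mu> + 1) k * ((y / 2)\<^sup>2) ^ k" for k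
    proof -
      have n: "0 \<le> kc 1 (\<mu> + 1) k" using \<mu> by (intro kc_nonneg) auto
      have "kc 1 (\<mu> + 1) k / fact k \<le> kc 1 (\<mu> + 1) k / 1" using n by (intro divide_left_mono) (auto simp: fact_ge_1)
      then have "kc 1 (\<mu> + 1) k / fact k * ((y / 2)\<^sup>2) ^ k \<le> kc 1 (\<mu> + 1) k * ((y / 2)\<^sup>2) ^ k" by (intro mult_right_mono) auto
      then show ?thesis using n by (simp add: abs_mult)
    qed
  qed
  then show ?thesis unfolding e by (rule summable_mult)
qed

text \<open>The power and the Bessel function carry separate orders because \<open>S_plus\<close>
  combines \<open>I\<close> of the orders \<open>\<nu>\<close> and \<open>- \<nu>\<close> under one
  and the same power. For \<open>\<mu> > - 1\<close> every term of the series is nonnegative, so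
  termwise integration is allowed; each term is a Gaussian moment, and the moments sum to Kummer's
  series.\<close>

lemma bessel_gauss_integral:
  fixes \<mu> \<nu> \<eta> x :: real
  assumes \<mu>: "- 1 < \<mu>" and x: "0 < x" and al: "0 < (\<eta> + \<mu> - \<nu>) / 2"
  defines "\<alpha> \<equiv> (\<eta> + \<mu> - \<nu>) / 2"
    and "h \<equiv> \<lambda>z. z powr (\<eta> - 1) * ((x * z) powr (- \<nu>) * bessel_I \<mu> (x * z)) * exp (- ((z\<^sup>2 + x\<^sup>2) / 2))"
  shows "set_integrable lborel {0<..} h"
    and "(LINT z:{0<..}|lborel. h z) = exp (- (x\<^sup>2 / 2)) * x powr (\<mu> - \<nu>) * 2 powr (\<alpha> - 1 - \<mu>) *
          (Gamma \<alpha> / Gamma (\<mu> + 1)) * kF \<alpha> (\<mu> + 1) (x\<^sup>2 / 2)"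
proof -
  have al: "0 < \<alpha>" using al by (simp add: \<alpha>_def)
  have m1: "0 < \<mu> + 1" using \<mu> by simp
  have Gp: "0 < Gamma \<alpha>" "0 < Gamma (\<mu> + 1)" using al m1 by (auto intro!: Gamma_real_pos)
  define A where "A = exp (- (x\<^sup>2 / 2)) * x powr (\<mu> - \<nu>) * 2 powr (\<alpha> - 1 - \<mu>) * (Gamma \<alpha> / Gamma (\<mu> + 1))"
  have A0: "0 \<le> A" using Gp by (simp add: A_def)
  define t where "t k z = (if 0 < z then z powr (\<eta> - 1) * ((x * z) powr (- \<nu>) *
      ((x * z / 2) powr (2 * real k + \<mu>) * rGamma (real k + \<mu> + 1) / fact k)) * exp (- ((z\<^sup>2 + x\<^sup>2) / 2)) else 0)" for k z
  have tm[measurable]: "t k \<in> borel_measurable borel" for k unfolding t_def[abs_def] by measurable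
  have rG: "rGamma (real k + \<mu> + 1) = 1 / (Gamma (\<mu> + 1) * pochhammer (\<mu> + 1) k)" for k
    using Gamma_shift[OF m1, of k] by (simp add: rGamma_inverse_Gamma inverse_eq_divide add_ac)
  have rp: "0 < rGamma (real k + \<mu> + 1)" for k using Gp(2) pochhammer_pos[OF m1, of k] by (simp add: rG)
  have t0: "0 \<le> t k z" for k z using rp[of k] by (simp add: t_def less_imp_le)
  define c where "c k = exp (- (x\<^sup>2 / 2)) * (x powr (2 * real k + \<mu> - \<nu>) / 2 powr (2 * real k + \<mu>)) * rGamma (real k + \<mu> + 1) / fact k" for k
  have c0: "0 \<le> c k" for k using rp[of k] by (simp add: c_def less_imp_le)
  have te: "t k z = c k * (z powr (2 * (\<alpha> + real k) - 1) * exp (- (z\<^sup>2 / 2)))" if z: "0 < z" for k z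
  proof -
    have "z powr (\<eta> - 1) * (z powr (- \<nu>) * z powr (2 * real k + \<mu>)) = z powr (2 * (\<alpha> + real k) - 1)"
    proof -
      have "2 * (\<alpha> + real k) - 1 = (\<eta> - 1) + (- \<nu> + (2 * real k + \<mu>))" by (simp add: \<alpha>_def)
      then show ?thesis by (simp only: powr_add)
    qed
    moreover have "x powr (- \<nu>) * x powr (2 * real k + \<mu>) = x powr (2 * real k + \<mu> - \<nu>)"
      using x by (simp add: algebra_simps flip: powr_add)
    moreover have "exp (- ((z\<^sup>2 + x\<^sup>2) / 2)) = exp (- (z\<^sup>2 / 2)) * exp (- (x\<^sup>2 / 2))"
      by (simp add: add_divide_distrib flip: exp_add)
    moreover have "t k z = (z powr (\<eta> - 1) * (z powr (- \<nu>) * z powr (2 * real k + \<mu>))) * (x powr (- \<nu>) * x powr (2 * real k + \<mu>))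
        * exp (- ((z\<^sup>2 + x\<^sup>2) / 2)) / 2 powr (2 * real k + \<mu>) * rGamma (real k + \<mu> + 1) / fact k"
      using z x by (simp add: t_def powr_mult powr_divide)
    ultimately show ?thesis by (simp add: c_def)
  qed
  have I: "(\<integral>\<^sup>+z. ennreal (t k z) \<partial>lborel) = ennreal (A * (kc \<alpha> (\<mu> + 1) k * (x\<^sup>2 / 2) ^ k))" for k
  proof -
    have ak: "0 < \<alpha> + real k" using al by simp
    have "(\<integral>\<^sup>+z. ennreal (t k z) \<partial>lborel) = (\<integral>\<^sup>+z. ennreal (c k) * (if 0 < z then ennreal (z powr (2 * (\<alpha> + real k) - 1) * exp (- (z\<^sup>2 / 2))) else 0) \<partial>lborel)"
    proof (intro nn_integral_cong)
      fix z
      show "ennreal (t k z) = ennreal (c k) * (if 0 < z then ennreal (z powr (2 * (\<alpha> + real k) - 1) * exp (- (z\<^sup>2 / 2))) else 0)"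
      proof (cases "0 < z")
        case True
        then show ?thesis using te[OF True, of k] c0[of k] by (simp add: ennreal_mult')
      qed (simp add: t_def)
    qed
    also have "\<dots> = ennreal (c k) * ennreal (2 powr (\<alpha> + real k - 1) * Gamma (\<alpha> + real k))"
      unfolding nn_integral_gauss_moment[OF ak, symmetric] by (rule nn_integral_cmult) measurable
    also have "\<dots> = ennreal (c k * (2 powr (\<alpha> + real k - 1) * Gamma (\<alpha> + real k)))"
      using c0[of k] by (rule ennreal_mult'[symmetric])
    also have "c k * (2 powr (\<alpha> + real k - 1) * Gamma (\<alpha> + real k)) = A * (kc \<alpha> (\<mu> + 1) k * (x\<^sup>2 / 2) ^ k)"
    proof -
      have 1: "x powr (2 * real k + \<mu> - \<nu>) = (x\<^sup>2) ^ k * x powr (\<mu> - \<nu>)"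
      proof -
        have "2 * real k + \<mu> - \<nu> = real (2 * k) + (\<mu> - \<nu>)" by simp
        then show ?thesis by (simp only: powr_add powr_realpow[OF x] power_mult)
      qed
      have 2: "2 powr (\<alpha> + real k - 1) / 2 powr (2 * real k + \<mu>) = 2 powr (\<alpha> - 1 - \<mu>) / 2 ^ k"
      proof -
        have "2 powr (\<alpha> + real k - 1) / 2 powr (2 * real k + \<mu>) = 2 powr ((\<alpha> + real k - 1) - (2 * real k + \<mu>))" by (rule powr_diff[symmetric])
        also have "(\<alpha> + real k - 1) - (2 * real k + \<mu>) = (\<alpha> - 1 - \<mu>) - real k" by simp
        also have "2 powr ((\<alpha> - 1 - \<mu>) - real k) = 2 powr (\<alpha> - 1 - \<mu>) / 2 ^ k"
          using powr_diff[of 2 "\<alpha> - 1 - \<mu>" "real k"] powr_realpow[of 2 k] by simp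
        finally show ?thesis .
      qed
      have "c k * (2 powr (\<alpha> + real k - 1) * Gamma (\<alpha> + real k))
         = exp (- (x\<^sup>2 / 2)) * x powr (2 * real k + \<mu> - \<nu>) * (2 powr (\<alpha> + real k - 1) / 2 powr (2 * real k + \<mu>)) * rGamma (real k + \<mu> + 1) / fact k * Gamma (\<alpha> + real k)"
        by (simp add: c_def)
      also have "\<dots> = A * (kc \<alpha> (\<mu> + 1) k * (x\<^sup>2 / 2) ^ k)"
        unfolding 1 2 rG Gamma_shift[OF al] A_def kc_def by (simp add: power_divide mult_ac)
      finally show ?thesis .
    qed
    finally show ?thesis .
  qed
  have sums: "(\<lambda>k. t k z) sums (if 0 < z then h z else 0)" for z
  proof (cases "0 < z")
    case True
    have s: "(\<lambda>k. (x * z / 2) powr (2 * real k + \<mu>) * rGamma (real k + \<mu> + 1) / fact k) sums bessel_I \<mu> (x * z)"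
      unfolding bessel_I_def using bessel_I_summable[OF \<mu>, of "x * z"] x True by (intro summable_sums) auto
    show ?thesis unfolding t_def h_def using True
      by (simp only: if_True) (intro sums_mult sums_mult2 s)
  qed (simp add: t_def)
  have h0: "0 \<le> (if 0 < z then h z else 0)" for z by (rule sums_le[OF _ sums_zero sums[of z]]) (rule t0)
  have hm[measurable]: "(\<lambda>z. if 0 < z then h z else 0) \<in> borel_measurable borel"
  proof -
    have "(\<lambda>z. if 0 < z then h z else 0) = (\<lambda>z. \<Sum>k. t k z)" using sums by (simp add: sums_iff fun_eq_iff)
    then show ?thesis by simp
  qed
  have ksum: "(\<lambda>k. A * (kc \<alpha> (\<mu> + 1) k * (x\<^sup>2 / 2) ^ k)) sums (A * kF \<alpha> (\<mu> + 1) (x\<^sup>2 / 2))"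
    unfolding kF_def using kc_summable[of \<alpha> "\<mu> + 1" "x\<^sup>2 / 2"] al m1 by (intro sums_mult summable_sums) auto
  have N: "(\<integral>\<^sup>+z. ennreal (if 0 < z then h z else 0) \<partial>lborel) = ennreal (A * kF \<alpha> (\<mu> + 1) (x\<^sup>2 / 2))"
  proof -
    have "ennreal (if 0 < z then h z else 0) = (\<Sum>k. ennreal (t k z))" for z
      using sums[of z] t0 by (simp add: suminf_ennreal2 sums_iff)
    then have "(\<integral>\<^sup>+z. ennreal (if 0 < z then h z else 0) \<partial>lborel) = (\<integral>\<^sup>+z. (\<Sum>k. ennreal (t k z)) \<partial>lborel)" by simp
    also have "\<dots> = (\<Sum>k. \<integral>\<^sup>+z. ennreal (t k z) \<partial>lborel)" by (rule nn_integral_suminf) simp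
    also have "\<dots> = ennreal (A * kF \<alpha> (\<mu> + 1) (x\<^sup>2 / 2))"
      unfolding I using ksum A0 kc_nonneg[of \<alpha> "\<mu> + 1"] al m1 by (subst suminf_ennreal2) (auto simp: sums_iff)
    finally show ?thesis .
  qed
  have v0: "0 \<le> A * kF \<alpha> (\<mu> + 1) (x\<^sup>2 / 2)" using A0 kF_pos[of \<alpha> "\<mu> + 1" "x\<^sup>2 / 2"] al m1 by simp
  have hb: "has_bochner_integral lborel (\<lambda>z. if 0 < z then h z else 0) (A * kF \<alpha> (\<mu> + 1) (x\<^sup>2 / 2))"
    using h0 N v0 by (intro has_bochner_integral_nn_integral) auto
  have e: "(\<lambda>z. indicat_real {0<..} z *\<^sub>R h z) = (\<lambda>z. if 0 < z then h z else 0)" by (auto simp: indicator_def)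
  show "set_integrable lborel {0<..} h" unfolding set_integrable_def e using hb by (rule integrable.intros)
  show "(LINT z:{0<..}|lborel. h z) = exp (- (x\<^sup>2 / 2)) * x powr (\<mu> - \<nu>) * 2 powr (\<alpha> - 1 - \<mu>) *
          (Gamma \<alpha> / Gamma (\<mu> + 1)) * kF \<alpha> (\<mu> + 1) (x\<^sup>2 / 2)"
    unfolding set_lebesgue_integral_def e using has_bochner_integral_integral_eq[OF hb] by (simp add: A_def)
qed

section \<open>The defining integrals in terms of Kummer's and Tricomi's functions\<close>

lemma kD_eq_kF:
  assumes "0 \<le> a" "0 < b"
  shows "kD a b s = a / b * kF (a + 1) (b + 1) s"
proof -
  have "diffs (kc a b) k = a / b * kc (a + 1) (b + 1) k" for k
  proof -
    have 1: "pochhammer a k * (a + k) = a * pochhammer (a + 1) k" "pochhammer b k * (b + k) = b * pochhammer (b + 1) k"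
      using pochhammer_Suc[of a k] pochhammer_rec[of a k] pochhammer_Suc[of b k] pochhammer_rec[of b k] by auto
    have "diffs (kc a b) k = (pochhammer a k * (a + k)) / (pochhammer b k * (b + k)) / fact k"
      by (simp add: kc_diffs[OF assms(2)] kc_def)
    then show ?thesis unfolding 1 by (simp add: kc_def)
  qed
  moreover have "summable (\<lambda>k. kc (a + 1) (b + 1) k * s ^ k)" using assms by (intro kc_summable) auto
  ultimately show ?thesis unfolding kD_def kF_def by (simp only: mult.assoc suminf_mult)
qed

text \<open>Coefficientwise, \<open>(1 - b + k) / pochhammer (2 - b) k = (1 - b) / pochhammer (1 -
  b) k\<close>. This is the form of the derivative that the integral with \<open>I\<close> of order
  \<open>- b\<close> produces.\<close>

lemma kB'_eq_kF:
  assumes "0 < a" "0 < b" "b < 1" "0 < s"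
  shows "kB' a b s = (1 - b) * s powr (- b) * kF (a + 1 - b) (1 - b) s"
proof -
  have a': "0 \<le> a + 1 - b" "0 < 2 - b" "0 < 1 - b" using assms by auto
  have c: "(1 - b) * kc (a + 1 - b) (2 - b) k + real k * kc (a + 1 - b) (2 - b) k = (1 - b) * kc (a + 1 - b) (1 - b) k" for k
  proof -
    have 1: "pochhammer (1 - b) k * (1 - b + k) = (1 - b) * pochhammer (2 - b) k"
      using pochhammer_Suc[of "1 - b" k] pochhammer_rec[of "1 - b" k] by (simp add: algebra_simps)
    have p: "0 < pochhammer (1 - b) k" "0 < pochhammer (2 - b) k" using a' by (auto intro!: pochhammer_pos)
    have "(1 - b + k) / pochhammer (2 - b) k = (1 - b) / pochhammer (1 - b) k"
      using p 1 by (simp add: frac_eq_eq mult.commute)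
    then have "(1 - b + k) / pochhammer (2 - b) k * (pochhammer (a + 1 - b) k / fact k) = (1 - b) / pochhammer (1 - b) k * (pochhammer (a + 1 - b) k / fact k)"
      by simp
    then show ?thesis by (simp add: kc_def algebra_simps add_divide_distrib diff_divide_distrib)
  qed
  have S1: "(\<lambda>k. (1 - b) * (kc (a + 1 - b) (2 - b) k * s ^ k)) sums ((1 - b) * kF (a + 1 - b) (2 - b) s)"
    unfolding kF_def by (intro sums_mult summable_sums kc_summable a')
  have S2: "(\<lambda>k. real k * kc (a + 1 - b) (2 - b) k * s ^ k) sums (s * kD (a + 1 - b) (2 - b) s)"
    unfolding kD_def by (rule series_shift[OF a'(1,2) kD_summable[OF a'(1,2)]])
  have S3: "(\<lambda>k. (1 - b) * (kc (a + 1 - b) (1 - b) k * s ^ k)) sums ((1 - b) * kF (a + 1 - b) (1 - b) s)"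
    unfolding kF_def by (intro sums_mult summable_sums kc_summable a')
  have "(\<lambda>k. (1 - b) * (kc (a + 1 - b) (2 - b) k * s ^ k) + real k * kc (a + 1 - b) (2 - b) k * s ^ k) = (\<lambda>k. (1 - b) * (kc (a + 1 - b) (1 - b) k * s ^ k))"
  proof
    fix k
    have "(1 - b) * (kc (a + 1 - b) (2 - b) k * s ^ k) + real k * kc (a + 1 - b) (2 - b) k * s ^ k
       = ((1 - b) * kc (a + 1 - b) (2 - b) k + real k * kc (a + 1 - b) (2 - b) k) * s ^ k" by (simp add: algebra_simps)
    then show "(1 - b) * (kc (a + 1 - b) (2 - b) k * s ^ k) + real k * kc (a + 1 - b) (2 - b) k * s ^ k = (1 - b) * (kc (a + 1 - b) (1 - b) k * s ^ k)"
      unfolding c by simp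
  qed
  then have key: "(1 - b) * kF (a + 1 - b) (2 - b) s + s * kD (a + 1 - b) (2 - b) s = (1 - b) * kF (a + 1 - b) (1 - b) s"
    using sums_unique2[OF sums_add[OF S1 S2]] S3 by simp
  have p: "s powr (1 - b) = s * s powr (- b)" using assms powr_add[of s 1 "- b"] by simp
  have "kB' a b s = s powr (- b) * ((1 - b) * kF (a + 1 - b) (2 - b) s + s * kD (a + 1 - b) (2 - b) s)"
    unfolding kB'_def p by (simp add: algebra_simps)
  then show ?thesis unfolding key by simp
qed

lemma Y_minus_eq:
  assumes "0 < n" "0 < \<eta>" "0 < x"
  shows "Y_minus ((n - 2) / 2) \<eta> x = 2 powr (\<eta> / 2 - n / 2) * (Gamma (\<eta> / 2) / Gamma (n / 2)) * exp (- (x\<^sup>2 / 2)) * kF (\<eta> / 2) (n / 2) (x\<^sup>2 / 2)"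
  unfolding Y_minus_def S_minus_def
  using bessel_gauss_integral(2)[of "(n - 2) / 2" x \<eta> "(n - 2) / 2"] assms by (simp add: diff_divide_distrib)

text \<open>Common factor of the two \<open>Y_plus\<close> integrals; being positive, it cancels in
  their quotient.\<close>

definition tricomi_const :: "real \<Rightarrow> real \<Rightarrow> real" where
  "tricomi_const a b = 2 powr (a - b) * (pi / (2 * sin (b * pi))) * (Gamma (a + 1 - b) / (Gamma b * Gamma (1 - b)))"

lemma sin_pi_pos: "0 < b \<Longrightarrow> b < 1 \<Longrightarrow> 0 < sin (b * pi)"
  using sin_gt_zero[of "b * pi"] by simp

lemma tricomi_const_pos: "0 < a \<Longrightarrow> 0 < b \<Longrightarrow> b < 1 \<Longrightarrow> 0 < tricomi_const a b"
  unfolding tricomi_const_def by (intro mult_pos_pos divide_pos_pos Gamma_real_pos sin_pi_pos) auto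

text \<open>At these non-integral orders \<open>K\<close> is a multiple of the difference of
  \<open>I\<close> at \<open>- \<nu>\<close> and at \<open>\<nu>\<close>; the condition
  \<open>0 < \<eta> - 2 * \<nu>\<close> gives convergence at 0 of the first integral.\<close>

lemma Y_plus_diff:
  assumes \<nu>: "- 1 < \<nu>" "\<nu> < 1" "\<nu> \<noteq> 0" and x: "0 < x" and \<eta>: "0 < \<eta>" "0 < \<eta> - 2 * \<nu>"
  shows "Y_plus \<nu> \<eta> x = pi / (2 * sin (\<nu> * pi)) * (
      exp (- (x\<^sup>2 / 2)) * x powr (- 2 * \<nu>) * 2 powr (\<eta> / 2 - 1) * (Gamma (\<eta> / 2 - \<nu>) / Gamma (1 - \<nu>)) * kF (\<eta> / 2 - \<nu>) (1 - \<nu>) (x\<^sup>2 / 2)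
      - exp (- (x\<^sup>2 / 2)) * 2 powr (\<eta> / 2 - 1 - \<nu>) * (Gamma (\<eta> / 2) / Gamma (\<nu> + 1)) * kF (\<eta> / 2) (\<nu> + 1) (x\<^sup>2 / 2))"
proof -
  define h where "h \<mu> z = z powr (\<eta> - 1) * ((x * z) powr (- \<nu>) * bessel_I \<mu> (x * z)) * exp (- ((z\<^sup>2 + x\<^sup>2) / 2))" for \<mu> z
  have "\<nu> \<notin> \<int>"
  proof
    assume "\<nu> \<in> \<int>"
    then obtain i :: int where i: "\<nu> = of_int i" by (auto elim: Ints_cases)
    then show False using \<nu> by auto
  qed
  then have "z powr (\<eta> - 1) * S_plus \<nu> (x * z) * exp (- ((z\<^sup>2 + x\<^sup>2) / 2)) = pi / (2 * sin (\<nu> * pi)) * (h (- \<nu>) z - h \<nu> z)" for z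
    by (simp add: S_plus_def bessel_K_def h_def Let_def field_simps)
  then have "Y_plus \<nu> \<eta> x = (LINT z:{0<..}|lborel. pi / (2 * sin (\<nu> * pi)) * (h (- \<nu>) z - h \<nu> z))" by (simp add: Y_plus_def)
  also have "\<dots> = pi / (2 * sin (\<nu> * pi)) * ((LINT z:{0<..}|lborel. h (- \<nu>) z) - (LINT z:{0<..}|lborel. h \<nu> z))"
  proof -
    have "set_integrable lborel {0<..} (h (- \<nu>))" "set_integrable lborel {0<..} (h \<nu>)"
      unfolding h_def using bessel_gauss_integral(1)[of "- \<nu>" x \<eta> \<nu>] bessel_gauss_integral(1)[of \<nu> x \<eta> \<nu>] assms by auto
    then show ?thesis by (simp add: set_integral_diff(2))
  qed
  also have "(LINT z:{0<..}|lborel. h (- \<nu>) z) = exp (- (x\<^sup>2 / 2)) * x powr (- 2 * \<nu>) * 2 powr (\<eta> / 2 - 1) * (Gamma (\<eta> / 2 - \<nu>) / Gamma (1 - \<nu>)) * kF (\<eta> / 2 - \<nu>) (1 - \<nu>) (x\<^sup>2 / 2)"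
  proof -
    have e: "(\<eta> + - \<nu> - \<nu>) / 2 = \<eta> / 2 - \<nu>" "- \<nu> - \<nu> = - 2 * \<nu>" "\<eta> / 2 - \<nu> - 1 - - \<nu> = \<eta> / 2 - 1" "- \<nu> + 1 = 1 - \<nu>" by (auto simp: field_simps)
    show ?thesis unfolding h_def using bessel_gauss_integral(2)[of "- \<nu>" x \<eta> \<nu>, unfolded e] assms by simp
  qed
  also have "(LINT z:{0<..}|lborel. h \<nu> z) = exp (- (x\<^sup>2 / 2)) * 2 powr (\<eta> / 2 - 1 - \<nu>) * (Gamma (\<eta> / 2) / Gamma (\<nu> + 1)) * kF (\<eta> / 2) (\<nu> + 1) (x\<^sup>2 / 2)"
    unfolding h_def using bessel_gauss_integral(2)[of \<nu> x \<eta> \<nu>] assms by simp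
  finally show ?thesis .
qed

lemma powr_twice: "0 < x \<Longrightarrow> x powr (2 * e) = 2 powr e * (x\<^sup>2 / 2) powr e"
  for x e :: real
  using powr_powr[of x 2 e] by (simp add: powr_divide)

text \<open>The differences supplied by \<open>Y_plus_diff\<close> are multiples of the left-hand
  sides of the connection formula: of the formula itself for order \<open>b - 1\<close>, and of its
  derivative for order \<open>b\<close>, where raising \<open>\<eta>\<close> by 2 turns
  \<open>a\<close> into \<open>a + 1\<close>.\<close>

lemma Y_plus_eq:
  assumes n: "0 < n" "n < 2" and \<eta>: "0 < \<eta>" and x: "0 < x"
  defines "a \<equiv> \<eta> / 2" and "b \<equiv> n / 2" and "s \<equiv> x\<^sup>2 / 2"
  shows "Y_plus ((n - 2) / 2) \<eta> x = tricomi_const a b * exp (- s) * jint a (b - a - 1) s"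
    and "Y_plus (n / 2) (\<eta> + 2) x = tricomi_const a b * exp (- s) * jint (a + 1) (b - a - 1) s"
proof -
  have ab: "0 < a" "0 < b" "b < 1" and s: "0 < s" using assms by (auto simp: a_def b_def s_def)
  note cf = connection_formula[OF ab s]
  define C where "C = Gamma (a + 1 - b) / (Gamma b * Gamma (1 - b))"
  have sb: "sin ((b - 1) * pi) = - sin (b * pi)" by (simp add: algebra_simps sin_diff)
  have sp: "0 < sin (b * pi)" using sin_pi_pos ab by simp
  have e1: "(n - 2) / 2 = b - 1" by (simp add: b_def field_simps)
  have "Y_plus (b - 1) \<eta> x = pi / (2 * sin ((b - 1) * pi)) * (
      exp (- s) * x powr (2 * (1 - b)) * 2 powr (a - 1) * (Gamma (a + 1 - b) / Gamma (2 - b)) * kF (a + 1 - b) (2 - b) s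
      - exp (- s) * 2 powr (a - b) * (Gamma a / Gamma b) * kF a b s)"
    using Y_plus_diff[of "b - 1" x \<eta>] ab \<eta> x by (simp add: a_def s_def algebra_simps)
  also have "x powr (2 * (1 - b)) = 2 powr (1 - b) * s powr (1 - b)" unfolding s_def by (rule powr_twice[OF x])
  also have "exp (- s) * (2 powr (1 - b) * s powr (1 - b)) * 2 powr (a - 1) * (Gamma (a + 1 - b) / Gamma (2 - b)) * kF (a + 1 - b) (2 - b) s
     = exp (- s) * 2 powr (a - b) * (Gamma (a + 1 - b) / Gamma (2 - b) * kB a b s)"
  proof -
    have "2 powr (1 - b) * 2 powr (a - 1) = 2 powr (a - b)" by (simp flip: powr_add)
    then have "exp (- s) * (2 powr (1 - b) * 2 powr (a - 1)) * (Gamma (a + 1 - b) / Gamma (2 - b) * kB a b s) = exp (- s) * 2 powr (a - b) * (Gamma (a + 1 - b) / Gamma (2 - b) * kB a b s)" by simp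
    then show ?thesis by (simp add: kB_def mult_ac)
  qed
  finally have "Y_plus (b - 1) \<eta> x = pi / (2 * sin (b * pi)) * exp (- s) * 2 powr (a - b) * (Gamma a / Gamma b * kF a b s - Gamma (a + 1 - b) / Gamma (2 - b) * kB a b s)"
    unfolding sb using sp by (simp add: field_simps)
  then show "Y_plus ((n - 2) / 2) \<eta> x = tricomi_const a b * exp (- s) * jint a (b - a - 1) s"
    unfolding e1 cf(1) tricomi_const_def by (simp add: mult_ac)
  have "Y_plus b (\<eta> + 2) x = pi / (2 * sin (b * pi)) * (
      exp (- s) * x powr (2 * (- b)) * 2 powr a * (Gamma (a + 1 - b) / Gamma (1 - b)) * kF (a + 1 - b) (1 - b) s
      - exp (- s) * 2 powr (a - b) * (Gamma (a + 1) / Gamma (b + 1)) * kF (a + 1) (b + 1) s)"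
    using Y_plus_diff[of b x "\<eta> + 2"] ab \<eta> x by (simp add: a_def s_def algebra_simps add_divide_distrib)
  also have "x powr (2 * (- b)) = 2 powr (- b) * s powr (- b)" unfolding s_def by (rule powr_twice[OF x])
  also have "exp (- s) * (2 powr (- b) * s powr (- b)) * 2 powr a * (Gamma (a + 1 - b) / Gamma (1 - b)) * kF (a + 1 - b) (1 - b) s
     = exp (- s) * 2 powr (a - b) * (Gamma (a + 1 - b) / Gamma (2 - b) * kB' a b s)"
  proof -
    have "1 - b \<notin> \<int>\<^sub>\<le>\<^sub>0" using ab nonpos_Ints_nonpos[of "1 - b"] by force
    then have "Gamma (2 - b) = (1 - b) * Gamma (1 - b)" using Gamma_plus1[of "1 - b"] by (simp add: add.commute)
    then have g: "Gamma (a + 1 - b) / Gamma (2 - b) * kB' a b s = Gamma (a + 1 - b) / Gamma (1 - b) * (s powr (- b) * kF (a + 1 - b) (1 - b) s)"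
      unfolding kB'_eq_kF[OF ab s] using ab by simp
    have "2 powr (- b) * 2 powr a = 2 powr (a - b)" by (simp flip: powr_add)
    then have "exp (- s) * (2 powr (- b) * 2 powr a) * (Gamma (a + 1 - b) / Gamma (2 - b) * kB' a b s) = exp (- s) * 2 powr (a - b) * (Gamma (a + 1 - b) / Gamma (2 - b) * kB' a b s)" by simp
    then show ?thesis unfolding g by (simp add: mult_ac)
  qed
  also have "exp (- s) * 2 powr (a - b) * (Gamma (a + 1) / Gamma (b + 1)) * kF (a + 1) (b + 1) s = exp (- s) * 2 powr (a - b) * (Gamma a / Gamma b * kD a b s)"
  proof -
    have "Gamma (a + 1) = a * Gamma a" "Gamma (b + 1) = b * Gamma b" using ab Gamma_shift[of a 1] Gamma_shift[of b 1] by (auto simp: mult.commute)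
    then show ?thesis using kD_eq_kF[of a b s] ab by (simp add: mult_ac)
  qed
  finally have "Y_plus b (\<eta> + 2) x = pi / (2 * sin (b * pi)) * exp (- s) * 2 powr (a - b) * (- (Gamma a / Gamma b * kD a b s - Gamma (a + 1 - b) / Gamma (2 - b) * kB' a b s))"
    by (simp add: algebra_simps)
  then show "Y_plus (n / 2) (\<eta> + 2) x = tricomi_const a b * exp (- s) * jint (a + 1) (b - a - 1) s"
    unfolding cf(2) b_def[symmetric] tricomi_const_def by (simp add: mult_ac)
qed

text \<open>The exponentials combine to the constant \<open>exp (- \<kappa>^2 / 2)\<close>. What
  remains is a multiple of \<open>t^(n - 1) * kF\<close>, and the flux expression with
  \<open>r = 1\<close>, divided by \<open>\<eta> - n\<close>, is a primitive of it.\<close>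

lemma Y_minus_integral:
  assumes n: "0 < n" and \<eta>: "0 < \<eta>" "\<eta> < n" and k: "0 < \<kappa>"
  defines "A \<equiv> 2 powr (\<eta> / 2 - n / 2) * (Gamma (\<eta> / 2) / Gamma (n / 2))"
  shows "(LINT a:{0<..<\<kappa>}|lborel. Y_minus ((n - 2) / 2) \<eta> a * a powr (n - 1) * exp ((a\<^sup>2 - \<kappa>\<^sup>2) / 2))
    = A * exp (- (\<kappa>\<^sup>2 / 2)) * (\<kappa> powr n * (kF (\<eta> / 2) (n / 2) (\<kappa>\<^sup>2 / 2) - kD (\<eta> / 2) (n / 2) (\<kappa>\<^sup>2 / 2)) / (n - \<eta>))"
proof -
  define a b where "a = \<eta> / 2" and "b = n / 2"
  have ab: "0 \<le> a" "a < b" "0 < b" using n \<eta> by (auto simp: a_def b_def)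
  define f where "f t = t powr (n - 1) * kF a b (t\<^sup>2 / 2)" for t
  define F where "F t = t powr n * (kD a b (t\<^sup>2 / 2) - kF a b (t\<^sup>2 / 2)) / (\<eta> - n)" for t
  have kc: "continuous_on UNIV (kF a b)" "continuous_on UNIV (kD a b)"
    using kF_deriv[OF ab(1,3)] kD_deriv[OF ab(1,3)] by (auto intro!: continuous_at_imp_continuous_on DERIV_isCont)
  note [measurable] = kc(1)[THEN borel_measurable_continuous_onI]
  have f0: "0 \<le> f t" for t unfolding f_def using kF_pos[OF ab(1,3), of "t\<^sup>2 / 2"] by simp
  have F_alt: "F t = t powr n * (kF a b (t\<^sup>2 / 2) - kD a b (t\<^sup>2 / 2)) / (n - \<eta>)" for t
    using \<eta> by (simp add: F_def divide_simps) (simp add: algebra_simps)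
  have "(\<integral>\<^sup>+t. (if 0 < t \<and> t < \<kappa> then ennreal (f t) else 0) \<partial>lborel) = ennreal (F \<kappa> - F 0)"
  proof (rule nn_integral_FTC_open[of _ _ "{}"])
    show "continuous_on {0..\<kappa>} F"
      unfolding F_def using n \<eta>
      by (intro continuous_intros continuous_on_powr' continuous_on_compose2[OF kc(1)] continuous_on_compose2[OF kc(2)]) auto
    show "(F has_real_derivative f x) (at x)" if "x \<in> {0<..<\<kappa>} - {}" for x
    proof -
      have x: "0 < x" using that by simp
      have "((\<lambda>x. x powr n * (kD a b (x\<^sup>2 / (2 * 1)) - kF a b (x\<^sup>2 / (2 * 1)))) has_real_derivative (2 * a - n) * x powr (n - 1) * kF a b (x\<^sup>2 / (2 * 1))) (at x)"
        unfolding b_def by (rule gauss_flux_deriv[OF zero_less_one x kF_deriv kD_deriv kummer_equation]) (use ab in \<open>auto simp: b_def\<close>)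
      from DERIV_cdivide[OF this, of "\<eta> - n"] show ?thesis
        using \<eta> by (simp add: F_def[abs_def] f_def a_def)
    qed
  qed (use k f0 in auto)
  also have "F 0 = 0" using n by (simp add: F_def)
  finally have N: "(\<integral>\<^sup>+t. (if 0 < t \<and> t < \<kappa> then ennreal (f t) else 0) \<partial>lborel) = ennreal (F \<kappa>)" by simp
  have F0: "0 \<le> F \<kappa>" unfolding F_alt using kD_less_kF[OF ab(1,3,2), of "\<kappa>\<^sup>2 / 2"] \<eta> by simp
  have "has_bochner_integral lborel (\<lambda>t. if 0 < t \<and> t < \<kappa> then f t else 0) (F \<kappa>)"
  proof (rule has_bochner_integral_nn_integral)
    show "(\<lambda>t. if 0 < t \<and> t < \<kappa> then f t else 0) \<in> borel_measurable lborel" unfolding f_def by measurable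
    have "ennreal (if 0 < t \<and> t < \<kappa> then f t else 0) = (if 0 < t \<and> t < \<kappa> then ennreal (f t) else 0)" for t by simp
    then show "(\<integral>\<^sup>+t. ennreal (if 0 < t \<and> t < \<kappa> then f t else 0) \<partial>lborel) = ennreal (F \<kappa>)" using N by simp
  qed (use f0 F0 in auto)
  then have I: "(\<integral>t. (if 0 < t \<and> t < \<kappa> then f t else 0) \<partial>lborel) = F \<kappa>" by (rule has_bochner_integral_integral_eq)
  have "(LINT a:{0<..<\<kappa>}|lborel. Y_minus ((n - 2) / 2) \<eta> a * a powr (n - 1) * exp ((a\<^sup>2 - \<kappa>\<^sup>2) / 2))
      = (\<integral>t. A * exp (- (\<kappa>\<^sup>2 / 2)) * (if 0 < t \<and> t < \<kappa> then f t else 0) \<partial>lborel)"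
    unfolding set_lebesgue_integral_def
  proof (intro Bochner_Integration.integral_cong refl)
    fix t :: real
    have "exp (- (t\<^sup>2 / 2)) * exp ((t\<^sup>2 - \<kappa>\<^sup>2) / 2) = exp (- (\<kappa>\<^sup>2 / 2))" by (simp add: diff_divide_distrib flip: exp_add)
    then have "A * (exp (- (t\<^sup>2 / 2)) * exp ((t\<^sup>2 - \<kappa>\<^sup>2) / 2)) * f t = A * exp (- (\<kappa>\<^sup>2 / 2)) * f t" by simp
    then show "indicat_real {0<..<\<kappa>} t *\<^sub>R (Y_minus ((n - 2) / 2) \<eta> t * t powr (n - 1) * exp ((t\<^sup>2 - \<kappa>\<^sup>2) / 2))
       = A * exp (- (\<kappa>\<^sup>2 / 2)) * (if 0 < t \<and> t < \<kappa> then f t else 0)"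
      using Y_minus_eq[OF n \<eta>(1), of t] by (auto simp: indicator_def A_def f_def a_def b_def mult_ac)
  qed
  also have "\<dots> = A * exp (- (\<kappa>\<^sup>2 / 2)) * F \<kappa>" using I by simp
  finally show ?thesis by (simp add: F_alt a_def b_def)
qed

text \<open>Multiplied out, either equation says that a ratio equals \<open>b - a\<close>: the first
  one the Tricomi ratio at \<open>\<kappa>^2 / (2 * V^2)\<close>, the second one the Kummer ratio at
  \<open>\<kappa>^2 / 2\<close>.\<close>

lemma eta_kappa_solution_iff:
  assumes n: "0 < n" "n < 2" and V: "1 < V"
  shows "eta_kappa_solution n V (\<eta>, \<kappa>) \<longleftrightarrow> 0 < \<eta> \<and> \<eta> < n \<and> 0 < \<kappa> \<and>
    kummer_ratio (\<eta> / 2) (n / 2) (\<kappa>\<^sup>2 / 2) = n / 2 - \<eta> / 2 \<and>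
    tricomi_ratio (\<eta> / 2) (n / 2) (1 / V\<^sup>2 * (\<kappa>\<^sup>2 / 2)) = n / 2 - \<eta> / 2"
proof (cases "0 < \<eta> \<and> 0 < \<kappa>")
  case True
  then have \<eta>: "0 < \<eta>" and k: "0 < \<kappa>" by auto
  define a b \<sigma> where "a = \<eta> / 2" and "b = n / 2" and "\<sigma> = (\<kappa> / V)\<^sup>2 / 2"
  have ab: "0 < a" "0 < b" "b < 1" "b - a - 1 \<le> 0" using n \<eta> by (auto simp: a_def b_def)
  have x: "0 < \<kappa> / V" using k V by simp
  have s: "0 < \<sigma>" using k V by (simp add: \<sigma>_def)
  have se: "1 / V\<^sup>2 * (\<kappa>\<^sup>2 / 2) = \<sigma>" "\<kappa>\<^sup>2 / V\<^sup>2 = 2 * \<sigma>" by (simp_all add: \<sigma>_def power_divide)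
  have J0: "0 < jint a (b - a - 1) \<sigma>" using ab s by (intro jint_pos)
  have T: "0 < tricomi_const a b * exp (- \<sigma>)" using tricomi_const_pos[of a b] ab by simp
  have R: "Y_plus (n / 2) (\<eta> + 2) (\<kappa> / V) / Y_plus ((n - 2) / 2) \<eta> (\<kappa> / V) = jint (a + 1) (b - a - 1) \<sigma> / jint a (b - a - 1) \<sigma>"
    unfolding b_def[symmetric] using Y_plus_eq[OF n \<eta> x, folded a_def b_def \<sigma>_def] tricomi_const_pos[of a b] ab by simp
  have "Y_plus (n / 2) (\<eta> + 2) (\<kappa> / V) / Y_plus ((n - 2) / 2) \<eta> (\<kappa> / V) = (n - \<eta> - \<kappa>\<^sup>2 / V\<^sup>2) / (\<kappa>\<^sup>2 / V\<^sup>2)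
      \<longleftrightarrow> \<sigma> * (jint (a + 1) (b - a - 1) \<sigma> / jint a (b - a - 1) \<sigma>) = b - a - \<sigma>"
    unfolding R se(2) using s by (simp add: field_simps a_def b_def)
  also have "\<dots> \<longleftrightarrow> tricomi_ratio a b \<sigma> = b - a" by (auto simp: tricomi_ratio_def algebra_simps)
  finally have eq1: "Y_plus (n / 2) (\<eta> + 2) (\<kappa> / V) / Y_plus ((n - 2) / 2) \<eta> (\<kappa> / V) = (n - \<eta> - \<kappa>\<^sup>2 / V\<^sup>2) / (\<kappa>\<^sup>2 / V\<^sup>2)
      \<longleftrightarrow> tricomi_ratio a b \<sigma> = b - a" .
  \<comment> \<open>The first equation forces \<open>\<eta> < n\<close>, because the Tricomi ratio
    is at least its positive argument.\<close>
  have lt: "\<eta> < n" if "tricomi_ratio a b \<sigma> = b - a"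
    using tricomi_ratio_ge[of a b \<sigma>] ab s that by (simp add: a_def b_def)
  have eq2: "\<kappa> powr (2 - n)
       * (LINT a:{0<..<\<kappa>}|lborel. Y_minus ((n - 2) / 2) \<eta> a * a powr (n - 1) * exp ((a\<^sup>2 - \<kappa>\<^sup>2) / 2))
       / Y_minus ((n - 2) / 2) \<eta> \<kappa> = 1 \<longleftrightarrow> kummer_ratio a b (\<kappa>\<^sup>2 / 2) = b - a" if l: "\<eta> < n"
  proof -
    define A where "A = 2 powr (\<eta> / 2 - n / 2) * (Gamma (\<eta> / 2) / Gamma (n / 2)) * exp (- (\<kappa>\<^sup>2 / 2))"
    have A: "0 < A" unfolding A_def using \<eta> n by (intro mult_pos_pos divide_pos_pos Gamma_real_pos) auto
    have kp: "0 < kF a b (\<kappa>\<^sup>2 / 2)" using ab by (intro kF_pos) auto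
    have p: "\<kappa> powr (2 - n) * \<kappa> powr n = \<kappa>\<^sup>2" using k by (simp flip: powr_add)
    have "\<kappa> powr (2 - n)
       * (LINT a:{0<..<\<kappa>}|lborel. Y_minus ((n - 2) / 2) \<eta> a * a powr (n - 1) * exp ((a\<^sup>2 - \<kappa>\<^sup>2) / 2))
       / Y_minus ((n - 2) / 2) \<eta> \<kappa>
       = (\<kappa> powr (2 - n) * \<kappa> powr n) * (A * (kF a b (\<kappa>\<^sup>2 / 2) - kD a b (\<kappa>\<^sup>2 / 2)) / (n - \<eta>)) / (A * kF a b (\<kappa>\<^sup>2 / 2))"
      unfolding Y_minus_integral[OF n(1) \<eta> l k] Y_minus_eq[OF n(1) \<eta> k] A_def a_def b_def by simp
    also have "\<dots> = kummer_ratio a b (\<kappa>\<^sup>2 / 2) / (b - a)"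
      unfolding p kummer_ratio_def using A kp l by (simp add: a_def b_def divide_simps)
    finally have e: "\<kappa> powr (2 - n)
       * (LINT a:{0<..<\<kappa>}|lborel. Y_minus ((n - 2) / 2) \<eta> a * a powr (n - 1) * exp ((a\<^sup>2 - \<kappa>\<^sup>2) / 2))
       / Y_minus ((n - 2) / 2) \<eta> \<kappa> = kummer_ratio a b (\<kappa>\<^sup>2 / 2) / (b - a)" .
    show ?thesis unfolding e using l by (auto simp: a_def b_def)
  qed
  show ?thesis
    unfolding eta_kappa_solution_def prod.case eq1 se(1)
    using eq2 lt \<eta> k unfolding a_def b_def by blast
qed (auto simp: eta_kappa_solution_def)

section \<open>Maximisation over the interface\<close>

lemma is_max_of_spectrum_unique:
  assumes "is_max_of_spectrum n R s" "is_max_of_spectrum n R s'"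
  shows "s = s'"
  using assms unfolding is_max_of_spectrum_def by (metis Re_complex_of_real order_antisym)

lemma Sigma_bar_eq: "is_max_of_spectrum n R s \<Longrightarrow> Sigma_bar n R = s"
  unfolding Sigma_bar_def by (blast intro: is_max_of_spectrum_unique)

theorem lemma4p3:
  fixes n r1 r2 V :: real
  assumes "0 < n" and "n < 2" and "0 < r1" and "r1 < r2" and "V = sqrt (r2 / r1)"
  shows "(\<exists>!p. eta_kappa_solution n V p) \<and>
         (\<forall>c>0. is_max_of_spectrum n (ell r1 r2 c) (Sigma_bar n (ell r1 r2 c))) \<and>
         (\<exists>c>0. Sigma_bar n (ell r1 r2 c) = eta_const n V - n) \<and>
         (\<forall>c>0. Sigma_bar n (ell r1 r2 c) \<le> eta_const n V - n) \<and>
         (\<forall>c>0. Sigma_bar n (ell r1 r2 c) = eta_const n V - n \<longleftrightarrow> c = kappa_const n V * sqrt r1)"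
proof -
  define b \<theta> where "b = n / 2" and "\<theta> = r1 / r2"
  have b: "0 < b" "b < 1" using assms by (auto simp: b_def)
  have \<theta>: "0 < \<theta>" "\<theta> < 1" using assms by (auto simp: \<theta>_def)
  have V: "1 < V" and V2: "1 / V\<^sup>2 = \<theta>" using assms by (auto simp: \<theta>_def)
  \<comment> \<open>With \<open>s = c^2 / (2 * r1)\<close> the outer argument
    \<open>c^2 / (2 * r2)\<close> is \<open>\<theta> * s\<close>, so one variable describes the
    interface in both phases.\<close>
  define double where "double a s \<longleftrightarrow> 0 < a \<and> a < b \<and> 0 < s \<and> kummer_ratio a b s = b - a \<and> tricomi_ratio a b (\<theta> * s) = b - a" for a s
  have spec: "is_max_of_spectrum n (ell r1 r2 c) (2 * a - n)"
    if "0 < c" "0 < a" "a < b" "kummer_ratio a b (c\<^sup>2 / (2 * r1)) = tricomi_ratio a b (\<theta> * (c\<^sup>2 / (2 * r1)))" for a c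
  proof -
    have "\<theta> * (c\<^sup>2 / (2 * r1)) = c\<^sup>2 / (2 * r2)" using assms by (simp add: \<theta>_def)
    then interpret matched_profile n r1 r2 c a
      by unfold_locales (use that assms in \<open>auto simp: b_def\<close>)
    show ?thesis by (rule is_max_of_spectrum_matched)
  qed
  \<comment> \<open>Away from \<open>s0\<close> the comparison at \<open>a0\<close> has the sign
    that an intermediate value argument on \<open>(0, a0)\<close> needs, so the matching parameter
    there is strictly smaller than \<open>a0\<close>.\<close>
  have match: "\<exists>a\<le>a0. 0 < a \<and> a < b \<and> (a = a0 \<longleftrightarrow> s = s0) \<and> kummer_ratio a b s = tricomi_ratio a b (\<theta> * s)"
    if d0: "double a0 s0" and sp: "0 < s" for a0 s0 s
  proof (cases "s = s0")
    case True
    then show ?thesis using d0 by (intro exI[of _ a0]) (auto simp: double_def)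
  next
    case False
    have "kummer_ratio a0 b s < tricomi_ratio a0 b (\<theta> * s)"
      using d0 sp False b \<theta> unfolding double_def by (intro ratio_comparison[of a0 b \<theta> s0]) auto
    then obtain a where "0 < a" "a < a0" "kummer_ratio a b s = tricomi_ratio a b (\<theta> * s)"
      using exists_ratio_match[OF b(2) \<theta> sp, of a0] d0 by (auto simp: double_def)
    then show ?thesis using False d0 by (intro exI[of _ a]) (auto simp: double_def)
  qed
  \<comment> \<open>Injectivity in \<open>a\<close> comes from spectral theory: every solution of
    the matching equation at \<open>s\<close> yields the maximum \<open>2 * a - n\<close> of the
    spectrum of the same operator.\<close>
  have unique: "a = a'" if "0 < a" "a < b" "0 < a'" "a' < b" "0 < s"
      "kummer_ratio a b s = tricomi_ratio a b (\<theta> * s)" "kummer_ratio a' b s = tricomi_ratio a' b (\<theta> * s)" for a a' s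
  proof -
    define c where "c = sqrt (2 * r1 * s)"
    have c: "0 < c" "c\<^sup>2 / (2 * r1) = s" using assms that by (auto simp: c_def)
    have "2 * a - n = 2 * a' - n"
      by (rule is_max_of_spectrum_unique[of n "ell r1 r2 c"]; rule spec) (use c that in auto)
    then show ?thesis by simp
  qed
  obtain a0 s0 where ds: "double a0 s0" using exists_double_match[OF b \<theta>] by (auto simp: double_def)
  then have a0: "0 < a0" "a0 < b" "0 < s0" by (auto simp: double_def)
  have double_unique: "a = a0 \<and> s = s0" if d: "double a s" for a s
  proof -
    \<comment> \<open>The parameter found at \<open>s1\<close>, which is at most \<open>a2\<close>,
      must be \<open>a1\<close> by uniqueness. Exchanging the roles gives equality of the parameters
      and then of the points.\<close>
    have le: "a1 \<le> a2 \<and> (a1 = a2 \<longrightarrow> s1 = s2)" if d1: "double a1 s1" and d2: "double a2 s2" for a1 s1 a2 s2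
    proof -
      have s1: "0 < s1" using d1 by (simp add: double_def)
      obtain a where "a \<le> a2" "0 < a" "a < b" "a = a2 \<longleftrightarrow> s1 = s2" "kummer_ratio a b s1 = tricomi_ratio a b (\<theta> * s1)"
        using match[OF d2 s1] by blast
      moreover have "a = a1" using calculation d1 by (intro unique[of a a1 s1]) (auto simp: double_def)
      ultimately show ?thesis by blast
    qed
    show ?thesis using le[OF d ds] le[OF ds d] by auto
  qed
  define \<eta> \<kappa> where "\<eta> = 2 * a0" and "\<kappa> = sqrt (2 * s0)"
  have k: "0 < \<kappa>" "\<kappa>\<^sup>2 / 2 = s0" using a0 by (auto simp: \<kappa>_def)
  have sol_iff: "eta_kappa_solution n V (\<eta>', \<kappa>') \<longleftrightarrow> 0 < \<kappa>' \<and> double (\<eta>' / 2) (\<kappa>'\<^sup>2 / 2)" for \<eta>' \<kappa>'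
    unfolding eta_kappa_solution_iff[OF assms(1,2) V] V2 b_def[symmetric] double_def by (auto simp: b_def)
  have sol: "eta_kappa_solution n V p \<longleftrightarrow> p = (\<eta>, \<kappa>)" for p
  proof (cases p)
    case (Pair \<eta>' \<kappa>')
    have "\<kappa>' = \<kappa>" if "0 < \<kappa>'" "\<kappa>'\<^sup>2 / 2 = s0" using that k power2_eq_iff_nonneg[of \<kappa>' \<kappa>] by auto
    then have "0 < \<kappa>' \<and> double (\<eta>' / 2) (\<kappa>'\<^sup>2 / 2) \<Longrightarrow> \<eta>' = \<eta> \<and> \<kappa>' = \<kappa>"
      using double_unique[of "\<eta>' / 2" "\<kappa>'\<^sup>2 / 2"] by (simp add: \<eta>_def)
    moreover have "0 < \<kappa> \<and> double (\<eta> / 2) (\<kappa>\<^sup>2 / 2)" using ds k by (simp add: \<eta>_def)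
    ultimately show ?thesis unfolding Pair sol_iff by blast
  qed
  have THE_sol: "(THE p. eta_kappa_solution n V p) = (\<eta>, \<kappa>)" unfolding sol by simp
  then have const_eq: "eta_const n V = \<eta>" "kappa_const n V = \<kappa>" by (auto simp: eta_const_def kappa_const_def)
  have main: "\<exists>a\<le>a0. (a = a0 \<longleftrightarrow> c = \<kappa> * sqrt r1) \<and> is_max_of_spectrum n (ell r1 r2 c) (2 * a - n)" if c: "0 < c" for c
  proof -
    have s: "0 < c\<^sup>2 / (2 * r1)" using c assms by simp
    have "c\<^sup>2 / (2 * r1) = s0 \<longleftrightarrow> c\<^sup>2 = (\<kappa> * sqrt r1)\<^sup>2"
      using assms a0 by (simp add: \<kappa>_def power_mult_distrib field_simps)
    also have "\<dots> \<longleftrightarrow> c = \<kappa> * sqrt r1" using c k assms by (intro power2_eq_iff_nonneg) auto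
    finally have "c\<^sup>2 / (2 * r1) = s0 \<longleftrightarrow> c = \<kappa> * sqrt r1" .
    then show ?thesis using match[OF ds s] spec[OF c] by metis
  qed
  have 1: "\<exists>!p. eta_kappa_solution n V p" unfolding sol by simp
  have 2: "is_max_of_spectrum n (ell r1 r2 c) (Sigma_bar n (ell r1 r2 c))" if "0 < c" for c
    using main[OF that] Sigma_bar_eq by metis
  have 3: "Sigma_bar n (ell r1 r2 c) \<le> eta_const n V - n \<and>
      (Sigma_bar n (ell r1 r2 c) = eta_const n V - n \<longleftrightarrow> c = kappa_const n V * sqrt r1)" if c: "0 < c" for c
  proof -
    obtain a where a: "a \<le> a0" "a = a0 \<longleftrightarrow> c = \<kappa> * sqrt r1" "is_max_of_spectrum n (ell r1 r2 c) (2 * a - n)"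
      using main[OF c] by blast
    show ?thesis unfolding Sigma_bar_eq[OF a(3)] const_eq using a by (auto simp: \<eta>_def)
  qed
  have "0 < kappa_const n V * sqrt r1" unfolding const_eq using k assms by simp
  then have 4: "\<exists>c>0. Sigma_bar n (ell r1 r2 c) = eta_const n V - n" using 3 by blast
  show ?thesis using 1 2 3 4 by blast
qed

end
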